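(* Let $n\ge 1$, and let $\underline{a}=(a_1,\dots,a_s)$ and $\underline{b}=(b_1,\dots,b_t)$ be (possibly empty) finite sequences of positive integers with $\sum_i a_i\le n$ and $\sum_j b_j\le n$. Let $\mathfrak q^{\sf B}_n(\underline a\mid\underline b)\subset\mathfrak{so}_{2n+1}$ be the corresponding standard seaweed subalgebra and let $\Gamma=\Gamma^{\sf C}_n(\underline a\mid\underline b)$ be the type-C meander graph (with $2n$ vertices) of the pair $(\underline a\mid\underline b)$. Then $$\mathrm{ind}\,\mathfrak q^{\sf B}_n(\underline a\mid\underline b)=\#\{\text{cycles of }\Gamma\}+\tfrac12\,\#\{\text{segments of }\Gamma\text{ that are not }\sigma\text{-stable}\}.$$
   Context: The ground field is algebraically closed of characteristic zero. The index $\mathrm{ind}\,\mathfrak q$ of a Lie algebra $\mathfrak q$ is the minimum over $\gamma\in\mathfrak q^*$ of $\dim\mathfrak q_\gamma$, where $\mathfrak q_\gamma=\{x\in\mathfrak q:\gamma([x,y])=0\ \forall y\in\mathfrak q\}$. **Odd orthogonal seaweeds.** Realise $\mathfrak{so}_{2n+1}=\{x\in\mathfrak{gl}_{2n+1}: \hat x=-x\}$, where $\hat{\ }$ is the transpose with respect to the antidiagonal; the upper- and lower-triangular matrices in it form two opposite Borel subalgebras. A composition is a finite (possibly empty) sequence of positive integers. For a composition $\underline a=(a_1,\dots,a_s)$ with $\sum a_i\le n$, the standard parabolic $\mathfrak p^{\sf B}_n(\underline a)$ is the set of matrices of $\mathfrak{so}_{2n+1}$ that are block upper-triangular with consecutive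 diagonal block sizes $(a_1,\dots,a_s,2(n-\sum a_i)+1,a_s,\dots,a_1)$; its Levi subalgebra is $\mathfrak{gl}_{a_1}\oplus\dots\oplus\mathfrak{gl}_{a_s}\oplus\mathfrak{so}_{2(n-\sum a_i)+1}$. The opposite-standard parabolic attached to a composition $\underline b$ with $\sum b_j\le n$ is defined in the same way with block lower-triangular matrices. The standard seaweed $\mathfrak q^{\sf B}_n(\underline a\mid\underline b)$ is the intersection of the standard parabolic attached to $\underline a$ and the opposite-standard parabolic attached to $\underline b$. **Type-C meander graph.** For $\underline a$ with $\sum a_i\le n$ put $d=n-\sum a_i$ and $\underline{\tilde a}=(a_1,\dots,a_s,2d,a_s,\dots,a_1)$, a composition of $2n$ (the part $2d$ is omitted if $d=0$); similarly define $\underline{\tilde b}$. $\Gamma^{\sf C}_n(\underline a\mid\underline b)$ is the (multi)graph with vertices $1,\dots,2n$ placed consecutively on a horizontal line. Cut $1,\dots,2n$ into consecutive intervals of lengths given by $\underline{\tilde a}$; for each interval $\{p,\dots,q\}$ draw above the line the nested arcs joining $p$ with $q$, $p+1$ with $q-1$, etc. (the middle vertex of an odd interval gets no arc). Draw arcs below the line in the same way using $\underline{\tilde b}$. Each connected component is either a cycle (two vertices joined by an upper and a lower arc form a cycle) or a segment (a path; an isolated vertex counts as a segment). The graph is invariant under the reflection $\sigma:i\mapsto 2n+1-i$; a segment is $\sigma$-stable if $\sigma$ maps it to itself. *)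

theory Defs
  imports "HOL-Computational_Algebra.Computational_Algebra" "HOL-Library.Function_Algebras"
begin

section \<open>Matrices and the index of a Lie algebra\<close>

text \<open>
  An \<open>N \<times> N\<close> matrix is a function of two indices in \<open>{1..N}\<close> that vanishes
  outside this range. The additive structure is the pointwise one; the pointwise product of
  functions is not the matrix product and is not used.
\<close>

type_synonym 'k matrix = "nat \<Rightarrow> nat \<Rightarrow> 'k"

definition gl :: "nat \<Rightarrow> 'k::field matrix set" where
  "gl N = {x. \<forall>i j. i \<notin> {1..N} \<or> j \<notin> {1..N} \<longrightarrow> x i j = 0}"

definition mscale :: "'k::field \<Rightarrow> 'k matrix \<Rightarrow> 'k matrix" where
  "mscale c x = (\<lambda>i j. c * x i j)"

definition mmult :: "nat \<Rightarrow> 'k::field matrix \<Rightarrow> 'k matrix \<Rightarrow> 'k matrix" where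
  "mmult N x y = (\<lambda>i j. \<Sum>k=1..N. x i k * y k j)"

definition bracket :: "nat \<Rightarrow> 'k::field matrix \<Rightarrow> 'k matrix \<Rightarrow> 'k matrix" where
  "bracket N x y = mmult N x y - mmult N y x"

interpretation mat_vs: vector_space "mscale :: 'k::field \<Rightarrow> 'k matrix \<Rightarrow> 'k matrix"
  by standard (auto simp: mscale_def fun_eq_iff algebra_simps)

text \<open>
  Linear forms on a subspace \<open>q\<close>. The values outside \<open>q\<close> are arbitrary and never used.
\<close>

definition linear_forms :: "'k::field matrix set \<Rightarrow> ('k matrix \<Rightarrow> 'k) set" where
  "linear_forms q = {\<gamma>. (\<forall>x\<in>q. \<forall>y\<in>q. \<gamma> (x + y) = \<gamma> x + \<gamma> y) \<and>
                        (\<forall>c. \<forall>x\<in>q. \<gamma> (mscale c x) = c * \<gamma> x)}"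

definition stabiliser :: "nat \<Rightarrow> 'k::field matrix set \<Rightarrow> ('k matrix \<Rightarrow> 'k) \<Rightarrow> 'k matrix set" where
  "stabiliser N q \<gamma> = {x \<in> q. \<forall>y\<in>q. \<gamma> (bracket N x y) = 0}"

definition lie_index :: "nat \<Rightarrow> 'k::field matrix set \<Rightarrow> nat" where
  "lie_index N q = (LEAST d. \<exists>\<gamma>\<in>linear_forms q. mat_vs.dim (stabiliser N q \<gamma>) = d)"

section \<open>Odd orthogonal seaweeds\<close>

definition composition :: "nat list \<Rightarrow> bool" where
  "composition c \<longleftrightarrow> (\<forall>k\<in>set c. k > 0)"

text \<open>
  The consecutive intervals into which a composition \<open>c\<close> cuts \<open>{1..sum_list c}\<close>,
  numbered from \<open>0\<close>.
\<close>

definition interval :: "nat list \<Rightarrow> nat \<Rightarrow> nat set" where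
  "interval c k = {sum_list (take k c) + 1 .. sum_list (take (Suc k) c)}"

definition anti_transpose :: "nat \<Rightarrow> 'k::field matrix \<Rightarrow> 'k matrix" where
  "anti_transpose N x =
     (\<lambda>i j. if i \<in> {1..N} \<and> j \<in> {1..N} then x (N + 1 - j) (N + 1 - i) else 0)"

definition so :: "nat \<Rightarrow> 'k::field matrix set" where
  "so N = {x \<in> gl N. anti_transpose N x = - x}"

definition block_upper :: "nat list \<Rightarrow> 'k::field matrix \<Rightarrow> bool" where
  "block_upper c x \<longleftrightarrow>
     (\<forall>k<length c. \<forall>l<k. \<forall>i\<in>interval c k. \<forall>j\<in>interval c l. x i j = 0)"

definition block_lower :: "nat list \<Rightarrow> 'k::field matrix \<Rightarrow> bool" where
  "block_lower c x \<longleftrightarrow>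
     (\<forall>l<length c. \<forall>k<l. \<forall>i\<in>interval c k. \<forall>j\<in>interval c l. x i j = 0)"

definition block_sizes_B :: "nat \<Rightarrow> nat list \<Rightarrow> nat list" where
  "block_sizes_B n a = a @ [2 * (n - sum_list a) + 1] @ rev a"

definition parabolic_B :: "nat \<Rightarrow> nat list \<Rightarrow> 'k::field matrix set" where
  "parabolic_B n a = {x \<in> so (2 * n + 1). block_upper (block_sizes_B n a) x}"

definition opp_parabolic_B :: "nat \<Rightarrow> nat list \<Rightarrow> 'k::field matrix set" where
  "opp_parabolic_B n b = {x \<in> so (2 * n + 1). block_lower (block_sizes_B n b) x}"

definition seaweed_B :: "nat \<Rightarrow> nat list \<Rightarrow> nat list \<Rightarrow> 'k::field matrix set" where
  "seaweed_B n a b = parabolic_B n a \<inter> opp_parabolic_B n b"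

section \<open>Type-C meander graphs\<close>

text \<open>
  An edge is tagged with the side on which it is drawn, so an upper and a lower arc with the
  same two end points are different edges.
\<close>

datatype side = Above | Below

type_synonym edge = "side \<times> nat set"

definition arcs :: "nat list \<Rightarrow> nat set set" where
  "arcs c = {{i, j} | i j k. k < length c \<and> i \<in> interval c k \<and> j \<in> interval c k \<and> i < j \<and>
               i + j = Min (interval c k) + Max (interval c k)}"

definition meander_edges :: "nat list \<Rightarrow> nat list \<Rightarrow> edge set" where
  "meander_edges c c' = {Above} \<times> arcs c \<union> {Below} \<times> arcs c'"

definition parts_C :: "nat \<Rightarrow> nat list \<Rightarrow> nat list" where
  "parts_C n a = (let d = n - sum_list a in a @ (if d = 0 then [] else [2 * d]) @ rev a)"

definition edges_C :: "nat \<Rightarrow> nat list \<Rightarrow> nat list \<Rightarrow> edge set" where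
  "edges_C n a b = meander_edges (parts_C n a) (parts_C n b)"

definition adjacency :: "edge set \<Rightarrow> (nat \<times> nat) set" where
  "adjacency E = {(u, v). \<exists>s. (s, {u, v}) \<in> E}"

definition components :: "nat set \<Rightarrow> edge set \<Rightarrow> nat set set" where
  "components V E = V // (adjacency E)\<^sup>*"

definition edges_within :: "edge set \<Rightarrow> nat set \<Rightarrow> edge set" where
  "edges_within E C = {e \<in> E. snd e \<subseteq> C}"

definition is_cycle :: "edge set \<Rightarrow> nat set \<Rightarrow> bool" where
  "is_cycle E C \<longleftrightarrow> (\<exists>vs es. length vs \<ge> 2 \<and> distinct vs \<and> set vs = C \<and>
     distinct es \<and> set es = edges_within E C \<and> length es = length vs \<and>
     (\<forall>i<length es. snd (es ! i) = {vs ! i, vs ! (Suc i mod length vs)}))"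

definition is_segment :: "edge set \<Rightarrow> nat set \<Rightarrow> bool" where
  "is_segment E C \<longleftrightarrow> (\<exists>vs es. distinct vs \<and> set vs = C \<and>
     distinct es \<and> set es = edges_within E C \<and> length vs = Suc (length es) \<and>
     (\<forall>i<length es. snd (es ! i) = {vs ! i, vs ! Suc i}))"

definition cycles_C :: "nat \<Rightarrow> nat list \<Rightarrow> nat list \<Rightarrow> nat set set" where
  "cycles_C n a b = {C \<in> components {1..2 * n} (edges_C n a b). is_cycle (edges_C n a b) C}"

definition segments_C :: "nat \<Rightarrow> nat list \<Rightarrow> nat list \<Rightarrow> nat set set" where
  "segments_C n a b = {C \<in> components {1..2 * n} (edges_C n a b). is_segment (edges_C n a b) C}"

definition sigma_stable :: "nat \<Rightarrow> nat set \<Rightarrow> bool" where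
  "sigma_stable n C \<longleftrightarrow> (\<lambda>i. 2 * n + 1 - i) ` C = C"

end

theory Submission
  imports Defs "Jordan_Normal_Form.Determinant"
begin

text \<open>
  Call a finite set \<open>K\<close> of linear forms \<open>g k\<close> together with a form \<open>f\<close> a slice for a Lie algebra \<open>q\<close> if
  every form of the affine family \<open>f + \<Sum> c k * g k\<close> has at least \<open>card K\<close> independent elements in its
  stabiliser, while the forms \<open>g k\<close> separate the stabiliser of \<open>f\<close>. Then \<open>card K\<close> is the index: the
  coadjoint orbits of the family are dense, and this is expressed without any algebraic geometry by showing that
  all coefficients of the minors of a linear pencil through \<open>f\<close> are annihilated by the coadjoint
  action. Panyushev's inductive reduction through an abelian ideal on which a form is nondegenerate lifts
  slices, so a slice of a seaweed is obtained from a slice of a smaller one, down to equal first blocks and to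
  parabolic subalgebras, where it is given by an explicit skew-symmetric matrix as in the Kostant cascade. On the
  graph side each reduction contracts arcs and hence changes neither the cycles nor the segments
  up to reflection, so \<open>2 * card K\<close> and twice the number of cycles plus the number of unstable
  segments satisfy the same recursion.
\<close>


subsection \<open>Linear forms and brackets\<close>

text \<open>A lower bound on the dimension of the stabiliser is needed at every linear form, but the
  slice controls only its own family and no group is at hand to move other forms into it. The
  substitute is a pencil f + t\<delta>. Suppose all minors of a fixed size vanish to order k in t on
  all pencils through f. Then the coefficient of t^k does not change when \<delta> is altered by a
  coadjoint direction x.f; this is the infinitesimal trace of exp(tx). Transversality reduces
  \<delta> to a slice direction, where the minor is zero, and k increases. A slice certifies both
  inequalities for the index at once and survives each reduction, whereas the index alone would
  require a genericity argument at every step. Counts on the graph side are doubled because a single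
  unstable segment weighs one half. For b1 = 2 a1 a reduction produces a part equal to 0, so both
  sides are developed for lists with zero parts, which are dropped on reaching the head.\<close>

lemma linear_formsD:
  assumes "\<gamma> \<in> linear_forms q"
  shows "x \<in> q \<Longrightarrow> y \<in> q \<Longrightarrow> \<gamma> (x + y) = \<gamma> x + \<gamma> y"
    and "x \<in> q \<Longrightarrow> \<gamma> (mscale c x) = c * \<gamma> x"
  using assms by (auto simp: linear_forms_def)

lemma linear_forms_antimono: "p \<subseteq> q \<Longrightarrow> \<gamma> \<in> linear_forms q \<Longrightarrow> \<gamma> \<in> linear_forms p"
  unfolding linear_forms_def by blast

lemma linear_forms_UNIV: "\<gamma> \<in> linear_forms UNIV \<Longrightarrow> \<gamma> \<in> linear_forms p"
  by (rule linear_forms_antimono) auto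

lemma linear_forms_zero:
  fixes q :: "'k::field matrix set"
  assumes "\<gamma> \<in> linear_forms q" "mat_vs.subspace q"
  shows "\<gamma> 0 = 0"
  using linear_formsD(2)[OF assms(1) mat_vs.subspace_0[OF assms(2)], of 0]
  by (simp only: mat_vs.scale_zero_left mult_zero_left)

lemma linear_forms_diff:
  fixes q :: "'k::field matrix set"
  assumes "\<gamma> \<in> linear_forms q" "mat_vs.subspace q" "x \<in> q" "y \<in> q"
  shows "\<gamma> (x - y) = \<gamma> x - \<gamma> y"
proof -
  have m: "mscale (-1) y = - y" by (auto simp: mscale_def fun_eq_iff)
  have "mscale (-1) y \<in> q" using assms mat_vs.subspace_scale by blast
  then show ?thesis
    using linear_formsD(1)[OF assms(1,3), of "- y"] linear_formsD(2)[OF assms(1,4), of "-1"] by (simp add: m)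
qed

lemma linear_forms_sum:
  fixes q :: "'k::field matrix set"
  assumes "\<gamma> \<in> linear_forms q" "mat_vs.subspace q" "\<And>i. i \<in> I \<Longrightarrow> x i \<in> q"
  shows "\<gamma> (\<Sum>i\<in>I. mscale (c i) (x i)) = (\<Sum>i\<in>I. c i * \<gamma> (x i))"
  using assms(3)
proof (induction I rule: infinite_finite_induct)
  case (insert i I)
  have "(\<Sum>i\<in>I. mscale (c i) (x i)) \<in> q"
    using assms(2) insert by (intro mat_vs.subspace_sum mat_vs.subspace_scale) auto
  moreover have "mscale (c i) (x i) \<in> q" using assms(2) insert mat_vs.subspace_scale by blast
  moreover have "\<gamma> (\<Sum>i\<in>I. mscale (c i) (x i)) = (\<Sum>i\<in>I. c i * \<gamma> (x i))"
    using insert.IH insert.prems by blast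
  ultimately have "\<gamma> (mscale (c i) (x i) + (\<Sum>i\<in>I. mscale (c i) (x i))) = c i * \<gamma> (x i) + (\<Sum>i\<in>I. c i * \<gamma> (x i))"
    using linear_formsD(1)[OF assms(1)] linear_formsD(2)[OF assms(1) insert.prems[of i]] by simp
  then show ?case by (simp only: sum.insert[OF insert(1,2)])
qed (simp_all add: linear_forms_zero[OF assms(1,2)])

text \<open>Induction on the forms: restrict to the kernel of one of them, apply the hypothesis
  there, and correct by a multiple of that form. This finite-dimensional duality is the source of
  all existence statements about stabiliser elements below.\<close>

lemma linear_form_in_span:
  fixes q :: "'k::field matrix set"
  assumes "mat_vs.subspace q" "finite I" "\<And>i. i \<in> I \<Longrightarrow> \<phi> i \<in> linear_forms q" "\<delta> \<in> linear_forms q"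
    and "\<And>y. y \<in> q \<Longrightarrow> (\<And>i. i \<in> I \<Longrightarrow> \<phi> i y = 0) \<Longrightarrow> \<delta> y = 0"
  shows "\<exists>c. \<forall>y\<in>q. \<delta> y = (\<Sum>i\<in>I. c i * \<phi> i y)"
  using assms(2,1,3-)
proof (induction I arbitrary: q rule: finite_induct)
  case (insert j I)
  define q0 where "q0 = {y \<in> q. \<phi> j y = 0}"
  have lj: "\<phi> j \<in> linear_forms q" using insert by auto
  have q0: "mat_vs.subspace q0"
    unfolding q0_def mat_vs.subspace_def
    using linear_formsD[OF lj] linear_forms_zero[OF lj] insert(4) mat_vs.subspace_0[OF insert(4)]
      mat_vs.subspace_add[OF insert(4)] mat_vs.subspace_scale[OF insert(4)]
    by auto
  have sub: "q0 \<subseteq> q" by (auto simp: q0_def)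
  have "\<exists>c. \<forall>y\<in>q0. \<delta> y = (\<Sum>i\<in>I. c i * \<phi> i y)"
  proof (rule insert(3)[OF q0])
    show "\<phi> i \<in> linear_forms q0" if "i \<in> I" for i using linear_forms_antimono[OF sub] insert(5) that by blast
    show "\<delta> \<in> linear_forms q0" using linear_forms_antimono[OF sub] insert(6) by blast
    show "\<delta> y = 0" if "y \<in> q0" "\<And>i. i \<in> I \<Longrightarrow> \<phi> i y = 0" for y
      using that insert(7)[of y] by (auto simp: q0_def)
  qed
  then obtain c where c: "\<And>y. y \<in> q0 \<Longrightarrow> \<delta> y = (\<Sum>i\<in>I. c i * \<phi> i y)" by blast
  show ?case
  proof (cases "\<forall>y\<in>q. \<phi> j y = 0")
    case True
    then have "\<forall>y\<in>q. \<delta> y = (\<Sum>i\<in>insert j I. (c(j := 0)) i * \<phi> i y)"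
      using c insert(1,2) by (auto simp: q0_def intro!: sum.cong)
    then show ?thesis by blast
  next
    case False
    then obtain y0 where y0: "y0 \<in> q" "\<phi> j y0 \<noteq> 0" by blast
    \<comment> \<open>The coefficient is forced by evaluation at \<open>y0\<close>, since modulo
      \<open>q0\<close> every \<open>y\<close> is a multiple of \<open>y0\<close>.\<close>
    define e where "e = (\<delta> y0 - (\<Sum>i\<in>I. c i * \<phi> i y0)) / \<phi> j y0"
    have "\<delta> y = (\<Sum>i\<in>insert j I. (c(j := e)) i * \<phi> i y)" if y: "y \<in> q" for y
    proof -
      define r where "r = \<phi> j y / \<phi> j y0"
      have m: "mscale r y0 \<in> q" using insert(4) y0 mat_vs.subspace_scale by blast
      have lin: "\<psi> (y - mscale r y0) = \<psi> y - r * \<psi> y0" if "\<psi> \<in> linear_forms q" for \<psi>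
        using linear_forms_diff[OF that insert(4) y m] linear_formsD(2)[OF that y0(1)] by simp
      have "y - mscale r y0 \<in> q0"
        using lin[OF lj] y0 m y insert(4) by (auto simp: q0_def r_def intro: mat_vs.subspace_diff)
      then have "\<delta> (y - mscale r y0) = (\<Sum>i\<in>I. c i * \<phi> i (y - mscale r y0))" by (rule c)
      also have "\<dots> = (\<Sum>i\<in>I. c i * (\<phi> i y - r * \<phi> i y0))"
        using insert lin by (intro sum.cong) auto
      finally have "\<delta> y = r * \<delta> y0 + (\<Sum>i\<in>I. c i * (\<phi> i y - r * \<phi> i y0))"
        using lin[OF insert(6)] by (metis add.commute diff_add_cancel)
      also have "\<dots> = e * \<phi> j y + (\<Sum>i\<in>I. c i * \<phi> i y)"
        using y0 by (simp add: e_def r_def sum_subtractf algebra_simps sum_distrib_left sum_divide_distrib diff_divide_distrib)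
      also have "\<dots> = (\<Sum>i\<in>insert j I. (c(j := e)) i * \<phi> i y)"
        using insert(1,2) by (auto intro!: sum.cong)
      finally show ?thesis .
    qed
    then show ?thesis by blast
  qed
qed auto

lemma mmult_assoc: "mmult N (mmult N x y) z = mmult N x (mmult N y z)"
proof (intro ext)
  fix i j
  have "(\<Sum>k=1..N. (\<Sum>l=1..N. x i l * y l k) * z k j) = (\<Sum>k=1..N. \<Sum>l=1..N. x i l * (y l k * z k j))"
    by (simp add: sum_distrib_right mult.assoc)
  also have "\<dots> = (\<Sum>l=1..N. \<Sum>k=1..N. x i l * (y l k * z k j))"
    by (rule sum.swap)
  finally show "mmult N (mmult N x y) z i j = mmult N x (mmult N y z) i j"
    by (simp add: mmult_def sum_distrib_left)
qed

lemma mmult_add_left: "mmult N (x + y) z = mmult N x z + mmult N y z"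
  and mmult_add_right: "mmult N z (x + y) = mmult N z x + mmult N z y"
  and mmult_diff_left: "mmult N (x - y) z = mmult N x z - mmult N y z"
  and mmult_diff_right: "mmult N z (x - y) = mmult N z x - mmult N z y"
  and mmult_scale_left: "mmult N (mscale c x) z = mscale c (mmult N x z)"
  and mmult_scale_right: "mmult N z (mscale c x) = mscale c (mmult N z x)"
  by (simp_all add: mmult_def mscale_def fun_eq_iff distrib_left distrib_right left_diff_distrib
      right_diff_distrib sum.distrib sum_subtractf sum_distrib_left mult.assoc mult.left_commute)

lemma bracket_add_left: "bracket N (x + y) z = bracket N x z + bracket N y z"
  and bracket_add_right: "bracket N z (x + y) = bracket N z x + bracket N z y"
  and bracket_scale_left: "bracket N (mscale c x) z = mscale c (bracket N x z)"
  and bracket_scale_right: "bracket N z (mscale c x) = mscale c (bracket N z x)"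
  by (auto simp: bracket_def mmult_add_left mmult_add_right mmult_scale_left mmult_scale_right
      mat_vs.scale_right_diff_distrib)

lemma bracket_jacobi:
  "bracket N x (bracket N v w) = bracket N (bracket N x v) w + bracket N v (bracket N x w)"
  by (simp add: bracket_def mmult_diff_left mmult_diff_right mmult_assoc)

lemma bracket_swap: "bracket N y x = - bracket N x y"
  by (simp add: bracket_def)

lemma bracket_zero [simp]: "bracket N 0 x = 0" "bracket N x 0 = 0"
  by (auto simp: bracket_def mmult_def fun_eq_iff)

lemma bracket_sum_left: "bracket N (\<Sum>i\<in>I. mscale (c i) (x i)) z = (\<Sum>i\<in>I. mscale (c i) (bracket N (x i) z))"
proof (induction I rule: infinite_finite_induct)
  case (insert i I)
  then show ?case
    by (simp only: sum.insert[OF insert(1,2)] bracket_add_left bracket_scale_left)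
qed (simp_all only: sum.infinite sum.empty bracket_zero not_False_eq_True)

subsection \<open>Finite-dimensional subspaces of matrices\<close>

definition munit :: "nat \<Rightarrow> nat \<Rightarrow> 'k::field matrix" where
  "munit i j = (\<lambda>k l. if k = i \<and> l = j then 1 else 0)"

lemma gl_subset_span:
  "(gl N :: 'k::field matrix set) \<subseteq> mat_vs.span ((\<lambda>(i, j). munit i j) ` ({1..N} \<times> {1..N}))"
proof
  fix x :: "'k matrix" assume x: "x \<in> gl N"
  have "x = (\<Sum>(i, j)\<in>{1..N} \<times> {1..N}. mscale (x i j) (munit i j))" (is "_ = ?r")
  proof (intro ext)
    fix k l
    have s: "(sum g S) k l = sum (\<lambda>p. g p k l) S" for g :: "nat \<times> nat \<Rightarrow> 'k matrix" and S
      by (induction S rule: infinite_finite_induct) auto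
    have "?r k l = (\<Sum>p\<in>{1..N} \<times> {1..N}. if p = (k, l) then x k l else 0)"
      unfolding s by (intro sum.cong) (auto simp: mscale_def munit_def split: if_splits)
    also have "\<dots> = x k l" using x by (auto simp: gl_def)
    finally show "x k l = ?r k l" ..
  qed
  moreover have "?r \<in> mat_vs.span ((\<lambda>(i, j). munit i j) ` ({1..N} \<times> {1..N}))"
    by (rule mat_vs.span_sum) (clarsimp, intro mat_vs.span_scale mat_vs.span_base, force)
  ultimately show "x \<in> mat_vs.span ((\<lambda>(i, j). munit i j) ` ({1..N} \<times> {1..N}))" by simp
qed

lemma finite_independent_gl:
  fixes B :: "'k::field matrix set"
  assumes "B \<subseteq> gl N" "mat_vs.independent B"
  shows "finite B"
proof -
  have "B \<subseteq> mat_vs.span ((\<lambda>(i, j). munit i j) ` ({1..N} \<times> {1..N}))"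
    using assms(1) gl_subset_span by (rule subset_trans)
  from mat_vs.independent_span_bound[OF _ assms(2) this] show ?thesis by simp
qed

lemma finite_basis_gl:
  fixes q :: "'k::field matrix set"
  assumes "q \<subseteq> gl N"
  obtains B where "finite B" "B \<subseteq> q" "mat_vs.independent B" "q \<subseteq> mat_vs.span B" "card B = mat_vs.dim q"
proof -
  obtain B where B: "B \<subseteq> q" "mat_vs.independent B" "q \<subseteq> mat_vs.span B" "card B = mat_vs.dim q"
    using mat_vs.basis_exists[of q] by blast
  then show ?thesis using that[of B] finite_independent_gl[of B N] assms by blast
qed

text \<open>Indexed families are used because stabiliser elements are produced one for each slice
  coordinate; that they are distinct is then a consequence
  (\<open>independent_family_inj\<close>).\<close>

definition independent_family :: "'i set \<Rightarrow> ('i \<Rightarrow> 'k::field matrix) \<Rightarrow> bool" where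
  "independent_family K X \<longleftrightarrow> (\<forall>c. (\<Sum>k\<in>K. mscale (c k) (X k)) = 0 \<longrightarrow> (\<forall>k\<in>K. c k = 0))"

lemma independent_family_inj:
  fixes X :: "'i \<Rightarrow> 'k::field matrix"
  assumes "independent_family K X" "finite K"
  shows "inj_on X K" "mat_vs.independent (X ` K)"
proof -
  show inj: "inj_on X K"
  proof (rule inj_onI, rule ccontr)
    fix i j assume ij: "i \<in> K" "j \<in> K" "X i = X j" "i \<noteq> j"
    define c :: "'i \<Rightarrow> 'k" where "c = (\<lambda>k. if k = i then 1 else if k = j then -1 else 0)"
    have "(\<Sum>k\<in>K. mscale (c k) (X k)) = (\<Sum>k\<in>{i, j}. mscale (c k) (X k))"
      using assms ij by (intro sum.mono_neutral_right) (auto simp: c_def mscale_def fun_eq_iff)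
    also have "\<dots> = 0" using ij by (auto simp: c_def mscale_def fun_eq_iff)
    finally have "c i = 0" using assms(1) ij by (auto simp: independent_family_def)
    then show False by (simp add: c_def)
  qed
  show "mat_vs.independent (X ` K)"
  proof (rule mat_vs.independent_if_scalars_zero)
    fix u x assume u: "(\<Sum>x\<in>X ` K. mscale (u x) x) = 0" "x \<in> X ` K"
    then have "(\<Sum>k\<in>K. mscale (u (X k)) (X k)) = 0" by (simp add: sum.reindex[OF inj])
    then have "\<forall>k\<in>K. u (X k) = 0" using assms(1) by (auto simp: independent_family_def)
    then show "u x = 0" using u by auto
  qed (use assms in auto)
qed

lemma independent_family_card_le_dim:
  fixes q :: "'k::field matrix set"
  assumes "q \<subseteq> gl N" "independent_family K X" "finite K" "\<And>k. k \<in> K \<Longrightarrow> X k \<in> q"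
  shows "card K \<le> mat_vs.dim q"
proof -
  obtain B where B: "finite B" "B \<subseteq> q" "mat_vs.independent B" "q \<subseteq> mat_vs.span B" "card B = mat_vs.dim q"
    by (rule finite_basis_gl[OF assms(1)])
  have "card (X ` K) \<le> card B"
    using mat_vs.independent_span_bound[OF B(1) independent_family_inj(2)[OF assms(2,3)]] B(4) assms(4) by auto
  then show ?thesis using B(5) card_image[OF independent_family_inj(1)[OF assms(2,3)]] by simp
qed

lemma dependent_family_if_card_gt:
  fixes q :: "'k::field matrix set"
  assumes "q \<subseteq> gl N" "finite K" "\<And>k. k \<in> K \<Longrightarrow> X k \<in> q" "mat_vs.dim q < card K"
  obtains c where "(\<Sum>k\<in>K. mscale (c k) (X k)) = 0" "\<exists>k\<in>K. c k \<noteq> 0"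
proof -
  have "\<not> independent_family K X"
    using independent_family_card_le_dim[OF assms(1) _ assms(2), of X] assms(3,4) leD by blast
  then show ?thesis using that unfolding independent_family_def by blast
qed

subsection \<open>Determinants of linear matrix pencils\<close>

text \<open>Entries are given by a function on pairs of indices, so that rows and columns can be
  replaced by function update and no dimension conditions appear.\<close>

definition minor :: "nat \<Rightarrow> (nat \<Rightarrow> nat \<Rightarrow> 'a) \<Rightarrow> 'a::comm_ring_1" where
  "minor m A = det (mat m m (\<lambda>(i, j). A i j))"

lemma minor_leibniz:
  "minor m A = (\<Sum>p\<in>{p. p permutes {0..<m}}. signof p * (\<Prod>i=0..<m. A i (p i)))"
proof -
  have "minor m A = (\<Sum>p\<in>{p. p permutes {0..<m}}. signof p * (\<Prod>i=0..<m. mat m m (\<lambda>(i, j). A i j) $$ (i, p i)))"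
    unfolding minor_def by (rule det_def') auto
  also have "\<dots> = (\<Sum>p\<in>{p. p permutes {0..<m}}. signof p * (\<Prod>i=0..<m. A i (p i)))"
  proof (intro sum.cong refl arg_cong2[where f = times] prod.cong)
    fix p i assume "p \<in> {p. p permutes {0..<m}}" "i \<in> {0..<m}"
    then have "i < m" "p i < m" using permutes_in_image[of p "{0..<m}" i] by auto
    then show "mat m m (\<lambda>(i, j). A i j) $$ (i, p i) = A i (p i)" by simp
  qed
  finally show ?thesis .
qed

text \<open>Evaluation is a ring homomorphism and commutes with determinants. It is applied both to
  polynomials in t and to polynomials in z with coefficients in k[t].\<close>

lemma poly_minor: "poly (minor m A) x = minor m (\<lambda>i j. poly (A i j) x)"
proof -
  interpret h: comm_ring_hom "\<lambda>p. poly p x" by unfold_locales auto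
  have "map_mat (\<lambda>p. poly p x) (mat m m (\<lambda>(i, j). A i j)) = mat m m (\<lambda>(i, j). poly (A i j) x)"
    by (intro eq_matI) auto
  then show ?thesis unfolding minor_def using h.hom_det[of "mat m m (\<lambda>(i, j). A i j)"] by simp
qed

lemma minor_one: "minor m (\<lambda>i j. if i = j then 1 else 0) = 1"
proof -
  have "mat m m (\<lambda>(i, j). if i = j then 1 else 0) = (1\<^sub>m m :: 'a mat)" by (intro eq_matI) auto
  then show ?thesis by (simp add: minor_def)
qed

lemma minor_cong: "(\<And>i j. i < m \<Longrightarrow> j < m \<Longrightarrow> A i j = B i j) \<Longrightarrow> minor m A = minor m B"
  unfolding minor_def by (intro arg_cong[where f = det] eq_matI) auto

lemma minor_dependent_rows:
  fixes A :: "nat \<Rightarrow> nat \<Rightarrow> 'a::idom"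
  assumes "\<And>j. j < m \<Longrightarrow> (\<Sum>i<m. c i * A i j) = 0" "i0 < m" "c i0 \<noteq> 0"
  shows "minor m A = 0"
proof -
  let ?M = "mat m m (\<lambda>(i, j). A j i)"
  have "?M *\<^sub>v vec m c = 0\<^sub>v m"
    using assms(1) by (intro eq_vecI) (auto simp: scalar_prod_def mult.commute atLeast0LessThan)
  moreover have "vec m c \<noteq> 0\<^sub>v m" using assms(2,3) by (metis index_vec index_zero_vec(1))
  ultimately have "det ?M = 0"
    using det_0_iff_vec_prod_zero[of ?M m] by (metis mat_carrier vec_carrier)
  moreover have "transpose_mat (mat m m (\<lambda>(i, j). A i j)) = ?M" by (intro eq_matI) auto
  ultimately show ?thesis using det_transpose[of "mat m m (\<lambda>(i, j). A i j)" m] by (simp add: minor_def)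
qed

lemma coeff_prod_linear:
  fixes a d :: "'i \<Rightarrow> 'a::comm_ring_1"
  assumes "finite S"
  shows "coeff (\<Prod>i\<in>S. [:a i, d i:]) 0 = (\<Prod>i\<in>S. a i)"
    and "coeff (\<Prod>i\<in>S. [:a i, d i:]) 1 = (\<Sum>k\<in>S. \<Prod>i\<in>S. if i = k then d i else a i)"
proof -
  show c0: "coeff (\<Prod>i\<in>S. [:a i, d i:]) 0 = (\<Prod>i\<in>S. a i)" for S
    by (induction S rule: infinite_finite_induct) (auto simp: coeff_mult)
  show "coeff (\<Prod>i\<in>S. [:a i, d i:]) 1 = (\<Sum>k\<in>S. \<Prod>i\<in>S. if i = k then d i else a i)"
    using assms
  proof (induction S rule: finite_induct)
    case (insert x S)
    have "coeff (\<Prod>i\<in>insert x S. [:a i, d i:]) 1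
        = a x * coeff (\<Prod>i\<in>S. [:a i, d i:]) 1 + d x * coeff (\<Prod>i\<in>S. [:a i, d i:]) 0"
      using insert(1,2) by (simp add: coeff_mult atMost_Suc)
    also have "\<dots> = (\<Sum>k\<in>S. \<Prod>i\<in>insert x S. if i = k then d i else a i)
        + (\<Prod>i\<in>insert x S. if i = x then d i else a i)"
    proof (rule arg_cong2[where f = "(+)"])
      have "(\<Prod>i\<in>insert x S. if i = k then d i else a i) = a x * (\<Prod>i\<in>S. if i = k then d i else a i)" if "k \<in> S" for k
        using insert(1,2) that by auto
      then show "a x * coeff (\<Prod>i\<in>S. [:a i, d i:]) 1 = (\<Sum>k\<in>S. \<Prod>i\<in>insert x S. if i = k then d i else a i)"
        by (simp only: insert.IH sum_distrib_left cong: sum.cong)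
      have "(\<Prod>i\<in>S. if i = x then d i else a i) = (\<Prod>i\<in>S. a i)" using insert(2) by (intro prod.cong) auto
      then show "d x * coeff (\<Prod>i\<in>S. [:a i, d i:]) 0 = (\<Prod>i\<in>insert x S. if i = x then d i else a i)"
        using insert(1,2) by (simp add: c0)
    qed
    finally show ?case using insert(1,2) by (simp add: add.commute)
  qed auto
qed

lemma coeff_minor_linear_0: "coeff (minor m (\<lambda>i j. [:A i j, D i j:])) 0 = minor m A"
  unfolding poly_0_coeff_0[symmetric] poly_minor by simp

text \<open>The derivative of a determinant may be summed over rows or over columns. Splitting the
  perturbation sends \<open>B\<close> to the rows and \<open>C\<close> to the columns, which is how
  the two terms of [x,[v,w]] = [[x,v],w] + [v,[x,w]] are absorbed.\<close>

lemma coeff_minor_linear_1: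
  fixes A B C :: "nat \<Rightarrow> nat \<Rightarrow> 'a::comm_ring_1"
  shows "coeff (minor m (\<lambda>i j. [:A i j, B i j + C i j:])) 1 =
    (\<Sum>k<m. minor m (\<lambda>i j. if i = k then B i j else A i j)) +
    (\<Sum>k<m. minor m (\<lambda>i j. if j = k then C i j else A i j))"
proof -
  let ?P = "{p. p permutes {0..<m}}"
  have sg: "(signof p :: 'a poly) = [:signof p:]" for p by (simp add: of_int_poly)
  have "coeff (minor m (\<lambda>i j. [:A i j, B i j + C i j:])) 1
      = (\<Sum>p\<in>?P. signof p * (\<Sum>k=0..<m. \<Prod>i=0..<m. if i = k then B i (p i) + C i (p i) else A i (p i)))"
    unfolding minor_leibniz coeff_sum sg by (simp add: coeff_prod_linear(2)[simplified])
  also have "\<dots> = (\<Sum>p\<in>?P. signof p * (\<Sum>k=0..<m. (\<Prod>i=0..<m. if i = k then B i (p i) else A i (p i))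
        + (\<Prod>i=0..<m. if i = k then C i (p i) else A i (p i))))"
  proof (intro sum.cong refl arg_cong2[where f = times])
    fix p k assume k: "k \<in> {0..<m}"
    have s: "(\<Prod>i=0..<m. if i = k then X i else A i (p i)) = X k * (\<Prod>i\<in>{0..<m} - {k}. A i (p i))" for X :: "nat \<Rightarrow> 'a"
    proof -
      have "(\<Prod>i=0..<m. if i = k then X i else A i (p i))
        = (if k = k then X k else A k (p k)) * (\<Prod>i\<in>{0..<m} - {k}. if i = k then X i else A i (p i))"
        using k by (intro prod.remove) auto
      also have "(\<Prod>i\<in>{0..<m} - {k}. if i = k then X i else A i (p i)) = (\<Prod>i\<in>{0..<m} - {k}. A i (p i))"
        by (intro prod.cong) auto
      finally show ?thesis by simp
    qed
    show "(\<Prod>i=0..<m. if i = k then B i (p i) + C i (p i) else A i (p i))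
      = (\<Prod>i=0..<m. if i = k then B i (p i) else A i (p i)) + (\<Prod>i=0..<m. if i = k then C i (p i) else A i (p i))"
      unfolding s by (simp add: distrib_right)
  qed
  also have "\<dots> = (\<Sum>p\<in>?P. \<Sum>k=0..<m. signof p * (\<Prod>i=0..<m. if i = k then B i (p i) else A i (p i)))
      + (\<Sum>p\<in>?P. \<Sum>k=0..<m. signof p * (\<Prod>i=0..<m. if i = k then C i (p i) else A i (p i)))"
    by (simp add: sum.distrib distrib_left sum_distrib_left)
  \<comment> \<open>The entry in row i lies in column p i, so reindexing by the permutation turns a
    distinguished row into a distinguished column.\<close>
  also have "(\<Sum>p\<in>?P. \<Sum>k=0..<m. signof p * (\<Prod>i=0..<m. if i = k then C i (p i) else A i (p i)))
      = (\<Sum>p\<in>?P. \<Sum>k=0..<m. signof p * (\<Prod>i=0..<m. if p i = k then C i (p i) else A i (p i)))"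
  proof (rule sum.cong[OF refl])
    fix p assume "p \<in> ?P"
    then have p: "p permutes {0..<m}" by simp
    have "(\<Sum>k=0..<m. signof p * (\<Prod>i=0..<m. if p i = k then C i (p i) else A i (p i)))
      = (\<Sum>k=0..<m. signof p * (\<Prod>i=0..<m. if p i = p k then C i (p i) else A i (p i)))"
      by (rule sum.permute[OF p, unfolded comp_def])
    also have "\<dots> = (\<Sum>k=0..<m. signof p * (\<Prod>i=0..<m. if i = k then C i (p i) else A i (p i)))"
      using permutes_inj[OF p] by (auto simp: inj_eq)
    finally show "(\<Sum>k=0..<m. signof p * (\<Prod>i=0..<m. if i = k then C i (p i) else A i (p i)))
      = (\<Sum>k=0..<m. signof p * (\<Prod>i=0..<m. if p i = k then C i (p i) else A i (p i)))" ..
  qed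
  finally show ?thesis
    unfolding minor_leibniz atLeast0LessThan[symmetric]
    by (subst (asm) (1 2) sum.swap) simp
qed

text \<open>Substituting \<open>z = u t\<close> in a polynomial in \<open>z\<close> with coefficients in \<open>k[t]\<close>.\<close>

lemma coeff_poly_linear_substitution:
  fixes Q :: "'a::comm_ring_1 poly poly"
  shows "coeff (poly Q [:0, u:]) k = (\<Sum>j\<le>k. u ^ j * coeff (coeff Q j) (k - j))"
proof -
  have pw: "[:0, u:] ^ j = monom (u ^ j) j" for j
    by (induction j) (simp_all add: monom_altdef mult.commute power_mult_distrib flip: smult_monom)
  have c: "coeff (coeff Q j * [:0, u:] ^ j) k = (if k < j then 0 else u ^ j * coeff (coeff Q j) (k - j))" for j
    unfolding pw by (subst mult.commute) (rule coeff_monom_mult)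
  have "coeff (poly Q [:0, u:]) k = (\<Sum>j\<le>degree Q. if k < j then 0 else u ^ j * coeff (coeff Q j) (k - j))"
    by (simp add: poly_altdef coeff_sum c)
  also have "\<dots> = (\<Sum>j\<le>degree Q + k. if k < j then 0 else u ^ j * coeff (coeff Q j) (k - j))"
    by (intro sum.mono_neutral_left) (auto simp: coeff_eq_0)
  also have "\<dots> = (\<Sum>j\<le>k. if k < j then 0 else u ^ j * coeff (coeff Q j) (k - j))"
    by (intro sum.mono_neutral_right) auto
  also have "\<dots> = (\<Sum>j\<le>k. u ^ j * coeff (coeff Q j) (k - j))" by (intro sum.cong) auto
  finally show ?thesis .
qed

text \<open>For fixed \<open>l\<close> the evaluations are the values of one polynomial in
  \<open>s\<close>, and over an infinite field a polynomial with only zero values is zero.\<close>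

lemma coeff_coeff_zero_if_all_evaluations_zero:
  fixes Q :: "'a::field_char_0 poly poly"
  assumes "\<And>s. coeff (poly Q [:s:]) l = 0"
  shows "coeff (coeff Q j) l = 0"
proof -
  define p where "p = (\<Sum>j\<le>degree Q. monom (coeff (coeff Q j) l) j)"
  have pw: "[:s:] ^ j = [:s ^ j:]" for s :: 'a and j by (induction j) (auto simp: one_pCons)
  have "poly p s = 0" for s
    using assms[of s] by (simp add: p_def poly_sum poly_monom poly_altdef[of Q] coeff_sum pw mult.commute)
  then have "p = 0" using poly_all_0_iff_0 by blast
  then have "coeff p j = 0" by simp
  then show ?thesis
    by (cases "j \<le> degree Q") (auto simp: p_def coeff_sum coeff_eq_0 if_distrib cong: if_cong)
qed

subsection \<open>A slice criterion for the index\<close>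

text \<open>This is the negative of the usual coadjoint action; orbits and tangent directions are
  the same, and minus signs disappear.\<close>

definition coadjoint :: "nat \<Rightarrow> 'k::field matrix \<Rightarrow> ('k matrix \<Rightarrow> 'k) \<Rightarrow> 'k matrix \<Rightarrow> 'k" where
  "coadjoint N x \<gamma> = (\<lambda>y. \<gamma> (bracket N x y))"

text \<open>A minor of the skew form (x,y) -> (f + t\<delta>)([x,y]). The kernel of this form is the
  stabiliser, so vanishing minors of a given size mean a large stabiliser.\<close>

definition pencil_minor ::
  "nat \<Rightarrow> nat \<Rightarrow> ('k::field matrix \<Rightarrow> 'k) \<Rightarrow> ('k matrix \<Rightarrow> 'k) \<Rightarrow> (nat \<Rightarrow> 'k matrix) \<Rightarrow> (nat \<Rightarrow> 'k matrix) \<Rightarrow> 'k poly" where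
  "pencil_minor N m f \<delta> v w = minor m (\<lambda>i j. [:f (bracket N (v i) (w j)), \<delta> (bracket N (v i) (w j)):])"

text \<open>The quantifiers over all \<open>\<delta>\<close>, \<open>v\<close> and \<open>w\<close>
  carry the induction on \<open>k\<close>: its step replaces \<open>\<delta>\<close> by other
  directions and the vectors by brackets.\<close>

definition vanishing_order ::
  "nat \<Rightarrow> 'k::field matrix set \<Rightarrow> nat \<Rightarrow> ('k matrix \<Rightarrow> 'k) \<Rightarrow> nat \<Rightarrow> bool" where
  "vanishing_order N q m f k \<longleftrightarrow> (\<forall>\<delta>\<in>linear_forms q. \<forall>v w. range v \<subseteq> q \<longrightarrow> range w \<subseteq> q \<longrightarrow>
     (\<forall>l<k. coeff (pencil_minor N m f \<delta> v w) l = 0))"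

locale matrix_lie_algebra =
  fixes N :: nat and q :: "'k::field_char_0 matrix set"
  assumes subspace: "mat_vs.subspace q"
    and bracket_closed: "x \<in> q \<Longrightarrow> y \<in> q \<Longrightarrow> bracket N x y \<in> q"
    and subset_gl: "q \<subseteq> gl N"
begin

lemma linear_forms_add: "\<gamma> \<in> linear_forms q \<Longrightarrow> \<delta> \<in> linear_forms q \<Longrightarrow> (\<lambda>y. \<gamma> y + s * \<delta> y) \<in> linear_forms q"
  unfolding linear_forms_def by (auto simp: algebra_simps)

lemma linear_forms_scale: "\<gamma> \<in> linear_forms q \<Longrightarrow> (\<lambda>y. s * \<gamma> y) \<in> linear_forms q"
  unfolding linear_forms_def by (auto simp: algebra_simps)

lemma linear_forms_coadjoint: "\<gamma> \<in> linear_forms q \<Longrightarrow> x \<in> q \<Longrightarrow> coadjoint N x \<gamma> \<in> linear_forms q"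
  using bracket_closed[of x] unfolding linear_forms_def coadjoint_def
  by (auto simp: bracket_add_right bracket_scale_right)

text \<open>In f + t(\<delta> + z\<delta>') the coefficients of t^l with l < k vanish for every
  value of z, hence identically in z. After putting z = t only the term constant in z can reach
  t^k.\<close>

lemma coeff_quadratic_pencil:
  assumes f: "f \<in> linear_forms q" and d: "\<delta> \<in> linear_forms q" "\<delta>' \<in> linear_forms q"
    and van: "vanishing_order N q m f k" and vw: "range v \<subseteq> q" "range w \<subseteq> q"
  shows "coeff (minor m (\<lambda>i j. [:f (bracket N (v i) (w j)), \<delta> (bracket N (v i) (w j)), \<delta>' (bracket N (v i) (w j)):])) k
    = coeff (pencil_minor N m f \<delta> v w) k"
proof -
  let ?e = "\<lambda>i j. bracket N (v i) (w j)"
  define Q where "Q = minor m (\<lambda>i j. [:[:f (?e i j), \<delta> (?e i j):], [:0, \<delta>' (?e i j):]:])"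
  have "poly Q [:s:] = pencil_minor N m f (\<lambda>y. \<delta> y + s * \<delta>' y) v w" for s
    unfolding Q_def poly_minor pencil_minor_def by (simp add: mult.commute)
  then have "coeff (poly Q [:s:]) l = 0" if "l < k" for s l
    using van linear_forms_add[OF d, of s] vw that unfolding vanishing_order_def by auto
  then have z: "coeff (coeff Q j) l = 0" if "l < k" for j l
    using coeff_coeff_zero_if_all_evaluations_zero that by blast
  have "minor m (\<lambda>i j. [:f (?e i j), \<delta> (?e i j), \<delta>' (?e i j):]) = poly Q [:0, 1:]"
    unfolding Q_def poly_minor by simp
  then have "coeff (minor m (\<lambda>i j. [:f (?e i j), \<delta> (?e i j), \<delta>' (?e i j):])) k = (\<Sum>j\<le>k. coeff (coeff Q j) (k - j))"
    by (simp add: coeff_poly_linear_substitution)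
  also have "\<dots> = (\<Sum>j\<in>{0}. coeff (coeff Q j) (k - j))"
    by (intro sum.mono_neutral_right) (auto simp: z)
  also have "coeff Q 0 = pencil_minor N m f \<delta> v w"
    unfolding Q_def pencil_minor_def by (rule coeff_minor_linear_0)
  then have "(\<Sum>j\<in>{0}. coeff (coeff Q j) (k - j)) = coeff (pencil_minor N m f \<delta> v w) k" by simp
  finally show ?thesis .
qed

text \<open>Evaluate f + t\<delta> on [v,w] + z[x,[v,w]], an infinitesimal automorphism. For z = ut
  this is the pencil with direction \<delta> + u x.f up to a term in t^2, which
  \<open>coeff_quadratic_pencil\<close> removes. The coefficient of u t^k is therefore that of z
  t^(k-1), a sum of coefficients of t^(k-1) in minors with one vector replaced by its bracket with
  x, and all of these vanish.\<close>

lemma leading_coeff_along_orbit_stationary: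
  assumes f: "f \<in> linear_forms q" and d: "\<delta> \<in> linear_forms q" and x: "x \<in> q"
    and van: "vanishing_order N q m f k" and vw: "range v \<subseteq> q" "range w \<subseteq> q"
  obtains p where "\<And>u. coeff (pencil_minor N m f (\<lambda>y. \<delta> y + u * coadjoint N x f y) v w) k = poly p u" "coeff p 1 = 0"
proof -
  let ?e = "\<lambda>i j. bracket N (v i) (w j)"
  let ?A = "\<lambda>i j. [:f (?e i j), \<delta> (?e i j):]"
  let ?B = "\<lambda>i j. [:f (bracket N (bracket N x (v i)) (w j)), \<delta> (bracket N (bracket N x (v i)) (w j)):]"
  let ?C = "\<lambda>i j. [:f (bracket N (v i) (bracket N x (w j))), \<delta> (bracket N (v i) (bracket N x (w j))):]"
  have inq: "v i \<in> q" "w i \<in> q" for i using vw by auto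
  define Q where "Q = minor m (\<lambda>i j. [:?A i j, ?B i j + ?C i j:])"
  define p where "p = (\<Sum>j\<le>k. monom (coeff (coeff Q j) (k - j)) j)"
  have lin: "\<gamma> (bracket N x (?e i j)) = \<gamma> (bracket N (bracket N x (v i)) (w j)) + \<gamma> (bracket N (v i) (bracket N x (w j)))"
    if "\<gamma> \<in> linear_forms q" for \<gamma> i j
    unfolding bracket_jacobi[of N x] by (intro linear_formsD(1)[OF that] bracket_closed x inq)
  have "poly p u = coeff (pencil_minor N m f (\<lambda>y. \<delta> y + u * coadjoint N x f y) v w) k" for u
  proof -
    have "poly p u = coeff (poly Q [:0, u:]) k"
      by (simp add: p_def poly_sum poly_monom coeff_poly_linear_substitution mult.commute)
    also have "poly Q [:0, u:] = minor m (\<lambda>i j. [:f (?e i j), (\<delta> (?e i j) + u * coadjoint N x f (?e i j)),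
        u * coadjoint N x \<delta> (?e i j):])"
      unfolding Q_def poly_minor by (intro minor_cong) (simp add: coadjoint_def lin f d algebra_simps)
    finally show ?thesis
      using coeff_quadratic_pencil[OF f linear_forms_add[OF d linear_forms_coadjoint[OF f x]]
          linear_forms_scale[OF linear_forms_coadjoint[OF d x]] van vw] by simp
  qed
  moreover have "coeff p 1 = 0"
  proof (cases k)
    case (Suc k')
    have "coeff p 1 = coeff (coeff Q 1) k'"
      unfolding p_def Suc using coeff_sum_monom[of 1 "Suc k'" "\<lambda>j. coeff (coeff Q j) (Suc k' - j)"] by simp
    also have "coeff Q 1 = (\<Sum>l<m. minor m (\<lambda>i j. if i = l then ?B i j else ?A i j)) +
        (\<Sum>l<m. minor m (\<lambda>i j. if j = l then ?C i j else ?A i j))"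
      unfolding Q_def by (rule coeff_minor_linear_1)
    also have "(\<lambda>l. minor m (\<lambda>i j. if i = l then ?B i j else ?A i j))
        = (\<lambda>l. pencil_minor N m f \<delta> (v(l := bracket N x (v l))) w)"
      unfolding pencil_minor_def by (intro ext minor_cong) auto
    also have "(\<lambda>l. minor m (\<lambda>i j. if j = l then ?C i j else ?A i j))
        = (\<lambda>l. pencil_minor N m f \<delta> v (w(l := bracket N x (w l))))"
      unfolding pencil_minor_def by (intro ext minor_cong) auto
    also have "coeff ((\<Sum>l<m. pencil_minor N m f \<delta> (v(l := bracket N x (v l))) w)
        + (\<Sum>l<m. pencil_minor N m f \<delta> v (w(l := bracket N x (w l))))) k' = 0"
    proof -
      have r: "range (v(l := bracket N x (v l))) \<subseteq> q" "range (w(l := bracket N x (w l))) \<subseteq> q" for l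
        using inq bracket_closed[OF x] by auto
      have z: "coeff (pencil_minor N m f \<delta> v' w') k' = 0" if "range v' \<subseteq> q" "range w' \<subseteq> q" for v' w'
        using van d that unfolding vanishing_order_def Suc by blast
      show ?thesis
        unfolding coeff_add coeff_sum by (simp add: z[OF r(1) vw(2)] z[OF vw(1) r(2)])
    qed
    finally show ?thesis .
  qed (simp add: p_def)
  ultimately show ?thesis using that[of p] by simp
qed

text \<open>The point u = 0 is not special: moving \<open>\<delta>\<close> along the same direction
  shows that the derivative vanishes everywhere, and in characteristic zero the polynomial is then
  constant.\<close>

lemma leading_coeff_along_orbit_constant:
  assumes f: "f \<in> linear_forms q" and d: "\<delta> \<in> linear_forms q" and x: "x \<in> q"
    and van: "vanishing_order N q m f k" and vw: "range v \<subseteq> q" "range w \<subseteq> q"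
  shows "coeff (pencil_minor N m f (\<lambda>y. \<delta> y + coadjoint N x f y) v w) k = coeff (pencil_minor N m f \<delta> v w) k"
proof -
  obtain p where p: "\<And>u. coeff (pencil_minor N m f (\<lambda>y. \<delta> y + u * coadjoint N x f y) v w) k = poly p u"
    using leading_coeff_along_orbit_stationary[OF assms] by metis
  have "poly (pderiv p) s = 0" for s
  proof -
    define \<delta>s where "\<delta>s = (\<lambda>y. \<delta> y + s * coadjoint N x f y)"
    have ds: "\<delta>s \<in> linear_forms q" unfolding \<delta>s_def by (intro linear_forms_add d linear_forms_coadjoint f x)
    obtain p' where p': "\<And>u. coeff (pencil_minor N m f (\<lambda>y. \<delta>s y + u * coadjoint N x f y) v w) k = poly p' u" "coeff p' 1 = 0"
      using leading_coeff_along_orbit_stationary[OF f ds x van vw] by metis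
    have "(\<lambda>y. \<delta>s y + u * coadjoint N x f y) = (\<lambda>y. \<delta> y + (s + u) * coadjoint N x f y)" for u
      by (auto simp: \<delta>s_def algebra_simps)
    then have "poly p' u = poly (pcompose p [:s, 1:]) u" for u
      using p'(1)[of u] p[of "s + u"] by (simp add: poly_pcompose)
    then have "p' = pcompose p [:s, 1:]" using poly_eq_poly_eq_iff by blast
    then have "pderiv p' = pcompose (pderiv p) [:s, 1:]" by (simp add: pderiv_pcompose pderiv_pCons)
    then have "poly (pderiv p) s = poly (pderiv p') 0" by (simp add: poly_pcompose)
    also have "\<dots> = 0" using p'(2) by (simp add: poly_0_coeff_0 coeff_pderiv)
    finally show ?thesis .
  qed
  then have "pderiv p = 0" using poly_all_0_iff_0 by blast
  then have "degree p = 0" by (simp add: pderiv_eq_0_iff)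
  then obtain c where "p = [:c:]" by (rule degree_eq_zeroE)
  then show ?thesis using p[of 1] p[of 0] by simp
qed

section \<open>Vanishing of minors and the dimension of stabilisers\<close>

lemma subspace_stabiliser:
  assumes "\<gamma> \<in> linear_forms q"
  shows "mat_vs.subspace (stabiliser N q \<gamma>)"
  unfolding mat_vs.subspace_def stabiliser_def
proof (intro conjI ballI allI CollectI, goal_cases)
  case 2 then show ?case by (simp add: linear_forms_zero[OF assms subspace])
next
  case (4 x y z) then show ?case
    using linear_formsD(1)[OF assms bracket_closed[of x z] bracket_closed[of y z]] by (simp add: bracket_add_left)
next
  case (6 c x y) then show ?case
    using linear_formsD(2)[OF assms bracket_closed[of x y]] by (simp add: bracket_scale_left)
qed (use subspace mat_vs.subspace_0 mat_vs.subspace_add mat_vs.subspace_scale in blast)+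

text \<open>The X and the m vectors \<open>v\<close> together outnumber the dimension of
  \<open>q\<close>. The resulting relation involves some v_i because the X are independent, and
  modulo the stabiliser it becomes a relation between the rows.\<close>

lemma minor_zero_if_dim_stabiliser_ge:
  assumes g: "\<gamma> \<in> linear_forms q" and K: "finite K" "independent_family K X" "\<And>k. k \<in> K \<Longrightarrow> X k \<in> stabiliser N q \<gamma>"
    and m: "mat_vs.dim q < card K + m" and vw: "range v \<subseteq> q" "range w \<subseteq> q"
  shows "minor m (\<lambda>i j. \<gamma> (bracket N (v i) (w j))) = 0"
proof -
  have Xq: "X k \<in> q" if "k \<in> K" for k using K(3)[OF that] by (simp add: stabiliser_def)
  have inq: "v i \<in> q" "w i \<in> q" for i using vw by auto
  let ?Y = "case_sum X v"
  have 1: "mat_vs.dim q < card (K <+> {..<m})" using m K(1) by (simp add: card_Plus)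
  have 2: "finite (K <+> {..<m})" using K(1) by simp
  have 3: "?Y k \<in> q" if "k \<in> K <+> {..<m}" for k using that Xq inq by auto
  obtain c where c: "(\<Sum>k\<in>K <+> {..<m}. mscale (c k) (?Y k)) = 0" "\<exists>k\<in>K <+> {..<m}. c k \<noteq> 0"
    by (rule dependent_family_if_card_gt[OF subset_gl 2 3 1])
  have sum: "(\<Sum>k\<in>K. mscale (c (Inl k)) (X k)) + (\<Sum>i<m. mscale (c (Inr i)) (v i)) = 0"
    using c(1) K(1) by (simp add: sum.Plus)
  obtain i0 where i0: "i0 < m" "c (Inr i0) \<noteq> 0"
  proof (rule ccontr)
    assume "\<not> thesis"
    then have z: "\<forall>i<m. c (Inr i) = 0" using that by blast
    then have "(\<Sum>i<m. mscale (c (Inr i)) (v i)) = 0" by (intro sum.neutral) (auto simp: mscale_def fun_eq_iff)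
    then have "\<forall>k\<in>K. c (Inl k) = 0"
      using sum K(2)[unfolded independent_family_def, rule_format, of "\<lambda>k. c (Inl k)"] by simp
    then show False using z c(2) by auto
  qed
  have "(\<Sum>i<m. c (Inr i) * \<gamma> (bracket N (v i) (w j))) = 0" for j
  proof -
    have "(\<Sum>i<m. c (Inr i) * \<gamma> (bracket N (v i) (w j))) = \<gamma> (bracket N (\<Sum>i<m. mscale (c (Inr i)) (v i)) (w j))"
      unfolding bracket_sum_left by (rule linear_forms_sum[OF g subspace, symmetric]) (auto intro: bracket_closed inq)
    also have "(\<Sum>i<m. mscale (c (Inr i)) (v i)) = mscale (-1) (\<Sum>k\<in>K. mscale (c (Inl k)) (X k))"
      using sum by (simp add: add_eq_0_iff2 mscale_def fun_eq_iff)
    also have "\<gamma> (bracket N \<dots> (w j)) = 0"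
    proof -
      have "mscale (-1) (\<Sum>k\<in>K. mscale (c (Inl k)) (X k)) \<in> stabiliser N q \<gamma>"
        using subspace_stabiliser[OF g] K(3)
        by (intro mat_vs.subspace_scale mat_vs.subspace_sum) auto
      then show ?thesis using inq by (simp add: stabiliser_def)
    qed
    finally show ?thesis .
  qed
  then show ?thesis by (rule minor_dependent_rows[where c = "\<lambda>i. c (Inr i)", OF _ i0])
qed

text \<open>If the stabiliser were smaller, there would be m vectors independent modulo it. The
  forms \<gamma>([v_i,.]) are then independent, and dual vectors in \<open>q\<close> turn the minor
  into that of an identity matrix.\<close>

lemma dim_stabiliser_ge_if_minors_zero:
  assumes g: "\<gamma> \<in> linear_forms q" and m: "r + m \<le> mat_vs.dim q + 1"
    and z: "\<And>v w. range v \<subseteq> q \<Longrightarrow> range w \<subseteq> q \<Longrightarrow> minor m (\<lambda>i j. \<gamma> (bracket N (v i) (w j))) = 0"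
  shows "r \<le> mat_vs.dim (stabiliser N q \<gamma>)"
proof (rule ccontr)
  assume r: "\<not> ?thesis"
  let ?S = "stabiliser N q \<gamma>"
  have Sq: "?S \<subseteq> q" by (auto simp: stabiliser_def)
  have S: "mat_vs.subspace ?S" by (rule subspace_stabiliser[OF g])
  obtain B where B: "finite B" "B \<subseteq> ?S" "mat_vs.independent B" "?S \<subseteq> mat_vs.span B" "card B = mat_vs.dim ?S"
    by (rule finite_basis_gl[of ?S N]) (use Sq subset_gl in blast)
  have "B \<subseteq> q" using B(2) Sq by blast
  obtain B' where B': "B \<subseteq> B'" "B' \<subseteq> q" "mat_vs.independent B'" "q \<subseteq> mat_vs.span B'"
    by (rule mat_vs.maximal_independent_subset_extend[OF \<open>B \<subseteq> q\<close> B(3)])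
  have finB': "finite B'" by (rule finite_independent_gl[OF _ B'(3), of N]) (use B'(2) subset_gl in blast)
  have "card B' = mat_vs.dim q" by (rule sym, rule mat_vs.dim_unique[OF B'(2,4,3) refl])
  \<comment> \<open>From dim S < r and r + m <= dim q + 1 at least m basis vectors remain outside
    the stabiliser.\<close>
  then have "m \<le> card (B' - B)" using card_Diff_subset[OF B(1) B'(1)] B(5) m r by simp
  then obtain T where T: "T \<subseteq> B' - B" "card T = m" "finite T" by (rule obtain_subset_with_card_n)
  obtain v0 where v0: "bij_betw v0 {0..<m} T" using ex_bij_betw_nat_finite[OF T(3)] T(2) by auto
  define v where "v = (\<lambda>i. if i < m then v0 i else 0)"
  have v0T: "v0 i \<in> T" if "i < m" for i using v0 that by (auto simp: bij_betw_def)
  have vq: "v i \<in> q" for i using v0T[of i] T(1) B'(2) mat_vs.subspace_0[OF subspace] by (auto simp: v_def)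
  have indep: "\<forall>i<m. c i = 0" if c: "(\<Sum>i<m. mscale (c i) (v i)) \<in> ?S" for c
  proof -
    have inj: "inj_on v0 {..<m}" and im: "v0 ` {..<m} = T" using v0 by (auto simp: bij_betw_def atLeast0LessThan)
    obtain u where u: "(\<Sum>i<m. mscale (c i) (v i)) = (\<Sum>b\<in>B. mscale (u b) b)"
      using c B(4) mat_vs.span_finite[OF B(1)] by blast
    define c' where "c' = (\<lambda>b. if b \<in> T then c (the_inv_into {..<m} v0 b) else if b \<in> B then - u b else 0)"
    have "(\<Sum>b\<in>B \<union> T. mscale (c' b) b) = (\<Sum>b\<in>B. mscale (c' b) b) + (\<Sum>b\<in>T. mscale (c' b) b)"
      using B(1) T by (intro sum.union_disjoint) auto
    also have "(\<Sum>b\<in>B. mscale (c' b) b) = (\<Sum>b\<in>B. - mscale (u b) b)"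
      using T(1) by (intro sum.cong refl) (auto simp: c'_def mscale_def fun_eq_iff)
    also have "(\<Sum>b\<in>B. - mscale (u b) b) = - (\<Sum>b\<in>B. mscale (u b) b)" by (rule sum_negf)
    also have "(\<Sum>b\<in>T. mscale (c' b) b) = (\<Sum>i<m. mscale (c' (v0 i)) (v0 i))"
      unfolding im[symmetric] by (rule sum.reindex[OF inj, unfolded comp_def])
    also have "\<dots> = (\<Sum>i<m. mscale (c i) (v i))"
      using v0T by (intro sum.cong refl) (auto simp: c'_def v_def the_inv_into_f_f[OF inj])
    finally have "(\<Sum>b\<in>B \<union> T. mscale (c' b) b) = 0" unfolding u left_minus .
    moreover have "B \<union> T \<subseteq> B'" using T(1) B'(1) by blast
    ultimately have z: "c' b = 0" if "b \<in> B \<union> T" for b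
      using mat_vs.independentD[OF B'(3) _ _ _ that, of c'] B(1) T(3) by blast
    show ?thesis
    proof (intro allI impI)
      fix i assume i: "i < m"
      then have "c' (v0 i) = 0" using z v0T by blast
      then show "c i = 0" using v0T[OF i] i by (simp add: c'_def the_inv_into_f_f[OF inj])
    qed
  qed
  have lf: "coadjoint N (v i) \<gamma> \<in> linear_forms q" for i by (rule linear_forms_coadjoint[OF g vq])
  \<comment> \<open>Without a dual vector the j-th form would be a combination of the others, and
    the corresponding combination of the v_i would lie in the stabiliser.\<close>
  have "\<exists>y\<in>q. \<forall>i<m. \<gamma> (bracket N (v i) y) = (if i = j then 1 else 0)" if j: "j < m" for j
  proof -
    have "\<exists>y\<in>q. (\<forall>i<m. i \<noteq> j \<longrightarrow> \<gamma> (bracket N (v i) y) = 0) \<and> \<gamma> (bracket N (v j) y) \<noteq> 0"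
    proof (rule ccontr)
      assume "\<not> ?thesis"
      then have h: "\<And>y. y \<in> q \<Longrightarrow> (\<And>i. i \<in> {..<m} - {j} \<Longrightarrow> coadjoint N (v i) \<gamma> y = 0) \<Longrightarrow> coadjoint N (v j) \<gamma> y = 0"
        by (auto simp: coadjoint_def)
      have "\<exists>c. \<forall>y\<in>q. coadjoint N (v j) \<gamma> y = (\<Sum>i\<in>{..<m} - {j}. c i * coadjoint N (v i) \<gamma> y)"
        by (rule linear_form_in_span[where \<phi> = "\<lambda>i. coadjoint N (v i) \<gamma>", OF subspace _ lf lf h]) auto
      then obtain c where c: "\<And>y. y \<in> q \<Longrightarrow> coadjoint N (v j) \<gamma> y = (\<Sum>i\<in>{..<m} - {j}. c i * coadjoint N (v i) \<gamma> y)"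
        by blast
      define c' where "c' = c(j := -1)"
      have "(\<Sum>i<m. c' i * \<gamma> (bracket N (v i) y)) = 0" if "y \<in> q" for y
      proof -
        have "(\<Sum>i<m. c' i * \<gamma> (bracket N (v i) y))
          = c' j * \<gamma> (bracket N (v j) y) + (\<Sum>i\<in>{..<m} - {j}. c' i * \<gamma> (bracket N (v i) y))"
          using j by (intro sum.remove) auto
        also have "(\<Sum>i\<in>{..<m} - {j}. c' i * \<gamma> (bracket N (v i) y)) = (\<Sum>i\<in>{..<m} - {j}. c i * \<gamma> (bracket N (v i) y))"
          by (intro sum.cong) (auto simp: c'_def)
        also have "\<dots> = \<gamma> (bracket N (v j) y)" using c[OF that] by (simp add: coadjoint_def)
        finally show ?thesis by (simp add: c'_def)
      qed
      then have "\<gamma> (bracket N (\<Sum>i<m. mscale (c' i) (v i)) y) = 0" if "y \<in> q" for y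
        unfolding bracket_sum_left using linear_forms_sum[OF g subspace, of "{..<m}" "\<lambda>i. bracket N (v i) y" c']
          bracket_closed[OF vq that] that by auto
      moreover have "(\<Sum>i<m. mscale (c' i) (v i)) \<in> q"
        using subspace vq by (intro mat_vs.subspace_sum mat_vs.subspace_scale) auto
      ultimately have "(\<Sum>i<m. mscale (c' i) (v i)) \<in> ?S" by (auto simp: stabiliser_def)
      then have "c' j = 0" using indep j by blast
      then show False by (simp add: c'_def)
    qed
    then obtain y where y: "y \<in> q" "\<forall>i<m. i \<noteq> j \<longrightarrow> \<gamma> (bracket N (v i) y) = 0" "\<gamma> (bracket N (v j) y) \<noteq> 0" by blast
    define y' where "y' = mscale (1 / \<gamma> (bracket N (v j) y)) y"
    have "\<gamma> (bracket N (v i) y') = 1 / \<gamma> (bracket N (v j) y) * \<gamma> (bracket N (v i) y)" for i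
      unfolding y'_def bracket_scale_right by (rule linear_formsD(2)[OF g bracket_closed[OF vq y(1)]])
    moreover have "y' \<in> q" unfolding y'_def by (rule mat_vs.subspace_scale[OF subspace y(1)])
    ultimately show ?thesis using y(2,3) by (intro bexI[of _ y']) auto
  qed
  then obtain w0 where w0: "\<And>j. j < m \<Longrightarrow> w0 j \<in> q" "\<And>i j. i < m \<Longrightarrow> j < m \<Longrightarrow> \<gamma> (bracket N (v i) (w0 j)) = (if i = j then 1 else 0)"
    by metis
  define w where "w = (\<lambda>j. if j < m then w0 j else 0)"
  have "minor m (\<lambda>i j. \<gamma> (bracket N (v i) (w j))) = minor m (\<lambda>i j. if i = j then 1 else 0)"
    by (intro minor_cong) (auto simp: w_def w0(2))
  then have "minor m (\<lambda>i j. \<gamma> (bracket N (v i) (w j))) = 1" by (simp add: minor_one)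
  moreover have "range w \<subseteq> q" using w0(1) mat_vs.subspace_0[OF subspace] by (auto simp: w_def)
  moreover have "range v \<subseteq> q" using vq by blast
  ultimately show False using z[of v w] by simp
qed

end

text \<open>
  A form \<open>f\<close> and a slice \<open>f + span (g ` K)\<close> transversal to the coadjoint orbit of \<open>f\<close>
  along which no stabiliser has dimension below \<open>card K\<close>.
\<close>

definition has_slice :: "nat \<Rightarrow> 'k::field matrix set \<Rightarrow> nat set \<Rightarrow> bool" where
  "has_slice N q K \<longleftrightarrow> (\<exists>f g. f \<in> linear_forms UNIV \<and> (\<forall>k\<in>K. g k \<in> linear_forms UNIV) \<and>
     (\<forall>c. \<exists>X. (\<forall>k\<in>K. X k \<in> stabiliser N q (\<lambda>x. f x + (\<Sum>k\<in>K. c k * g k x))) \<and> independent_family K X) \<and>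
     (\<forall>x\<in>stabiliser N q f. (\<forall>k\<in>K. g k x = 0) \<longrightarrow> x = 0))"

lemma has_sliceE:
  assumes "has_slice N q K"
  obtains f g where "f \<in> linear_forms UNIV" "\<forall>k\<in>K. g k \<in> linear_forms UNIV"
    "\<forall>c. \<exists>X. (\<forall>k\<in>K. X k \<in> stabiliser N q (\<lambda>x. f x + (\<Sum>k\<in>K. c k * g k x))) \<and> independent_family K X"
    "\<forall>x\<in>stabiliser N q f. (\<forall>k\<in>K. g k x = 0) \<longrightarrow> x = 0"
  using assms unfolding has_slice_def by (elim exE conjE) (rule that; assumption)

lemma linear_forms_UNIV_sum:
  fixes f :: "'k::field matrix \<Rightarrow> 'k"
  assumes "f \<in> linear_forms UNIV" "\<And>k. k \<in> K \<Longrightarrow> g k \<in> linear_forms UNIV"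
  shows "(\<lambda>x. f x + (\<Sum>k\<in>K. c k * g k x)) \<in> linear_forms (UNIV :: 'k::field matrix set)"
  using assms unfolding linear_forms_def
  by (auto simp: algebra_simps sum.distrib sum_distrib_left)

lemma sum_matrix_apply: "(\<Sum>p\<in>S. h p) i j = (\<Sum>p\<in>S. (h p :: 'k::field matrix) i j)"
  by (induction S rule: infinite_finite_induct) auto

lemma mscale_minus_one: "mscale (-1) x = - x"
  by (simp add: mscale_def fun_eq_iff)

lemma linear_forms_uminus:
  assumes "\<gamma> \<in> linear_forms q" "x \<in> q"
  shows "\<gamma> (- x) = - \<gamma> x"
  using linear_formsD(2)[OF assms, of "-1"] by (simp only: mscale_minus_one mult_minus_left mult_1_left)

section \<open>The index of an algebra with a slice, and the lifting of slices\<close>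

context matrix_lie_algebra
begin

text \<open>The coordinates \<open>g k\<close> embed the stabiliser into the space of vectors
  indexed by \<open>K\<close>. These vectors are encoded as matrices supported in row 0, so that the
  dimension theory of matrices applies to them.\<close>

lemma dim_stabiliser_le_card:
  fixes K :: "nat set" and g :: "nat \<Rightarrow> 'k matrix \<Rightarrow> 'k"
  assumes f: "f \<in> linear_forms q" and K: "finite K" and g: "\<And>k. k \<in> K \<Longrightarrow> g k \<in> linear_forms q"
    and z: "\<And>x. x \<in> stabiliser N q f \<Longrightarrow> (\<And>k. k \<in> K \<Longrightarrow> g k x = 0) \<Longrightarrow> x = 0"
  shows "mat_vs.dim (stabiliser N q f) \<le> card K"
proof -
  let ?S = "stabiliser N q f"
  have Sq: "?S \<subseteq> q" by (auto simp: stabiliser_def)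
  obtain B where B: "finite B" "B \<subseteq> ?S" "mat_vs.independent B" "?S \<subseteq> mat_vs.span B" "card B = mat_vs.dim ?S"
    by (rule finite_basis_gl[of ?S N]) (use Sq subset_gl in blast)
  define \<phi> :: "'k matrix \<Rightarrow> 'k matrix" where "\<phi> x = (\<Sum>k\<in>K. mscale (g k x) (munit 0 k))" for x
  have \<phi>: "\<phi> x 0 k = g k x" if "k \<in> K" for x k
    using K that by (simp add: \<phi>_def sum_matrix_apply mscale_def munit_def if_distrib cong: if_cong)
  have "independent_family B \<phi>"
    unfolding independent_family_def
  proof (intro allI impI)
    fix c assume c: "(\<Sum>b\<in>B. mscale (c b) (\<phi> b)) = 0"
    have "g k (\<Sum>b\<in>B. mscale (c b) b) = 0" if k: "k \<in> K" for k
    proof -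
      have "g k (\<Sum>b\<in>B. mscale (c b) b) = (\<Sum>b\<in>B. c b * g k b)"
        using B(2) Sq by (intro linear_forms_sum[OF g[OF k] subspace]) auto
      also have "\<dots> = (\<Sum>b\<in>B. mscale (c b) (\<phi> b)) 0 k" by (simp add: sum_matrix_apply mscale_def \<phi>[OF k])
      finally show ?thesis by (simp add: c)
    qed
    moreover have "(\<Sum>b\<in>B. mscale (c b) b) \<in> ?S"
      using B(2) subspace_stabiliser[OF f] by (intro mat_vs.subspace_sum mat_vs.subspace_scale) auto
    ultimately have "(\<Sum>b\<in>B. mscale (c b) b) = 0" using z by blast
    then show "\<forall>b\<in>B. c b = 0" using mat_vs.independentD[OF B(3,1) subset_refl] by blast
  qed
  note ind = independent_family_inj[OF this B(1)]
  have "\<phi> ` B \<subseteq> mat_vs.span (munit 0 ` K)"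
    unfolding \<phi>_def
    by (intro image_subsetI mat_vs.span_sum mat_vs.span_scale mat_vs.span_base) (rule imageI)
  then have "card (\<phi> ` B) \<le> card (munit 0 ` K :: 'k matrix set)"
    by (rule mat_vs.independent_span_bound[OF finite_imageI[OF K] ind(2), THEN conjunct2])
  also have "\<dots> \<le> card K" by (rule card_image_le[OF K])
  finally show ?thesis using B(5) card_image[OF ind(1)] by simp
qed

theorem lie_index_eq_card_slice:
  assumes slice: "has_slice N q K" and K: "finite K"
  shows "lie_index N q = card K"
proof -
  obtain f g where f: "f \<in> linear_forms UNIV" and g0: "\<forall>k\<in>K. g k \<in> linear_forms UNIV"
    and X0: "\<forall>c. \<exists>X. (\<forall>k\<in>K. X k \<in> stabiliser N q (\<lambda>x. f x + (\<Sum>k\<in>K. c k * g k x))) \<and> independent_family K X"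
    and z0: "\<forall>x\<in>stabiliser N q f. (\<forall>k\<in>K. g k x = 0) \<longrightarrow> x = 0"
    by (rule has_sliceE[OF slice])
  note g = bspec[OF g0] and X = spec[OF X0]
  have z: "x = 0" if "x \<in> stabiliser N q f" "\<And>k. k \<in> K \<Longrightarrow> g k x = 0" for x using z0 that by simp
  note fq = linear_forms_UNIV[OF f] and gq = linear_forms_UNIV[OF g]
  note lq = linear_forms_UNIV[OF linear_forms_UNIV_sum[OF f g]]
  \<comment> \<open>With this size, all minors vanish at \<gamma> precisely when the rank is at most
    dim q - card K, that is, when the stabiliser of \<gamma> has dimension at least
    \<open>card K\<close>.\<close>
  define m where "m = mat_vs.dim q + 1 - card K"
  have Kq: "card K \<le> mat_vs.dim q"
  proof -
    obtain Y where "\<forall>k\<in>K. Y k \<in> stabiliser N q (\<lambda>x. f x + (\<Sum>k\<in>K. 0 * g k x))" "independent_family K Y"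
      using X[of "\<lambda>_. 0"] by blast
    then show ?thesis
      using independent_family_card_le_dim[OF subset_gl _ K, of Y] by (auto simp: stabiliser_def)
  qed
  \<comment> \<open>For every value of t the form on this pencil belongs to the family, so the minor
    has only zero values.\<close>
  have slice_zero: "pencil_minor N m f (\<lambda>y. \<Sum>k\<in>K. d k * g k y) v w = 0" if vw: "range v \<subseteq> q" "range w \<subseteq> q" for d v w
  proof -
    have "poly (pencil_minor N m f (\<lambda>y. \<Sum>k\<in>K. d k * g k y) v w) t = 0" for t
    proof -
      obtain Y where Y: "\<forall>k\<in>K. Y k \<in> stabiliser N q (\<lambda>x. f x + (\<Sum>k\<in>K. (t * d k) * g k x))" "independent_family K Y"
        using X[of "\<lambda>k. t * d k"] by blast
      have "minor m (\<lambda>i j. f (bracket N (v i) (w j)) + (\<Sum>k\<in>K. (t * d k) * g k (bracket N (v i) (w j)))) = 0"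
        by (rule minor_zero_if_dim_stabiliser_ge[OF lq K Y(2) _ _ vw]) (use Y(1) Kq in \<open>auto simp: m_def\<close>)
      then show ?thesis by (simp add: pencil_minor_def poly_minor sum_distrib_left mult.assoc)
    qed
    then show ?thesis using poly_all_0_iff_0 by blast
  qed
  obtain B where B: "finite B" "B \<subseteq> q" "q \<subseteq> mat_vs.span B"
    by (rule finite_basis_gl[OF subset_gl]) blast
  \<comment> \<open>A common zero in \<open>q\<close> of the forms b.f and of the \<open>g k\<close>
    stabilises \<open>f\<close> and has zero coordinates, so it is 0. By duality these forms span
    all forms on \<open>q\<close>.\<close>
  have transversal: "\<exists>x\<in>q. \<exists>d. \<forall>y\<in>q. \<delta> y = (\<Sum>k\<in>K. d k * g k y) + coadjoint N x f y" if d: "\<delta> \<in> linear_forms q" for \<delta>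
  proof -
    define \<phi> where "\<phi> = case_sum (\<lambda>b. coadjoint N b f) g"
    have "\<exists>c. \<forall>y\<in>q. \<delta> y = (\<Sum>i\<in>B <+> K. c i * \<phi> i y)"
    proof (rule linear_form_in_span[OF subspace])
      show "finite (B <+> K)" using B(1) K by simp
      show "\<phi> i \<in> linear_forms q" if "i \<in> B <+> K" for i
        using that linear_forms_coadjoint[OF fq] B(2) gq by (auto simp: \<phi>_def)
      show "\<delta> y = 0" if y: "y \<in> q" "\<And>i. i \<in> B <+> K \<Longrightarrow> \<phi> i y = 0" for y
      proof -
        have b: "f (bracket N b y) = 0" if "b \<in> B" for b
          using y(2)[OF InlI[OF that]] by (simp add: \<phi>_def coadjoint_def)
        have "f (bracket N y x) = 0" if x: "x \<in> q" for x
        proof -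
          obtain u where u: "x = (\<Sum>b\<in>B. mscale (u b) b)"
            using x B(3) mat_vs.span_finite[OF B(1)] by blast
          have "f (bracket N x y) = (\<Sum>b\<in>B. u b * f (bracket N b y))"
            unfolding u bracket_sum_left by (rule linear_forms_sum[OF f mat_vs.subspace_UNIV]) simp
          then have "f (bracket N x y) = 0" by (simp add: b)
          then show ?thesis
            unfolding bracket_swap[of N y x] by (simp add: linear_forms_uminus[OF f])
        qed
        then have "y \<in> stabiliser N q f" using y(1) by (simp add: stabiliser_def)
        moreover have "g k y = 0" if "k \<in> K" for k using y(2)[OF InrI[OF that]] by (simp add: \<phi>_def)
        ultimately have "y = 0" by (rule z)
        then show ?thesis using linear_forms_zero[OF d subspace] by simp
      qed
    qed fact
    then obtain c where c: "\<And>y. y \<in> q \<Longrightarrow> \<delta> y = (\<Sum>i\<in>B <+> K. c i * \<phi> i y)" by blast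
    define x where "x = (\<Sum>b\<in>B. mscale (c (Inl b)) b)"
    have "\<delta> y = (\<Sum>k\<in>K. c (Inr k) * g k y) + coadjoint N x f y" if "y \<in> q" for y
    proof -
      have "f (bracket N x y) = (\<Sum>b\<in>B. c (Inl b) * f (bracket N b y))"
        unfolding x_def bracket_sum_left by (rule linear_forms_sum[OF f mat_vs.subspace_UNIV]) simp
      then show ?thesis
        using c[OF that] by (simp add: sum.Plus B(1) K \<phi>_def coadjoint_def)
    qed
    moreover have "x \<in> q" unfolding x_def
      using B(2) subspace by (intro mat_vs.subspace_sum mat_vs.subspace_scale) auto
    ultimately show ?thesis by (intro bexI[of _ x] exI[of _ "\<lambda>k. c (Inr k)"]) auto
  qed
  \<comment> \<open>The coefficient of t^k depends only on the slice component of
    \<open>\<delta>\<close>, whose pencil minor is identically zero.\<close>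
  have van: "vanishing_order N q m f k" for k
  proof (induction k)
    case (Suc k)
    have "coeff (pencil_minor N m f \<delta> v w) k = 0" if d: "\<delta> \<in> linear_forms q" and vw: "range v \<subseteq> q" "range w \<subseteq> q" for \<delta> and v w :: "nat \<Rightarrow> 'k matrix"
    proof -
      obtain x d where x: "x \<in> q" and xd: "\<And>y. y \<in> q \<Longrightarrow> \<delta> y = (\<Sum>k\<in>K. d k * g k y) + coadjoint N x f y"
        using transversal[OF d] by metis
      have l: "(\<lambda>y. \<Sum>k\<in>K. d k * g k y) \<in> linear_forms q"
        using gq unfolding linear_forms_def by (auto simp: algebra_simps sum.distrib sum_distrib_left)
      have br: "bracket N (v i) (w j) \<in> q" for i j using vw by (intro bracket_closed) auto
      have "pencil_minor N m f \<delta> v w = pencil_minor N m f (\<lambda>y. (\<Sum>k\<in>K. d k * g k y) + coadjoint N x f y) v w"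
        unfolding pencil_minor_def by (intro minor_cong) (simp add: xd br)
      then show ?thesis
        using leading_coeff_along_orbit_constant[OF fq l x Suc vw] slice_zero[OF vw] by simp
    qed
    then show ?case using Suc unfolding vanishing_order_def by (auto simp: less_Suc_eq)
  qed (simp add: vanishing_order_def)
  have ge: "card K \<le> mat_vs.dim (stabiliser N q \<gamma>)" if g: "\<gamma> \<in> linear_forms q" for \<gamma>
  proof (rule dim_stabiliser_ge_if_minors_zero[OF g])
    show "card K + m \<le> mat_vs.dim q + 1" using Kq by (simp add: m_def)
    fix v w :: "nat \<Rightarrow> 'k matrix" assume vw: "range v \<subseteq> q" "range w \<subseteq> q"
    \<comment> \<open>Every form \<gamma> is the value at t = 1 of the pencil through
      \<open>f\<close> in the direction \<gamma> - f.\<close>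
    define \<delta> where "\<delta> = (\<lambda>y. \<gamma> y + (-1) * f y)"
    have d: "\<delta> \<in> linear_forms q" unfolding \<delta>_def by (rule linear_forms_add[OF g fq])
    have "coeff (pencil_minor N m f \<delta> v w) l = 0" for l
      using van[of "Suc l"] d vw unfolding vanishing_order_def by blast
    then have "pencil_minor N m f \<delta> v w = 0" by (simp add: poly_eq_iff)
    then have "poly (pencil_minor N m f \<delta> v w) 1 = 0" by simp
    then show "minor m (\<lambda>i j. \<gamma> (bracket N (v i) (w j))) = 0"
      by (simp add: pencil_minor_def poly_minor \<delta>_def)
  qed
  have dimf: "mat_vs.dim (stabiliser N q f) = card K"
    using ge[OF fq] dim_stabiliser_le_card[OF fq K gq z] by (rule antisym[rotated])
  show ?thesis unfolding lie_index_def
  proof (rule Least_equality)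
    show "\<exists>\<gamma>\<in>linear_forms q. mat_vs.dim (stabiliser N q \<gamma>) = card K"
      using dimf fq by blast
    show "card K \<le> d" if "\<exists>\<gamma>\<in>linear_forms q. mat_vs.dim (stabiliser N q \<gamma>) = d" for d
      using that ge by blast
  qed
qed

text \<open>Here \<open>qx\<close> is the stabiliser in \<open>q\<close> of the restriction of
  \<open>\<xi>\<close> to \<open>V\<close>, and \<open>q'\<close> is its image modulo
  \<open>V\<close>. The lifted form f'(\<rho> x) + \<xi>(x) agrees with \<open>\<xi>\<close> on
  \<open>V\<close> for all slice parameters, while on brackets of elements of \<open>qx\<close> only
  the part from \<open>q'\<close> remains. Hence stabilisers correspond to those in
  \<open>q'\<close>, and \<open>inj\<close> excludes a contribution of \<open>V\<close>. The case V
  = 0, \<xi> = 0 transports slices along isomorphisms.\<close>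

lemma has_slice_reduction:
  fixes N' :: nat and q' V :: "'k matrix set"
  assumes V: "mat_vs.subspace V" "V \<subseteq> q" "\<And>x v. x \<in> q \<Longrightarrow> v \<in> V \<Longrightarrow> bracket N x v \<in> V"
    and xi: "\<xi> \<in> linear_forms UNIV"
    and rho: "\<And>x y. \<rho> (x + y) = \<rho> x + \<rho> y" "\<And>c x. \<rho> (mscale c x) = mscale c (\<rho> x)" "\<And>v. v \<in> V \<Longrightarrow> \<rho> v = 0"
    and qx: "qx = {x \<in> q. \<forall>v\<in>V. \<xi> (bracket N x v) = 0}"
    and onto: "\<And>x. x \<in> qx \<Longrightarrow> \<rho> x \<in> q'" "\<And>x'. x' \<in> q' \<Longrightarrow> \<exists>x\<in>qx. \<rho> x = x'"
    and hom: "\<And>x y. x \<in> qx \<Longrightarrow> y \<in> qx \<Longrightarrow> \<xi> (bracket N x y) = 0"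
      "\<And>x y. x \<in> qx \<Longrightarrow> y \<in> qx \<Longrightarrow> \<rho> (bracket N x y) = bracket N' (\<rho> x) (\<rho> y)"
    and inj: "\<And>v. v \<in> V \<Longrightarrow> (\<And>y. y \<in> q \<Longrightarrow> \<xi> (bracket N v y) = 0) \<Longrightarrow> v = 0"
    and ker: "\<And>x. x \<in> qx \<Longrightarrow> \<rho> x = 0 \<Longrightarrow> x \<in> V"
    and slice: "has_slice N' q' K"
  shows "has_slice N q K"
proof -
  obtain f' g' where f': "f' \<in> linear_forms UNIV" and g0: "\<forall>k\<in>K. g' k \<in> linear_forms UNIV"
    and X0: "\<forall>c. \<exists>X. (\<forall>k\<in>K. X k \<in> stabiliser N' q' (\<lambda>x. f' x + (\<Sum>k\<in>K. c k * g' k x))) \<and> independent_family K X"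
    and z0: "\<forall>x\<in>stabiliser N' q' f'. (\<forall>k\<in>K. g' k x = 0) \<longrightarrow> x = 0"
    by (rule has_sliceE[OF slice])
  note g' = bspec[OF g0] and X' = spec[OF X0]
  have z': "x = 0" if "x \<in> stabiliser N' q' f'" "\<And>k. k \<in> K \<Longrightarrow> g' k x = 0" for x using z0 that by simp
  define f where "f x = f' (\<rho> x) + \<xi> x" for x
  define g where "g k x = g' k (\<rho> x)" for k x
  define F' where "F' c x = f' x + (\<Sum>k\<in>K. c k * g' k x)" for c x
  define F where "F c x = f x + (\<Sum>k\<in>K. c k * g k x)" for c x
  have FF: "F c x = F' c (\<rho> x) + \<xi> x" for c x by (simp add: F_def F'_def f_def g_def)
  have F'l: "F' c \<in> linear_forms UNIV" for c unfolding F'_def by (rule linear_forms_UNIV_sum[OF f' g'])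
  have fl: "f \<in> linear_forms UNIV"
    unfolding f_def linear_forms_def
    using linear_formsD[OF f'] linear_formsD[OF xi] by (auto simp: rho algebra_simps)
  have gl: "g k \<in> linear_forms UNIV" if "k \<in> K" for k
    unfolding g_def linear_forms_def using linear_formsD[OF g'[OF that]] by (auto simp: rho)
  have Fl: "F c \<in> linear_forms UNIV" for c unfolding F_def by (rule linear_forms_UNIV_sum[OF fl gl])
  have qxq: "qx \<subseteq> q" by (auto simp: qx)
  have swap: "\<gamma> (bracket N x y) = - \<gamma> (bracket N y x)" if "\<gamma> \<in> linear_forms UNIV" for \<gamma> x y
    unfolding bracket_swap[of N y x] using linear_forms_uminus[OF that] by simp
  have FV: "F c (bracket N v x) = \<xi> (bracket N v x)" if "x \<in> q" "v \<in> V" for c v x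
  proof -
    have "F c (bracket N x v) = \<xi> (bracket N x v)"
      using rho(3)[OF V(3)[OF that]] linear_forms_zero[OF F'l mat_vs.subspace_UNIV] by (simp add: FF)
    then show ?thesis by (simp add: swap[OF Fl, of _ v] swap[OF xi, of v])
  qed
  have Fq: "F c (bracket N x y) = F' c (bracket N' (\<rho> x) (\<rho> y))" if "x \<in> qx" "y \<in> qx" for c x y
    using hom that by (simp add: FF)
  have VN: "V \<subseteq> gl N" using V(2) subset_gl by blast
  obtain B where B: "finite B" "B \<subseteq> V" "V \<subseteq> mat_vs.span B"
    by (rule finite_basis_gl[OF VN]) blast
  \<comment> \<open>Lift x' to x in \<open>qx\<close>. The form F_c([x,.]) vanishes on
    \<open>qx\<close>, the common kernel of the forms \<xi>([b,.]) with b in V, so it equals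
    \<xi>([v,.]) for some v in V. The difference x - v stabilises F_c and still lies over
    x'.\<close>
  have corr: "\<exists>x\<in>stabiliser N q (F c). \<rho> x = x'" if x': "x' \<in> stabiliser N' q' (F' c)" for c x'
  proof -
    obtain x where x: "x \<in> qx" "\<rho> x = x'" using onto(2)[of x'] x' by (auto simp: stabiliser_def)
    have xq: "x \<in> q" using x(1) qxq by blast
    have "\<exists>u. \<forall>y\<in>q. coadjoint N x (F c) y = (\<Sum>b\<in>B. u b * coadjoint N b \<xi> y)"
    proof (rule linear_form_in_span[OF subspace B(1)])
      show "coadjoint N b \<xi> \<in> linear_forms q" if "b \<in> B" for b
        using that B(2) V(2) by (intro linear_forms_coadjoint linear_forms_UNIV[OF xi]) auto
      show "coadjoint N x (F c) \<in> linear_forms q"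
        by (intro linear_forms_coadjoint linear_forms_UNIV[OF Fl] xq)
      fix y assume y: "y \<in> q" "\<And>b. b \<in> B \<Longrightarrow> coadjoint N b \<xi> y = 0"
      have "\<xi> (bracket N y v) = 0" if v: "v \<in> V" for v
      proof -
        obtain u where u: "v = (\<Sum>b\<in>B. mscale (u b) b)" using v B(3) mat_vs.span_finite[OF B(1)] by blast
        have "\<xi> (bracket N v y) = (\<Sum>b\<in>B. u b * \<xi> (bracket N b y))"
          unfolding u bracket_sum_left by (rule linear_forms_sum[OF xi mat_vs.subspace_UNIV]) simp
        also have "\<dots> = 0" using y(2) by (simp add: coadjoint_def)
        finally show ?thesis by (simp add: swap[OF xi, of y])
      qed
      then have yx: "y \<in> qx" using y(1) by (simp add: qx)
      have "F' c (bracket N' x' (\<rho> y)) = 0" using x' onto(1)[OF yx] by (simp add: stabiliser_def)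
      then show "coadjoint N x (F c) y = 0" using Fq[OF x(1) yx] x(2) by (simp add: coadjoint_def)
    qed
    then obtain u where u: "\<And>y. y \<in> q \<Longrightarrow> F c (bracket N x y) = (\<Sum>b\<in>B. u b * \<xi> (bracket N b y))"
      by (auto simp: coadjoint_def)
    define v where "v = (\<Sum>b\<in>B. mscale (u b) b)"
    have vV: "v \<in> V" unfolding v_def using B(2) V(1) by (intro mat_vs.subspace_sum mat_vs.subspace_scale) auto
    then have mV: "mscale (-1) v \<in> V" by (rule mat_vs.subspace_scale[OF V(1)])
    have "F c (bracket N (x + mscale (-1) v) y) = 0" if y: "y \<in> q" for y
    proof -
      have "\<xi> (bracket N v y) = (\<Sum>b\<in>B. u b * \<xi> (bracket N b y))"
        unfolding v_def bracket_sum_left by (rule linear_forms_sum[OF xi mat_vs.subspace_UNIV]) simp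
      moreover have "F c (bracket N (mscale (-1) v) y) = - \<xi> (bracket N v y)"
        using FV[OF y mV, of c] unfolding bracket_scale_left linear_formsD(2)[OF xi UNIV_I] linear_formsD(2)[OF Fl UNIV_I]
        by simp
      ultimately show ?thesis
        unfolding bracket_add_left linear_formsD(1)[OF Fl UNIV_I UNIV_I] by (simp only: u[OF y] right_minus)
    qed
    moreover have "x + mscale (-1) v \<in> q" using xq mV V(2) mat_vs.subspace_add[OF subspace] by blast
    moreover have "\<rho> (x + mscale (-1) v) = x'" unfolding rho(1) rho(3)[OF mV] by (simp add: x(2))
    ultimately show ?thesis unfolding stabiliser_def by blast
  qed
  have rho_sum: "\<rho> (\<Sum>k\<in>J. mscale (c k) (X k)) = (\<Sum>k\<in>J. mscale (c k) (\<rho> (X k)))" for J :: "nat set" and c X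
  proof (induction J rule: infinite_finite_induct)
    case (insert k J)
    then show ?case by (simp only: sum.insert[OF insert(1,2)] rho)
  qed (simp_all only: sum.infinite sum.empty not_False_eq_True rho(3)[OF mat_vs.subspace_0[OF V(1)]])
  have "\<exists>X. (\<forall>k\<in>K. X k \<in> stabiliser N q (F c)) \<and> independent_family K X" for c
  proof -
    obtain Y where Y: "\<forall>k\<in>K. Y k \<in> stabiliser N' q' (F' c)" "independent_family K Y"
      using X'[of c] unfolding F'_def by blast
    have "\<forall>k\<in>K. \<exists>x. x \<in> stabiliser N q (F c) \<and> \<rho> x = Y k" using corr Y(1) by blast
    then obtain X where X: "\<And>k. k \<in> K \<Longrightarrow> X k \<in> stabiliser N q (F c)" "\<And>k. k \<in> K \<Longrightarrow> \<rho> (X k) = Y k"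
      by metis
    have "independent_family K X" unfolding independent_family_def
    proof (intro allI impI)
      fix d assume "(\<Sum>k\<in>K. mscale (d k) (X k)) = 0"
      then have "\<rho> (\<Sum>k\<in>K. mscale (d k) (X k)) = 0" using rho(3)[OF mat_vs.subspace_0[OF V(1)]] by simp
      then have "(\<Sum>k\<in>K. mscale (d k) (Y k)) = 0" unfolding rho_sum by (simp add: X(2))
      then show "\<forall>k\<in>K. d k = 0" using Y(2) by (simp add: independent_family_def)
    qed
    then show ?thesis using X(1) by blast
  qed
  \<comment> \<open>Such an x kills V under \<open>\<xi>\<close>, so it lies in \<open>qx\<close>;
    its image has zero coordinates and stabilises f', hence is 0. Thus x is in V, where
    \<open>inj\<close> applies.\<close>
  moreover have "x = 0" if x: "x \<in> stabiliser N q f" "\<And>k. k \<in> K \<Longrightarrow> g k x = 0" for x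
  proof -
    have F0: "F (\<lambda>_. 0) = f" "F' (\<lambda>_. 0) = f'" by (auto simp: F_def F'_def)
    have xq: "x \<in> q" and xs: "\<And>y. y \<in> q \<Longrightarrow> f (bracket N x y) = 0" using x(1) by (auto simp: stabiliser_def)
    have "\<xi> (bracket N x v) = 0" if "v \<in> V" for v
      using xs[of v] FV[OF xq that, of "\<lambda>_. 0"] V(2) that unfolding F0 by (auto simp: swap[OF xi, of x] swap[OF fl, of x])
    then have xx: "x \<in> qx" using xq by (simp add: qx)
    have "f' (bracket N' (\<rho> x) y') = 0" if y': "y' \<in> q'" for y'
    proof -
      obtain y where y: "y \<in> qx" "\<rho> y = y'" using onto(2)[OF y'] by blast
      have "y \<in> q" using y(1) qxq by blast
      then show ?thesis using Fq[OF xx y(1), of "\<lambda>_. 0", unfolded F0] xs by (simp add: y(2))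
    qed
    then have "\<rho> x \<in> stabiliser N' q' f'" using onto(1)[OF xx] by (simp add: stabiliser_def)
    then have "\<rho> x = 0" using x(2) by (intro z') (auto simp: g_def)
    then have xV: "x \<in> V" by (rule ker[OF xx])
    show ?thesis
    proof (rule inj[OF xV])
      show "\<xi> (bracket N x y) = 0" if "y \<in> q" for y
        using FV[OF that xV, of "\<lambda>_. 0", unfolded F0] xs[OF that] by simp
    qed
  qed
  ultimately show ?thesis
    unfolding has_slice_def F_def using fl gl by (intro exI[of _ f] exI[of _ g] conjI ballI allI impI) simp_all
qed

end

subsection \<open>Orthogonal incidence algebras\<close>

lemma so_iff:
  "x \<in> so N \<longleftrightarrow> (\<forall>i j. x i j \<noteq> 0 \<longrightarrow> i \<in> {1..N} \<and> j \<in> {1..N}) \<and>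
     (\<forall>i\<in>{1..N}. \<forall>j\<in>{1..N}. x (N + 1 - j) (N + 1 - i) = - x i j)"
  unfolding so_def gl_def anti_transpose_def fun_eq_iff by auto

lemma so_support: "x \<in> so N \<Longrightarrow> x i j \<noteq> 0 \<Longrightarrow> 1 \<le> i \<and> i \<le> N \<and> 1 \<le> j \<and> j \<le> N"
  by (auto simp: so_iff)

lemma so_mirror: "x \<in> so N \<Longrightarrow> 1 \<le> i \<Longrightarrow> i \<le> N \<Longrightarrow> 1 \<le> j \<Longrightarrow> j \<le> N \<Longrightarrow> x (N + 1 - j) (N + 1 - i) = - x i j"
  by (auto simp: so_iff)

text \<open>These positions are fixed by the mirror symmetry, so the entry equals its own negative;
  characteristic zero enters.\<close>

lemma so_antidiagonal:
  fixes x :: "'k::field_char_0 matrix"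
  assumes "x \<in> so N"
  shows "x i (N + 1 - i) = 0"
proof (cases "1 \<le> i \<and> i \<le> N")
  case True
  then have "x (N + 1 - (N + 1 - i)) (N + 1 - i) = - x i (N + 1 - i)"
    by (intro so_mirror[OF assms]) auto
  moreover have "N + 1 - (N + 1 - i) = i" using True by simp
  ultimately show ?thesis by simp
qed (use so_support[OF assms] in blast)

text \<open>Reflection in the antidiagonal carries the other half of the matrix into this one. It
  confines the later entry computations to i + j <= N.\<close>

lemma so_eqI:
  fixes x y :: "'k::field_char_0 matrix"
  assumes "x \<in> so N" "y \<in> so N"
    and eq: "\<And>i j. 1 \<le> i \<Longrightarrow> 1 \<le> j \<Longrightarrow> i + j \<le> N \<Longrightarrow> x i j = y i j"
  shows "x = y"
proof (intro ext)
  fix i j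
  show "x i j = y i j"
  proof (cases "1 \<le> i \<and> i \<le> N \<and> 1 \<le> j \<and> j \<le> N")
    case True
    consider "i + j \<le> N" | "j = N + 1 - i" | "(N + 1 - j) + (N + 1 - i) \<le> N" using True by linarith
    then show ?thesis
    proof cases
      case 3
      then have "x (N + 1 - j) (N + 1 - i) = y (N + 1 - j) (N + 1 - i)" using True by (intro eq) auto
      then show ?thesis using so_mirror[OF assms(1)] so_mirror[OF assms(2)] True by auto
    next
      case 2
      show ?thesis unfolding 2 using so_antidiagonal[OF assms(1)] so_antidiagonal[OF assms(2)] by simp
    qed (use True eq in auto)
  next
    case False
    then have "x i j = 0" "y i j = 0" using so_support[OF assms(1), of i j] so_support[OF assms(2), of i j] by auto
    then show ?thesis by simp
  qed
qed

lemma subspace_so: "mat_vs.subspace (so N)"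
proof -
  have "so N = {x. (\<forall>i j. i \<notin> {1..N} \<or> j \<notin> {1..N} \<longrightarrow> x i j = 0) \<and>
     (\<forall>i\<in>{1..N}. \<forall>j\<in>{1..N}. x (N + 1 - j) (N + 1 - i) = - x i j)}"
    unfolding set_eq_iff so_iff by auto
  then show ?thesis unfolding mat_vs.subspace_def by (auto simp: mscale_def)
qed

lemma sum_mirror: "(\<Sum>k=1..N. h (N + 1 - k)) = (\<Sum>k=1..(N::nat). h k)"
  by (rule sum.reindex_bij_witness[where i = "\<lambda>k. N + 1 - k" and j = "\<lambda>k. N + 1 - k"]) auto

lemma bracket_so:
  fixes x y :: "'k::field matrix"
  assumes x: "x \<in> so N" and y: "y \<in> so N"
  shows "bracket N x y \<in> so N"
proof -
  have m: "mmult N x y (N + 1 - j) (N + 1 - i) = mmult N y x i j"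
    if ij: "i \<in> {1..N}" "j \<in> {1..N}" and x: "x \<in> so N" and y: "y \<in> so N" for i j and x y :: "'k matrix"
  proof -
    have "mmult N x y (N + 1 - j) (N + 1 - i) = (\<Sum>k=1..N. x (N + 1 - j) (N + 1 - k) * y (N + 1 - k) (N + 1 - i))"
      unfolding mmult_def by (rule sum_mirror[symmetric])
    also have "\<dots> = (\<Sum>k=1..N. y i k * x k j)"
    proof (intro sum.cong refl)
      fix k assume "k \<in> {1..N}"
      then show "x (N + 1 - j) (N + 1 - k) * y (N + 1 - k) (N + 1 - i) = y i k * x k j"
        using so_mirror[OF x, of k j] so_mirror[OF y, of i k] ij by simp
    qed
    finally show ?thesis by (simp add: mmult_def)
  qed
  have z: "mmult N x y i j = 0" if "i \<notin> {1..N} \<or> j \<notin> {1..N}" and x: "x \<in> so N" and y: "y \<in> so N" for i j and x y :: "'k matrix"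
    unfolding mmult_def
  proof (intro sum.neutral ballI)
    fix k
    show "x i k * y k j = 0"
      using that(1) so_support[OF x, of i k] so_support[OF y, of k j] by (cases "x i k = 0"; cases "y k j = 0") auto
  qed
  show ?thesis
    unfolding so_iff
  proof (intro conjI allI impI ballI)
    fix i j
    show "bracket N x y (N + 1 - j) (N + 1 - i) = - bracket N x y i j" if "i \<in> {1..N}" "j \<in> {1..N}"
      using m[OF that x y] m[OF that y x] by (simp add: bracket_def)
    assume nz: "bracket N x y i j \<noteq> 0"
    have "i \<in> {1..N} \<and> j \<in> {1..N}"
    proof (rule ccontr)
      assume "\<not> ?thesis"
      then have o: "i \<notin> {1..N} \<or> j \<notin> {1..N}" by blast
      show False using nz z[OF o x y] z[OF o y x] by (simp add: bracket_def)
    qed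
    then show "i \<in> {1..N}" "j \<in> {1..N}" by auto
  qed
qed

text \<open>Seaweeds are orthogonal incidence algebras: one relation on indices says which entries
  may be nonzero, and its transitivity gives closure under brackets.\<close>

definition incidence :: "nat \<Rightarrow> (nat \<Rightarrow> nat \<Rightarrow> bool) \<Rightarrow> 'k::field matrix set" where
  "incidence N R = {x \<in> so N. \<forall>i j. x i j \<noteq> 0 \<longrightarrow> R i j}"

lemma matrix_lie_algebra_incidence:
  assumes trans: "\<And>i j k. R i j \<Longrightarrow> R j k \<Longrightarrow> R i k"
  shows "matrix_lie_algebra N (incidence N R :: 'k::field_char_0 matrix set)"
proof
  have sub: "incidence N R = so N \<inter> {x. \<forall>i j. x i j \<noteq> 0 \<longrightarrow> R i j}" by (auto simp: incidence_def)
  have "mat_vs.subspace {x :: 'k matrix. \<forall>i j. x i j \<noteq> 0 \<longrightarrow> R i j}"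
    unfolding mat_vs.subspace_def mscale_def
  proof (intro conjI ballI allI CollectI impI, goal_cases)
    case (2 x y i j)
    then show ?case by (cases "x i j = 0") auto
  qed auto
  then show "mat_vs.subspace (incidence N R :: 'k matrix set)"
    unfolding sub by (rule mat_vs.subspace_inter[OF subspace_so])
  show "incidence N R \<subseteq> (gl N :: 'k matrix set)" by (auto simp: incidence_def so_def)
  fix x y :: "'k matrix" assume xy: "x \<in> incidence N R" "y \<in> incidence N R"
  have m: "R i j" if "mmult N x y i j \<noteq> 0" and x: "x \<in> incidence N R" and y: "y \<in> incidence N R" for i j and x y :: "'k matrix"
  proof -
    have "\<exists>k. x i k * y k j \<noteq> 0"
    proof (rule ccontr)
      assume "\<not> ?thesis"
      then have "x i k * y k j = 0" for k by blast
      then have "mmult N x y i j = 0" unfolding mmult_def by (intro sum.neutral ballI)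
      then show False using that(1) by contradiction
    qed
    then obtain k where "x i k * y k j \<noteq> 0" ..
    then have "R i k" "R k j" using x y by (auto simp: incidence_def)
    then show ?thesis by (rule trans)
  qed
  have "R i j" if "bracket N x y i j \<noteq> 0" for i j
    using that m[OF _ xy] m[OF _ xy(2,1)] by (cases "mmult N x y i j = 0") (auto simp: bracket_def)
  moreover have "bracket N x y \<in> so N" using xy by (intro bracket_so) (auto simp: incidence_def)
  ultimately show "bracket N x y \<in> incidence N R" by (simp add: incidence_def)
qed

text \<open>The skew-symmetrised matrix unit; for indices in range it is 0 on the
  antidiagonal.\<close>

definition so_unit :: "nat \<Rightarrow> nat \<Rightarrow> nat \<Rightarrow> 'k::field matrix" where
  "so_unit N i j = munit i j - munit (N + 1 - j) (N + 1 - i)"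

lemma so_unit_apply: "so_unit N i j k l = (if k = i \<and> l = j then 1 else 0) - (if k = N + 1 - j \<and> l = N + 1 - i then 1 else 0)"
  by (simp add: so_unit_def munit_def)

lemma so_unit_support:
  assumes "(so_unit N i j :: 'k::field matrix) k l \<noteq> 0"
  shows "(k = i \<and> l = j) \<or> (k = N + 1 - j \<and> l = N + 1 - i)"
proof (rule ccontr)
  assume n: "\<not> ?thesis"
  have "(so_unit N i j :: 'k matrix) k l = 0"
    unfolding so_unit_apply using n by (simp only: if_False de_Morgan_disj diff_self)
  then show False using assms by contradiction
qed

lemma so_unit_in_so:
  assumes "1 \<le> i" "i \<le> N" "1 \<le> j" "j \<le> N"
  shows "(so_unit N i j :: 'k::field matrix) \<in> so N"
  unfolding so_iff
proof (intro conjI allI impI ballI)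
  fix k l
  assume "(so_unit N i j :: 'k matrix) k l \<noteq> 0"
  from so_unit_support[OF this] show "k \<in> {1..N}" "l \<in> {1..N}" using assms by auto
next
  fix k l assume kl: "k \<in> {1..N}" "l \<in> {1..N}"
  have e: "N + 1 - l = i \<and> N + 1 - k = j \<longleftrightarrow> k = N + 1 - j \<and> l = N + 1 - i"
    "N + 1 - l = N + 1 - j \<and> N + 1 - k = N + 1 - i \<longleftrightarrow> k = i \<and> l = j"
    using assms kl by auto
  show "(so_unit N i j :: 'k matrix) (N + 1 - l) (N + 1 - k) = - so_unit N i j k l"
    unfolding so_unit_apply e by (simp only: minus_diff_eq)
qed

lemma so_unit_in_incidence:
  assumes "1 \<le> i" "i \<le> N" "1 \<le> j" "j \<le> N" and R: "R i j" "R (N + 1 - j) (N + 1 - i)"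
  shows "(so_unit N i j :: 'k::field matrix) \<in> incidence N R"
  unfolding incidence_def using so_unit_in_so[OF assms(1-4)] so_unit_support[of N i j] R by blast

subsection \<open>Levels\<close>

text \<open>The index of the diagonal block of \<open>i\<close>, counted from the middle block, which has level \<open>0\<close>.\<close>

fun lev :: "nat \<Rightarrow> nat list \<Rightarrow> nat \<Rightarrow> int" where
  "lev N [] i = 0"
| "lev N (a # as) i = (if i \<le> a then - (1 + int (length as)) else if i + a > N then 1 + int (length as)
     else lev (N - 2 * a) as (i - a))"

lemma lev_bounds: "- int (length a) \<le> lev N a i" "lev N a i \<le> int (length a)"
proof (induction a arbitrary: N i)
  case (Cons x a)
  { case 1 show ?case using Cons(1)[of "N - 2 * x" "i - x"] by auto }
  { case 2 show ?case using Cons(2)[of "N - 2 * x" "i - x"] by auto }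
qed auto

lemma lev_mono: "i \<le> j \<Longrightarrow> lev N a i \<le> lev N a j"
proof (induction a arbitrary: N i j)
  case (Cons x a)
  then show ?case
    using lev_bounds(1)[of a "N - 2 * x" "j - x"] lev_bounds(2)[of "N - 2 * x" a "i - x"]
      Cons.IH[of "i - x" "j - x" "N - 2 * x"] by auto
qed auto

lemma lev_mirror: "2 * sum_list a \<le> N \<Longrightarrow> 1 \<le> i \<Longrightarrow> i \<le> N \<Longrightarrow> lev N a (N + 1 - i) = - lev N a i"
proof (induction a arbitrary: N i)
  case (Cons x a)
  have "lev (N - 2 * x) a (N - 2 * x + 1 - (i - x)) = - lev (N - 2 * x) a (i - x)" if "\<not> i \<le> x" "\<not> i + x > N"
    using Cons.prems that by (intro Cons.IH) auto
  moreover have "N + 1 - i - x = N - 2 * x + 1 - (i - x)" if "\<not> i \<le> x" "\<not> i + x > N" using that by linarith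
  ultimately show ?case using Cons.prems by auto
qed auto

text \<open>The seaweed described through levels instead of an enumeration of blocks. A part equal
  to 0 merely leaves a level without indices, so the reductions need no special case.\<close>

definition sw :: "nat \<Rightarrow> nat list \<Rightarrow> nat list \<Rightarrow> 'k::field matrix set" where
  "sw n a b = incidence (2 * n + 1) (\<lambda>i j. lev (2 * n + 1) a i \<le> lev (2 * n + 1) a j \<and> lev (2 * n + 1) b j \<le> lev (2 * n + 1) b i)"

lemma matrix_lie_algebra_sw: "matrix_lie_algebra (2 * n + 1) (sw n a b :: 'k::field_char_0 matrix set)"
  unfolding sw_def by (rule matrix_lie_algebra_incidence) auto

lemma interval_Cons_Suc: "interval (x # c) (Suc k) = {i. x < i \<and> i - x \<in> interval c k}"
  by (auto simp: interval_def)

lemma interval_append: "k < length c \<Longrightarrow> interval (c @ d) k = interval c k"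
  by (simp add: interval_def)

lemma interval_last: "interval (c @ [x]) (length c) = {sum_list c + 1..sum_list c + x}"
  by (simp add: interval_def)

lemma interval_cover: "1 \<le> i \<Longrightarrow> i \<le> sum_list c \<Longrightarrow> \<exists>k<length c. i \<in> interval c k"
proof (induction c arbitrary: i)
  case (Cons x c)
  show ?case
  proof (cases "i \<le> x")
    case True
    then show ?thesis using Cons.prems by (intro exI[of _ 0]) (auto simp: interval_def)
  next
    case False
    then have "1 \<le> i - x" "i - x \<le> sum_list c" using Cons.prems by auto
    then obtain k where "k < length c" "i - x \<in> interval c k" using Cons.IH by blast
    then show ?thesis using False by (intro exI[of _ "Suc k"]) (auto simp: interval_Cons_Suc)
  qed
qed auto

lemma lev_interval:
  assumes "sum_list a \<le> n" "k < length (block_sizes_B n a)" "i \<in> interval (block_sizes_B n a) k"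
  shows "lev (2 * n + 1) a i = int k - int (length a)"
  using assms
proof (induction a arbitrary: n k i)
  case (Cons x a)
  have b: "block_sizes_B n (x # a) = x # block_sizes_B (n - x) a @ [x]"
    by (simp add: block_sizes_B_def)
  have len: "length (block_sizes_B (n - x) a) = 2 * length a + 1" by (simp add: block_sizes_B_def)
  have sm: "sum_list (block_sizes_B (n - x) a) = 2 * (n - x) + 1"
    using Cons.prems(1) by (simp add: block_sizes_B_def sum_list_rev)
  have N: "2 * n + 1 - 2 * x = 2 * (n - x) + 1" using Cons.prems(1) by simp
  show ?case
  proof (cases k)
    case 0
    then show ?thesis using Cons.prems(3) by (simp add: b interval_def)
  next
    case (Suc k')
    have i: "x < i" "i - x \<in> interval (block_sizes_B (n - x) a @ [x]) k'"
      using Cons.prems(3) unfolding b Suc interval_Cons_Suc by auto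
    show ?thesis
    proof (cases "k' < length (block_sizes_B (n - x) a)")
      case True
      then have i': "i - x \<in> interval (block_sizes_B (n - x) a) k'" using i(2) by (simp add: interval_append)
      have "sum_list (take (Suc k') (block_sizes_B (n - x) a)) \<le> 2 * (n - x) + 1"
        using sm by (metis append_take_drop_id le_add1 sum_list_append)
      then have "i - x \<le> 2 * (n - x) + 1" using i' by (simp add: interval_def)
      then show ?thesis
        using Cons.IH[OF _ True i'] Cons.prems(1) i(1) N by (auto simp: Suc)
    next
      case False
      then have k': "k' = length (block_sizes_B (n - x) a)" using Cons.prems(2) by (simp add: b Suc)
      have "int k' = 2 * int (length a) + 1" using k' len by simp
      moreover have "2 * (n - x) + 1 < i - x" using i(2) sm unfolding k' interval_last by auto
      ultimately show ?thesis using Cons.prems(1) i(1) by (auto simp: Suc)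
    qed
  qed
qed (simp add: block_sizes_B_def)

lemma seaweed_B_eq_sw:
  assumes a: "sum_list a \<le> n" and b: "sum_list b \<le> n"
  shows "seaweed_B n a b = sw n a b"
proof -
  let ?N = "2 * n + 1"
  have cover: "\<exists>k<length (block_sizes_B n c). i \<in> interval (block_sizes_B n c) k" if "1 \<le> i" "i \<le> ?N" "sum_list c \<le> n" for i c
    using that by (intro interval_cover) (simp_all add: block_sizes_B_def sum_list_rev)
  have up: "block_upper (block_sizes_B n a) x \<longleftrightarrow> (\<forall>i j. x i j \<noteq> 0 \<longrightarrow> lev ?N a i \<le> lev ?N a j)" if x: "x \<in> so ?N" for x :: "'a matrix"
  proof
    assume u: "block_upper (block_sizes_B n a) x"
    show "\<forall>i j. x i j \<noteq> 0 \<longrightarrow> lev ?N a i \<le> lev ?N a j"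
    proof (intro allI impI, rule ccontr)
      fix i j assume ij: "x i j \<noteq> 0" "\<not> lev ?N a i \<le> lev ?N a j"
      obtain k where k: "k < length (block_sizes_B n a)" "i \<in> interval (block_sizes_B n a) k"
        using cover[of i a] so_support[OF x ij(1)] a by blast
      obtain l where l: "l < length (block_sizes_B n a)" "j \<in> interval (block_sizes_B n a) l"
        using cover[of j a] so_support[OF x ij(1)] a by blast
      have "l < k" using lev_interval[OF a k] lev_interval[OF a l] ij(2) by simp
      then show False using u k l ij(1) unfolding block_upper_def by blast
    qed
  next
    assume r: "\<forall>i j. x i j \<noteq> 0 \<longrightarrow> lev ?N a i \<le> lev ?N a j"
    show "block_upper (block_sizes_B n a) x" unfolding block_upper_def
    proof (intro allI impI ballI, rule ccontr)
      fix k l i j assume h: "k < length (block_sizes_B n a)" "l < k" "i \<in> interval (block_sizes_B n a) k"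
        "j \<in> interval (block_sizes_B n a) l" "x i j \<noteq> 0"
      have "lev ?N a i \<le> lev ?N a j" using r h(5) by blast
      then show False using lev_interval[OF a h(1,3)] lev_interval[OF a _ h(4)] h(1,2) by simp
    qed
  qed
  have lo: "block_lower (block_sizes_B n b) x \<longleftrightarrow> (\<forall>i j. x i j \<noteq> 0 \<longrightarrow> lev ?N b j \<le> lev ?N b i)" if x: "x \<in> so ?N" for x :: "'a matrix"
  proof
    assume u: "block_lower (block_sizes_B n b) x"
    show "\<forall>i j. x i j \<noteq> 0 \<longrightarrow> lev ?N b j \<le> lev ?N b i"
    proof (intro allI impI, rule ccontr)
      fix i j assume ij: "x i j \<noteq> 0" "\<not> lev ?N b j \<le> lev ?N b i"
      obtain k where k: "k < length (block_sizes_B n b)" "i \<in> interval (block_sizes_B n b) k"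
        using cover[of i b] so_support[OF x ij(1)] b by blast
      obtain l where l: "l < length (block_sizes_B n b)" "j \<in> interval (block_sizes_B n b) l"
        using cover[of j b] so_support[OF x ij(1)] b by blast
      have "k < l" using lev_interval[OF b k] lev_interval[OF b l] ij(2) by simp
      then show False using u k l ij(1) unfolding block_lower_def by blast
    qed
  next
    assume r: "\<forall>i j. x i j \<noteq> 0 \<longrightarrow> lev ?N b j \<le> lev ?N b i"
    show "block_lower (block_sizes_B n b) x" unfolding block_lower_def
    proof (intro allI impI ballI, rule ccontr)
      fix k l i j assume h: "l < length (block_sizes_B n b)" "k < l" "i \<in> interval (block_sizes_B n b) k"
        "j \<in> interval (block_sizes_B n b) l" "x i j \<noteq> 0"
      have "lev ?N b j \<le> lev ?N b i" using r h(5) by blast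
      then show False using lev_interval[OF b h(1,4)] lev_interval[OF b _ h(3)] h(1,2) by simp
    qed
  qed
  show ?thesis
    unfolding seaweed_B_def parabolic_B_def opp_parabolic_B_def sw_def incidence_def
    using up lo by auto
qed

text \<open>Negative transposition is an isomorphism that exchanges the two parabolics; the
  reduction lemma with V = 0 carries the slice across.\<close>

lemma has_slice_sw_swap:
  assumes "has_slice (2 * n + 1) (sw n b a :: 'k::field_char_0 matrix set) K"
  shows "has_slice (2 * n + 1) (sw n a b :: 'k matrix set) K"
proof -
  let ?N = "2 * n + 1"
  define \<rho> :: "'k matrix \<Rightarrow> 'k matrix" where "\<rho> x = (\<lambda>i j. - x j i)" for x
  interpret matrix_lie_algebra ?N "sw n a b :: 'k matrix set" by (rule matrix_lie_algebra_sw)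
  have sw: "\<rho> x \<in> sw n d c" if "x \<in> sw n c d" for x c d
  proof -
    have x: "x \<in> so ?N" and l: "\<And>i j. x i j \<noteq> 0 \<Longrightarrow> lev ?N c i \<le> lev ?N c j \<and> lev ?N d j \<le> lev ?N d i"
      using that by (simp_all add: sw_def incidence_def)
    have "\<rho> x \<in> so ?N"
      unfolding so_iff \<rho>_def using so_support[OF x] so_mirror[OF x] by simp
    then show ?thesis using l by (simp add: sw_def incidence_def \<rho>_def)
  qed
  show ?thesis
  proof (rule has_slice_reduction[where V = "{0}" and \<xi> = "\<lambda>_. 0" and \<rho> = \<rho> and N' = ?N])
    show "has_slice ?N (sw n b a :: 'k matrix set) K" by (rule assms)
    show "\<rho> (bracket ?N x y) = bracket ?N (\<rho> x) (\<rho> y)" for x y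
      by (simp add: \<rho>_def bracket_def mmult_def fun_eq_iff mult.commute)
    show "bracket ?N x v \<in> {0}" if "v \<in> {0}" for x v :: "'k matrix" using that by simp
    show "\<rho> v = 0" if "v \<in> {0}" for v using that by (auto simp: \<rho>_def fun_eq_iff)
    show "x \<in> {0}" if "\<rho> x = 0" for x using that by (auto simp: \<rho>_def fun_eq_iff)
    show "\<exists>x\<in>{x \<in> sw n a b. \<forall>v\<in>{0 :: 'k matrix}. (0::'k) = 0}. \<rho> x = x'" if "x' \<in> sw n b a" for x'
      using sw[OF that] by (intro bexI[of _ "\<rho> x'"]) (auto simp: \<rho>_def)
    show "\<rho> (x + y) = \<rho> x + \<rho> y" "\<rho> (mscale c x) = mscale c (\<rho> x)" for x y c
      by (auto simp: \<rho>_def mscale_def fun_eq_iff)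
    show "\<rho> x \<in> sw n b a" if "x \<in> {x \<in> sw n a b. \<forall>v\<in>{0 :: 'k matrix}. (0::'k) = 0}" for x
      using sw[of x a b] that by simp
    show "{0} \<subseteq> (sw n a b :: 'k matrix set)" using mat_vs.subspace_0[OF subspace] by simp
  qed (simp_all add: linear_forms_def)
qed

lemma bracket_apply: "bracket N x y i j = (\<Sum>k=1..N. x i k * y k j) - (\<Sum>k=1..N. y i k * x k j)"
  by (simp add: bracket_def mmult_def)

lemma sum_times_so_unit:
  fixes x :: "'k::field matrix"
  assumes "1 \<le> p" "p \<le> N" "1 \<le> r" "r \<le> N"
  shows "(\<Sum>k=1..N. x i k * so_unit N p r k l) = (if l = r then x i p else 0) - (if l = N + 1 - p then x i (N + 1 - r) else 0)"
proof -
  have "(\<Sum>k=1..N. x i k * so_unit N p r k l) = (\<Sum>k=1..N. (if k = p then (if l = r then x i k else 0) else 0)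
      - (if k = N + 1 - r then (if l = N + 1 - p then x i k else 0) else 0))"
    unfolding so_unit_apply by (intro sum.cong refl) (simp add: algebra_simps)
  also have "\<dots> = (if l = r then x i p else 0) - (if l = N + 1 - p then x i (N + 1 - r) else 0)"
  proof -
    have "1 \<le> N + 1 - p" "N + 1 - p \<le> N" "1 \<le> N + 1 - r" "N + 1 - r \<le> N" using assms by auto
    then show ?thesis using assms by (simp add: sum_subtractf)
  qed
  finally show ?thesis .
qed

lemma sum_so_unit_times:
  fixes x :: "'k::field matrix"
  assumes "1 \<le> p" "p \<le> N" "1 \<le> r" "r \<le> N"
  shows "(\<Sum>k=1..N. so_unit N p r i k * x k l) = (if i = p then x r l else 0) - (if i = N + 1 - r then x (N + 1 - p) l else 0)"
proof -
  have "(\<Sum>k=1..N. so_unit N p r i k * x k l) = (\<Sum>k=1..N. (if k = r then (if i = p then x k l else 0) else 0)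
      - (if k = N + 1 - p then (if i = N + 1 - r then x k l else 0) else 0))"
    unfolding so_unit_apply by (intro sum.cong refl) (simp add: algebra_simps)
  also have "\<dots> = (if i = p then x r l else 0) - (if i = N + 1 - r then x (N + 1 - p) l else 0)"
  proof -
    have "1 \<le> N + 1 - p" "N + 1 - p \<le> N" "1 \<le> N + 1 - r" "N + 1 - r \<le> N" using assms by auto
    then show ?thesis using assms by (simp add: sum_subtractf)
  qed
  finally show ?thesis .
qed

lemma sw_support:
  assumes "x \<in> sw n a b" "x i j \<noteq> 0"
  shows "lev (2 * n + 1) a i \<le> lev (2 * n + 1) a j" "lev (2 * n + 1) b j \<le> lev (2 * n + 1) b i"
  using assms by (auto simp: sw_def incidence_def)

lemma sw_so: "x \<in> sw n a b \<Longrightarrow> x \<in> so (2 * n + 1)"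
  by (simp add: sw_def incidence_def)

lemma so_unit_in_sw:
  assumes "sum_list a \<le> n" "sum_list b \<le> n" "1 \<le> i" "i \<le> 2 * n + 1" "1 \<le> j" "j \<le> 2 * n + 1"
    and "lev (2 * n + 1) a i \<le> lev (2 * n + 1) a j" "lev (2 * n + 1) b j \<le> lev (2 * n + 1) b i"
  shows "(so_unit (2 * n + 1) i j :: 'k::field matrix) \<in> sw n a b"
  unfolding sw_def
proof (rule so_unit_in_incidence[OF assms(3-6)])
  have m: "lev (2 * n + 1) c (2 * n + 1 + 1 - k) = - lev (2 * n + 1) c k" if "sum_list c \<le> n" "1 \<le> k" "k \<le> 2 * n + 1" for c k
    using that by (intro lev_mirror) auto
  show "lev (2 * n + 1) a (2 * n + 1 + 1 - j) \<le> lev (2 * n + 1) a (2 * n + 1 + 1 - i) \<and>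
    lev (2 * n + 1) b (2 * n + 1 + 1 - i) \<le> lev (2 * n + 1) b (2 * n + 1 + 1 - j)"
    unfolding m[OF assms(1,3,4)] m[OF assms(1,5,6)] m[OF assms(2,3,4)] m[OF assms(2,5,6)] using assms(7,8) by simp
qed (use assms(7,8) in simp)

lemma lev_Cons_first: "i \<le> x \<Longrightarrow> lev N (x # a) i = - (1 + int (length a))"
  by simp

lemma lev_Cons_first_iff: "i \<le> x \<longleftrightarrow> lev N (x # a) i = - (1 + int (length a))"
  using lev_bounds(1)[of a "N - 2 * x" "i - x"] by auto

lemma lev_Cons_last_iff: "2 * x < N \<Longrightarrow> N < i + x \<longleftrightarrow> lev N (x # a) i = 1 + int (length a)"
  using lev_bounds(2)[of "N - 2 * x" a "i - x"] by auto

text \<open>The first and last blocks have extreme levels, so an inequality between levels becomes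
  membership in the same block.\<close>

lemma sw_Cons_support:
  assumes x: "x \<in> sw n (a1 # as) (b1 # bs)" "x i j \<noteq> 0" and n: "a1 \<le> n" "b1 \<le> n"
  shows "j \<le> a1 \<Longrightarrow> i \<le> a1" "i \<le> b1 \<Longrightarrow> j \<le> b1"
    "2 * n + 1 < i + a1 \<Longrightarrow> 2 * n + 1 < j + a1" "2 * n + 1 < j + b1 \<Longrightarrow> 2 * n + 1 < i + b1"
proof -
  note s = sw_support[OF x]
  have b: "- int (length (c # cs)) \<le> lev (2 * n + 1) (c # cs) k" "lev (2 * n + 1) (c # cs) k \<le> int (length (c # cs))" for c cs k
    by (rule lev_bounds)+
  show "j \<le> a1 \<Longrightarrow> i \<le> a1"
    using s(1) b(1)[of a1 as i] unfolding lev_Cons_first_iff[where N = "2 * n + 1" and a = as] by (simp del: lev.simps)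
  show "i \<le> b1 \<Longrightarrow> j \<le> b1"
    using s(2) b(1)[of b1 bs j] unfolding lev_Cons_first_iff[where N = "2 * n + 1" and a = bs] by (simp del: lev.simps)
  show "2 * n + 1 < i + a1 \<Longrightarrow> 2 * n + 1 < j + a1"
    using s(1) b(2)[of a1 as j] n lev_Cons_last_iff[of a1 "2 * n + 1" _ as] by (simp del: lev.simps)
  show "2 * n + 1 < j + b1 \<Longrightarrow> 2 * n + 1 < i + b1"
    using s(2) b(2)[of b1 bs i] n lev_Cons_last_iff[of b1 "2 * n + 1" _ bs] by (simp del: lev.simps)
qed

subsection \<open>The reduction step\<close>

text \<open>
  The two reductions \<open>2 a1 \<le> b1\<close> (\<open>c = a1\<close>) and \<open>2 a1 \<ge> b1\<close> (\<open>c = b1 - a1\<close>) are treated at once: the form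
  \<open>x \<mapsto> \<Sum>i\<le>c. x i (i + e)\<close> identifies the first \<open>c\<close> indices with the last \<open>c\<close> indices of the first block of \<open>b\<close>.
\<close>

locale reduction_step =
  fixes n a1 b1 c e :: nat and as bs :: "nat list" and R' :: "nat \<Rightarrow> nat \<Rightarrow> bool"
  assumes a: "a1 + sum_list as \<le> n" and b: "b1 + sum_list bs \<le> n"
    and e: "b1 = e + c" and ca: "c \<le> a1" and ae: "a1 \<le> e" and alt: "c = a1 \<or> e = a1"
    and R'_iff: "\<And>i j. 1 \<le> i \<Longrightarrow> i \<le> 2 * (n - c) + 1 \<Longrightarrow> 1 \<le> j \<Longrightarrow> j \<le> 2 * (n - c) + 1 \<Longrightarrow>
      R' i j \<longleftrightarrow> lev (2 * n + 1) (a1 # as) (i + c) \<le> lev (2 * n + 1) (a1 # as) (j + c) \<and>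
        lev (2 * n + 1) (b1 # bs) (j + c) \<le> lev (2 * n + 1) (b1 # bs) (i + c) \<and>
        \<not> (a1 < i + c \<and> i + c \<le> e \<and> e < j + c \<and> j + c \<le> b1) \<and>
        \<not> (2 * n + 1 < i + c + b1 \<and> i + c + e \<le> 2 * n + 1 \<and> 2 * n + 1 < j + c + e \<and> j + c + a1 \<le> 2 * n + 1)"
begin

abbreviation "N \<equiv> 2 * n + 1"
abbreviation "N' \<equiv> 2 * (n - c) + 1"
abbreviation "q \<equiv> sw n (a1 # as) (b1 # bs)"

definition xi :: "'k::field_char_0 matrix \<Rightarrow> 'k" where
  "xi x = (\<Sum>i=1..c. x i (i + e))"

text \<open>The stabiliser of \<open>xi\<close> on \<open>V\<close> in coordinates
  (\<open>centraliser_eq_compatible\<close>): the c by c corner at e copies the one at 0, and the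
  entries from rows 1..c to columns c+1..a1 and from rows a1+1..e to columns e+1..b1 vanish.\<close>

definition compatible :: "'k::field_char_0 matrix \<Rightarrow> bool" where
  "compatible x \<longleftrightarrow> (\<forall>i k. 1 \<le> i \<and> i \<le> c \<and> c < k \<and> k \<le> a1 \<longrightarrow> x i k = 0) \<and>
     (\<forall>i k. a1 < k \<and> k \<le> b1 \<and> 1 \<le> i \<and> i \<le> c \<longrightarrow> x k (i + e) = (if e < k then x (k - e) i else 0))"

text \<open>Membership in \<open>q\<close> already bounds the columns by b1, so this is the upper
  right a1 by (b1 - a1) corner of the first diagonal block of b, with its mirror image.\<close>

definition V :: "'k::field_char_0 matrix set" where
  "V = {x \<in> q. \<forall>i j. i + j \<le> N \<and> x i j \<noteq> 0 \<longrightarrow> i \<le> a1 \<and> a1 < j}"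

text \<open>At these positions the entry of x belongs to \<open>V\<close> and carries no information
  modulo \<open>V\<close>, so the place is free for an entry from the deleted columns 1..c. For i >=
  1 such positions exist only if c < a1, hence only if e = a1.\<close>

definition exceptional :: "nat \<Rightarrow> nat \<Rightarrow> bool" where
  "exceptional i j \<longleftrightarrow> i + c \<le> a1 \<and> a1 < j + c \<and> j + c \<le> b1"

definition mirror_exceptional :: "nat \<Rightarrow> nat \<Rightarrow> bool" where
  "mirror_exceptional i j \<longleftrightarrow> N < j + c + a1 \<and> i + c + a1 \<le> N \<and> N < i + c + b1"

text \<open>The first and the last c indices are deleted. Deletion alone would lose the entries in
  rows c+1..a1 and columns 1..c; under the identification of i with i + e (here e = a1) they are
  stored at the exceptional positions.\<close>

definition rho :: "'k::field_char_0 matrix \<Rightarrow> 'k matrix" where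
  "rho x i j = (if \<not> (1 \<le> i \<and> i \<le> N' \<and> 1 \<le> j \<and> j \<le> N') then 0
     else if exceptional i j then x (i + c) (j + c - a1)
     else if mirror_exceptional i j then x (i + c + a1) (j + c)
     else x (i + c) (j + c))"

lemma bounds: "a1 \<le> n" "b1 \<le> n" "c \<le> n" "N' + 2 * c = N"
  using a b ca by auto

sublocale matrix_lie_algebra N q
  by (rule matrix_lie_algebra_sw)

lemmas support = sw_Cons_support[OF _ _ bounds(1,2)]

lemma rangeD: "x \<in> q \<Longrightarrow> x i j \<noteq> 0 \<Longrightarrow> 1 \<le> i \<and> i \<le> N \<and> 1 \<le> j \<and> j \<le> N"
  using so_support[OF sw_so] by blast

lemma unit_left:
  assumes "1 \<le> i" "i \<le> a1" "1 \<le> j" "j \<le> b1"  "j \<le> a1 \<or> i \<le> j"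
  shows "so_unit N i j \<in> q"
proof (rule so_unit_in_sw)
  show "lev N (a1 # as) i \<le> lev N (a1 # as) j"
    using assms lev_mono[of i j N "a1 # as"] lev_Cons_first[of i a1] lev_Cons_first[of j a1] by auto
  show "lev N (b1 # bs) j \<le> lev N (b1 # bs) i"
    using assms ae e lev_Cons_first[of i b1] lev_Cons_first[of j b1] by simp
qed (use assms a b bounds in auto)

lemma unit_right:
  assumes "1 \<le> i" "i \<le> j" "j \<le> b1"
  shows "so_unit N i j \<in> q"
proof (rule so_unit_in_sw)
  show "lev N (a1 # as) i \<le> lev N (a1 # as) j" using assms by (intro lev_mono)
  show "lev N (b1 # bs) j \<le> lev N (b1 # bs) i"
    using assms lev_Cons_first[of i b1] lev_Cons_first[of j b1] by simp
qed (use assms a b bounds in auto)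

lemma xi_bracket:
  "xi (bracket N x y) = (\<Sum>i=1..c. \<Sum>k=1..N. x i k * y k (i + e)) - (\<Sum>i=1..c. \<Sum>k=1..N. y i k * x k (i + e))"
  by (simp add: xi_def bracket_apply sum_subtractf)

lemma compatibleD:
  assumes "compatible x"
  shows "1 \<le> i \<Longrightarrow> i \<le> c \<Longrightarrow> c < k \<Longrightarrow> k \<le> a1 \<Longrightarrow> x i k = 0"
    and "a1 < k \<Longrightarrow> k \<le> b1 \<Longrightarrow> 1 \<le> i \<Longrightarrow> i \<le> c \<Longrightarrow> x k (i + e) = (if e < k then x (k - e) i else 0)"
  using assms unfolding compatible_def by blast+

text \<open>Compatibility and the support of \<open>q\<close> leave only the indices 1..c and
  e+1..b1 in the sum, and on the latter the corner of y may be read at 1..c.\<close>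

lemma compatible_sum:
  assumes x: "x \<in> q" and y: "y \<in> q" and C: "compatible x" "compatible y" and i: "1 \<le> i" "i \<le> c"
  shows "(\<Sum>k=1..N. x i k * y k (i + e)) = (\<Sum>k=1..c. x i k * y k (i + e)) + (\<Sum>k=1..c. x i (k + e) * y k i)"
proof -
  have "(\<Sum>k=1..N. x i k * y k (i + e)) = (\<Sum>k\<in>{1..c} \<union> {e + 1..e + c}. x i k * y k (i + e))"
  proof (rule sum.mono_neutral_right)
    show "\<forall>k\<in>{1..N} - ({1..c} \<union> {e + 1..e + c}). x i k * y k (i + e) = 0"
    proof
      fix k assume k: "k \<in> {1..N} - ({1..c} \<union> {e + 1..e + c})"
      consider "b1 < k" | "c < k" "k \<le> a1" | "a1 < k" "k \<le> e" using k e by fastforce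
      then show "x i k * y k (i + e) = 0"
      proof cases
        case 1
        have "x i k = 0" using support(2)[OF x, of i k] i ca ae e 1 by fastforce
        then show ?thesis by simp
      next
        case 2
        then show ?thesis using compatibleD(1)[OF C(1) i] by simp
      next
        case 3
        then have "y k (i + e) = 0" using compatibleD(2)[OF C(2) _ _ i, of k] e by simp
        then show ?thesis by simp
      qed
    qed
  qed (use e bounds in auto)
  also have "\<dots> = (\<Sum>k=1..c. x i k * y k (i + e)) + (\<Sum>k=e + 1..e + c. x i k * y k (i + e))"
    using ca ae by (intro sum.union_disjoint) auto
  also have "(\<Sum>k=e + 1..e + c. x i k * y k (i + e)) = (\<Sum>k=1..c. x i (k + e) * y (k + e) (i + e))"
    by (rule sum.reindex_bij_witness[where i = "\<lambda>k. k + e" and j = "\<lambda>k. k - e"]) auto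
  also have "\<dots> = (\<Sum>k=1..c. x i (k + e) * y k i)"
  proof (intro sum.cong refl)
    fix k assume "k \<in> {1..c}"
    then show "x i (k + e) * y (k + e) (i + e) = x i (k + e) * y k i"
      using compatibleD(2)[OF C(2) _ _ i, of "k + e"] ae e by simp
  qed
  finally show ?thesis .
qed

text \<open>Each of the two products contributes two c by c double sums; interchanging the summation
  indices matches those of xy with those of yx, and they cancel.\<close>

lemma xi_bracket_compatible:
  assumes "x \<in> q" "y \<in> q" "compatible x" "compatible y"
  shows "xi (bracket N x y) = 0"
proof -
  have T: "(\<Sum>i=1..c. \<Sum>k=1..N. x i k * y k (i + e)) =
      (\<Sum>i=1..c. \<Sum>k=1..c. x i k * y k (i + e)) + (\<Sum>i=1..c. \<Sum>k=1..c. x i (k + e) * y k i)"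
    if "x \<in> q" "y \<in> q" "compatible x" "compatible y" for x y :: "'a matrix"
    using compatible_sum[OF that] by (simp add: sum.distrib)
  have sw: "(\<Sum>i=1..c. \<Sum>k=1..c. x i k * y k (i + e)) = (\<Sum>i=1..c. \<Sum>k=1..c. y i (k + e) * x k i)" for x y :: "'a matrix"
    by (subst sum.swap) (simp add: mult.commute)
  show ?thesis
    unfolding xi_bracket T[OF assms] T[OF assms(2,1,4,3)] sw[of x y] sw[of y x] by simp
qed

lemma V_zero: "v \<in> V \<Longrightarrow> i + j \<le> N \<Longrightarrow> a1 < i \<or> j \<le> a1 \<Longrightarrow> v i j = 0"
  unfolding V_def by force

lemma V_compatible:
  assumes v: "v \<in> V"
  shows "compatible v"
  unfolding compatible_def
proof (intro conjI allI impI; elim conjE)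
  fix i k assume "1 \<le> i" "i \<le> c" "c < k" "k \<le> a1"
  then show "v i k = 0" using bounds ca by (intro V_zero[OF v]) auto
next
  fix i k assume h: "a1 < k" "k \<le> b1" "1 \<le> i" "i \<le> c"
  have "v k (i + e) = 0" using h bounds e by (intro V_zero[OF v]) auto
  moreover have "v (k - e) i = 0" using h bounds e ca by (intro V_zero[OF v]) auto
  ultimately show "v k (i + e) = (if e < k then v (k - e) i else 0)" by simp
qed

lemma unit_in_V:
  assumes "1 \<le> k" "k \<le> a1" "a1 < j" "j \<le> b1"
  shows "so_unit N k j \<in> V"
proof -
  have u: "i \<le> a1 \<and> a1 < l" if "i + l \<le> N" "(so_unit N k j :: 'a matrix) i l \<noteq> 0" for i l
    using so_unit_support[OF that(2)] assms bounds that(1) by auto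
  show ?thesis unfolding V_def using u unit_left[of k j] assms by auto
qed

lemma centraliser_eq_compatible:
  "{x \<in> q. \<forall>v\<in>V. xi (bracket N x v) = 0} = {x \<in> q. compatible x}"
proof (intro equalityI subsetI CollectI conjI; elim CollectE conjE)
  fix x :: "'a matrix" assume x: "x \<in> q" and "\<forall>v\<in>V. xi (bracket N x v) = 0"
  then have z: "xi (bracket N x (so_unit N k j)) = 0" if "1 \<le> k" "k \<le> a1" "a1 < j" "j \<le> b1" for k j
    using unit_in_V that by blast
  \<comment> \<open>Testing on the unit of \<open>V\<close> at (k, j) gives one equation between two
    entries of x. The alternatives e < j or not, k <= c or not, yield the clauses of
    \<open>compatible\<close>.\<close>
  have key: "(if e < j then x (j - e) k else 0) = (if k \<le> c then x j (k + e) else 0)"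
    if h: "1 \<le> k" "k \<le> a1" "a1 < j" "j \<le> b1" for k j
  proof -
    have r: "1 \<le> k" "k \<le> N" "1 \<le> j" "j \<le> N" using h bounds by auto
    have "(\<Sum>i=1..c. \<Sum>l=1..N. x i l * so_unit N k j l (i + e)) = (\<Sum>i=1..c. if i + e = j then x i k else 0)"
      unfolding sum_times_so_unit[OF r] using bounds e h by (intro sum.cong refl) auto
    also have "\<dots> = (\<Sum>i=1..c. if i = j - e then (if e < j then x i k else 0) else 0)"
      by (intro sum.cong refl) auto
    also have "\<dots> = (if e < j then x (j - e) k else 0)" using h e by (auto simp: sum.delta)
    finally have 1: "(\<Sum>i=1..c. \<Sum>l=1..N. x i l * so_unit N k j l (i + e)) = (if e < j then x (j - e) k else 0)" .
    have "(\<Sum>i=1..c. \<Sum>l=1..N. so_unit N k j i l * x l (i + e)) = (\<Sum>i=1..c. if i = k then x j (i + e) else 0)"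
      unfolding sum_so_unit_times[OF r] using bounds ca h by (intro sum.cong refl) auto
    also have "\<dots> = (if k \<le> c then x j (k + e) else 0)" using h by (auto simp: sum.delta)
    finally have 2: "(\<Sum>i=1..c. \<Sum>l=1..N. so_unit N k j i l * x l (i + e)) = (if k \<le> c then x j (k + e) else 0)" .
    show ?thesis using z[OF h] unfolding xi_bracket 1 2 by simp
  qed
  show "compatible x"
    unfolding compatible_def
  proof (intro conjI allI impI; elim conjE)
    fix i k assume "1 \<le> i" "i \<le> c" "c < k" "k \<le> a1"
    then show "x i k = 0" using key[of k "i + e"] e ae by simp
  next
    fix i k assume "a1 < k" "k \<le> b1" "1 \<le> i" "i \<le> c"
    then show "x k (i + e) = (if e < k then x (k - e) i else 0)" using key[of i k] ca by simp
  qed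
next
  fix x :: "'a matrix" assume "x \<in> q" "compatible x"
  moreover have "v \<in> q" if "v \<in> V" for v :: "'a matrix" using that by (simp add: V_def)
  ultimately show "\<forall>v\<in>V. xi (bracket N x v) = 0" using xi_bracket_compatible V_compatible by blast
qed

text \<open>An entry v_ij is carried to a position (k, k + e) seen by \<open>xi\<close>: by the unit
  at (j - e, i) from the left if j > e, by the unit at (j, i + e) from the right otherwise. In the
  second case a1 < e, hence c = a1 and i <= c.\<close>

lemma V_nondegenerate:
  assumes v: "v \<in> V" and z: "\<And>y. y \<in> q \<Longrightarrow> xi (bracket N v y) = 0"
  shows "v = 0"
proof -
  have vq: "v \<in> q" using v by (simp add: V_def)
  have main: "v i j = 0" if h: "1 \<le> i" "i \<le> a1" "a1 < j" "j \<le> b1" for i j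
  proof (cases "e < j")
    case True
    then have r: "1 \<le> j - e" "j - e \<le> N" "1 \<le> i" "i \<le> N" using h bounds by auto
    have "xi (bracket N v (so_unit N (j - e) i)) = 0"
      using h True e ca ae by (intro z unit_left) auto
    moreover have "(\<Sum>k=1..c. \<Sum>l=1..N. v k l * so_unit N (j - e) i l (k + e)) = 0"
      unfolding sum_times_so_unit[OF r] using h e ae bounds True by (intro sum.neutral) auto
    moreover have "(\<Sum>k=1..c. \<Sum>l=1..N. so_unit N (j - e) i k l * v l (k + e)) = (\<Sum>k=1..c. if k = j - e then v i j else 0)"
      unfolding sum_so_unit_times[OF r] using h e ae ca bounds True by (intro sum.cong) auto
    moreover have "1 \<le> j - e" "j - e \<le> c" using h True e by auto
    moreover then have "(\<Sum>k=1..c. if k = j - e then v i j else 0) = v i j" by simp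
    ultimately show ?thesis unfolding xi_bracket by simp
  next
    case False
    then have ic: "i \<le> c" using h alt by auto
    then have r: "1 \<le> j" "j \<le> N" "1 \<le> i + e" "i + e \<le> N" using h bounds e by auto
    have "xi (bracket N v (so_unit N j (i + e))) = 0"
      using h False e ic by (intro z unit_right) auto
    moreover have "(\<Sum>k=1..c. \<Sum>l=1..N. v k l * so_unit N j (i + e) l (k + e)) = (\<Sum>k=1..c. if k = i then v i j else 0)"
      unfolding sum_times_so_unit[OF r] using h e ae bounds False by (intro sum.cong) auto
    moreover have "\<dots> = v i j" using h ic by (simp add: sum.delta)
    moreover have "(\<Sum>k=1..c. \<Sum>l=1..N. so_unit N j (i + e) k l * v l (k + e)) = 0"
      unfolding sum_so_unit_times[OF r] using h e ca ic bounds False by (intro sum.neutral) auto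
    ultimately show ?thesis unfolding xi_bracket by simp
  qed
  show ?thesis
  proof (rule so_eqI[OF sw_so[OF vq] sw_so[OF mat_vs.subspace_0[OF subspace]]])
    fix i j :: nat assume ij: "1 \<le> i" "1 \<le> j" "i + j \<le> N"
    have "v i j = 0"
    proof (rule ccontr)
      assume nz: "v i j \<noteq> 0"
      then have "i \<le> a1" "a1 < j" using V_zero[OF v ij(3)] by (meson not_le)+
      moreover have "j \<le> b1" using support(2)[OF vq nz] \<open>i \<le> a1\<close> ae e by simp
      ultimately show False using main ij nz by blast
    qed
    then show "v i j = 0 i j" by simp
  qed
qed

lemma exceptional_mirror:
  assumes "1 \<le> i" "i \<le> N'" "1 \<le> j" "j \<le> N'"
  shows "exceptional (N' + 1 - j) (N' + 1 - i) \<longleftrightarrow> mirror_exceptional i j"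
    and "mirror_exceptional (N' + 1 - j) (N' + 1 - i) \<longleftrightarrow> exceptional i j"
    and "exceptional i j \<Longrightarrow> \<not> mirror_exceptional i j"
  unfolding exceptional_def mirror_exceptional_def using assms bounds e by auto

lemma rho_simps:
  assumes "1 \<le> i" "i \<le> N'" "1 \<le> j" "j \<le> N'"
  shows "exceptional i j \<Longrightarrow> rho x i j = x (i + c) (j + c - a1)"
    and "mirror_exceptional i j \<Longrightarrow> rho x i j = x (i + c + a1) (j + c)"
    and "\<not> exceptional i j \<Longrightarrow> \<not> mirror_exceptional i j \<Longrightarrow> rho x i j = x (i + c) (j + c)"
  using assms exceptional_mirror(3)[OF assms] by (auto simp: rho_def)

lemma rho_support: "rho x i j \<noteq> 0 \<Longrightarrow> 1 \<le> i \<and> i \<le> N' \<and> 1 \<le> j \<and> j \<le> N'"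
proof (rule ccontr)
  assume "rho x i j \<noteq> 0" and n: "\<not> (1 \<le> i \<and> i \<le> N' \<and> 1 \<le> j \<and> j \<le> N')"
  moreover have "rho x i j = 0" unfolding rho_def by (simp only: n if_True not_False_eq_True)
  ultimately show False by blast
qed

lemma rho_so:
  assumes x: "x \<in> so N"
  shows "rho x \<in> so N'"
  unfolding so_iff
proof (intro conjI allI impI ballI)
  fix i j
  assume "rho x i j \<noteq> 0"
  from rho_support[OF this] show "i \<in> {1..N'}" "j \<in> {1..N'}" by auto
next
  fix i j assume "i \<in> {1..N'}" "j \<in> {1..N'}"
  then have ij: "1 \<le> i" "i \<le> N'" "1 \<le> j" "j \<le> N'" by auto
  have r: "1 \<le> N' + 1 - j" "N' + 1 - j \<le> N'" "1 \<le> N' + 1 - i" "N' + 1 - i \<le> N'" using ij by linarith+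
  note m = exceptional_mirror[OF ij] and R = rho_simps[OF ij, of x] and R' = rho_simps[OF r, of x]
  show "rho x (N' + 1 - j) (N' + 1 - i) = - rho x i j"
  proof (cases "exceptional i j")
    case True
    then have t: "i + c \<le> a1" "a1 < j + c" "j + c \<le> b1" by (auto simp: exceptional_def)
    have e: "N' + 1 - j + c + a1 = N + 1 - (j + c - a1)" "N' + 1 - i + c = N + 1 - (i + c)"
      using ij bounds t by linarith+
    have "rho x (N' + 1 - j) (N' + 1 - i) = x (N + 1 - (j + c - a1)) (N + 1 - (i + c))"
      using R'(2) m(2) True unfolding e by blast
    also have "\<dots> = - x (i + c) (j + c - a1)" using ij bounds t by (intro so_mirror[OF x]) linarith+
    finally show ?thesis using R(1) True by simp
  next
    case F: False
    show ?thesis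
    proof (cases "mirror_exceptional i j")
      case True
      then have t: "N < j + c + a1" "i + c + a1 \<le> N" "N < i + c + b1" by (auto simp: mirror_exceptional_def)
      have e: "N' + 1 - j + c = N + 1 - (j + c)" "N' + 1 - i + c - a1 = N + 1 - (i + c + a1)"
        using ij bounds t by linarith+
      have "rho x (N' + 1 - j) (N' + 1 - i) = x (N + 1 - (j + c)) (N + 1 - (i + c + a1))"
        using R'(1) m(1) True unfolding e by blast
      also have "\<dots> = - x (i + c + a1) (j + c)" using ij bounds t by (intro so_mirror[OF x]) linarith+
      finally show ?thesis using R(2) True by simp
    next
      case False
      have e: "N' + 1 - j + c = N + 1 - (j + c)" "N' + 1 - i + c = N + 1 - (i + c)"
        using ij bounds by linarith+
      have "rho x (N' + 1 - j) (N' + 1 - i) = x (N + 1 - (j + c)) (N + 1 - (i + c))"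
        using R'(3) m(1,2) F False unfolding e by blast
      also have "\<dots> = - x (i + c) (j + c)" using ij bounds by (intro so_mirror[OF x]) linarith+
      finally show ?thesis using R(3) F False by simp
    qed
  qed
qed

lemma rho_V:
  assumes v: "v \<in> V"
  shows "rho v = 0"
proof (rule so_eqI)
  have "v \<in> q" using v by (simp add: V_def)
  then show "rho v \<in> so N'" by (intro rho_so sw_so)
  show "0 \<in> so N'" by (rule mat_vs.subspace_0[OF subspace_so])
  fix i j :: nat assume ij: "1 \<le> i" "1 \<le> j" "i + j \<le> N'"
  then have r: "1 \<le> i" "i \<le> N'" "1 \<le> j" "j \<le> N'" by linarith+
  have nm: "\<not> mirror_exceptional i j" unfolding mirror_exceptional_def using ij bounds e by linarith
  have vq: "v \<in> q" using v by (simp add: V_def)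
  have "rho v i j = 0"
  proof (cases "exceptional i j")
    case True
    then have t: "i + c \<le> a1" "a1 < j + c" "j + c \<le> b1" by (auto simp: exceptional_def)
    have "v (i + c) (j + c - a1) = 0" using t ij bounds e alt by (intro V_zero[OF v]) auto
    then show ?thesis using rho_simps(1)[OF r True, of v] by simp
  next
    case False
    have "v (i + c) (j + c) = 0"
    proof (rule ccontr)
      assume nz: "v (i + c) (j + c) \<noteq> 0"
      have "i + c \<le> a1" "a1 < j + c" using V_zero[OF v, of "i + c" "j + c"] nz ij bounds by linarith+
      moreover have "j + c \<le> b1" using support(2)[OF vq nz] calculation ae e by linarith
      ultimately show False using False by (simp add: exceptional_def)
    qed
    then show ?thesis using rho_simps(3)[OF r False nm, of v] by simp
  qed
  then show "rho v i j = 0 i j" by simp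
qed

text \<open>This is the origin of the rectangles excluded in \<open>R'_iff\<close>: when c = a1, the
  block of b is cut at e and these entries are the ones lost.\<close>

lemma compatible_middle_zero:
  assumes "compatible x" "a1 < i" "i \<le> e" "e < j" "j \<le> b1"
  shows "x i j = 0"
  using compatibleD(2)[OF assms(1), of i "j - e"] assms(2-) e by simp

lemma rho_in_target:
  assumes x: "x \<in> q" and C: "compatible x"
  shows "rho x \<in> incidence N' R'"
proof -
  have half: "R' i j" if ij: "1 \<le> i" "1 \<le> j" "i + j \<le> N'" and nz: "rho x i j \<noteq> 0" for i j
  proof -
    have r: "1 \<le> i" "i \<le> N'" "1 \<le> j" "j \<le> N'" using ij by linarith+
    have nm: "\<not> mirror_exceptional i j" unfolding mirror_exceptional_def using ij bounds e by linarith
    have n4: "\<not> (2 * n + 1 < i + c + b1 \<and> i + c + e \<le> 2 * n + 1 \<and> 2 * n + 1 < j + c + e \<and> j + c + a1 \<le> 2 * n + 1)"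
      using ij bounds e by linarith
    show ?thesis
    proof (cases "exceptional i j")
      case True
      then have t: "i + c \<le> a1" "a1 < j + c" "j + c \<le> b1" by (auto simp: exceptional_def)
      have "lev (2 * n + 1) (a1 # as) (i + c) \<le> lev (2 * n + 1) (a1 # as) (j + c)" using t by (intro lev_mono) linarith
      moreover have "lev (2 * n + 1) (b1 # bs) (j + c) \<le> lev (2 * n + 1) (b1 # bs) (i + c)"
        using lev_Cons_first[of "i + c" b1] lev_Cons_first[of "j + c" b1] t by simp
      moreover have "\<not> (a1 < i + c \<and> i + c \<le> e \<and> e < j + c \<and> j + c \<le> b1)" using t by linarith
      ultimately show ?thesis unfolding R'_iff[OF r] using n4 by blast
    next
      case False
      have nz': "x (i + c) (j + c) \<noteq> 0" using nz rho_simps(3)[OF r False nm, of x] by simp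
      have "\<not> (a1 < i + c \<and> i + c \<le> e \<and> e < j + c \<and> j + c \<le> b1)"
        using compatible_middle_zero[OF C] nz' by blast
      then show ?thesis unfolding R'_iff[OF r] using sw_support[OF x nz'] n4 by blast
    qed
  qed
  have mir: "R' (N' + 1 - j) (N' + 1 - i) \<longleftrightarrow> R' i j" if r: "1 \<le> i" "i \<le> N'" "1 \<le> j" "j \<le> N'" for i j
  proof -
    have r': "1 \<le> N' + 1 - j" "N' + 1 - j \<le> N'" "1 \<le> N' + 1 - i" "N' + 1 - i \<le> N'" using r by linarith+
    have e': "N' + 1 - j + c = N + 1 - (j + c)" "N' + 1 - i + c = N + 1 - (i + c)" using r bounds by linarith+
    have "lev N d (N + 1 - (i + c)) = - lev N d (i + c)" "lev N d (N + 1 - (j + c)) = - lev N d (j + c)" if "sum_list d \<le> n" for d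
      using that r bounds by (intro lev_mirror; linarith)+
    from this[of "a1 # as"] this[of "b1 # bs"]
    have l: "lev N (a1 # as) (N + 1 - (i + c)) = - lev N (a1 # as) (i + c)"
      "lev N (a1 # as) (N + 1 - (j + c)) = - lev N (a1 # as) (j + c)"
      "lev N (b1 # bs) (N + 1 - (i + c)) = - lev N (b1 # bs) (i + c)"
      "lev N (b1 # bs) (N + 1 - (j + c)) = - lev N (b1 # bs) (j + c)"
      using a b by simp_all
    have "a1 < N + 1 - (j + c) \<and> N + 1 - (j + c) \<le> e \<and> e < N + 1 - (i + c) \<and> N + 1 - (i + c) \<le> b1 \<longleftrightarrow>
      N < i + c + b1 \<and> i + c + e \<le> N \<and> N < j + c + e \<and> j + c + a1 \<le> N"
      "N < N + 1 - (j + c) + b1 \<and> N + 1 - (j + c) + e \<le> N \<and> N < N + 1 - (i + c) + e \<and> N + 1 - (i + c) + a1 \<le> N \<longleftrightarrow>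
      a1 < i + c \<and> i + c \<le> e \<and> e < j + c \<and> j + c \<le> b1"
      using r bounds by (intro iffI conjI; linarith)+
    then show ?thesis unfolding R'_iff[OF r] R'_iff[OF r'] e' l neg_le_iff_le by blast
  qed
  have so: "rho x \<in> so N'" using x by (intro rho_so sw_so)
  show ?thesis unfolding incidence_def
  proof (intro CollectI conjI allI impI so)
    fix i j assume nz: "rho x i j \<noteq> 0"
    then have r: "1 \<le> i" "i \<le> N'" "1 \<le> j" "j \<le> N'" using rho_support by blast+
    consider "i + j \<le> N'" | "j = N' + 1 - i" | "(N' + 1 - j) + (N' + 1 - i) \<le> N'" using r by linarith
    then show "R' i j"
    proof cases
      case 1 then show ?thesis using half r nz by blast
    next
      case 2 then show ?thesis using so_antidiagonal[OF so, of i] nz by simp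
    next
      case 3
      have "rho x (N' + 1 - j) (N' + 1 - i) \<noteq> 0" using so_mirror[OF so r] nz by simp
      then have "R' (N' + 1 - j) (N' + 1 - i)" using half 3 r by simp
      then show ?thesis using mir[OF r] by blast
    qed
  qed
qed

text \<open>Every entry outside \<open>V\<close> can be read off: directly if both indices exceed c;
  from the copy at (i + e, j + e) if both are at most c; from an exceptional position if j <= c < i
  <= a1. For i <= c < j <= a1 it is zero by compatibility.\<close>

lemma rho_injective_mod_V:
  assumes x: "x \<in> q" and C: "compatible x" and z: "rho x = 0"
  shows "x \<in> V"
proof -
  have plain: "x (i + c) (j + c) = 0" if ij: "1 \<le> i" "1 \<le> j" "i + j \<le> N'" "\<not> exceptional i j" for i j
  proof -
    have r: "1 \<le> i" "i \<le> N'" "1 \<le> j" "j \<le> N'" using ij by linarith+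
    have "\<not> mirror_exceptional i j" unfolding mirror_exceptional_def using ij bounds e by linarith
    then show ?thesis using rho_simps(3)[OF r ij(4), of x] z by simp
  qed
  have "i \<le> a1 \<and> a1 < j" if ij: "i + j \<le> N" "x i j \<noteq> 0" for i j
  proof (rule ccontr)
    assume n: "\<not> ?thesis"
    have r: "1 \<le> i" "i \<le> N" "1 \<le> j" "j \<le> N" using rangeD[OF x ij(2)] by auto
    show False
    proof (cases "j \<le> a1")
      case True
      have i: "i \<le> a1" by (rule support(1)[OF x ij(2) True])
      show False
      proof (cases "j \<le> c")
        case jc: True
        show False
        proof (cases "i \<le> c")
          case True
          have "x (i + e) (j + e) = x i j"
            using compatibleD(2)[OF C, of "i + e" j] r True jc ae e by simp
          moreover have "x ((i + e - c) + c) ((j + e - c) + c) = 0"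
            using r True jc ca ae bounds e by (intro plain, unfold exceptional_def) linarith+
          ultimately show False using ij(2) ca ae by simp
        next
          case False
          then have ea: "e = a1" using alt i by linarith
          have r': "1 \<le> i - c" "i - c \<le> N'" "1 \<le> j + a1 - c" "j + a1 - c \<le> N'"
            using False i jc ca r bounds e ea by linarith+
          have ex: "exceptional (i - c) (j + a1 - c)" unfolding exceptional_def using False i jc ca r e ea by linarith
          have "x (i - c + c) (j + a1 - c + c - a1) = 0" using rho_simps(1)[OF r' ex, of x] z by simp
          then show False using ij(2) False jc ca by simp
        qed
      next
        case jc: False
        show False
        proof (cases "i \<le> c")
          case True then show False using compatibleD(1)[OF C, of i j] jc r \<open>j \<le> a1\<close> ij(2) by simp
        next
          case False
          have "x (i - c + c) (j - c + c) = 0"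
            using False jc r ij(1) bounds \<open>j \<le> a1\<close> by (intro plain, unfold exceptional_def) linarith+
          then show False using False jc ij(2) by simp
        qed
      qed
    next
      case False
      then have i: "a1 < i" using n by simp
      have "x (i - c + c) (j - c + c) = 0"
        using False i ca r ij(1) bounds by (intro plain, unfold exceptional_def) linarith+
      then show False using False i ca ij(2) by simp
    qed
  qed
  then show ?thesis unfolding V_def using x by blast
qed

text \<open>At an ordinary position the deleted summation indices contribute nothing. At an
  exceptional position the index runs through c+1..b1, and its part beyond a1 stands for the deleted
  indices 1..c.\<close>

lemma rho_bracket:
  assumes x: "x \<in> q" and y: "y \<in> q" and C: "compatible x" "compatible y"
  shows "rho (bracket N x y) = bracket N' (rho x) (rho y)"
proof (rule so_eqI)
  have so: "x \<in> so N" "y \<in> so N" by (rule sw_so[OF x], rule sw_so[OF y])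
  show "rho (bracket N x y) \<in> so N'" by (intro rho_so bracket_so so)
  show "bracket N' (rho x) (rho y) \<in> so N'" by (intro rho_so bracket_so so)
  fix i j :: nat assume ij: "1 \<le> i" "1 \<le> j" "i + j \<le> N'"
  then have r: "1 \<le> i" "i \<le> N'" "1 \<le> j" "j \<le> N'" by linarith+
  have nm: "\<not> mirror_exceptional i j" unfolding mirror_exceptional_def using ij bounds e by linarith
  have shift: "(\<Sum>k=1..N'. h (k + c)) = (\<Sum>k=c + 1..N - c. h k)" for h :: "nat \<Rightarrow> 'a"
    by (rule sum.reindex_bij_witness[where i = "\<lambda>k. k - c" and j = "\<lambda>k. k + c"]) (use bounds in auto)
  have main: "(\<Sum>k=1..N'. rho x i k * rho y k j) =
      (if exceptional i j then (\<Sum>k=1..N. x (i + c) k * y k (j + c - a1)) else (\<Sum>k=1..N. x (i + c) k * y k (j + c)))"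
    if x: "x \<in> q" and y: "y \<in> q" and C: "compatible x" "compatible y" for x y :: "'a matrix"
  proof (cases "exceptional i j")
    case True
    then have t: "i + c \<le> a1" "a1 < j + c" "j + c \<le> b1" by (auto simp: exceptional_def)
    then have ea: "e = a1" using alt ij by linarith
    define J where "J = j + c - a1"
    have J: "1 \<le> J" "J \<le> c" using t ea e by (auto simp: J_def)
    have summand: "rho x i k * rho y k j = (if k + c \<le> a1 then x (i + c) (k + c) * y (k + c) J
        else if k + c \<le> b1 then x (i + c) (k + c - a1) * y (k + c - a1) J else 0)" if k: "k \<in> {1..N'}" for k
    proof -
      have rk: "1 \<le> k" "k \<le> N'" using k by auto
      have nmk: "\<not> mirror_exceptional i k" "\<not> mirror_exceptional k j"
        unfolding mirror_exceptional_def using t bounds e by linarith+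
      consider "k + c \<le> a1" | "a1 < k + c" "k + c \<le> b1" | "b1 < k + c" by linarith
      then show ?thesis
      proof cases
        case 1
        then have "\<not> exceptional i k" "exceptional k j" using t by (auto simp: exceptional_def)
        then show ?thesis
          using 1 rho_simps(3)[OF r(1,2) rk, of x] rho_simps(1)[OF rk r(3,4), of y] nmk by (simp add: J_def)
      next
        case 2
        then have ex: "exceptional i k" "\<not> exceptional k j" using t by (auto simp: exceptional_def)
        have "y (k + c) (j + c) = y (k + c - a1) J"
          using compatibleD(2)[OF C(2) 2 J] 2 t unfolding ea J_def by simp
        then show ?thesis
          using 2 rho_simps(1)[OF r(1,2) rk ex(1), of x] rho_simps(3)[OF rk r(3,4) ex(2) nmk(2), of y] by simp
      next
        case 3
        then have "\<not> exceptional i k" using t by (auto simp: exceptional_def)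
        then have "rho x i k = x (i + c) (k + c)" using rho_simps(3)[OF r(1,2) rk, of x] nmk by simp
        also have "\<dots> = 0" using support(2)[OF x, of "i + c" "k + c"] 3 t ae e by fastforce
        finally show ?thesis using 3 ae e by simp
      qed
    qed
    have "(\<Sum>k=1..N'. rho x i k * rho y k j) = (\<Sum>k=1..N'. if k + c \<le> a1 then x (i + c) (k + c) * y (k + c) J
        else if k + c \<le> b1 then x (i + c) (k + c - a1) * y (k + c - a1) J else 0)"
      using summand by (rule sum.cong[OF refl])
    also have "\<dots> = (\<Sum>k=c + 1..N - c. if k \<le> a1 then x (i + c) k * y k J
        else if k \<le> b1 then x (i + c) (k - a1) * y (k - a1) J else 0)"
      by (rule shift)
    also have "\<dots> = (\<Sum>k\<in>{c + 1..a1} \<union> {a1 + 1..a1 + c}. if k \<le> a1 then x (i + c) k * y k J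
        else if k \<le> b1 then x (i + c) (k - a1) * y (k - a1) J else 0)"
      by (rule sum.mono_neutral_right) (use bounds e ea ca in auto)
    also have "\<dots> = (\<Sum>k=c + 1..a1. x (i + c) k * y k J) + (\<Sum>k=a1 + 1..a1 + c. x (i + c) (k - a1) * y (k - a1) J)"
      using ca e ea by (subst sum.union_disjoint) (auto intro!: arg_cong2[where f = "(+)"] sum.cong)
    also have "(\<Sum>k=a1 + 1..a1 + c. x (i + c) (k - a1) * y (k - a1) J) = (\<Sum>k=1..c. x (i + c) k * y k J)"
      by (rule sum.reindex_bij_witness[where i = "\<lambda>k. k + a1" and j = "\<lambda>k. k - a1"]) auto
    also have "(\<Sum>k=c + 1..a1. x (i + c) k * y k J) + (\<Sum>k=1..c. x (i + c) k * y k J) = (\<Sum>k\<in>{1..c} \<union> {c + 1..a1}. x (i + c) k * y k J)"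
      by (subst sum.union_disjoint) (auto simp: add.commute)
    also have "\<dots> = (\<Sum>k=1..N. x (i + c) k * y k J)"
    proof (rule sum.mono_neutral_left)
      show "\<forall>k\<in>{1..N} - ({1..c} \<union> {c + 1..a1}). x (i + c) k * y k J = 0"
      proof
        fix k assume "k \<in> {1..N} - ({1..c} \<union> {c + 1..a1})"
        then have "a1 < k" by auto
        then have "y k J = 0" using support(1)[OF y, of k J] J ca by fastforce
        then show "x (i + c) k * y k J = 0" by simp
      qed
    qed (use bounds ca in auto)
    finally show ?thesis using True by (simp add: J_def)
  next
    case False
    \<comment> \<open>A nonzero term would force i + c <= a1 and j + c <= b1. The position is not
      exceptional, so j + c <= a1, and then the factor y k (j + c) vanishes by
      compatibility.\<close>
    have zero_left: "x (i + c) k * y k (j + c) = 0" if "k \<le> c" for k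
    proof (rule ccontr)
      assume "x (i + c) k * y k (j + c) \<noteq> 0"
      then have nz: "x (i + c) k \<noteq> 0" "y k (j + c) \<noteq> 0" by auto
      have k1: "1 \<le> k" using rangeD[OF x nz(1)] by simp
      have "i + c \<le> a1" using support(1)[OF x nz(1)] that ca by linarith
      moreover have "j + c \<le> b1" using support(2)[OF y nz(2)] that ca ae e by linarith
      ultimately have "j + c \<le> a1" using False by (simp add: exceptional_def)
      then show False using compatibleD(1)[OF C(2) k1 that, of "j + c"] ij nz(2) by simp
    qed
    have zero_right: "x (i + c) k * y k (j + c) = 0" if "N - c < k" for k
    proof (rule ccontr)
      assume "x (i + c) k * y k (j + c) \<noteq> 0"
      then have nz: "x (i + c) k \<noteq> 0" "y k (j + c) \<noteq> 0" by auto
      have "N < i + c + b1" using support(4)[OF x nz(1)] that ca ae e by linarith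
      moreover have "N < j + c + a1" using support(3)[OF y nz(2)] that ca by linarith
      ultimately show False using ij bounds by linarith
    qed
    \<comment> \<open>If one of the two positions is exceptional or a mirror of such, the other
      factor vanishes, so \<open>rho\<close> may be replaced by the plain entries
      throughout.\<close>
    have "rho x i k * rho y k j = x (i + c) (k + c) * y (k + c) (j + c)" if k: "k \<in> {1..N'}" for k
    proof -
      have rk: "1 \<le> k" "k \<le> N'" using k by auto
      note X = rho_simps[OF r(1,2) rk, of x] and Y = rho_simps[OF rk r(3,4), of y]
      consider (a) "exceptional i k" | (b) "mirror_exceptional i k" | (c) "exceptional k j" | (d) "mirror_exceptional k j"
        | (e) "\<not> exceptional i k" "\<not> mirror_exceptional i k" "\<not> exceptional k j" "\<not> mirror_exceptional k j" by blast
      then show ?thesis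
      proof cases
        case a
        then have t: "i + c \<le> a1" "a1 < k + c" "k + c \<le> b1" by (auto simp: exceptional_def)
        have "y (k + c) (j + c) = 0"
        proof (rule ccontr)
          assume nz: "y (k + c) (j + c) \<noteq> 0"
          have "j + c \<le> b1" by (rule support(2)[OF y nz t(3)])
          moreover have "\<not> j + c \<le> a1" using support(1)[OF y nz] t by linarith
          ultimately show False using False t by (simp add: exceptional_def)
        qed
        moreover have "\<not> exceptional k j" "\<not> mirror_exceptional k j"
          unfolding exceptional_def mirror_exceptional_def using t bounds by linarith+
        ultimately show ?thesis using Y(3) by simp
      next
        case b
        then have t: "N < k + c + a1" "i + c + a1 \<le> N" "N < i + c + b1" by (auto simp: mirror_exceptional_def)
        have "y (k + c) (j + c) = 0"
          using support(3)[OF y, of "k + c" "j + c"] t ij bounds by fastforce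
        moreover have "\<not> exceptional k j" "\<not> mirror_exceptional k j"
          unfolding exceptional_def mirror_exceptional_def using t bounds ij by linarith+
        ultimately show ?thesis using Y(3) by simp
      next
        case c
        then have t: "k + c \<le> a1" "a1 < j + c" "j + c \<le> b1" by (auto simp: exceptional_def)
        have ni: "\<not> i + c \<le> a1" using False t by (simp add: exceptional_def)
        then have "x (i + c) (k + c) = 0" using support(1)[OF x, of "i + c" "k + c"] t by blast
        moreover have "\<not> exceptional i k" "\<not> mirror_exceptional i k"
          unfolding exceptional_def mirror_exceptional_def using t ni bounds by linarith+
        ultimately show ?thesis using X(3) by simp
      next
        case d
        then have t: "N < j + c + a1" "k + c + a1 \<le> N" "N < k + c + b1" by (auto simp: mirror_exceptional_def)
        have "x (i + c) (k + c) = 0"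
          using support(4)[OF x, of "i + c" "k + c"] t ij bounds by fastforce
        moreover have "\<not> exceptional i k" "\<not> mirror_exceptional i k"
          unfolding exceptional_def mirror_exceptional_def using t bounds ij by linarith+
        ultimately show ?thesis using X(3) by simp
      next
        case e
        then show ?thesis using X(3) Y(3) by simp
      qed
    qed
    then have "(\<Sum>k=1..N'. rho x i k * rho y k j) = (\<Sum>k=1..N'. x (i + c) (k + c) * y (k + c) (j + c))"
      by (rule sum.cong[OF refl])
    also have "\<dots> = (\<Sum>k=c + 1..N - c. x (i + c) k * y k (j + c))" by (rule shift)
    also have "\<dots> = (\<Sum>k=1..N. x (i + c) k * y k (j + c))"
    proof (rule sum.mono_neutral_left)
      show "\<forall>k\<in>{1..N} - {c + 1..N - c}. x (i + c) k * y k (j + c) = 0"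
      proof
        fix k assume "k \<in> {1..N} - {c + 1..N - c}"
        then have "k \<le> c \<or> N - c < k" by auto
        then show "x (i + c) k * y k (j + c) = 0" using zero_left zero_right by blast
      qed
    qed auto
    finally show ?thesis using False by simp
  qed
  have "rho (bracket N x y) i j = (if exceptional i j then bracket N x y (i + c) (j + c - a1) else bracket N x y (i + c) (j + c))"
    using rho_simps(1)[OF r, of "bracket N x y"] rho_simps(3)[OF r _ nm, of "bracket N x y"] by simp
  then show "rho (bracket N x y) i j = bracket N' (rho x) (rho y) i j"
    unfolding bracket_apply main[OF x y C] main[OF y x C(2,1)] by simp
qed

lemma rho_onto:
  assumes x': "x' \<in> incidence N' R'"
  shows "\<exists>x\<in>{x \<in> q. compatible x}. rho x = x'"
proof -
  have so': "x' \<in> so N'" and R': "\<And>i j. x' i j \<noteq> 0 \<Longrightarrow> R' i j" using x' by (auto simp: incidence_def)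
  \<comment> \<open>\<open>M\<close> holds the entries of x' at ordinary positions. \<open>L\<close>
    fills the columns 1..c: the corner is copied from e, and exceptional entries are moved back.
    Positions belonging to \<open>V\<close> stay zero; subtracting the mirror image of
    \<open>L\<close> restores skewness.\<close>
  define M where "M i j = (if c < i \<and> i + c \<le> N \<and> c < j \<and> j + c \<le> N \<and> \<not> exceptional (i - c) (j - c) \<and>
      \<not> mirror_exceptional (i - c) (j - c) then x' (i - c) (j - c) else 0)" for i j
  define L where "L i j = (if 1 \<le> i \<and> i \<le> c \<and> 1 \<le> j \<and> j \<le> c then x' (i + e - c) (j + e - c)
      else if c < i \<and> i \<le> a1 \<and> 1 \<le> j \<and> j \<le> c then x' (i - c) (j + e - c) else 0)" for i j
  define x where "x i j = M i j + L i j - (if 1 \<le> i \<and> i \<le> N \<and> 1 \<le> j \<and> j \<le> N then L (N + 1 - j) (N + 1 - i) else 0)" for i j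
  have Lz: "L i j = 0" if "\<not> (1 \<le> i \<and> i \<le> a1 \<and> 1 \<le> j \<and> j \<le> c)" for i j using that ca by (auto simp: L_def)
  have Mz: "M i j = 0" if "\<not> (c < i \<and> i + c \<le> N \<and> c < j \<and> j + c \<le> N)" for i j using that by (auto simp: M_def)
  have Mmir: "M (N + 1 - j) (N + 1 - i) = - M i j" if r: "1 \<le> i" "i \<le> N" "1 \<le> j" "j \<le> N" for i j
  proof (cases "c < i \<and> i + c \<le> N \<and> c < j \<and> j + c \<le> N")
    case True
    then have r': "1 \<le> i - c" "i - c \<le> N'" "1 \<le> j - c" "j - c \<le> N'" using bounds by linarith+
    have ee: "N + 1 - j - c = N' + 1 - (j - c)" "N + 1 - i - c = N' + 1 - (i - c)" using True r bounds by linarith+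
    have tt: "c < N + 1 - j \<and> N + 1 - j + c \<le> N \<and> c < N + 1 - i \<and> N + 1 - i + c \<le> N" using True r by linarith
    show ?thesis
      unfolding M_def ee exceptional_mirror(1,2)[OF r'] so_mirror[OF so' r'] using True tt by auto
  next
    case False
    then have "\<not> (c < N + 1 - j \<and> N + 1 - j + c \<le> N \<and> c < N + 1 - i \<and> N + 1 - i + c \<le> N)" using r by linarith
    then show ?thesis using False Mz by simp
  qed
  have so: "x \<in> so N" unfolding so_iff
  proof (intro conjI allI impI ballI)
    fix i j assume nz: "x i j \<noteq> 0"
    have "1 \<le> i \<and> i \<le> N \<and> 1 \<le> j \<and> j \<le> N"
    proof (rule ccontr)
      assume n: "\<not> ?thesis"
      have "M i j = 0" "L i j = 0" using n Mz[of i j] Lz[of i j] bounds by (force, force)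
      then have "x i j = 0" unfolding x_def by (simp only: n if_False add_0_left diff_self)
      then show False using nz by contradiction
    qed
    then show "i \<in> {1..N}" "j \<in> {1..N}" by auto
  next
    fix i j assume "i \<in> {1..N}" "j \<in> {1..N}"
    then have r: "1 \<le> i" "i \<le> N" "1 \<le> j" "j \<le> N" by auto
    have r': "1 \<le> N + 1 - j" "N + 1 - j \<le> N" "1 \<le> N + 1 - i" "N + 1 - i \<le> N" "N + 1 - (N + 1 - i) = i" "N + 1 - (N + 1 - j) = j"
      using r by linarith+
    show "x (N + 1 - j) (N + 1 - i) = - x i j"
      unfolding x_def Mmir[OF r] r'(5,6) using r r' by simp
  qed
  have nonzero: "M i j \<noteq> 0 \<or> L i j \<noteq> 0" if h: "i + j \<le> N" "x i j \<noteq> 0" for i j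
  proof -
    have "L (N + 1 - j) (N + 1 - i) = 0" using h(1) bounds by (intro Lz) linarith
    then show ?thesis using h(2) unfolding x_def by (auto split: if_splits)
  qed
  have left: "x i j = M i j + L i j" if "i + j \<le> N" for i j
  proof -
    have "L (N + 1 - j) (N + 1 - i) = 0" using that bounds by (intro Lz) linarith
    then show ?thesis unfolding x_def by simp
  qed
  have lev_half: "lev N (a1 # as) i \<le> lev N (a1 # as) j \<and> lev N (b1 # bs) j \<le> lev N (b1 # bs) i"
    if h: "i + j \<le> N" "x i j \<noteq> 0" for i j
    using nonzero[OF h]
  proof
    assume nz: "M i j \<noteq> 0"
    then have t: "c < i" "i + c \<le> N" "c < j" "j + c \<le> N" using Mz by blast+
    then have r': "1 \<le> i - c" "i - c \<le> N'" "1 \<le> j - c" "j - c \<le> N'" using bounds by linarith+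
    have "x' (i - c) (j - c) \<noteq> 0"
    proof
      assume "x' (i - c) (j - c) = 0"
      then have "M i j = 0" by (simp add: M_def)
      then show False using nz by contradiction
    qed
    from R'[OF this] show ?thesis unfolding R'_iff[OF r'] using t by simp
  next
    assume "L i j \<noteq> 0"
    then have t: "i \<le> a1" "j \<le> a1" using Lz[of i j] ca by force+
    then show ?thesis using lev_Cons_first[of i a1] lev_Cons_first[of j a1] lev_Cons_first[of i b1] lev_Cons_first[of j b1] ae e by simp
  qed
  have xq: "x \<in> q" unfolding sw_def incidence_def
  proof (intro CollectI conjI[OF so] allI impI)
    fix i j assume nz: "x i j \<noteq> 0"
    have r: "1 \<le> i" "i \<le> N" "1 \<le> j" "j \<le> N" using so_support[OF so nz] by auto
    consider "i + j \<le> N" | "j = N + 1 - i" | "(N + 1 - j) + (N + 1 - i) \<le> N" using r by linarith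
    then show "lev N (a1 # as) i \<le> lev N (a1 # as) j \<and> lev N (b1 # bs) j \<le> lev N (b1 # bs) i"
    proof cases
      case 1 then show ?thesis using lev_half nz by blast
    next
      case 2 then show ?thesis using so_antidiagonal[OF so, of i] nz by simp
    next
      case 3
      have "x (N + 1 - j) (N + 1 - i) \<noteq> 0" using so_mirror[OF so r] nz by simp
      from lev_half[OF 3 this] have l: "lev N (a1 # as) (N + 1 - j) \<le> lev N (a1 # as) (N + 1 - i)"
        "lev N (b1 # bs) (N + 1 - i) \<le> lev N (b1 # bs) (N + 1 - j)" by auto
      have m: "lev N d (N + 1 - k) = - lev N d k" if "sum_list d \<le> n" "1 \<le> k" "k \<le> N" for d k
        using that by (intro lev_mirror) linarith+
      have ab: "sum_list (a1 # as) \<le> n" "sum_list (b1 # bs) \<le> n" using a b by auto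
      show ?thesis
        using l unfolding m[OF ab(1) r(1,2)] m[OF ab(1) r(3,4)] m[OF ab(2) r(1,2)] m[OF ab(2) r(3,4)] by simp
    qed
  qed
  have C: "compatible x" unfolding compatible_def
  proof (intro conjI allI impI; elim conjE)
    fix i k assume h: "1 \<le> i" "i \<le> c" "c < k" "k \<le> a1"
    have "M i k = 0" "L i k = 0" using h Mz[of i k] Lz[of i k] by auto
    then show "x i k = 0" using left[of i k] h bounds by simp
  next
    fix i k assume h: "a1 < k" "k \<le> b1" "1 \<le> i" "i \<le> c"
    have l: "x k (i + e) = M k (i + e)" using left[of k "i + e"] Lz[of k "i + e"] h bounds e by simp
    have ne: "\<not> exceptional (k - c) (i + e - c)" "\<not> mirror_exceptional (k - c) (i + e - c)"
      unfolding exceptional_def mirror_exceptional_def using h bounds e ca ae by linarith+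
    have M: "M k (i + e) = x' (k - c) (i + e - c)" unfolding M_def using h bounds e ca ae ne by simp
    show "x k (i + e) = (if e < k then x (k - e) i else 0)"
    proof (cases "e < k")
      case True
      then have k: "1 \<le> k - e" "k - e \<le> c" "k - e + e - c = k - c" using h e by linarith+
      have "M (k - e) i = 0" using h Mz[of "k - e" i] by auto
      moreover have "L (k - e) i = x' (k - c) (i + e - c)" unfolding L_def using k h by simp
      moreover have "k - e + i \<le> N" using k h bounds by linarith
      ultimately have "x (k - e) i = x' (k - c) (i + e - c)" using left[of "k - e" i] by simp
      then show ?thesis using True l M by simp
    next
      case False
      have r': "1 \<le> k - c" "k - c \<le> N'" "1 \<le> i + e - c" "i + e - c \<le> N'" using h bounds e ca ae by linarith+
      have "x' (k - c) (i + e - c) = 0"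
      proof (rule ccontr)
        assume "x' (k - c) (i + e - c) \<noteq> 0"
        from R'[OF this] show False unfolding R'_iff[OF r'] using h False e ca ae by simp
      qed
      then show ?thesis using False l M by simp
    qed
  qed
  have "rho x = x'"
  proof (rule so_eqI[OF rho_so[OF so] so'])
    fix i j :: nat assume ij: "1 \<le> i" "1 \<le> j" "i + j \<le> N'"
    then have r: "1 \<le> i" "i \<le> N'" "1 \<le> j" "j \<le> N'" by linarith+
    have nm: "\<not> mirror_exceptional i j" unfolding mirror_exceptional_def using ij bounds e by linarith
    show "rho x i j = x' i j"
    proof (cases "exceptional i j")
      case True
      then have t: "i + c \<le> a1" "a1 < j + c" "j + c \<le> b1" by (auto simp: exceptional_def)
      then have ea: "e = a1" using alt ij by linarith
      have J: "1 \<le> j + c - a1" "j + c - a1 \<le> c" "i + c + (j + c - a1) \<le> N" "j + c - a1 + a1 - c = j" using t ea e ij bounds by linarith+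
      have "M (i + c) (j + c - a1) = 0" using J Mz[of "i + c" "j + c - a1"] by auto
      moreover have "L (i + c) (j + c - a1) = x' i j" unfolding L_def ea J(4) using J t ij by simp
      ultimately show ?thesis using rho_simps(1)[OF r True, of x] left[OF J(3)] by simp
    next
      case False
      have "i + c + (j + c) \<le> N" using ij bounds by linarith
      then have "x (i + c) (j + c) = M (i + c) (j + c) + L (i + c) (j + c)" by (rule left)
      moreover have "L (i + c) (j + c) = 0" using ij by (intro Lz) linarith
      moreover have "M (i + c) (j + c) = x' i j" unfolding M_def using False nm ij bounds by simp
      ultimately show ?thesis using rho_simps(3)[OF r False nm, of x] by simp
    qed
  qed
  then show ?thesis using xq C by blast
qed

lemma V_ideal:
  assumes x: "x \<in> q" and v: "v \<in> V"
  shows "bracket N x v \<in> V"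
proof -
  have vq: "v \<in> q" using v by (simp add: V_def)
  have vs: "k \<le> a1 \<and> a1 < j \<or> N < j + a1 \<and> k + a1 \<le> N" if nz: "v k j \<noteq> 0" for k j
  proof -
    have r: "1 \<le> k" "k \<le> N" "1 \<le> j" "j \<le> N" using rangeD[OF vq nz] by auto
    consider "k + j \<le> N" | "j = N + 1 - k" | "(N + 1 - j) + (N + 1 - k) \<le> N" using r by linarith
    then show ?thesis
    proof cases
      case 1 then show ?thesis using V_zero[OF v] nz by (meson not_le)
    next
      case 2 then show ?thesis using so_antidiagonal[OF sw_so[OF vq], of k] nz by simp
    next
      case 3
      have "v (N + 1 - j) (N + 1 - k) \<noteq> 0" using so_mirror[OF sw_so[OF vq] r] nz by simp
      then have "N + 1 - j \<le> a1" "a1 < N + 1 - k" using V_zero[OF v 3] by (meson not_le)+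
      then show ?thesis using r by linarith
    qed
  qed
  have "i \<le> a1 \<and> a1 < j" if h: "i + j \<le> N" "bracket N x v i j \<noteq> 0" for i j
  proof -
    have "(\<exists>k. x i k * v k j \<noteq> 0) \<or> (\<exists>k. v i k * x k j \<noteq> 0)"
    proof (rule ccontr)
      assume "\<not> ?thesis"
      then have "bracket N x v i j = 0" unfolding bracket_apply by (simp only: not_ex not_not de_Morgan_disj sum.neutral_const diff_self)
      then show False using h(2) by simp
    qed
    then show ?thesis
    proof (elim disjE exE)
      fix k assume "x i k * v k j \<noteq> 0"
      then have nz: "x i k \<noteq> 0" "v k j \<noteq> 0" by auto
      from vs[OF nz(2)] show ?thesis
      proof
        assume "k \<le> a1 \<and> a1 < j" then show ?thesis using support(1)[OF x nz(1)] by blast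
      next
        assume k: "N < j + a1 \<and> k + a1 \<le> N"
        have "N < k + b1" using support(4)[OF vq nz(2)] k ae e by linarith
        then have "N < i + b1" by (rule support(4)[OF x nz(1)])
        then show ?thesis using h(1) k bounds by linarith
      qed
    next
      fix k assume "v i k * x k j \<noteq> 0"
      then have nz: "v i k \<noteq> 0" "x k j \<noteq> 0" by auto
      from vs[OF nz(1)] show ?thesis
      proof
        assume "i \<le> a1 \<and> a1 < k" then show ?thesis using support(1)[OF x nz(2)] by force
      next
        assume k: "N < k + a1 \<and> i + a1 \<le> N"
        have "N < j + a1" using support(3)[OF x nz(2)] k by blast
        moreover have "N < i + b1" using support(4)[OF vq nz(1)] k ae e by linarith
        ultimately show ?thesis using h(1) bounds by linarith
      qed
    qed
  qed
  then show ?thesis unfolding V_def using bracket_closed[OF x vq] by blast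
qed

lemma subspace_V: "mat_vs.subspace V"
proof -
  have eq: "V = q \<inter> {x. \<forall>i j. i + j \<le> N \<and> \<not> (i \<le> a1 \<and> a1 < j) \<longrightarrow> x i j = 0}" unfolding V_def by blast
  have "mat_vs.subspace {x :: 'a matrix. \<forall>i j. i + j \<le> N \<and> \<not> (i \<le> a1 \<and> a1 < j) \<longrightarrow> x i j = 0}"
    unfolding mat_vs.subspace_def mscale_def by simp
  then show ?thesis unfolding eq by (rule mat_vs.subspace_inter[OF subspace])
qed

theorem has_slice_step:
  assumes "has_slice N' (incidence N' R' :: 'k::field_char_0 matrix set) K"
  shows "has_slice N (q :: 'k matrix set) K"
proof (rule has_slice_reduction[where V = V and \<xi> = xi and \<rho> = rho and N' = N' and q' = "incidence N' R'",
      OF subspace_V _ V_ideal _ _ _ rho_V centraliser_eq_compatible[symmetric] _ rho_onto _ _ V_nondegenerate _ assms])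
  show "V \<subseteq> (q :: 'k matrix set)" by (auto simp: V_def)
  show "xi \<in> linear_forms (UNIV :: 'k matrix set)"
    by (simp add: linear_forms_def xi_def mscale_def sum.distrib sum_distrib_left)
  show "rho (x + y) = rho x + rho y" "rho (mscale c x) = mscale c (rho x)" for x y :: "'k matrix" and c
    by (simp_all add: fun_eq_iff rho_def mscale_def)
  fix x y :: "'k matrix" assume "x \<in> {x \<in> q. compatible x}"
  then have x: "x \<in> q" "compatible x" by auto
  show "rho x \<in> incidence N' R'" by (rule rho_in_target[OF x])
  show "rho x = 0 \<Longrightarrow> x \<in> V" by (rule rho_injective_mod_V[OF x])
  assume "y \<in> {x \<in> q. compatible x}"
  then have y: "y \<in> q" "compatible y" by auto
  show "xi (bracket N x y) = 0" by (rule xi_bracket_compatible[OF x(1) y(1) x(2) y(2)])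
  show "rho (bracket N x y) = bracket N' (rho x) (rho y)" by (rule rho_bracket[OF x(1) y(1) x(2) y(2)])
qed

end

text \<open>The case c = a1, e = b1 - a1: deleting a1 indices removes the first block of a, and the
  rest of the first block of b is cut at e into parts of size b1 - 2 a1 and a1.\<close>

lemma has_slice_step_long:
  assumes "a1 + sum_list as \<le> n" "b1 + sum_list bs \<le> n" "2 * a1 \<le> b1"
    and slice: "has_slice (2 * (n - a1) + 1) (sw (n - a1) as ((b1 - 2 * a1) # a1 # bs) :: 'k::field_char_0 matrix set) K"
  shows "has_slice (2 * n + 1) (sw n (a1 # as) (b1 # bs) :: 'k matrix set) K"
proof -
  let ?N = "2 * n + 1" and ?N' = "2 * (n - a1) + 1" and ?b = "(b1 - 2 * a1) # a1 # bs"
  define R' where "R' i j \<longleftrightarrow> lev ?N' as i \<le> lev ?N' as j \<and> lev ?N' ?b j \<le> lev ?N' ?b i" for i j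
  have "reduction_step n a1 b1 a1 (b1 - a1) as bs R'"
  proof
    fix i j assume ij: "1 \<le> i" "i \<le> ?N'" "1 \<le> j" "j \<le> ?N'"
    have N: "?N - 2 * a1 = ?N'" using assms by simp
    have A: "lev ?N (a1 # as) (k + a1) = lev ?N' as k" if "1 \<le> k" "k \<le> ?N'" for k
    proof -
      have "\<not> k + a1 \<le> a1" "\<not> ?N < k + a1 + a1" using that assms by linarith+
      then show ?thesis unfolding lev.simps N by simp
    qed
    define L where "L = int (length bs)"
    define m where "m k = lev (?N - 2 * b1) bs (k + a1 - b1)" for k
    have mb: "- L \<le> m k" "m k \<le> L" for k unfolding m_def L_def by (rule lev_bounds)+
    have B: "lev ?N (b1 # bs) (k + a1) = (if k + a1 \<le> b1 then - (1 + L) else if ?N < k + a1 + b1 then 1 + L else m k)"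
      if "1 \<le> k" "k \<le> ?N'" for k
      unfolding lev.simps m_def L_def by simp
    have B': "lev ?N' ?b k = (if k + 2 * a1 \<le> b1 then - (2 + L) else if k + a1 \<le> b1 then - (1 + L)
        else if ?N < k + b1 then 2 + L else if ?N < k + a1 + b1 then 1 + L else m k)"
      if k: "1 \<le> k" "k \<le> ?N'" for k
    proof -
      have c: "k \<le> b1 - 2 * a1 \<longleftrightarrow> k + 2 * a1 \<le> b1" "k + (b1 - 2 * a1) > ?N' \<longleftrightarrow> ?N < k + b1"
        using assms k by linarith+
      have d: "k - (b1 - 2 * a1) \<le> a1 \<longleftrightarrow> k + a1 \<le> b1" 
        "k - (b1 - 2 * a1) + a1 > ?N' - 2 * (b1 - 2 * a1) \<longleftrightarrow> ?N < k + a1 + b1"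
        if "\<not> k + 2 * a1 \<le> b1"
        using assms k that by linarith+
      have e: "?N' - 2 * (b1 - 2 * a1) - 2 * a1 = ?N - 2 * b1" "k - (b1 - 2 * a1) - a1 = k + a1 - b1"
        using assms k by linarith+
      have nc: "\<not> ?N < k + b1" if "k + a1 \<le> b1" using that assms by linarith
      show ?thesis
        unfolding lev.simps(2)[of ?N'] c lev.simps(2)[of _ a1] e m_def L_def using d nc by simp
    qed
    show "R' i j \<longleftrightarrow> lev ?N (a1 # as) (i + a1) \<le> lev ?N (a1 # as) (j + a1) \<and>
        lev ?N (b1 # bs) (j + a1) \<le> lev ?N (b1 # bs) (i + a1) \<and>
        \<not> (a1 < i + a1 \<and> i + a1 \<le> b1 - a1 \<and> b1 - a1 < j + a1 \<and> j + a1 \<le> b1) \<and>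
        \<not> (2 * n + 1 < i + a1 + b1 \<and> i + a1 + (b1 - a1) \<le> 2 * n + 1 \<and> 2 * n + 1 < j + a1 + (b1 - a1) \<and> j + a1 + a1 \<le> 2 * n + 1)"
      unfolding R'_def A[OF ij(1,2)] A[OF ij(3,4)] B[OF ij(1,2)] B[OF ij(3,4)] B'[OF ij(1,2)] B'[OF ij(3,4)]
      using mb[of i] mb[of j] assms ij by (auto split: if_splits)
  qed (use assms in auto)
  from reduction_step.has_slice_step[OF this, of K]
  show ?thesis using slice unfolding sw_def R'_def .
qed

text \<open>The case e = a1, c = b1 - a1: the excluded rectangles in \<open>R'_iff\<close> are
  empty, and both first blocks simply become shorter by c.\<close>

lemma has_slice_step_short:
  assumes "a1 + sum_list as \<le> n" "b1 + sum_list bs \<le> n" "a1 \<le> b1" "b1 \<le> 2 * a1"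
    and slice: "has_slice (2 * (n - (b1 - a1)) + 1) (sw (n - (b1 - a1)) ((2 * a1 - b1) # as) (a1 # bs) :: 'k::field_char_0 matrix set) K"
  shows "has_slice (2 * n + 1) (sw n (a1 # as) (b1 # bs) :: 'k matrix set) K"
proof -
  define c where "c = b1 - a1"
  have c: "b1 = a1 + c" "c \<le> a1" "2 * a1 - b1 = a1 - c" "b1 - a1 = c" using assms by (auto simp: c_def)
  let ?N = "2 * n + 1" and ?N' = "2 * (n - c) + 1" and ?a = "(a1 - c) # as" and ?b = "a1 # bs"
  define R' where "R' i j \<longleftrightarrow> lev ?N' ?a i \<le> lev ?N' ?a j \<and> lev ?N' ?b j \<le> lev ?N' ?b i" for i j
  have "reduction_step n a1 b1 c a1 as bs R'"
  proof
    fix i j assume ij: "1 \<le> i" "i \<le> ?N'" "1 \<le> j" "j \<le> ?N'"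
    have L: "lev ?N ((x + c) # xs) (k + c) = lev ?N' (x # xs) k" if k: "1 \<le> k" "k \<le> ?N'" and x: "x + c \<le> n" for x xs k
    proof -
      have "k + c \<le> x + c \<longleftrightarrow> k \<le> x" "?N < k + c + (x + c) \<longleftrightarrow> ?N' < k + x" "?N - 2 * (x + c) = ?N' - 2 * x"
        "k + c - (x + c) = k - x"
        using k x by (linarith, linarith, auto)
      then show ?thesis unfolding lev.simps by simp
    qed
    have A: "lev ?N (a1 # as) (k + c) = lev ?N' ?a k" and B: "lev ?N (b1 # bs) (k + c) = lev ?N' ?b k"
      if k: "1 \<le> k" "k \<le> ?N'" for k
      using L[OF k, of "a1 - c" as] L[OF k, of a1 bs] c assms(1,2) by simp_all
    have f: "\<not> (a1 < i + c \<and> i + c \<le> a1 \<and> a1 < j + c \<and> j + c \<le> b1)"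
      "\<not> (2 * n + 1 < i + c + b1 \<and> i + c + a1 \<le> 2 * n + 1 \<and> 2 * n + 1 < j + c + a1 \<and> j + c + a1 \<le> 2 * n + 1)"
      by linarith+
    show "R' i j \<longleftrightarrow> lev ?N (a1 # as) (i + c) \<le> lev ?N (a1 # as) (j + c) \<and>
        lev ?N (b1 # bs) (j + c) \<le> lev ?N (b1 # bs) (i + c) \<and>
        \<not> (a1 < i + c \<and> i + c \<le> a1 \<and> a1 < j + c \<and> j + c \<le> b1) \<and>
        \<not> (2 * n + 1 < i + c + b1 \<and> i + c + a1 \<le> 2 * n + 1 \<and> 2 * n + 1 < j + c + a1 \<and> j + c + a1 \<le> 2 * n + 1)"
      unfolding R'_def A[OF ij(1,2)] A[OF ij(3,4)] B[OF ij(1,2)] B[OF ij(3,4)] using f by blast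
  qed (use assms c in auto)
  note red = this
  have "sw (n - (b1 - a1)) ((2 * a1 - b1) # as) (a1 # bs) = (incidence ?N' R' :: 'k matrix set)"
    unfolding c(3,4) sw_def R'_def ..
  note s = slice[unfolded this, unfolded c(4)]
  show ?thesis by (rule reduction_step.has_slice_step[OF red s])
qed

text \<open>The algebra is the direct sum of gl_m and the smaller seaweed. On gl_m the diagonal form
  with coefficients 1, ..., m is regular; diagonal matrices stabilise its whole family and are
  separated by their entries. The condition \<open>0 \<notin> K'\<close> keeps the shifted copy of
  \<open>K'\<close> disjoint from \<open>{1..m}\<close>.\<close>

lemma has_slice_equal_heads:
  assumes as: "m + sum_list as \<le> n" and bs: "m + sum_list bs \<le> n"
    and K': "finite K'" "0 \<notin> K'"
    and slice: "has_slice (2 * (n - m) + 1) (sw (n - m) as bs :: 'k::field_char_0 matrix set) K'"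
  shows "has_slice (2 * n + 1) (sw n (m # as) (m # bs) :: 'k matrix set) ({1..m} \<union> (\<lambda>k. k + m) ` K')"
proof -
  define N N' where NN: "N = 2 * n + 1" "N' = 2 * (n - m) + 1"
  let ?q = "sw n (m # as) (m # bs) :: 'k matrix set" and ?q' = "sw (n - m) as bs :: 'k matrix set"
  have mn: "m \<le> n" "N' + 2 * m = N" using as by (auto simp: NN)
  interpret matrix_lie_algebra N ?q unfolding NN by (rule matrix_lie_algebra_sw)
  note support = sw_Cons_support[where n = n, OF _ _ mn(1) mn(1), folded NN]
  note in_so = sw_so[where n = n, folded NN] sw_so[where n = "n - m", folded NN]
  note in_sw = so_unit_in_sw[where n = n, folded NN]
  note in_support = sw_support[where n = n, folded NN] sw_support[where n = "n - m", folded NN]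
  have mem: "x \<in> ?q \<longleftrightarrow> x \<in> so N \<and> (\<forall>i j. x i j \<noteq> 0 \<longrightarrow> lev N (m # as) i \<le> lev N (m # as) j \<and> lev N (m # bs) j \<le> lev N (m # bs) i)"
    "x \<in> ?q' \<longleftrightarrow> x \<in> so N' \<and> (\<forall>i j. x i j \<noteq> 0 \<longrightarrow> lev N' as i \<le> lev N' as j \<and> lev N' bs j \<le> lev N' bs i)" for x
    by (simp_all only: sw_def incidence_def NN mem_Collect_eq)
  obtain f' g' where f': "f' \<in> linear_forms UNIV" and g'0: "\<forall>k\<in>K'. g' k \<in> linear_forms UNIV"
    and X'0: "\<forall>c. \<exists>X. (\<forall>k\<in>K'. X k \<in> stabiliser N' ?q' (\<lambda>x. f' x + (\<Sum>k\<in>K'. c k * g' k x))) \<and> independent_family K' X"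
    and z': "\<forall>x\<in>stabiliser N' ?q' f'. (\<forall>k\<in>K'. g' k x = 0) \<longrightarrow> x = 0"
    by (rule has_sliceE[OF slice[folded NN]])
  note g' = bspec[OF g'0]
  define \<sigma> :: "'k matrix \<Rightarrow> 'k matrix" where
    "\<sigma> x = (\<lambda>i j. if 1 \<le> i \<and> i \<le> N' \<and> 1 \<le> j \<and> j \<le> N' then x (i + m) (j + m) else 0)" for x
  define lift :: "'k matrix \<Rightarrow> 'k matrix" where
    "lift x = (\<lambda>i j. if m < i \<and> i + m \<le> N \<and> m < j \<and> j + m \<le> N then x (i - m) (j - m) else 0)" for x
  define f where "f x = f' (\<sigma> x) + (\<Sum>i=1..m. of_nat i * x i i)" for x
  define g where "g k x = (if k \<le> m then x k k else g' (k - m) (\<sigma> x))" for k x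
  define K where "K = {1..m} \<union> (\<lambda>k. k + m) ` K'"
  have sig_add: "\<sigma> (x + y) = \<sigma> x + \<sigma> y" "\<sigma> (mscale d x) = mscale d (\<sigma> x)" for x y d
    by (auto simp: \<sigma>_def mscale_def fun_eq_iff)
  have sig0: "\<sigma> 0 = 0" by (auto simp: \<sigma>_def fun_eq_iff)
  have fl: "f \<in> linear_forms UNIV"
  proof -
    have "(\<lambda>x. f' (\<sigma> x)) \<in> linear_forms UNIV" using linear_formsD[OF f'] by (simp add: linear_forms_def sig_add)
    from linear_formsD[OF this] show ?thesis
      unfolding linear_forms_def f_def by (simp add: sum.distrib distrib_left sum_distrib_left) (simp add: mscale_def mult.left_commute)
  qed
  have gl: "g k \<in> linear_forms UNIV" if "k \<in> K" for k
  proof (cases "k \<le> m")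
    case True
    then show ?thesis by (simp add: linear_forms_def g_def mscale_def)
  next
    case False
    then have "k - m \<in> K'" using that by (auto simp: K_def)
    then show ?thesis using False linear_formsD[OF g'] by (simp add: linear_forms_def g_def sig_add)
  qed
  have lev_shift: "lev N (m # xs) (k + m) = lev N' xs k" if "1 \<le> k" "k \<le> N'" for xs k
  proof -
    have "\<not> k + m \<le> m" "\<not> N < k + m + m" "N - 2 * m = N'" using that mn by linarith+
    then show ?thesis by simp
  qed
  have sigq: "\<sigma> x \<in> ?q'" if x: "x \<in> ?q" for x
  proof -
    have so: "x \<in> so N" by (rule in_so(1)[OF x])
    have "\<sigma> x \<in> so N'" unfolding so_iff
    proof (intro conjI allI impI ballI)
      fix i j assume ij: "i \<in> {1..N'}" "j \<in> {1..N'}"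
      have e: "N' + 1 - j + m = N + 1 - (j + m)" "N' + 1 - i + m = N + 1 - (i + m)" using ij mn by auto
      have r: "1 \<le> N' + 1 - j" "N' + 1 - j \<le> N'" "1 \<le> N' + 1 - i" "N' + 1 - i \<le> N'" using ij by auto
      have "x (N + 1 - (j + m)) (N + 1 - (i + m)) = - x (i + m) (j + m)"
        using ij mn by (intro so_mirror[OF so]) auto
      then show "\<sigma> x (N' + 1 - j) (N' + 1 - i) = - \<sigma> x i j"
        unfolding \<sigma>_def e using ij r by simp
    qed (auto simp: \<sigma>_def split: if_splits)
    moreover have "lev N' as i \<le> lev N' as j \<and> lev N' bs j \<le> lev N' bs i" if nz: "\<sigma> x i j \<noteq> 0" for i j
    proof -
      have r: "1 \<le> i" "i \<le> N'" "1 \<le> j" "j \<le> N'" and nz': "x (i + m) (j + m) \<noteq> 0"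
        using nz by (auto simp: \<sigma>_def split: if_splits)
      show ?thesis using in_support(1,2)[OF x nz'] unfolding lev_shift[OF r(1,2)] lev_shift[OF r(3,4)] by blast
    qed
    ultimately show ?thesis unfolding mem by blast
  qed
  have liftq: "lift x \<in> ?q" if x: "x \<in> ?q'" for x
  proof -
    have so: "x \<in> so N'" by (rule in_so(2)[OF x])
    have "lift x \<in> so N" unfolding so_iff
    proof (intro conjI allI impI ballI)
      fix i j assume ij: "i \<in> {1..N}" "j \<in> {1..N}"
      show "lift x (N + 1 - j) (N + 1 - i) = - lift x i j"
      proof (cases "m < i \<and> i + m \<le> N \<and> m < j \<and> j + m \<le> N")
        case True
        have e: "N + 1 - j - m = N' + 1 - (j - m)" "N + 1 - i - m = N' + 1 - (i - m)" using True mn by linarith+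
        have "x (N' + 1 - (j - m)) (N' + 1 - (i - m)) = - x (i - m) (j - m)"
          using True mn by (intro so_mirror[OF so]) linarith+
        moreover have "m < N + 1 - j \<and> N + 1 - j + m \<le> N \<and> m < N + 1 - i \<and> N + 1 - i + m \<le> N"
          using True by linarith
        ultimately show ?thesis unfolding lift_def e using True by simp
      next
        case False
        then have "\<not> (m < N + 1 - j \<and> N + 1 - j + m \<le> N \<and> m < N + 1 - i \<and> N + 1 - i + m \<le> N)"
          using ij by auto
        then show ?thesis unfolding lift_def by (simp only: False if_False minus_zero)
      qed
    qed (auto simp: lift_def split: if_splits)
    moreover have "lev N (m # as) i \<le> lev N (m # as) j \<and> lev N (m # bs) j \<le> lev N (m # bs) i"
      if nz: "lift x i j \<noteq> 0" for i j
    proof -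
      have t: "m < i" "i + m \<le> N" "m < j" "j + m \<le> N" and nz': "x (i - m) (j - m) \<noteq> 0"
        using nz by (auto simp: lift_def split: if_splits)
      then have r: "1 \<le> i - m" "i - m \<le> N'" "1 \<le> j - m" "j - m \<le> N'" using mn by linarith+
      have e: "i - m + m = i" "j - m + m = j" using t by auto
      show ?thesis
        using in_support(3,4)[OF x nz'] lev_shift[OF r(1,2)] lev_shift[OF r(3,4)] unfolding e by (simp only:)
    qed
    ultimately show ?thesis unfolding mem by blast
  qed
  have siglift: "\<sigma> (lift x) = x" if "x \<in> ?q'" for x
  proof (intro ext)
    fix i j show "\<sigma> (lift x) i j = x i j"
    proof (cases "1 \<le> i \<and> i \<le> N' \<and> 1 \<le> j \<and> j \<le> N'")
      case True
      then have "m < i + m \<and> i + m + m \<le> N \<and> m < j + m \<and> j + m + m \<le> N" using mn by linarith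
      then show ?thesis unfolding \<sigma>_def lift_def using True by simp
    next
      case False
      then have "x i j = 0" using so_support[OF in_so(2)[OF that]] by blast
      then show ?thesis unfolding \<sigma>_def by (simp only: False if_False)
    qed
  qed
  have sigbr: "\<sigma> (bracket N x y) = bracket N' (\<sigma> x) (\<sigma> y)" if x: "x \<in> ?q" and y: "y \<in> ?q" for x y
  proof (intro ext)
    fix i j
    have main: "(\<Sum>k=1..N'. \<sigma> x i k * \<sigma> y k j) = (\<Sum>k=1..N. x (i + m) k * y k (j + m))"
      if r: "1 \<le> i" "i \<le> N'" "1 \<le> j" "j \<le> N'" and x: "x \<in> ?q" for x y :: "'k matrix"
    proof -
      have "(\<Sum>k=1..N'. \<sigma> x i k * \<sigma> y k j) = (\<Sum>k=m + 1..N - m. x (i + m) k * y k (j + m))"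
        by (rule sum.reindex_bij_witness[where i = "\<lambda>k. k - m" and j = "\<lambda>k. k + m"]) (use mn r in \<open>auto simp: \<sigma>_def\<close>)
      also have "\<dots> = (\<Sum>k=1..N. x (i + m) k * y k (j + m))"
      proof (rule sum.mono_neutral_left)
        show "\<forall>k\<in>{1..N} - {m + 1..N - m}. x (i + m) k * y k (j + m) = 0"
        proof
          fix k assume "k \<in> {1..N} - {m + 1..N - m}"
          then have "k \<le> m \<or> N < k + m" by auto
          then have "x (i + m) k = 0"
            using support(1)[OF x, of "i + m" k] support(4)[OF x, of "i + m" k] r mn by (cases "x (i + m) k = 0") auto
          then show "x (i + m) k * y k (j + m) = 0" by simp
        qed
      qed auto
      finally show ?thesis .
    qed
    show "\<sigma> (bracket N x y) i j = bracket N' (\<sigma> x) (\<sigma> y) i j"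
    proof (cases "1 \<le> i \<and> i \<le> N' \<and> 1 \<le> j \<and> j \<le> N'")
      case True
      then show ?thesis using main[OF _ _ _ _ x, of y] main[OF _ _ _ _ y, of x] by (simp add: bracket_apply \<sigma>_def[of "bracket N x y"])
    next
      case False
      then have "bracket N' (\<sigma> x) (\<sigma> y) i j = 0"
        using so_support[OF bracket_so[OF in_so(2)[OF sigq[OF x]] in_so(2)[OF sigq[OF y]]]] by blast
      then show ?thesis unfolding \<sigma>_def[of "bracket N x y"] by (simp only: False if_False)
    qed
  qed
  have Ksum: "(\<Sum>k\<in>K. h k) = (\<Sum>k=1..m. h k) + (\<Sum>k\<in>K'. h (k + m))" for h :: "nat \<Rightarrow> 'a::comm_monoid_add"
  proof -
    have "{1..m} \<inter> (\<lambda>k. k + m) ` K' = {}" using K'(2) by auto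
    then have "(\<Sum>k\<in>K. h k) = (\<Sum>k=1..m. h k) + sum h ((\<lambda>k. k + m) ` K')"
      unfolding K_def using K'(1) by (intro sum.union_disjoint) auto
    also have "sum h ((\<lambda>k. k + m) ` K') = (\<Sum>k\<in>K'. h (k + m))" by (simp add: sum.reindex)
    finally show ?thesis .
  qed
  define F' where "F' c x = f' x + (\<Sum>k\<in>K'. c k * g' k x)" for c x
  have F'l: "F' c \<in> linear_forms UNIV" for c unfolding F'_def by (rule linear_forms_UNIV_sum[OF f' g'])
  have F'0: "F' c 0 = 0" for c by (rule linear_forms_zero[OF F'l mat_vs.subspace_UNIV])
  have K'pos: "0 < k" if "k \<in> K'" for k using K'(2) that by (cases k) auto
  have F: "f x + (\<Sum>k\<in>K. c k * g k x) = F' (\<lambda>k. c (k + m)) (\<sigma> x) + (\<Sum>i=1..m. (of_nat i + c i) * x i i)" for c x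
  proof -
    have "(\<Sum>k\<in>K'. c (k + m) * g (k + m) x) = (\<Sum>k\<in>K'. c (k + m) * g' k (\<sigma> x))"
      by (intro sum.cong) (auto simp: g_def dest: K'pos)
    moreover have "(\<Sum>k=1..m. c k * g k x) = (\<Sum>k=1..m. c k * x k k)" by (intro sum.cong) (auto simp: g_def)
    ultimately show ?thesis by (simp add: Ksum f_def F'_def distrib_right sum.distrib)
  qed
  have diag_lift: "bracket N (lift x) y i i = 0" "bracket N y (lift x) i i = 0" if "i \<le> m" for x y i
    using that by (simp_all add: bracket_apply lift_def)
  have slice1: "\<exists>X. (\<forall>k\<in>K. X k \<in> stabiliser N ?q (\<lambda>x. f x + (\<Sum>k\<in>K. c k * g k x))) \<and> independent_family K X" for c
  proof -
    define c' where "c' k = c (k + m)" for k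
    obtain Y where Y: "\<forall>k\<in>K'. Y k \<in> stabiliser N' ?q' (F' c')" "independent_family K' Y"
      using spec[OF X'0, of c'] unfolding F'_def by (elim exE conjE)
    define X where "X k = (if k \<le> m then so_unit N k k else lift (Y (k - m)))" for k
    have Yq: "Y k \<in> ?q'" if "k \<in> K'" for k using Y(1) that by (simp add: stabiliser_def)
    have siguni: "\<sigma> (so_unit N k k) = 0" if "1 \<le> k" "k \<le> m" for k
    proof (intro ext)
      fix i j show "\<sigma> (so_unit N k k) i j = 0 i j"
      proof (cases "1 \<le> i \<and> i \<le> N' \<and> 1 \<le> j \<and> j \<le> N'")
        case True
        have "(so_unit N k k :: 'k matrix) (i + m) (j + m) = 0"
        proof (rule ccontr)
          assume "(so_unit N k k :: 'k matrix) (i + m) (j + m) \<noteq> 0"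
          from so_unit_support[OF this] show False using True that mn by linarith
        qed
        then show ?thesis unfolding \<sigma>_def by simp
      next
        case False
        then show ?thesis unfolding \<sigma>_def by (simp only: False if_False zero_fun_apply)
      qed
    qed
    have "X k \<in> stabiliser N ?q (\<lambda>x. f x + (\<Sum>k\<in>K. c k * g k x))" if k: "k \<in> K" for k
    proof (cases "k \<le> m")
      case True
      have "k \<notin> (\<lambda>k. k + m) ` K'" using True K'(2) by auto
      then have k1: "1 \<le> k" using k by (auto simp: K_def)
      have r: "1 \<le> k" "k \<le> N" using k1 True mn by linarith+
      have u: "so_unit N k k \<in> ?q" by (rule in_sw) (use as bs r in auto)
      have "f (bracket N (so_unit N k k) y) + (\<Sum>k'\<in>K. c k' * g k' (bracket N (so_unit N k k) y)) = 0" if y: "y \<in> ?q" for y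
      proof -
        have "bracket N (so_unit N k k) y i i = 0" if "i \<in> {1..m}" for i
          unfolding bracket_apply sum_so_unit_times[OF r r] sum_times_so_unit[OF r r] using that mn True by auto
        then show ?thesis unfolding F sigbr[OF u y] siguni[OF k1 True] bracket_zero F'0 by simp
      qed
      then show ?thesis using u True by (simp add: stabiliser_def X_def)
    next
      case False
      then have k': "k - m \<in> K'" using k by (auto simp: K_def)
      have u: "lift (Y (k - m)) \<in> ?q" by (rule liftq[OF Yq[OF k']])
      have "f (bracket N (lift (Y (k - m))) y) + (\<Sum>k'\<in>K. c k' * g k' (bracket N (lift (Y (k - m))) y)) = 0" if y: "y \<in> ?q" for y
      proof -
        have "F' c' (bracket N' (Y (k - m)) (\<sigma> y)) = 0" using Y(1) k' sigq[OF y] by (simp add: stabiliser_def)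
        then show ?thesis
          unfolding F sigbr[OF u y] siglift[OF Yq[OF k']] c'_def[symmetric] by (simp add: diag_lift)
      qed
      then show ?thesis using u False by (simp add: stabiliser_def X_def)
    qed
    moreover have "independent_family K X" unfolding independent_family_def
    proof (intro allI impI)
      fix d assume d: "(\<Sum>k\<in>K. mscale (d k) (X k)) = 0"
      have unit: "so_unit N k k i i = (if i = k then 1 else 0 :: 'k)" if "1 \<le> k" "k \<le> m" "i \<le> m" for k i
        unfolding so_unit_apply using that mn by auto
      have d1: "d i = 0" if i: "1 \<le> i" "i \<le> m" for i
      proof -
        have "0 = (\<Sum>k\<in>K. mscale (d k) (X k)) i i" by (simp add: d)
        also have "\<dots> = (\<Sum>k=1..m. d k * X k i i) + (\<Sum>k\<in>K'. d (k + m) * X (k + m) i i)"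
          by (simp add: sum_matrix_apply Ksum mscale_def)
        also have "(\<Sum>k\<in>K'. d (k + m) * X (k + m) i i) = 0"
          using i K'pos by (intro sum.neutral) (auto simp: X_def lift_def)
        also have "(\<Sum>k=1..m. d k * X k i i) = (\<Sum>k=1..m. if k = i then d i else 0)"
          using i by (intro sum.cong) (auto simp: X_def unit)
        finally show ?thesis using i by simp
      qed
      have sig_sum: "\<sigma> (\<Sum>k\<in>J. mscale (e k) (Z k)) = (\<Sum>k\<in>J. mscale (e k) (\<sigma> (Z k)))" for J :: "nat set" and e Z
      proof (induction J rule: infinite_finite_induct)
        case (insert k J)
        then show ?case by (simp only: sum.insert[OF insert(1,2)] sig_add)
      qed (simp_all only: sum.infinite sum.empty not_False_eq_True sig0)
      have "0 = (\<Sum>k\<in>K. mscale (d k) (\<sigma> (X k)))" using sig_sum[of d X K] d sig0 by simp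
      also have "\<dots> = (\<Sum>k=1..m. mscale (d k) (\<sigma> (X k))) + (\<Sum>k\<in>K'. mscale (d (k + m)) (\<sigma> (X (k + m))))" by (rule Ksum)
      also have "(\<Sum>k=1..m. mscale (d k) (\<sigma> (X k))) = 0"
        using d1 by (intro sum.neutral ballI) (auto simp: mscale_def fun_eq_iff)
      also have "(\<Sum>k\<in>K'. mscale (d (k + m)) (\<sigma> (X (k + m)))) = (\<Sum>k\<in>K'. mscale (d (k + m)) (Y k))"
        using K'pos by (intro sum.cong refl arg_cong2[where f = mscale]) (auto simp: X_def siglift Yq)
      finally have "0 = 0 + (\<Sum>k\<in>K'. mscale (d (k + m)) (Y k))" .
      then have "(\<Sum>k\<in>K'. mscale (d (k + m)) (Y k)) = 0" by (metis add_0)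
      then have "\<forall>k\<in>K'. d (k + m) = 0" using Y(2) unfolding independent_family_def by (elim allE[of _ "\<lambda>k. d (k + m)"]) simp
      then show "\<forall>k\<in>K. d k = 0" using d1 by (auto simp: K_def)
    qed
    ultimately show ?thesis by blast
  qed
  have slice2: "x = 0" if x: "x \<in> stabiliser N ?q f" and gx: "\<forall>k\<in>K. g k x = 0" for x
  proof -
    have xq: "x \<in> ?q" and st: "\<And>y. y \<in> ?q \<Longrightarrow> f (bracket N x y) = 0" using x by (auto simp: stabiliser_def)
    have f0: "f y = F' (\<lambda>_. 0) (\<sigma> y) + (\<Sum>i=1..m. of_nat i * y i i)" for y by (simp add: f_def F'_def)
    have corner: "x i j = 0" if ij: "1 \<le> i" "i \<le> m" "1 \<le> j" "j \<le> m" for i j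
    proof (cases "i = j")
      case True
      then have "g i x = 0" using gx ij by (auto simp: K_def)
      then show ?thesis using True ij by (simp add: g_def)
    next
      case False
      have r: "1 \<le> j" "j \<le> N" "1 \<le> i" "i \<le> N" using ij mn by linarith+
      have u: "so_unit N j i \<in> ?q"
        by (rule in_sw) (use as bs r ij in auto)
      have su: "\<sigma> (so_unit N j i) = 0"
      proof (intro ext)
        fix k l show "\<sigma> (so_unit N j i) k l = 0 k l"
        proof (cases "1 \<le> k \<and> k \<le> N' \<and> 1 \<le> l \<and> l \<le> N'")
          case True
          have "(so_unit N j i :: 'k matrix) (k + m) (l + m) = 0"
          proof (rule ccontr)
            assume "(so_unit N j i :: 'k matrix) (k + m) (l + m) \<noteq> 0"
            from so_unit_support[OF this] show False using True ij mn by linarith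
          qed
          then show ?thesis unfolding \<sigma>_def by simp
        next
          case False
          then show ?thesis unfolding \<sigma>_def by (simp only: False if_False zero_fun_apply)
        qed
      qed
      have d: "bracket N x (so_unit N j i) k k = (if k = i then x i j else 0) - (if k = j then x i j else 0)" if "k \<in> {1..m}" for k
        unfolding bracket_apply sum_so_unit_times[OF r] sum_times_so_unit[OF r] using that ij mn by auto
      have "0 = (\<Sum>k=1..m. of_nat k * ((if k = i then x i j else 0) - (if k = j then x i j else 0)))"
        using st[OF u] unfolding f0 sigbr[OF xq u] su bracket_zero F'0 by (simp add: d)
      also have "\<dots> = (\<Sum>k=1..m. if k = i then of_nat i * x i j else 0) - (\<Sum>k=1..m. if k = j then of_nat j * x i j else 0)"
        unfolding sum_subtractf[symmetric] by (intro sum.cong refl) auto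
      \<comment> \<open>Distinct coefficients i and j have an invertible difference in
        characteristic zero, so off-diagonal entries of a stabiliser element vanish.\<close>
      also have "\<dots> = (of_nat i - of_nat j) * x i j" using ij by (simp add: left_diff_distrib)
      finally show ?thesis using False by simp
    qed
    have "\<sigma> x \<in> stabiliser N' ?q' f'" unfolding stabiliser_def
    proof (intro CollectI conjI ballI sigq[OF xq])
      fix y assume y: "y \<in> ?q'"
      have "f (bracket N x (lift y)) = F' (\<lambda>_. 0) (bracket N' (\<sigma> x) y)"
        unfolding f0 sigbr[OF xq liftq[OF y]] siglift[OF y] by (simp add: diag_lift)
      then show "f' (bracket N' (\<sigma> x) y) = 0" using st[OF liftq[OF y]] by (simp add: F'_def)
    qed
    moreover have "\<forall>k\<in>K'. g' k (\<sigma> x) = 0"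
    proof
      fix k assume k: "k \<in> K'"
      then have "g (k + m) x = 0" using gx by (simp add: K_def)
      then show "g' k (\<sigma> x) = 0" using K'pos[OF k] by (simp add: g_def)
    qed
    ultimately have sx: "\<sigma> x = 0" using z' by blast
    show ?thesis
    proof (rule so_eqI[OF in_so(1)[OF xq] in_so(1)[OF mat_vs.subspace_0[OF subspace]]])
      fix i j :: nat assume ij: "1 \<le> i" "1 \<le> j" "i + j \<le> N"
      have "x i j = 0"
      proof (cases "m < i \<and> m < j")
        case True
        then have "\<sigma> x (i - m) (j - m) = x i j" unfolding \<sigma>_def using ij mn by auto
        then show ?thesis by (simp add: sx)
      next
        case False
        then show ?thesis
          using support(1,2)[OF xq, of i j] corner[OF ij(1) _ ij(2)] by (cases "x i j = 0") auto
      qed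
      then show "x i j = 0 i j" by simp
    qed
  qed
  show ?thesis unfolding K_def[symmetric] has_slice_def NN[symmetric]
    using fl gl slice1 slice2 by (intro exI[of _ f] exI[of _ g] conjI ballI allI impI) simp_all
qed

subsection \<open>Parabolic subalgebras\<close>

lemma sum_delta_eq:
  assumes "finite S" "\<And>k. k \<in> S \<Longrightarrow> i = f k \<longleftrightarrow> k = t"
  shows "(\<Sum>k\<in>S. if i = f k then h k else (0 :: 'a::comm_monoid_add)) = (if t \<in> S then h t else 0)"
proof -
  have "(\<Sum>k\<in>S. if i = f k then h k else 0) = (\<Sum>k\<in>S. if k = t then h k else 0)"
    using assms(2) by (intro sum.cong) auto
  then show ?thesis using assms(1) by simp
qed

text \<open>The level function enters only through its monotonicity, its antisymmetry and the place
  where it becomes zero, so \<open>lev\<close> itself is kept out of the computations.\<close>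

locale parabolic =
  fixes n N A :: nat and lam :: "nat \<Rightarrow> int"
  assumes N: "N = 2 * n + 1" and An: "A \<le> n"
    and lam_mono: "\<And>i j. i \<le> j \<Longrightarrow> lam i \<le> lam j"
    and lam_mirror: "\<And>i. 1 \<le> i \<Longrightarrow> i \<le> N \<Longrightarrow> lam (N + 1 - i) = - lam i"
    and lam_neg: "\<And>i. 1 \<le> i \<Longrightarrow> i \<le> N \<Longrightarrow> lam i < 0 \<longleftrightarrow> i \<le> A"
begin

lemma Nb: "N \<le> 2 * n + 1" "2 * n + 1 \<le> N"
  using N by auto

definition s :: "nat \<Rightarrow> nat" where "s i = N + 1 - i"

text \<open>The Kostant cascade of type B consists of the roots e_p + e_(p+1) and e_p - e_(p+1) for
  odd p, with one short root left over in odd rank.\<close>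

definition pair :: "nat \<Rightarrow> bool" where "pair p \<longleftrightarrow> odd p \<and> p < A"
definition last_in :: "nat \<Rightarrow> nat" where "last_in u = Max {i. i \<le> A \<and> lam i = lam u}"
text \<open>Pairs inside a block: e_p - e_(p+1) is a root of the Levi subalgebra, and a torus
  coordinate takes its place. For the straddling pairs in \<open>T\<close> the root lies in the
  nilradical and its matrix unit is used.\<close>

definition S :: "nat set" where "S = {p. pair p \<and> lam p = lam (Suc p)}"
definition D :: "nat set" where "D = {i. A < i \<and> i \<le> n}"
definition T :: "nat set" where "T = {p. pair p \<and> lam p \<noteq> lam (Suc p)}"
text \<open>First indices of blocks of even length that start at an even index. Neither end of such
  a block has its partner inside, so the pairs inside number one less than half the length; the
  entry in the lower left corner supplies the missing coordinate.\<close>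

definition U :: "nat set" where "U = {u. even u \<and> 2 \<le> u \<and> u \<le> A \<and> lam (u - 1) \<noteq> lam u \<and> odd (last_in u)}"
definition K :: "nat set" where "K = S \<union> D \<union> U"

definition g :: "nat \<Rightarrow> 'k::field_char_0 matrix \<Rightarrow> 'k" where
  "g k x = (if k \<in> S then x k k - x (Suc k) (Suc k) else if k \<in> D then x k k else x (last_in k) k)"
text \<open>Root coordinates of the cascade: e_p - e_(p+1) for straddling pairs, e_p + e_(p+1) for
  all pairs, and the short root e_A if A is odd.\<close>

definition link :: "'k::field_char_0 matrix \<Rightarrow> 'k" where
  "link x = (\<Sum>p\<in>T. x p (Suc p)) + (\<Sum>p\<in>S \<union> T. x p (s (Suc p))) + (if odd A then x A (n + 1) else 0)"
definition f :: "(nat \<Rightarrow> 'k) \<Rightarrow> 'k::field_char_0 matrix \<Rightarrow> 'k" where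
  "f \<kappa> x = link x + (\<Sum>k\<in>K. \<kappa> k * g k x)"

lemma s_s: "1 \<le> i \<Longrightarrow> i \<le> N \<Longrightarrow> s (s i) = i"
  by (auto simp: s_def)

lemma s_range: "1 \<le> i \<Longrightarrow> i \<le> N \<Longrightarrow> 1 \<le> s i \<and> s i \<le> N"
  by (auto simp: s_def)

lemma s_eq_iff: "1 \<le> i \<Longrightarrow> i \<le> N \<Longrightarrow> 1 \<le> j \<Longrightarrow> j \<le> N \<Longrightarrow> i = s j \<longleftrightarrow> j = s i"
  by (auto simp: s_def)

lemma lam_s: "1 \<le> i \<Longrightarrow> i \<le> N \<Longrightarrow> lam (s i) = - lam i"
  unfolding s_def by (rule lam_mirror)

lemma s_mid: "s (n + 1) = n + 1"
  unfolding s_def using Nb by linarith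

lemma finites: "finite S" "finite D" "finite T" "finite U" "finite K"
proof -
  have "S \<subseteq> {..A}" "D \<subseteq> {..n}" "T \<subseteq> {..A}" "U \<subseteq> {..A}"
    by (auto simp: S_def D_def T_def U_def pair_def)
  then show "finite S" "finite D" "finite T" "finite U" by (auto intro: finite_subset)
  then show "finite K" by (simp add: K_def)
qed

lemma ST: "S \<inter> T = {}" "S \<inter> D = {}" "U \<inter> (S \<union> D) = {}"
  by (auto simp: S_def T_def D_def U_def pair_def)

lemma range_S: "k \<in> S \<union> T \<Longrightarrow> 1 \<le> k \<and> Suc k \<le> A \<and> odd k"
  by (auto simp: S_def T_def pair_def intro: Suc_leI odd_pos)

lemma range_D: "k \<in> D \<Longrightarrow> 1 \<le> k \<and> A < k \<and> k \<le> n"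
  by (auto simp: D_def)

lemma last_in: assumes "1 \<le> u" "u \<le> A" shows "u \<le> last_in u" "last_in u \<le> A" "lam (last_in u) = lam u"
  and "\<And>i. i \<le> A \<Longrightarrow> lam i = lam u \<Longrightarrow> i \<le> last_in u"
proof -
  have f: "finite {i. i \<le> A \<and> lam i = lam u}" by auto
  have "last_in u \<in> {i. i \<le> A \<and> lam i = lam u}" unfolding last_in_def by (rule Max_in[OF f]) (use assms in auto)
  then show "last_in u \<le> A" "lam (last_in u) = lam u" by auto
  show le: "\<And>i. i \<le> A \<Longrightarrow> lam i = lam u \<Longrightarrow> i \<le> last_in u" unfolding last_in_def by (rule Max_ge[OF f]) auto
  show "u \<le> last_in u" using assms le by blast
qed

lemma last_in_eqI:
  assumes "1 \<le> u" "u \<le> l" "l \<le> A" "lam l = lam u" "l = A \<or> lam l \<noteq> lam (Suc l)"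
  shows "last_in u = l"
proof -
  have ua: "u \<le> A" using assms by simp
  note li = last_in[OF assms(1) ua]
  have "l \<le> last_in u" by (rule li(4)) (use assms in auto)
  moreover have "\<not> l < last_in u"
  proof
    assume l: "l < last_in u"
    then have "lam l \<le> lam (Suc l)" "lam (Suc l) \<le> lam (last_in u)" by (auto intro: lam_mono)
    then show False using assms li l by auto
  qed
  ultimately show ?thesis by simp
qed

lemma range_U: "k \<in> U \<Longrightarrow> 2 \<le> k \<and> k \<le> A \<and> even k \<and> odd (last_in k) \<and> k < last_in k \<and> last_in k \<le> A"
proof -
  assume k: "k \<in> U"
  then have r: "1 \<le> k" "k \<le> A" by (auto simp: U_def)
  have "k \<noteq> last_in k" using k by (metis (mono_tags, lifting) U_def mem_Collect_eq)
  then show ?thesis using k last_in(1,2)[OF r] by (auto simp: U_def)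
qed

lemma sum_K: "(\<Sum>k\<in>K. h k) = (\<Sum>k\<in>S. h k) + (\<Sum>k\<in>D. h k) + (\<Sum>k\<in>U. h k :: 'a::comm_monoid_add)"
  unfolding K_def using finites ST by (simp add: sum.union_disjoint Int_commute)

text \<open>Entry (i, l) of the product of \<open>so_unit N a b\<close> with y. Via the trace form
  this unit represents the coordinate x_ba, up to skew-symmetrisation.\<close>

definition Qu :: "nat \<Rightarrow> nat \<Rightarrow> 'k::field_char_0 matrix \<Rightarrow> nat \<Rightarrow> nat \<Rightarrow> 'k" where
  "Qu a b y i l = (if i = a then y b l else 0) - (if i = s b then y (s a) l else 0)"

lemma mirror: "y \<in> so N \<Longrightarrow> 1 \<le> i \<Longrightarrow> i \<le> N \<Longrightarrow> 1 \<le> j \<Longrightarrow> j \<le> N \<Longrightarrow> y (s j) (s i) = - y i j"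
  unfolding s_def by (rule so_mirror)

lemma unit_bracket:
  fixes y :: "'k::field_char_0 matrix"
  assumes y: "y \<in> so N" and c: "1 \<le> c" "c \<le> N" and d: "1 \<le> d" "d \<le> N" and ab: "1 \<le> a" "a \<le> N" "1 \<le> b" "b \<le> N"
  shows "bracket N y (so_unit N c d) b a = Qu a b y d c - Qu a b y (s c) (s d)"
proof -
  have e: "bracket N y (so_unit N c d) b a = ((if a = d then y b c else 0) - (if a = s c then y b (s d) else 0))
      - ((if b = c then y d a else 0) - (if b = s d then y (s c) a else 0))"
    unfolding bracket_apply sum_times_so_unit[OF c d] sum_so_unit_times[OF c d] s_def by simp
  have m: "y (s a) (s d) = - y d a" "y (s a) c = - y (s c) a"
    using mirror[OF y d ab(1,2)] mirror[OF y _ _ ab(1,2), of "s c"] s_range[OF c] s_s[OF c] by auto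
  have i: "d = s b \<longleftrightarrow> b = s d" "s c = s b \<longleftrightarrow> b = c" "d = a \<longleftrightarrow> a = d" "s c = a \<longleftrightarrow> a = s c"
    using c d ab by (auto simp: s_def)
  show ?thesis unfolding e Qu_def m i by simp
qed

text \<open>The product of y with the skew matrix representing \<open>f\<close>; testing
  \<open>f\<close> on brackets with units amounts to comparing two mirrored entries of it
  (\<open>f_bracket\<close>).\<close>

definition Q :: "(nat \<Rightarrow> 'k) \<Rightarrow> 'k::field_char_0 matrix \<Rightarrow> nat \<Rightarrow> nat \<Rightarrow> 'k" where
  "Q \<kappa> y i l = (\<Sum>p\<in>T. Qu (Suc p) p y i l) + (\<Sum>p\<in>S \<union> T. Qu (s (Suc p)) p y i l) + (if odd A then Qu (n + 1) A y i l else 0)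
     + ((\<Sum>k\<in>S. \<kappa> k * (Qu k k y i l - Qu (Suc k) (Suc k) y i l)) + (\<Sum>k\<in>D. \<kappa> k * Qu k k y i l) + (\<Sum>k\<in>U. \<kappa> k * Qu k (last_in k) y i l))"

lemma f_bracket:
  fixes y :: "'k::field_char_0 matrix"
  assumes y: "y \<in> so N" and c: "1 \<le> c" "c \<le> N" and d: "1 \<le> d" "d \<le> N"
  shows "f \<kappa> (bracket N y (so_unit N c d)) = Q \<kappa> y d c - Q \<kappa> y (s c) (s d)"
proof -
  let ?B = "bracket N y (so_unit N c d)"
  note ub = unit_bracket[OF y c d]
  have r: "\<And>k. k \<le> A \<Longrightarrow> k \<le> N" using An Nb by auto
  have 1: "(\<Sum>p\<in>T. ?B p (Suc p)) = (\<Sum>p\<in>T. Qu (Suc p) p y d c - Qu (Suc p) p y (s c) (s d))"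
    by (intro sum.cong refl ub) (auto dest!: range_S[OF UnI2] intro: r)
  have sr: "1 \<le> s (Suc k) \<and> s (Suc k) \<le> N" if "k \<in> S \<union> T" for k
    using range_S[OF that] r by (intro s_range) auto
  have 2: "(\<Sum>p\<in>S \<union> T. ?B p (s (Suc p))) = (\<Sum>p\<in>S \<union> T. Qu (s (Suc p)) p y d c - Qu (s (Suc p)) p y (s c) (s d))"
    by (intro sum.cong refl ub) (use sr range_S r in fastforce)+
  have 3: "(if odd A then ?B A (n + 1) else 0) = (if odd A then Qu (n + 1) A y d c else 0) - (if odd A then Qu (n + 1) A y (s c) (s d) else 0)"
    using ub[of "n + 1" A] odd_pos[of A] An Nb by auto
  have 4: "(\<Sum>k\<in>S. \<kappa> k * g k ?B) = (\<Sum>k\<in>S. \<kappa> k * (Qu k k y d c - Qu (Suc k) (Suc k) y d c)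
      - \<kappa> k * (Qu k k y (s c) (s d) - Qu (Suc k) (Suc k) y (s c) (s d)))"
  proof (intro sum.cong refl)
    fix k assume k: "k \<in> S"
    have "1 \<le> k" "k \<le> N" "1 \<le> Suc k" "Suc k \<le> N" using range_S[of k] k An Nb by auto
    then show "\<kappa> k * g k ?B = \<kappa> k * (Qu k k y d c - Qu (Suc k) (Suc k) y d c)
      - \<kappa> k * (Qu k k y (s c) (s d) - Qu (Suc k) (Suc k) y (s c) (s d))"
      using k by (simp add: g_def ub right_diff_distrib)
  qed
  have 5: "(\<Sum>k\<in>D. \<kappa> k * g k ?B) = (\<Sum>k\<in>D. \<kappa> k * Qu k k y d c - \<kappa> k * Qu k k y (s c) (s d))"
  proof (intro sum.cong refl)
    fix k assume k: "k \<in> D"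
    have "1 \<le> k" "k \<le> N" "k \<notin> S" using range_D[OF k] k ST An Nb by auto
    then show "\<kappa> k * g k ?B = \<kappa> k * Qu k k y d c - \<kappa> k * Qu k k y (s c) (s d)"
      using k by (simp add: g_def ub right_diff_distrib)
  qed
  have 6: "(\<Sum>k\<in>U. \<kappa> k * g k ?B) = (\<Sum>k\<in>U. \<kappa> k * Qu k (last_in k) y d c - \<kappa> k * Qu k (last_in k) y (s c) (s d))"
  proof (intro sum.cong refl)
    fix k assume k: "k \<in> U"
    have "1 \<le> k" "k \<le> N" "1 \<le> last_in k" "last_in k \<le> N" "k \<notin> S" "k \<notin> D" using range_U[OF k] k ST An Nb by auto
    then show "\<kappa> k * g k ?B = \<kappa> k * Qu k (last_in k) y d c - \<kappa> k * Qu k (last_in k) y (s c) (s d)"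
      by (simp add: g_def ub right_diff_distrib)
  qed
  show ?thesis unfolding f_def link_def Q_def sum_K 1 2 3 4 5 6 sum_subtractf by (simp only: algebra_simps)
qed

text \<open>The last sum has at most one term, as \<open>last_in\<close> is injective on \<open>U\<close>.\<close>

lemma Q_eq:
  fixes y :: "'k::field_char_0 matrix"
  assumes i: "1 \<le> i" "i \<le> N"
  shows "Q \<kappa> y i l = (if i - 1 \<in> T then y (i - 1) l else 0) - (if s i \<in> T then y (s (Suc (s i))) l else 0)
    + (if s i - 1 \<in> S \<union> T then y (s i - 1) l else 0) - (if s i \<in> S \<union> T then y (Suc (s i)) l else 0)
    + (if odd A \<and> i = n + 1 then y A l else 0) - (if odd A \<and> i = s A then y (n + 1) l else 0)
    + (if i \<in> S then \<kappa> i * y i l else 0) - (if s i \<in> S then \<kappa> (s i) * y i l else 0)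
    - (if i - 1 \<in> S then \<kappa> (i - 1) * y i l else 0) + (if s i - 1 \<in> S then \<kappa> (s i - 1) * y i l else 0)
    + (if i \<in> D then \<kappa> i * y i l else 0) - (if s i \<in> D then \<kappa> (s i) * y i l else 0)
    + (if i \<in> U then \<kappa> i * y (last_in i) l else 0) - (\<Sum>k\<in>U. if i = s (last_in k) then \<kappa> k * y (s k) l else 0)"
proof -
  have rST: "1 \<le> k \<and> k \<le> N \<and> Suc k \<le> N \<and> k < N" if "k \<in> S \<union> T" for k using range_S[OF that] An Nb by auto
  have 1: "(\<Sum>p\<in>T. Qu (Suc p) p y i l) = (if i - 1 \<in> T then y (i - 1) l else 0) - (if s i \<in> T then y (s (Suc (s i))) l else 0)"
  proof -
    have "(\<Sum>p\<in>T. if i = Suc p then y p l else 0) = (if i - 1 \<in> T then y (i - 1) l else 0)"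
      by (rule sum_delta_eq[OF finites(3)]) (use i in auto)
    moreover have "(\<Sum>p\<in>T. if i = s p then y (s (Suc p)) l else 0) = (if s i \<in> T then y (s (Suc (s i))) l else 0)"
      by (rule sum_delta_eq[OF finites(3)]) (use i rST s_eq_iff in blast)
    ultimately show ?thesis by (simp add: Qu_def sum_subtractf)
  qed
  have fin: "finite (S \<union> T)" using finites by simp
  have 2: "(\<Sum>p\<in>S \<union> T. Qu (s (Suc p)) p y i l) = (if s i - 1 \<in> S \<union> T then y (s i - 1) l else 0) - (if s i \<in> S \<union> T then y (Suc (s i)) l else 0)"
  proof -
    have "(\<Sum>p\<in>S \<union> T. if i = s (Suc p) then y p l else 0) = (if s i - 1 \<in> S \<union> T then y (s i - 1) l else 0)"
    proof (rule sum_delta_eq[OF fin])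
      fix k assume "k \<in> S \<union> T"
      then show "i = s (Suc k) \<longleftrightarrow> k = s i - 1" using rST[of k] i s_range[OF i] by (auto simp: s_def)
    qed
    moreover have "(\<Sum>p\<in>S \<union> T. if i = s p then y (s (s (Suc p))) l else 0) = (\<Sum>p\<in>S \<union> T. if i = s p then y (Suc p) l else 0)"
      by (intro sum.cong refl if_cong) (use rST s_s[of "Suc _"] in auto)
    moreover have "(\<Sum>p\<in>S \<union> T. if i = s p then y (Suc p) l else 0) = (if s i \<in> S \<union> T then y (Suc (s i)) l else 0)"
      by (rule sum_delta_eq[OF fin]) (use i rST s_eq_iff in blast)
    ultimately show ?thesis by (simp only: Qu_def sum_subtractf)
  qed
  have 3: "(if odd A then Qu (n + 1) A y i l else 0) = (if odd A \<and> i = n + 1 then y A l else 0) - (if odd A \<and> i = s A then y (n + 1) l else 0)"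
    unfolding Qu_def s_mid by (simp only: if_distrib) simp
  have 4: "(\<Sum>k\<in>S. \<kappa> k * (Qu k k y i l - Qu (Suc k) (Suc k) y i l)) =
      (if i \<in> S then \<kappa> i * y i l else 0) - (if s i \<in> S then \<kappa> (s i) * y i l else 0)
    - (if i - 1 \<in> S then \<kappa> (i - 1) * y i l else 0) + (if s i - 1 \<in> S then \<kappa> (s i - 1) * y i l else 0)"
  proof -
    have "(\<Sum>k\<in>S. \<kappa> k * (Qu k k y i l - Qu (Suc k) (Suc k) y i l)) = (\<Sum>k\<in>S. if i = k then \<kappa> k * y i l else 0)
       - (\<Sum>k\<in>S. if i = s k then \<kappa> k * y i l else 0) - (\<Sum>k\<in>S. if i = Suc k then \<kappa> k * y i l else 0)
       + (\<Sum>k\<in>S. if i = s (Suc k) then \<kappa> k * y i l else 0)"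
      unfolding sum_subtractf[symmetric] sum.distrib[symmetric] by (intro sum.cong refl) (auto simp: Qu_def algebra_simps)
    moreover have "(\<Sum>k\<in>S. if i = k then \<kappa> k * y i l else 0) = (if i \<in> S then \<kappa> i * y i l else 0)"
      by (rule sum_delta_eq[OF finites(1)]) auto
    moreover have "(\<Sum>k\<in>S. if i = s k then \<kappa> k * y i l else 0) = (if s i \<in> S then \<kappa> (s i) * y i l else 0)"
      by (rule sum_delta_eq[OF finites(1)]) (use i rST s_eq_iff in blast)
    moreover have "(\<Sum>k\<in>S. if i = Suc k then \<kappa> k * y i l else 0) = (if i - 1 \<in> S then \<kappa> (i - 1) * y i l else 0)"
      by (rule sum_delta_eq[OF finites(1)]) (use i in auto)
    moreover have "(\<Sum>k\<in>S. if i = s (Suc k) then \<kappa> k * y i l else 0) = (if s i - 1 \<in> S then \<kappa> (s i - 1) * y i l else 0)"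
    proof (rule sum_delta_eq[OF finites(1)])
      fix k assume "k \<in> S"
      then show "i = s (Suc k) \<longleftrightarrow> k = s i - 1" using rST[of k] i s_range[OF i] by (auto simp: s_def)
    qed
    ultimately show ?thesis by (simp only:)
  qed
  have 5: "(\<Sum>k\<in>D. \<kappa> k * Qu k k y i l) = (if i \<in> D then \<kappa> i * y i l else 0) - (if s i \<in> D then \<kappa> (s i) * y i l else 0)"
  proof -
    have "(\<Sum>k\<in>D. \<kappa> k * Qu k k y i l) = (\<Sum>k\<in>D. if i = k then \<kappa> k * y i l else 0) - (\<Sum>k\<in>D. if i = s k then \<kappa> k * y i l else 0)"
      unfolding sum_subtractf[symmetric] by (intro sum.cong refl) (auto simp: Qu_def algebra_simps)
    moreover have "(\<Sum>k\<in>D. if i = k then \<kappa> k * y i l else 0) = (if i \<in> D then \<kappa> i * y i l else 0)"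
      by (rule sum_delta_eq[OF finites(2)]) auto
    moreover have "(\<Sum>k\<in>D. if i = s k then \<kappa> k * y i l else 0) = (if s i \<in> D then \<kappa> (s i) * y i l else 0)"
    proof (rule sum_delta_eq[OF finites(2)])
      fix k assume "k \<in> D"
      then show "i = s k \<longleftrightarrow> k = s i" using range_D[of k] i Nb by (intro s_eq_iff) auto
    qed
    ultimately show ?thesis by (simp only:)
  qed
  have 6: "(\<Sum>k\<in>U. \<kappa> k * Qu k (last_in k) y i l) = (if i \<in> U then \<kappa> i * y (last_in i) l else 0) - (\<Sum>k\<in>U. if i = s (last_in k) then \<kappa> k * y (s k) l else 0)"
  proof -
    have "(\<Sum>k\<in>U. \<kappa> k * Qu k (last_in k) y i l) = (\<Sum>k\<in>U. if i = k then \<kappa> k * y (last_in k) l else 0) - (\<Sum>k\<in>U. if i = s (last_in k) then \<kappa> k * y (s k) l else 0)"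
      unfolding sum_subtractf[symmetric] by (intro sum.cong refl) (auto simp: Qu_def algebra_simps)
    moreover have "(\<Sum>k\<in>U. if i = k then \<kappa> k * y (last_in k) l else 0) = (if i \<in> U then \<kappa> i * y (last_in i) l else 0)"
      by (rule sum_delta_eq[OF finites(4)]) auto
    ultimately show ?thesis by (simp only:)
  qed
  show ?thesis unfolding Q_def 1 2 3 4 5 6 by (simp only: algebra_simps)
qed

text \<open>What the parameters of \<open>U\<close> add to the rows in the lower half; its at most
  one term is identified in \<open>tail_last\<close>.\<close>

definition tail :: "(nat \<Rightarrow> 'k) \<Rightarrow> 'k::field_char_0 matrix \<Rightarrow> nat \<Rightarrow> nat \<Rightarrow> 'k" where
  "tail \<kappa> y i l = (\<Sum>k\<in>U. if i = last_in k then \<kappa> k * y (s k) l else 0)"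

lemma tail_s: "1 \<le> i \<Longrightarrow> i \<le> N \<Longrightarrow> (\<Sum>k\<in>U. if s i = s (last_in k) then \<kappa> k * y (s k) l else 0) = tail \<kappa> y i l"
  unfolding tail_def
proof (intro sum.cong refl if_cong)
  fix k assume "1 \<le> i" "i \<le> N" "k \<in> U"
  then show "s i = s (last_in k) \<longleftrightarrow> i = last_in k" using range_U[of k] An Nb by (auto simp: s_def)
qed

lemma tail_even: "even i \<Longrightarrow> tail \<kappa> y i l = 0"
  unfolding tail_def by (intro sum.neutral ballI) (auto dest: range_U)

lemma tail_big: "A < i \<Longrightarrow> tail \<kappa> y i l = 0"
  unfolding tail_def by (intro sum.neutral ballI) (auto dest: range_U)

lemma no_tail: "i \<le> n + 1 \<Longrightarrow> (\<Sum>k\<in>U. if i = s (last_in k) then h k else 0) = (0 :: 'k::field_char_0)"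
proof (intro sum.neutral ballI)
  fix k assume "i \<le> n + 1" "k \<in> U"
  then show "(if i = s (last_in k) then h k else 0) = 0" using range_U[of k] An Nb by (auto simp: s_def)
qed

text \<open>\<open>C\<close> is the torus parameter of a pair inside a block and \<open>chi\<close>
  marks straddling pairs. With both in the formulas the two kinds of pairs need only one
  computation.\<close>

definition C :: "(nat \<Rightarrow> 'k) \<Rightarrow> nat \<Rightarrow> 'k::field_char_0" where "C \<kappa> p = (if p \<in> S then \<kappa> p else 0)"
definition chi :: "nat \<Rightarrow> 'k::field_char_0" where "chi p = (if p \<in> T then 1 else 0)"

lemma pair_iff: "pair p \<longleftrightarrow> p \<in> S \<union> T"
  by (auto simp: S_def T_def)

lemma row_outside: "n < i \<Longrightarrow> i \<notin> S \<and> i \<notin> T \<and> i \<notin> D \<and> i \<notin> U" "n + 1 < i \<Longrightarrow> i - 1 \<notin> S \<and> i - 1 \<notin> T"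
  using An by (auto simp: S_def T_def D_def U_def pair_def)

text \<open>The representing matrix couples only the four indices p, p + 1 and their mirrors, apart
  from the terms with parameters of \<open>U\<close>.\<close>

lemma row_p:
  fixes y :: "'k::field_char_0 matrix"
  assumes p: "pair p"
  shows "Q \<kappa> y p l = C \<kappa> p * y p l"
    and "Q \<kappa> y (Suc p) l = - C \<kappa> p * y (Suc p) l + chi p * y p l + (if Suc p \<in> U then \<kappa> (Suc p) * y (last_in (Suc p)) l else 0)"
    and "Q \<kappa> y (s (Suc p)) l = y p l + C \<kappa> p * y (s (Suc p)) l"
    and "Q \<kappa> y (s p) l = - y (Suc p) l - C \<kappa> p * y (s p) l - chi p * y (s (Suc p)) l - tail \<kappa> y p l"
proof -
  have r: "1 \<le> p" "odd p" "p < A" "p \<le> N" "Suc p \<le> N" using p An Nb by (auto simp: pair_def odd_pos Suc_leI)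
  have sr: "1 \<le> s p" "s p \<le> N" "1 \<le> s (Suc p)" "s (Suc p) \<le> N" using s_range r by auto
  have big: "n + 1 < s p" "n + 1 < s (Suc p)" using r An Nb by (auto simp: s_def)
  have np: "p - 1 \<notin> S" "p - 1 \<notin> T" "p \<notin> D" "p \<notin> U" "p \<noteq> n + 1" "Suc p \<notin> S" "Suc p \<notin> T" "Suc p \<notin> D" "Suc p \<noteq> n + 1"
    using r An by (auto simp: S_def T_def D_def U_def pair_def)
  have pS: "p \<notin> S \<Longrightarrow> p \<in> T" "p \<in> S \<Longrightarrow> p \<notin> T" using p pair_iff ST by auto
  have ss: "s (s p) = p" "s (s (Suc p)) = Suc p" using s_s r by auto
  have sA: "p \<noteq> s A" "Suc p \<noteq> s A" "s p \<noteq> s A" "\<not> (odd A \<and> s (Suc p) = s A)" "s p \<noteq> n + 1" "s (Suc p) \<noteq> n + 1"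
  proof -
    have "odd A \<Longrightarrow> Suc p < A" using r by (metis Suc_lessI even_Suc)
    then show "\<not> (odd A \<and> s (Suc p) = s A)" using r An Nb by (auto simp: s_def)
  qed (use r An Nb in \<open>auto simp: s_def\<close>)
  note o = row_outside(1)[of "s p"] row_outside(1)[of "s (Suc p)"] row_outside(2)[of "s p"] row_outside(2)[of "s (Suc p)"]
  have nt: "(\<Sum>k\<in>U. if p = s (last_in k) then h k else 0) = (0 :: 'k)" "(\<Sum>k\<in>U. if Suc p = s (last_in k) then h k else 0) = (0 :: 'k)" for h
    using r An by (auto intro: no_tail)
  show "Q \<kappa> y p l = C \<kappa> p * y p l"
    unfolding Q_eq[OF r(1,4)] nt C_def using o big np sA by simp
  show "Q \<kappa> y (Suc p) l = - C \<kappa> p * y (Suc p) l + chi p * y p l + (if Suc p \<in> U then \<kappa> (Suc p) * y (last_in (Suc p)) l else 0)"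
    unfolding Q_eq[OF le_SucI[OF r(1)] r(5)] nt C_def chi_def using o big np sA pS by simp
  show "Q \<kappa> y (s (Suc p)) l = y p l + C \<kappa> p * y (s (Suc p)) l"
    unfolding Q_eq[OF sr(3,4)] tail_s[OF le_SucI[OF r(1)] r(5)] C_def chi_def ss using o big np sA pS r(2)
    by (cases "odd A") (simp_all add: tail_even)
  show "Q \<kappa> y (s p) l = - y (Suc p) l - C \<kappa> p * y (s p) l - chi p * y (s (Suc p)) l - tail \<kappa> y p l"
    unfolding Q_eq[OF sr(1,2)] tail_s[OF r(1,4)] C_def chi_def ss using o big np sA pS by simp
qed

lemma row_A:
  fixes y :: "'k::field_char_0 matrix"
  assumes A: "odd A"
  shows "Q \<kappa> y A l = 0" "Q \<kappa> y (n + 1) l = y A l" "Q \<kappa> y (s A) l = - y (n + 1) l - tail \<kappa> y A l"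
proof -
  have r: "1 \<le> A" "A \<le> N" "n + 1 \<le> N" "1 \<le> n + 1" using A An Nb by (auto simp: odd_pos Suc_leI)
  have sr: "1 \<le> s A" "s A \<le> N" using s_range r by auto
  have big: "n + 1 < s A" using r An Nb by (auto simp: s_def)
  have np: "A - 1 \<notin> S" "A - 1 \<notin> T" "A \<notin> S" "A \<notin> T" "A \<notin> D" "A \<notin> U" "n \<notin> S" "n \<notin> T" "A \<noteq> n + 1" "A \<noteq> s A" "s A \<noteq> n + 1"
    using A An big by (auto simp: S_def T_def D_def U_def pair_def)
  have ss: "s (s A) = A" using s_s r by auto
  note o = row_outside(1)[of "s A"] row_outside(2)[of "s A"] row_outside(1)[of "n + 1"]
  have nt: "(\<Sum>k\<in>U. if A = s (last_in k) then h k else 0) = (0 :: 'k)" "(\<Sum>k\<in>U. if n + 1 = s (last_in k) then h k else 0) = (0 :: 'k)" for h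
    using r An by (auto intro: no_tail)
  show "Q \<kappa> y A l = 0" unfolding Q_eq[OF r(1,2)] nt using o big np by simp
  show "Q \<kappa> y (n + 1) l = y A l" unfolding Q_eq[OF r(4,3)] nt s_mid using o big np A by simp
  show "Q \<kappa> y (s A) l = - y (n + 1) l - tail \<kappa> y A l"
    unfolding Q_eq[OF sr] tail_s[OF r(1,2)] ss using o big np A by simp
qed

lemma row_mid: "even A \<Longrightarrow> Q \<kappa> y (n + 1) l = (0 :: 'k::field_char_0)"
proof -
  assume A: "even A"
  have r: "n + 1 \<le> N" "1 \<le> n + 1" using Nb by auto
  have np: "n \<notin> S" "n \<notin> T" using An by (auto simp: S_def T_def D_def U_def pair_def)
  have nt: "(\<Sum>k\<in>U. if n + 1 = s (last_in k) then h k else 0) = (0 :: 'k)" for h by (rule no_tail) simp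
  show ?thesis unfolding Q_eq[OF r(2,1)] nt s_mid using row_outside(1)[of "n + 1"] np A by simp
qed

lemma row_D:
  fixes y :: "'k::field_char_0 matrix"
  assumes i: "i \<in> D"
  shows "Q \<kappa> y i l = \<kappa> i * y i l" "Q \<kappa> y (s i) l = - \<kappa> i * y (s i) l"
proof -
  have r: "1 \<le> i" "A < i" "i \<le> n" "i \<le> N" using range_D[OF i] Nb by auto
  have sr: "1 \<le> s i" "s i \<le> N" using s_range r by auto
  have big: "n + 1 < s i" using r An Nb by (auto simp: s_def)
  have np: "i - 1 \<notin> S" "i - 1 \<notin> T" "i \<notin> S" "i \<notin> T" "i \<notin> U" "i \<noteq> n + 1" "i \<noteq> s A" "s i \<noteq> n + 1" "s i \<noteq> s A"
    using r An Nb by (auto simp: S_def T_def D_def U_def pair_def s_def)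
  have ss: "s (s i) = i" using s_s r by auto
  note o = row_outside(1)[of "s i"] row_outside(2)[of "s i"]
  have nt: "(\<Sum>k\<in>U. if i = s (last_in k) then h k else 0) = (0 :: 'k)" for h using r by (auto intro: no_tail)
  show "Q \<kappa> y i l = \<kappa> i * y i l" unfolding Q_eq[OF r(1,4)] nt using o big np i by simp
  show "Q \<kappa> y (s i) l = - \<kappa> i * y (s i) l"
    unfolding Q_eq[OF sr] tail_s[OF r(1,4)] ss using o big np i r by (simp add: tail_big)
qed

end

text \<open>An element x of the stabiliser of the base form on which all slice coordinates vanish.
  Since x and the representing matrix are both skew, \<open>stab\<close> says that their commutator
  vanishes at all (i, j) with lam j <= lam i. The parameters k on \<open>S\<close> and
  \<open>D\<close> are nonzero, and distinct ones have nonzero sums and differences; the parameter 0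
  on \<open>U\<close> removes the coupling between different pairs.\<close>

locale parabolic_kernel = parabolic +
  fixes x :: "'k::field_char_0 matrix" and \<kappa> :: "nat \<Rightarrow> 'k"
  assumes so: "x \<in> so N" and lam_support: "\<And>i j. x i j \<noteq> 0 \<Longrightarrow> lam i \<le> lam j"
    and kap: "\<And>k. k \<in> S \<union> D \<Longrightarrow> \<kappa> k = of_nat k" "\<And>k. k \<in> U \<Longrightarrow> \<kappa> k = 0"
    and stab: "\<And>i j. 1 \<le> i \<Longrightarrow> i \<le> N \<Longrightarrow> 1 \<le> j \<Longrightarrow> j \<le> N \<Longrightarrow> lam j \<le> lam i \<Longrightarrow> Q \<kappa> x i j = Q \<kappa> x (s j) (s i)"
    and gz: "\<And>k. k \<in> K \<Longrightarrow> g k x = 0"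
begin

lemma level_zero: "lam j < lam i \<Longrightarrow> x i j = 0"
  using lam_support[of i j] by (cases "x i j = 0") auto

lemma antidiag: "x i (s i) = 0"
  unfolding s_def by (rule so_antidiagonal[OF so])

lemmas mirr = mirror[OF so]

lemma tail0: "tail \<kappa> x i l = 0"
  unfolding tail_def by (intro sum.neutral) (simp add: kap)

lemma rows:
  assumes p: "pair p"
  shows "Q \<kappa> x p l = C \<kappa> p * x p l"
    and "Q \<kappa> x (Suc p) l = - C \<kappa> p * x (Suc p) l + chi p * x p l"
    and "Q \<kappa> x (s (Suc p)) l = x p l + C \<kappa> p * x (s (Suc p)) l"
    and "Q \<kappa> x (s p) l = - x (Suc p) l - C \<kappa> p * x (s p) l - chi p * x (s (Suc p)) l"
  using row_p[OF p, where y = x and \<kappa> = \<kappa>] by (simp_all add: tail0 kap)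

lemma range_pair:
  assumes "pair p"
  shows "1 \<le> p" "p \<le> N" "1 \<le> Suc p" "Suc p \<le> N" "Suc p \<le> A" "lam p \<le> lam (Suc p)" "lam (Suc p) < 0" "p \<le> A"
    "1 \<le> s p" "s p \<le> N" "1 \<le> s (Suc p)" "s (Suc p) \<le> N" "s (s p) = p" "s (s (Suc p)) = Suc p"
    "lam (s p) = - lam p" "lam (s (Suc p)) = - lam (Suc p)"
proof -
  show r: "1 \<le> p" "p \<le> N" "1 \<le> Suc p" "Suc p \<le> N" "Suc p \<le> A" "lam p \<le> lam (Suc p)" "p \<le> A"
    using assms An Nb by (auto simp: pair_def odd_pos Suc_leI intro: lam_mono)
  show "lam (Suc p) < 0" using r lam_neg by blast
  show "1 \<le> s p" "s p \<le> N" "1 \<le> s (Suc p)" "s (Suc p) \<le> N" using s_range r by auto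
  show "s (s p) = p" "s (s (Suc p)) = Suc p" using s_s r by auto
  show "lam (s p) = - lam p" "lam (s (Suc p)) = - lam (Suc p)" using lam_s r by auto
qed

text \<open>Mirror symmetry turns the right-hand side of \<open>stab\<close> into an entry of x
  times the representing matrix, that is, into a column formula to be compared with the row
  formulas.\<close>

lemma columns_pair:
  assumes p: "pair p" and a: "1 \<le> a" "a \<le> N"
  shows "lam p \<le> lam a \<Longrightarrow> Q \<kappa> x a p = x a (s (Suc p)) + C \<kappa> p * x a p + chi p * x a (Suc p)"
    and "lam (Suc p) \<le> lam a \<Longrightarrow> Q \<kappa> x a (Suc p) = - x a (s p) - C \<kappa> p * x a (Suc p)"
    and "- lam (Suc p) \<le> lam a \<Longrightarrow> Q \<kappa> x a (s (Suc p)) = C \<kappa> p * x a (s (Suc p)) - chi p * x a (s p)"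
    and "- lam p \<le> lam a \<Longrightarrow> Q \<kappa> x a (s p) = - C \<kappa> p * x a (s p)"
proof -
  note r = range_pair[OF p]
  have m: "x j (s a) = - x a (s j)" if "1 \<le> j" "j \<le> N" for j
    using mirr[OF a s_range[OF that, THEN conjunct1] s_range[OF that, THEN conjunct2]] s_s[OF that] by simp
  note mm = m[OF r(1,2)] m[OF r(3,4)] m[OF r(9,10)] m[OF r(11,12)]
  show "lam p \<le> lam a \<Longrightarrow> Q \<kappa> x a p = x a (s (Suc p)) + C \<kappa> p * x a p + chi p * x a (Suc p)"
    using stab[OF a r(1,2)] unfolding rows[OF p] mm r(13,14) by simp
  show "lam (Suc p) \<le> lam a \<Longrightarrow> Q \<kappa> x a (Suc p) = - x a (s p) - C \<kappa> p * x a (Suc p)"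
    using stab[OF a r(3,4)] unfolding rows[OF p] mm r(13,14) by simp
  show "- lam (Suc p) \<le> lam a \<Longrightarrow> Q \<kappa> x a (s (Suc p)) = C \<kappa> p * x a (s (Suc p)) - chi p * x a (s p)"
    using stab[OF a r(11,12)] unfolding r(13,14) rows[OF p] mm r(13,14,16) by simp
  show "- lam p \<le> lam a \<Longrightarrow> Q \<kappa> x a (s p) = - C \<kappa> p * x a (s p)"
    using stab[OF a r(9,10)] unfolding r(13,14) rows[OF p] mm r(13,14,15) by simp
qed

lemma columns_A:
  assumes A: "odd A" and a: "1 \<le> a" "a \<le> N"
  shows "lam A \<le> lam a \<Longrightarrow> Q \<kappa> x a A = x a (n + 1)"
    and "0 \<le> lam a \<Longrightarrow> Q \<kappa> x a (n + 1) = - x a (s A)"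
    and "- lam A \<le> lam a \<Longrightarrow> Q \<kappa> x a (s A) = 0"
proof -
  have r: "1 \<le> A" "A \<le> N" "1 \<le> n + 1" "n + 1 \<le> N" using A An Nb by (auto simp: odd_pos Suc_leI)
  have m: "x j (s a) = - x a (s j)" if "1 \<le> j" "j \<le> N" for j
    using mirr[OF a s_range[OF that, THEN conjunct1] s_range[OF that, THEN conjunct2]] s_s[OF that] by simp
  have l: "lam (n + 1) = 0" using lam_s[OF r(3,4)] unfolding s_mid by simp
  note row = row_A[OF A, where y = x and \<kappa> = \<kappa>, unfolded tail0]
  show "lam A \<le> lam a \<Longrightarrow> Q \<kappa> x a A = x a (n + 1)"
    using stab[OF a r(1,2)] unfolding row m[OF r(3,4)] s_mid by simp
  show "0 \<le> lam a \<Longrightarrow> Q \<kappa> x a (n + 1) = - x a (s A)"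
    using stab[OF a r(3,4)] unfolding s_mid row l m[OF r(1,2)] by simp
  show "- lam A \<le> lam a \<Longrightarrow> Q \<kappa> x a (s A) = 0"
    using stab[OF a s_range[OF r(1,2), THEN conjunct1] s_range[OF r(1,2), THEN conjunct2]]
    unfolding s_s[OF r(1,2)] row lam_s[OF r(1,2)] by simp
qed

lemma level_D: "i \<in> D \<Longrightarrow> lam i = 0" "lam (n + 1) = 0"
proof -
  have r: "1 \<le> n + 1" "n + 1 \<le> N" using Nb by auto
  show l: "lam (n + 1) = 0" using lam_s[OF r] unfolding s_mid by simp
  assume "i \<in> D"
  then have i: "1 \<le> i" "i \<le> N" "A < i" "i \<le> n + 1" using range_D[of i] Nb by auto
  show "lam i = 0" using lam_neg[OF i(1,2)] i(3) lam_mono[OF i(4)] l by auto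
qed

lemma columns_D:
  assumes i: "i \<in> D" and a: "1 \<le> a" "a \<le> N" "0 \<le> lam a"
  shows "Q \<kappa> x a i = \<kappa> i * x a i" "Q \<kappa> x a (s i) = - \<kappa> i * x a (s i)"
proof -
  have r: "1 \<le> i" "i \<le> N" using range_D[OF i] Nb by auto
  note sr = s_range[OF r, THEN conjunct1] s_range[OF r, THEN conjunct2]
  have m: "x j (s a) = - x a (s j)" if "1 \<le> j" "j \<le> N" for j
    using mirr[OF a(1,2) s_range[OF that, THEN conjunct1] s_range[OF that, THEN conjunct2]] s_s[OF that] by simp
  note row = row_D[OF i, where y = x and \<kappa> = \<kappa>]
  show "Q \<kappa> x a i = \<kappa> i * x a i"
    using stab[OF a(1,2) r] a(3) unfolding row m[OF sr] s_s[OF r] level_D(1)[OF i] by simp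
  show "Q \<kappa> x a (s i) = - \<kappa> i * x a (s i)"
    using stab[OF a(1,2) sr] a(3) unfolding s_s[OF r] row m[OF r] lam_s[OF r] level_D(1)[OF i] by simp
qed

lemma column_mid:
  assumes A: "even A" and a: "1 \<le> a" "a \<le> N" "0 \<le> lam a"
  shows "Q \<kappa> x a (n + 1) = 0"
proof -
  have r: "1 \<le> n + 1" "n + 1 \<le> N" using Nb by auto
  show ?thesis using stab[OF a(1,2) r] a(3) unfolding s_mid row_mid[OF A] level_D(2) by simp
qed

text \<open>With the parameters of \<open>U\<close> equal to 0 the representing matrix preserves
  each of the sets \<open>P p\<close>, \<open>F\<close> and \<open>H i\<close>, so the relations
  decouple into rectangles of x.\<close>

definition P :: "nat \<Rightarrow> nat set" where "P p = {p, Suc p, s p, s (Suc p)}"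
definition F :: "nat set" where "F = (if odd A then {A, n + 1, s A} else {n + 1})"
definition H :: "nat \<Rightarrow> nat set" where "H i = {i, s i}"

lemma two: "z + z = 0 \<Longrightarrow> z = (0 :: 'k)"
  by (metis mult_2 mult_eq_0_iff zero_neq_numeral)

lemma of_nat_neq_minus: "1 \<le> i \<Longrightarrow> of_nat i \<noteq> - (of_nat j :: 'k)"
proof
  assume i: "1 \<le> i" and "of_nat i = - (of_nat j :: 'k)"
  then have "of_nat (i + j) = (0 :: 'k)" by simp
  then show False using i by (simp only: of_nat_eq_0_iff)
qed

lemma neg_eq: "- z = z \<Longrightarrow> z = (0 :: 'k)"
  by (rule two) (metis add.left_inverse)

lemma cancel: "a = z + b \<Longrightarrow> z + a = b \<Longrightarrow> a = (b :: 'k)"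
proof -
  assume "a = z + b" "z + a = b"
  then have "z + z = 0" by (simp add: add.assoc[symmetric])
  then show ?thesis using two \<open>a = z + b\<close> by simp
qed

lemma C_S: "p \<in> S \<Longrightarrow> C \<kappa> p = of_nat p" "p \<in> T \<Longrightarrow> C \<kappa> p = 0"
  and chi_S: "p \<in> S \<Longrightarrow> chi p = (0 :: 'k)" "p \<in> T \<Longrightarrow> chi p = (1 :: 'k)"
  using ST(1) by (auto simp: C_def chi_def kap)

text \<open>The block from p + 1 to l is one of those recorded in \<open>U\<close>, and up to sign
  the entry is its corner coordinate.\<close>

lemma U_zero:
  assumes "p \<in> T" "Suc p \<le> l" "l \<le> A" "odd l" "lam l = lam (Suc p)" "l = A \<or> lam l \<noteq> lam (Suc l)"
  shows "x (s (Suc p)) (s l) = 0"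
proof -
  have p: "pair p" using assms(1) pair_iff by blast
  note r = range_pair[OF p]
  have l: "last_in (Suc p) = l" by (rule last_in_eqI) (use assms in auto)
  have U: "Suc p \<in> U" using assms r l by (auto simp: U_def T_def pair_def)
  then have "g (Suc p) x = x l (Suc p)" using ST(3) l by (auto simp: g_def)
  moreover have "g (Suc p) x = 0" using U by (intro gz) (simp add: K_def)
  moreover have lr: "1 \<le> l" "l \<le> N" using assms An Nb by auto
  ultimately show ?thesis using mirr[OF lr r(3,4)] by simp
qed

text \<open>In the rows s (p + 1) and s p the levels are so high that all relations are available;
  they express the other entries through the four in these rows and the columns s p', s (p' + 1).
  The four vanish by level unless p + 1 and p' lie in one block, where the kinds of the two pairs
  decide: distinct parameters, further relations, or a coordinate of \<open>U\<close>.\<close>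

lemma pair_pair:
  assumes p: "pair p" and p': "pair p'" and lt: "p < p'" and ij: "i \<in> P p" "j \<in> P p'"
  shows "x i j = 0"
proof -
  note r = range_pair[OF p] and r' = range_pair[OF p']
  have lt': "Suc p < p'" using lt p p' by (metis Suc_lessI even_Suc pair_def)
  have l: "lam (Suc p) \<le> lam p'" using lt' by (intro lam_mono) simp
  let ?q = "Suc p" and ?q' = "Suc p'"
  let ?C = "C \<kappa> p" and ?C' = "C \<kappa> p'"
  have z: "x (s ?q) p' = 0" "x (s ?q) ?q' = 0" "x (s p) p' = 0" "x (s p) ?q' = 0"
    using r r' l by (intro level_zero; simp)+
  have sq: "x p p' = x (s ?q) (s ?q')" "x p ?q' = - x (s ?q) (s p')"
      "x p (s ?q') + ?C * x (s ?q) (s ?q') = ?C' * x (s ?q) (s ?q') - chi p' * x (s ?q) (s p')"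
      "x p (s p') + ?C * x (s ?q) (s p') = - ?C' * x (s ?q) (s p')"
    using columns_pair[OF p' r(11,12)] r r' l unfolding rows[OF p] z by simp_all
  have sp: "- x ?q p' = x (s p) (s ?q')" "- x ?q ?q' = - x (s p) (s p')"
      "- x ?q (s ?q') - ?C * x (s p) (s ?q') - chi p * x (s ?q) (s ?q') = ?C' * x (s p) (s ?q') - chi p' * x (s p) (s p')"
      "- x ?q (s p') - ?C * x (s p) (s p') - chi p * x (s ?q) (s p') = - ?C' * x (s p) (s p')"
    using columns_pair[OF p' r(9,10)] r r' l unfolding rows[OF p] z by simp_all
  have qp: "- ?C * x ?q p' + chi p * x p p' = x ?q (s ?q') + ?C' * x ?q p' + chi p' * x ?q ?q'" if "lam p' \<le> lam ?q"
    using columns_pair(1)[OF p' r(3,4)] that unfolding rows[OF p] by simp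
  have qq: "- ?C * x ?q ?q' + chi p * x p ?q' = - x ?q (s p') - ?C' * x ?q ?q'" if "lam ?q' \<le> lam ?q"
    using columns_pair(2)[OF p' r(3,4)] that unfolding rows[OF p] by simp
  have sp': "x ?q p' = - x (s p) (s ?q')" "x ?q ?q' = x (s p) (s p')"
      "x ?q (s ?q') + ?C * x (s p) (s ?q') = - ?C' * x (s p) (s ?q')" "x ?q (s p') + ?C * x (s p) (s p') = ?C' * x (s p) (s p')"
    if "chi p = (0::'k)" "chi p' = (0::'k)"
  proof -
    have m': "u + v = w" if "- u - v = - w" for u v w :: 'k
    proof -
      have "u + v = - (- u - v)" by simp
      also have "\<dots> = w" unfolding that by simp
      finally show ?thesis .
    qed
    have m: "u + v = - w" if "- u - v = w" for u v w :: 'k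
      unfolding that[symmetric] by simp
    show "x ?q p' = - x (s p) (s ?q')" "x ?q ?q' = x (s p) (s p')" using sp(1,2) by (metis minus_minus)+
    have "x ?q (s ?q') + ?C * x (s p) (s ?q') = - (?C' * x (s p) (s ?q'))"
      by (rule m) (use sp(3) that in simp)
    then show "x ?q (s ?q') + ?C * x (s p) (s ?q') = - ?C' * x (s p) (s ?q')" by simp
    show "x ?q (s p') + ?C * x (s p) (s p') = ?C' * x (s p) (s p')"
      by (rule m') (use sp(4) that in simp)
  qed
  have pp: "?C * x p p' = x p (s ?q') + ?C' * x p p' + chi p' * x p ?q'" if "lam p' \<le> lam p"
    using columns_pair(1)[OF p' r(1,2)] that unfolding rows[OF p] by simp
  have pq: "?C * x p ?q' = - x p (s p') - ?C' * x p ?q'" if "lam ?q' \<le> lam p"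
    using columns_pair(2)[OF p' r(1,2)] that unfolding rows[OF p] by simp
  have four: "x (s ?q) (s p') = 0 \<and> x (s ?q) (s ?q') = 0 \<and> x (s p) (s p') = 0 \<and> x (s p) (s ?q') = 0"
  proof -
    have TT: "x (s ?q) (s ?q') = 0" "x (s p) (s ?q') = 0" if "p' \<in> T"
      using that r r' l by (intro level_zero; auto simp: T_def)+
    have T: "x (s p) (s p') = 0" "x (s p) (s ?q') = 0" if "p \<in> T"
      using that r r' l by (intro level_zero; auto simp: T_def)+
    consider "lam ?q < lam p'" | "lam ?q = lam p'" "p \<in> S" "p' \<in> S" | "lam ?q = lam p'" "p \<in> S" "p' \<in> T"
      | "lam ?q = lam p'" "p \<in> T" "p' \<in> S" | "lam ?q = lam p'" "p \<in> T" "p' \<in> T"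
      using p p' l pair_iff by fastforce
    then show ?thesis
    proof cases
      case 1
      then show ?thesis using r r' by (intro conjI level_zero) auto
    next
      case 2
      have e: "lam p' \<le> lam ?q" "lam ?q' \<le> lam ?q" "lam p' \<le> lam p" "lam ?q' \<le> lam p" using 2 by (auto simp: S_def)
      \<comment> \<open>The parameters are the distinct positive integers p and p', so neither equal
        nor opposite; each of the four entries is killed by their difference or sum.\<close>
      have c: "?C \<noteq> ?C'" "?C \<noteq> - ?C'" "chi p = (0::'k)" "chi p' = (0::'k)"
        using 2 lt of_nat_neq_minus[OF r(1)] by (simp_all add: C_S chi_S)
      have "?C * x (s ?q) (s ?q') = ?C' * x (s ?q) (s ?q')"
        by (rule cancel[where z = "x p (s ?q')"]) (use pp[OF e(3)] sq c in \<open>simp_all add: algebra_simps\<close>)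
      moreover have "?C * x (s ?q) (s p') = - ?C' * x (s ?q) (s p')"
        by (rule cancel[where z = "x p (s p')"]) (use pq[OF e(4)] sq c in \<open>simp_all add: algebra_simps\<close>)
      moreover have "?C * x (s p) (s ?q') = - ?C' * x (s p) (s ?q')"
        by (rule cancel[where z = "x ?q (s ?q')"]) (use qp[OF e(1)] sp'[OF c(3,4)] c in \<open>simp_all add: algebra_simps\<close>)
      moreover have "?C * x (s p) (s p') = ?C' * x (s p) (s p')"
        by (rule cancel[where z = "x ?q (s p')"]) (use qq[OF e(2)] sp'[OF c(3,4)] c in \<open>simp_all add: algebra_simps\<close>)
      ultimately show ?thesis using c by (simp only: mult_cancel_right) blast
    next
      case 3
      have e: "lam p' \<le> lam ?q" "lam p' \<le> lam p" using 3 by (auto simp: S_def)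
      have c: "?C' = 0" "chi p = (0::'k)" "chi p' = (1::'k)" using 3 by (auto simp: C_S chi_S)
      have "x (s ?q) (s p') = 0"
        by (rule cancel[where z = "x p (s ?q')"]) (use pp[OF e(2)] sq c TT[OF 3(3)] in \<open>simp_all add: algebra_simps\<close>)
      moreover have "x (s p) (s p') = 0"
        by (rule cancel[where z = "- x ?q (s ?q')"]) (use qp[OF e(1)] sp c TT[OF 3(3)] in \<open>simp_all add: algebra_simps\<close>)
      ultimately show ?thesis using TT[OF 3(3)] by simp
    next
      case 4
      have e: "lam p' \<le> lam ?q" "lam ?q' \<le> lam ?q" using 4 by (auto simp: S_def)
      have c: "?C = 0" "chi p = (1::'k)" "chi p' = (0::'k)" using 4 by (auto simp: C_S chi_S)
      have "x (s ?q) (s ?q') = 0"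
        by (rule cancel[where z = "x ?q (s ?q')"]) (use qp[OF e(1)] sq(1) sp(1,3) c T[OF 4(2)] in \<open>simp_all add: algebra_simps\<close>)
      moreover have "x (s ?q) (s p') = 0"
        by (rule cancel[where z = "x ?q (s p')"]) (use qq[OF e(2)] sq(2) sp(2,4) c T[OF 4(2)] in \<open>simp_all add: algebra_simps\<close>)
      ultimately show ?thesis using T[OF 4(2)] by simp
    next
      case 5
      \<comment> \<open>Both pairs straddle, so their common block runs from the even index p + 1 to
        the odd index p' and belongs to \<open>U\<close>.\<close>
      have "x (s ?q) (s p') = 0"
        by (rule U_zero) (use 5 lt' r' p' in \<open>auto simp: T_def pair_def\<close>)
      then show ?thesis using T[OF 5(2)] TT[OF 5(3)] by simp
    qed
  qed
  show ?thesis using ij four z sq sp by (auto simp: P_def)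
qed

text \<open>The relations give x_pp = - x_qq for q = p + 1. The opposite equality comes from the
  coordinate \<open>g p\<close> if p is in \<open>S\<close> and from a second relation if p is in
  \<open>T\<close>.\<close>

lemma pair_self:
  assumes p: "pair p" and ij: "i \<in> P p" "j \<in> P p"
  shows "x i j = 0"
proof -
  note r = range_pair[OF p]
  let ?q = "Suc p"
  let ?C = "C \<kappa> p"
  have z: "x (s ?q) p = 0" "x (s ?q) ?q = 0" "x (s p) p = 0" "x (s p) ?q = 0"
    using r by (intro level_zero; simp)+
  have m: "x (s ?q) (s p) = - x p ?q" "x (s ?q) (s ?q) = - x ?q ?q" "x (s p) (s p) = - x p p" "x (s p) (s ?q) = - x ?q p"
      "x ?q (s p) = - x p (s ?q)"
    using mirr[OF r(1-4)] mirr[OF r(3,4) r(3,4)] mirr[OF r(1,2) r(1,2)] mirr[OF r(3,4) r(1,2)] mirr[OF r(1,2) r(11,12)] r(14) by simp_all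
  have a: "x p (s p) = 0" "x ?q (s ?q) = 0" by (rule antidiag)+
  have sq: "x p p = - x ?q ?q"
      "x p (s ?q) - ?C * x ?q ?q = - ?C * x ?q ?q + chi p * x p ?q"
    using columns_pair(1,3)[OF p r(11,12)] r unfolding rows[OF p] z m a by simp_all
  have sqS: "- (?C * x p ?q) = ?C * x p ?q" if "p \<in> S"
    using columns_pair(4)[OF p r(11,12)] r that unfolding rows[OF p] z m a S_def by simp
  have sp: "?C * x ?q p + chi p * x ?q ?q = - ?C * x ?q p + chi p * x p p"
      "x p (s ?q) + ?C * x p p + chi p * x p ?q = ?C * x p p"
    using columns_pair(3,4)[OF p r(9,10)] r unfolding rows[OF p] z m a by simp_all
  have d: "x p p = 0 \<and> x ?q ?q = 0 \<and> x p ?q = 0 \<and> x ?q p = 0 \<and> x p (s ?q) = 0"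
  proof (cases "p \<in> S")
    case True
    have c: "?C \<noteq> 0" "chi p = (0::'k)" using True r(1) by (auto simp: C_S chi_S)
    have "g p x = 0" using True by (intro gz) (simp add: K_def)
    then have e: "x p p = x ?q ?q" using True by (simp add: g_def)
    have "x p p = 0" by (rule cancel[where z = "x ?q ?q"]) (use e sq(1) in simp_all)
    moreover have "?C * x p ?q = 0" by (rule neg_eq[OF sqS[OF True]])
    moreover have "?C * x ?q p = 0" by (rule neg_eq) (use sp(1) c in simp)
    ultimately show ?thesis using c e sq(2) by simp
  next
    case False
    then have T: "p \<in> T" using p pair_iff by auto
    then have c: "?C = 0" "chi p = (1::'k)" by (auto simp: C_S chi_S)
    have "x ?q p = 0" using T r by (intro level_zero) (auto simp: T_def)
    moreover have "x p p = 0" by (rule cancel[where z = "x ?q ?q"]) (use sq(1) sp(1) c in simp_all)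
    moreover have "x p ?q = 0" by (rule cancel[where z = "x p (s ?q)"]) (use sq(2) sp(2) c in simp_all)
    ultimately show ?thesis using sq c by simp
  qed
  show ?thesis using ij z m a d by (auto simp: P_def)
qed

lemma pair_F:
  assumes p: "pair p" and ij: "i \<in> P p" "j \<in> F"
  shows "x i j = 0"
proof (cases "odd A")
  case A: True
  note r = range_pair[OF p]
  have lt: "Suc p < A" using p A by (metis Suc_lessI even_Suc pair_def)
  have l: "lam (Suc p) \<le> lam A" using lt by (intro lam_mono) simp
  have rA: "1 \<le> A" "A \<le> N" using A An Nb by (auto simp: odd_pos Suc_leI)
  have lA: "lam A < 0" using lam_neg[OF rA] by simp
  let ?q = "Suc p" and ?C = "C \<kappa> p"
  note lz = level_D(2) lam_s[OF rA]
  have z: "x (s ?q) A = 0" "x (s p) A = 0" "x (s ?q) (n + 1) = 0" "x (s p) (n + 1) = 0"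
    using r l lA lz by (intro level_zero; simp)+
  have sq: "x p A = 0" "x p (n + 1) = - x (s ?q) (s A)" "x p (s A) + ?C * x (s ?q) (s A) = 0"
    using columns_A[OF A r(11,12)] r l lA unfolding rows[OF p] z by simp_all
  have sp: "x ?q A = 0" "- x ?q (n + 1) = - x (s p) (s A)" "- x ?q (s A) - ?C * x (s p) (s A) - chi p * x (s ?q) (s A) = 0"
    using columns_A[OF A r(9,10)] r l lA unfolding rows[OF p] z by simp_all
  have two: "x (s ?q) (s A) = 0 \<and> x (s p) (s A) = 0"
  proof -
    consider "lam ?q < lam A" | "lam ?q = lam A" "p \<in> S" | "lam ?q = lam A" "p \<in> T"
      using l p pair_iff by fastforce
    then show ?thesis
    proof cases
      case 1
      then show ?thesis using r lz by (intro conjI level_zero) auto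
    next
      case 2
      have e: "lam A \<le> lam p" "lam A \<le> lam ?q" using 2 by (auto simp: S_def)
      have c: "chi p = (0::'k)" using 2 by (auto simp: chi_S)
      have "?C * x p A = x p (n + 1)" "- ?C * x ?q A + chi p * x p A = x ?q (n + 1)"
        using columns_A(1)[OF A r(1,2) e(1)] columns_A(1)[OF A r(3,4) e(2)] unfolding rows[OF p] by simp_all
      then show ?thesis using sq sp c by simp
    next
      case 3
      have "x (s ?q) (s A) = 0" by (rule U_zero) (use 3 lt A in auto)
      moreover have "x (s p) (s A) = 0" using 3 r lz by (intro level_zero) (auto simp: T_def)
      ultimately show ?thesis by blast
    qed
  qed
  show ?thesis using ij A z sq sp two by (auto simp: P_def F_def)
next
  case A: False
  then have A: "even A" by simp
  note r = range_pair[OF p]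
  have z: "x (s (Suc p)) (n + 1) = 0" "x (s p) (n + 1) = 0"
    using r level_D(2) by (intro level_zero; simp)+
  have "x p (n + 1) = 0" "x (Suc p) (n + 1) = 0"
    using column_mid[OF A r(11,12)] column_mid[OF A r(9,10)] r unfolding rows[OF p] z by simp_all
  then show ?thesis using ij A z by (auto simp: P_def F_def)
qed

lemma pair_D:
  assumes p: "pair p" and k: "k \<in> D" and ij: "i \<in> P p" "j \<in> H k"
  shows "x i j = 0"
proof -
  note r = range_pair[OF p]
  have rk: "1 \<le> k" "k \<le> N" using range_D[OF k] Nb by auto
  have z: "x (s (Suc p)) k = 0" "x (s p) k = 0" "x (s (Suc p)) (s k) = 0" "x (s p) (s k) = 0"
    using r level_D(1)[OF k] lam_s[OF rk] by (intro level_zero; simp)+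
  have "x p k = 0" "x (Suc p) k = 0" "x p (s k) = 0" "x (Suc p) (s k) = 0"
    using columns_D[OF k r(11,12)] columns_D[OF k r(9,10)] r unfolding rows[OF p] z by simp_all
  then show ?thesis using ij z by (auto simp: P_def H_def)
qed

lemma F_self:
  assumes ij: "i \<in> F" "j \<in> F"
  shows "x i j = 0"
proof (cases "odd A")
  case A: True
  have rA: "1 \<le> A" "A \<le> N" "1 \<le> n + 1" "n + 1 \<le> N" using A An Nb by (auto simp: odd_pos Suc_leI)
  have lA: "lam A < 0" using lam_neg[OF rA(1,2)] by simp
  note sr = s_range[OF rA(1,2), THEN conjunct1] s_range[OF rA(1,2), THEN conjunct2]
  note lz = level_D(2) lam_s[OF rA(1,2)]
  note row = row_A[OF A, where y = x and \<kappa> = \<kappa>, unfolded tail0]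
  have z: "x (n + 1) A = 0" "x (s A) A = 0" "x (s A) (n + 1) = 0" using lz lA by (intro level_zero; simp)+
  have a: "x (n + 1) (n + 1) = 0" "x A (s A) = 0" using antidiag[of "n + 1"] antidiag[of A] unfolding s_mid by auto
  have "x A A = 0" using columns_A(1)[OF A rA(3,4)] lA lz unfolding row a by simp
  moreover have "x (n + 1) (s A) = 0" using columns_A(3)[OF A sr] lz unfolding row by simp
  moreover have "x (s A) (s A) = - x A A" "x (n + 1) (s A) = - x A (n + 1)"
    using mirr[OF rA(1,2) rA(1,2)] mirr[OF rA] unfolding s_mid by auto
  ultimately show ?thesis using ij A z a by (auto simp: F_def)
next
  case False
  then show ?thesis using ij antidiag[of "n + 1"] unfolding s_mid by (auto simp: F_def)
qed

lemma F_D: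
  assumes k: "k \<in> D" and ij: "i \<in> F" "j \<in> H k"
  shows "x i j = 0"
proof -
  have rk: "1 \<le> k" "k \<le> N" and rn: "1 \<le> n + 1" "n + 1 \<le> N" using range_D[OF k] Nb by auto
  note lk = level_D(1)[OF k] lam_s[OF rk] level_D(2)
  have kap0: "\<kappa> k \<noteq> 0" using k rk by (simp add: kap)
  show ?thesis
  proof (cases "odd A")
    case A: True
    have rA: "1 \<le> A" "A \<le> N" using A An Nb by (auto simp: odd_pos Suc_leI)
    have lA: "lam A < 0" using lam_neg[OF rA] by simp
    note sr = s_range[OF rA, THEN conjunct1] s_range[OF rA, THEN conjunct2]
    note row = row_A[OF A, where y = x and \<kappa> = \<kappa>, unfolded tail0]
    have z: "x (s A) k = 0" "x (s A) (s k) = 0" using lk lA lam_s[OF rA] by (intro level_zero; simp)+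
    have "x (n + 1) k = 0" "x (n + 1) (s k) = 0"
      using columns_D[OF k sr] lam_s[OF rA] lA unfolding row z by simp_all
    moreover from this have "x A k = 0" "x A (s k) = 0"
      using columns_D[OF k rn] lk unfolding row by simp_all
    ultimately show ?thesis using ij A z by (auto simp: F_def H_def)
  next
    case False
    then have A: "even A" by simp
    have "x (n + 1) k = 0" "x (n + 1) (s k) = 0"
      using columns_D[OF k rn] lk kap0 unfolding row_mid[OF A] by simp_all
    then show ?thesis using ij A by (auto simp: F_def H_def)
  qed
qed

lemma D_D:
  assumes k: "k \<in> D" "l \<in> D" and ij: "i \<in> H k" "j \<in> H l"
  shows "x i j = 0"
proof -
  have rk: "1 \<le> k" "k \<le> N" and rl: "1 \<le> l" "l \<le> N" using range_D[OF k(1)] range_D[OF k(2)] Nb by auto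
  note sk = s_range[OF rk, THEN conjunct1] s_range[OF rk, THEN conjunct2]
  note lev = level_D(1)[OF k(1)] level_D(1)[OF k(2)] lam_s[OF rk]
  have kp: "\<kappa> k = of_nat k" "\<kappa> l = of_nat l" using k by (simp_all add: kap)
  have s: "of_nat k + of_nat l \<noteq> (0 :: 'k)" using rk by (metis add_is_0 not_one_le_zero of_nat_add of_nat_eq_0_iff)
  have e: "(of_nat k - of_nat l) * x k l = 0" "(of_nat k + of_nat l) * x k (s l) = 0"
    "(of_nat k + of_nat l) * x (s k) l = 0" "(of_nat k - of_nat l) * x (s k) (s l) = 0"
    using columns_D[OF k(2) rk] columns_D[OF k(2) sk] lev unfolding row_D[OF k(1)] kp
    by (auto simp: algebra_simps neg_eq_iff_add_eq_0 eq_neg_iff_add_eq_0)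
  have d: "x k k = 0"
  proof -
    have "g k x = 0" using k by (intro gz) (simp add: K_def)
    moreover have "k \<notin> S" using k ST by auto
    ultimately show ?thesis using k by (simp add: g_def)
  qed
  have "x (s k) (s k) = 0" using mirr[OF rk rk] d by simp
  then show ?thesis using ij e s d by (cases "k = l") (auto simp: H_def)
qed

lemma cover: "1 \<le> i \<Longrightarrow> i \<le> N \<Longrightarrow> (\<exists>p. pair p \<and> i \<in> P p) \<or> i \<in> F \<or> (\<exists>k\<in>D. i \<in> H k)"
proof -
  assume i: "1 \<le> i" "i \<le> N"
  have low: "(\<exists>p. pair p \<and> (j = p \<or> j = Suc p)) \<or> (odd A \<and> j = A) \<or> j \<in> D" if "1 \<le> j" "j \<le> n" for j
  proof -
    consider "A < j" | "j = A" "odd A" | "j \<le> A" "even j" | "odd j" "j < A" using that by (cases "A < j"; cases "j = A"; cases "odd j") auto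
    then show ?thesis
    proof cases
      case 3
      then have "pair (j - 1)" "j = Suc (j - 1)" using that by (auto simp: pair_def)
      then show ?thesis by blast
    qed (use that in \<open>auto simp: D_def pair_def\<close>)
  qed
  consider "i \<le> n" | "i = n + 1" | "n + 1 < i" by linarith
  then show ?thesis
  proof cases
    case 1
    then show ?thesis using low[OF i(1)] by (auto simp: P_def F_def H_def)
  next
    case 2
    then show ?thesis by (simp add: F_def)
  next
    case 3
    have si: "1 \<le> s i" "s i \<le> n" and ssi: "i = s (s i)" using 3 i Nb by (auto simp: s_def)
    from low[OF si] show ?thesis
    proof (elim disjE exE conjE)
      fix p assume "pair p" "s i = p"
      then show ?thesis using ssi by (intro disjI1 exI[of _ p]) (simp add: P_def)
    next
      fix p assume "pair p" "s i = Suc p"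
      then show ?thesis using ssi by (intro disjI1 exI[of _ p]) (simp add: P_def)
    next
      assume "odd A" "s i = A"
      then show ?thesis using ssi by (simp add: F_def)
    next
      assume "s i \<in> D"
      then show ?thesis using ssi by (intro disjI2 bexI[of _ "s i"]) (simp_all add: H_def)
    qed
  qed
qed

theorem zero: "x = 0"
proof -
  have sP: "s i \<in> P p" if p: "pair p" "i \<in> P p" for p i
    using p(2) unfolding P_def insert_iff empty_iff by (elim disjE) (simp_all only: range_pair(13,14)[OF p(1)] simp_thms)
  have sF: "s i \<in> F" if i: "i \<in> F" for i
  proof (cases "odd A")
    case True
    then have A: "1 \<le> A" "A \<le> N" using An Nb by (auto simp: odd_pos Suc_leI)
    show ?thesis using i True s_mid s_s[OF A] by (auto simp: F_def)
  next
    case False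
    then show ?thesis using i s_mid by (simp add: F_def)
  qed
  have sH: "s i \<in> H k" if k: "k \<in> D" "i \<in> H k" for k i
  proof -
    have "1 \<le> k" "k \<le> N" using range_D[OF k(1)] Nb by auto
    then have "s (s k) = k" by (rule s_s)
    then show ?thesis using k(2) unfolding H_def insert_iff empty_iff by (elim disjE) simp_all
  qed
  have "x i j = 0" if i: "1 \<le> i" "i \<le> N" and j: "1 \<le> j" "j \<le> N" for i j
  proof -
    have m: "x i j = - x (s j) (s i)" using mirr[OF i j] by simp
    show ?thesis using cover[OF i]
    proof (elim disjE exE conjE bexE)
      fix p assume p: "pair p" "i \<in> P p"
      show ?thesis using cover[OF j]
      proof (elim disjE exE conjE bexE)
        fix p' assume p': "pair p'" "j \<in> P p'"
        consider "p < p'" | "p = p'" | "p' < p" by linarith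
        then show ?thesis
        proof cases
          case 1 then show ?thesis by (rule pair_pair[OF p(1) p'(1) _ p(2) p'(2)])
        next
          case 2 then show ?thesis using pair_self[OF p] p' by simp
        next
          case 3 then show ?thesis unfolding m using pair_pair[OF p'(1) p(1) _ sP[OF p'] sP[OF p]] by simp
        qed
      next
        assume "j \<in> F"
        then show ?thesis by (rule pair_F[OF p])
      next
        fix k assume k: "k \<in> D" "j \<in> H k"
        show ?thesis by (rule pair_D[OF p(1) k(1) p(2) k(2)])
      qed
    next
      assume i: "i \<in> F"
      show ?thesis using cover[OF j]
      proof (elim disjE exE conjE bexE)
        fix p' assume p': "pair p'" "j \<in> P p'"
        show ?thesis unfolding m using pair_F[OF p'(1) sP[OF p'] sF[OF i]] by simp
      next
        assume "j \<in> F"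
        then show ?thesis by (rule F_self[OF i])
      next
        fix k assume k: "k \<in> D" "j \<in> H k"
        show ?thesis by (rule F_D[OF k(1) i k(2)])
      qed
    next
      fix k assume k: "k \<in> D" "i \<in> H k"
      show ?thesis using cover[OF j]
      proof (elim disjE exE conjE bexE)
        fix p' assume p': "pair p'" "j \<in> P p'"
        show ?thesis unfolding m using pair_D[OF p'(1) k(1) sP[OF p'] sH[OF k]] by simp
      next
        assume j: "j \<in> F"
        show ?thesis unfolding m using F_D[OF k(1) sF[OF j] sH[OF k]] by simp
      next
        fix l assume l: "l \<in> D" "j \<in> H l"
        show ?thesis by (rule D_D[OF k(1) l(1) k(2) l(2)])
      qed
    qed
  qed
  then have "x i j = 0" for i j using so_support[OF so, of i j] by (cases "x i j = 0") auto
  then show ?thesis by (intro ext) simp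
qed

end

section \<open>Explicit stabiliser elements along the slice of a parabolic\<close>

lemma linear_forms_rules:
  assumes "h \<in> linear_forms (UNIV :: 'k::field matrix set)"
  shows "h (x + y) = h x + h y" "h (x - y) = h x - h y" "h (mscale c x) = c * h x"
  using linear_formsD[OF assms] linear_forms_diff[OF assms mat_vs.subspace_UNIV] by simp_all

context parabolic
begin

abbreviation "par \<equiv> incidence N (\<lambda>i j. lam i \<le> lam j)"

lemma g_linear: "g k \<in> linear_forms (UNIV :: 'k::field_char_0 matrix set)"
  by (simp add: linear_forms_def g_def mscale_def algebra_simps)

lemma link_linear: "link \<in> linear_forms (UNIV :: 'k::field_char_0 matrix set)"
  by (simp add: linear_forms_def link_def mscale_def sum.distrib sum_distrib_left algebra_simps)

lemma f_linear: "f \<kappa> \<in> linear_forms (UNIV :: 'k::field_char_0 matrix set)"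
  unfolding f_def by (rule linear_forms_UNIV_sum[OF link_linear g_linear])

lemma par_lie: "matrix_lie_algebra N (par :: 'k::field_char_0 matrix set)"
  by (rule matrix_lie_algebra_incidence) (rule order_trans)

lemma unit_in_par:
  assumes "1 \<le> c" "c \<le> N" "1 \<le> d" "d \<le> N" "lam c \<le> lam d"
  shows "(so_unit N c d :: 'k::field_char_0 matrix) \<in> par"
  by (rule so_unit_in_incidence[OF assms(1-4)]) (use assms lam_mirror in simp_all)

lemma par_zero: "y \<in> par \<Longrightarrow> lam j < lam i \<Longrightarrow> y i j = 0"
  unfolding incidence_def mem_Collect_eq by (metis not_le)

lemma bracket_form_linear: "(\<lambda>X. f \<kappa> (bracket N y X)) \<in> linear_forms (UNIV :: 'k::field_char_0 matrix set)"
  unfolding linear_forms_def by (simp add: bracket_add_right bracket_scale_right linear_forms_rules[OF f_linear])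

lemma in_stabiliser:
  fixes X :: "'k::field_char_0 matrix"
  assumes "X \<in> par" "\<And>y. y \<in> par \<Longrightarrow> f \<kappa> (bracket N y X) = 0"
  shows "X \<in> stabiliser N par (f \<kappa>)"
  unfolding stabiliser_def
proof (intro CollectI conjI ballI assms(1))
  fix y :: "'k matrix" assume "y \<in> par"
  then show "f \<kappa> (bracket N X y) = 0"
    using assms(2)[of y] linear_forms_uminus[OF f_linear, of "bracket N y X" \<kappa>] by (simp add: bracket_swap[of N y X])
qed

text \<open>A root vector of weight e_i + e_j, where e_(s i) is read as -e_i; for indices in range
  it is antisymmetric in i and j.\<close>

definition W :: "nat \<Rightarrow> nat \<Rightarrow> 'k::field_char_0 matrix" where "W i j = so_unit N i (s j)"

lemma W_bracket:
  fixes y :: "'k::field_char_0 matrix"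
  assumes "y \<in> so N" "1 \<le> i" "i \<le> N" "1 \<le> j" "j \<le> N"
  shows "f \<kappa> (bracket N y (W i j)) = Q \<kappa> y (s j) i - Q \<kappa> y (s i) j"
  unfolding W_def using f_bracket[OF assms(1-3), of "s j"] s_range[OF assms(4,5)] s_s[OF assms(4,5)] by simp

lemma W_in_par:
  assumes "1 \<le> i" "i \<le> N" "1 \<le> j" "j \<le> N" "lam i \<le> - lam j"
  shows "(W i j :: 'k::field_char_0 matrix) \<in> par"
  unfolding W_def using assms s_range[OF assms(3,4)] lam_s[OF assms(3,4)] by (intro unit_in_par) auto

lemma tail_zero:
  assumes "y \<in> par" "1 \<le> i" "i \<le> N" "lam m < - lam i"
  shows "tail \<kappa> y i m = (0 :: 'k::field_char_0)"
  unfolding tail_def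
proof (intro sum.neutral ballI)
  fix k assume k: "k \<in> U"
  have r: "1 \<le> k" "k \<le> A" "k \<le> N" using range_U[OF k] An Nb by auto
  have "y (s k) m = 0" if "i = last_in k"
    by (rule par_zero[OF assms(1)]) (use assms(4) that last_in(3)[OF r(1,2)] lam_s[OF r(1,3)] in simp)
  then show "(if i = last_in k then \<kappa> k * y (s k) m else 0) = 0" by simp
qed

lemma U_unique:
  assumes k: "k \<in> U" "u \<in> U" "last_in k = last_in u"
  shows "k = u"
proof -
  have lt: "k' \<ge> u'" if u: "u' \<in> U" "k' \<in> U" "last_in k' = last_in u'" for k' u'
  proof (rule ccontr)
    assume "\<not> k' \<ge> u'"
    then have "k' \<le> u' - 1" by simp
    then have "lam k' \<le> lam (u' - 1)" "lam (u' - 1) \<le> lam u'" by (auto intro: lam_mono)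
    moreover have "lam k' = lam u'" using range_U[OF u(1)] range_U[OF u(2)] last_in(3)[of k'] last_in(3)[of u'] u(3) by simp
    ultimately show False using u(1) by (simp add: U_def)
  qed
  show ?thesis using lt[OF k(2,1,3)] lt[OF k(1,2) k(3)[symmetric]] by simp
qed

lemma tail_last:
  assumes "u \<in> U"
  shows "tail \<kappa> y (last_in u) m = \<kappa> u * y (s u) m"
proof -
  have "tail \<kappa> y (last_in u) m = (\<Sum>k\<in>U. if k = u then \<kappa> u * y (s u) m else 0)"
    unfolding tail_def using U_unique assms by (intro sum.cong refl) auto
  then show ?thesis using assms finites by simp
qed

text \<open>The first term has entry -1 at the corner (last_in u, u), which is what
  \<open>g u\<close> detects. The other terms without \<kappa> cancel its effect on the cascade
  entries of the pairs at the two ends of the block, and those with \<kappa> cancel the effect of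
  the parameter at u. If the block ends at A there is no pair to its right and n + 1 takes that
  place.\<close>

definition Xu :: "(nat \<Rightarrow> 'k) \<Rightarrow> nat \<Rightarrow> 'k::field_char_0 matrix" where
  "Xu \<kappa> u = (let l = u - 1; l' = last_in u; u' = Suc l' in
     if l' < A then W (s u) l' - W u l' - W l u' - W l (s u') + mscale (\<kappa> u / 2) (W l' u' + W l' (s u') - W l u + W l (s u))
     else W (s u) A - W u A - W l (n + 1) + mscale (\<kappa> u) (W A (n + 1)) - mscale (\<kappa> u / 2) (W l u - W l (s u)))"

lemma Xu_stabiliser:
  fixes \<kappa> :: "nat \<Rightarrow> 'k::field_char_0"
  assumes u: "u \<in> U"
  shows "Xu \<kappa> u \<in> stabiliser N par (f \<kappa>)"
proof -
  define l where "l = u - 1"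
  define l' where "l' = last_in u"
  define u' where "u' = Suc l'"
  have ru: "2 \<le> u" "u \<le> A" "even u" "odd l'" "u < l'" "l' \<le> A" using range_U[OF u] by (auto simp: l'_def)
  have ul: "u = Suc l" using ru by (simp add: l_def)
  have lam_l': "lam l' = lam u" using last_in(3)[of u] ru by (simp add: l'_def)
  have lam_l: "lam l < lam u" using u lam_mono[of l u] by (auto simp: U_def l_def)
  have r: "1 \<le> l" "l \<le> N" "1 \<le> u" "u \<le> N" "1 \<le> l'" "l' \<le> N" "1 \<le> u'" "u' \<le> N" using ru An Nb by (auto simp: l_def u'_def)
  have lam_u: "lam u < 0" using lam_neg[OF r(3,4)] ru by simp
  have "odd l" "l < A" using ru by (simp_all add: l_def)
  then have pl: "pair l" "l \<in> T" using lam_l unfolding ul by (simp_all add: pair_def T_def)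
  note sr = s_range[OF r(1,2)] s_range[OF r(3,4)] s_range[OF r(5,6)] s_range[OF r(7,8)]
  note ss = s_s[OF r(1,2)] s_s[OF r(3,4)] s_s[OF r(5,6)] s_s[OF r(7,8)]
  note ls = lam_s[OF r(1,2)] lam_s[OF r(3,4)] lam_s[OF r(5,6)] lam_s[OF r(7,8)]
  have cl: "C \<kappa> l = 0" "chi l = (1::'k)" using pl ST(1) by (auto simp: C_def chi_def)
  interpret matrix_lie_algebra N "par :: 'k matrix set" by (rule par_lie)
  note closed = mat_vs.subspace_add[OF subspace] mat_vs.subspace_diff[OF subspace] mat_vs.subspace_scale[OF subspace]
  have tl: "tail \<kappa> y l' m = \<kappa> u * y (s u) m" for y m unfolding l'_def by (rule tail_last[OF u])
  note rowl = row_p(2-4)[OF pl(1), where \<kappa> = \<kappa>, folded ul, unfolded cl mult_zero_left mult_1_left minus_zero add_0_left add_0_right diff_zero]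
  have Xu: "Xu \<kappa> u = (if l' < A then W (s u) l' - W u l' - W l u' - W l (s u') + mscale (\<kappa> u / 2) (W l' u' + W l' (s u') - W l u + W l (s u))
     else W (s u) A - W u A - W l (n + 1) + mscale (\<kappa> u) (W A (n + 1)) - mscale (\<kappa> u / 2) (W l u - W l (s u)))"
    unfolding Xu_def l_def l'_def u'_def Let_def ..
  have e7: "f \<kappa> (bracket N y (W l u)) = y l l + y u u"
    and e8: "f \<kappa> (bracket N y (W l (s u))) = y l l + y (s u) (s u)" if y: "y \<in> par" for y
  proof -
    have so: "y \<in> so N" using y by (simp add: incidence_def)
    have lz: "y i j = 0" if "lam j < lam i" for i j by (rule par_zero[OF y that])
    have z: "y (s u) u = 0" "y l' l = 0" using lam_u lam_l lam_l' ls by (auto intro: lz)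
    have a: "y u (s u) = 0" unfolding s_def by (rule so_antidiagonal[OF so])
    have t: "tail \<kappa> y l u = 0" "tail \<kappa> y l (s u) = 0" using lam_l lam_u ls by (auto intro: tail_zero[OF y r(1,2)])
    show "f \<kappa> (bracket N y (W l u)) = y l l + y u u"
      unfolding W_bracket[OF so r(1-4)] rowl z t by simp
    show "f \<kappa> (bracket N y (W l (s u))) = y l l + y (s u) (s u)"
      unfolding W_bracket[OF so r(1,2) conjunct1[OF sr(2)] conjunct2[OF sr(2)]] ss rowl t a
      using u z by (simp add: l'_def)
  qed
  show ?thesis
  proof (cases "l' < A")
    case True
    have pl': "pair l'" using ru True by (simp add: pair_def)
    have lam_u': "lam u < lam u'"
    proof -
      have "lam u' \<noteq> lam u" using last_in(4)[of u u'] True ru by (auto simp: l'_def u'_def)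
      moreover have "lam l' \<le> lam u'" by (rule lam_mono) (simp add: u'_def)
      ultimately show ?thesis using lam_l' by simp
    qed
    have lam_u0: "lam u' < 0" using lam_neg[OF r(7,8)] True by (simp add: u'_def)
    have "l' \<in> T" using pl' lam_u' lam_l' by (auto simp: T_def u'_def)
    then have cl': "C \<kappa> l' = 0" "chi l' = (1::'k)" using ST(1) by (auto simp: C_def chi_def)
    note rowl' = row_p(2-4)[OF pl', where \<kappa> = \<kappa>, folded u'_def, unfolded cl' tl mult_zero_left mult_1_left minus_zero add_0_left add_0_right diff_zero]
    have ux: "Xu \<kappa> u = W (s u) l' - W u l' - W l u' - W l (s u') + mscale (\<kappa> u / 2) (W l' u' + W l' (s u') - W l u + W l (s u))"
      unfolding Xu using True by simp
    have "Xu \<kappa> u \<in> par" unfolding ux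
      by (intro closed W_in_par) (use r sr ls lam_u lam_l lam_l' lam_u' lam_u0 in auto)
    then show ?thesis
    proof (rule in_stabiliser)
      fix y :: "'k matrix" assume y: "y \<in> par"
      have so: "y \<in> so N" using y by (simp add: incidence_def)
      have lz: "y i j = 0" if "lam j < lam i" for i j by (rule par_zero[OF y that])
      have z: "y (s u) u = 0" "y l' l = 0" "y u' u = 0" "y (s u') u = 0" "y (s u) u' = 0" "y (s u) (s u') = 0" "y (s u') u' = 0"
        using lam_u lam_l lam_l' lam_u' lam_u0 ls by (auto intro: lz)
      have zl: "y (last_in u') l = 0" "y (last_in u') l' = 0" if "u' \<in> U"
        using last_in(3)[of u'] range_U[OF that] lam_l lam_u' lam_l' by (auto intro: lz)
      have a: "y u (s u) = 0" "y u' (s u') = 0" unfolding s_def by (rule so_antidiagonal[OF so])+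
      have t: "tail \<kappa> y l u' = 0" "tail \<kappa> y l (s u') = 0" using lam_l lam_u' lam_u0 ls by (auto intro: tail_zero[OF y r(1,2)])
      have m: "y u' (s u) = - y u (s u')" "y (s u') (s u) = - y u u'" "y (s u) (s u) = - y u u" "y (s u') (s u') = - y u' u'"
        using mirror[OF so r(3,4) conjunct1[OF sr(4)] conjunct2[OF sr(4)]] mirror[OF so r(3,4) r(7,8)] mirror[OF so r(3,4) r(3,4)]
          mirror[OF so r(7,8) r(7,8)] unfolding ss by auto
      have e1: "f \<kappa> (bracket N y (W (s u) l')) = y u (s u') + y u u' + \<kappa> u * y u u - y l l' - \<kappa> u * y l' l'"
        unfolding W_bracket[OF so conjunct1[OF sr(2)] conjunct2[OF sr(2)] r(5,6)] ss rowl rowl' m using u by (simp add: l'_def)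
      have e2: "f \<kappa> (bracket N y (W u l')) = - y l l'"
        unfolding W_bracket[OF so r(3,4) r(5,6)] rowl rowl' z by simp
      have e3: "f \<kappa> (bracket N y (W l u')) = y u u'"
        unfolding W_bracket[OF so r(1,2) r(7,8)] rowl rowl' z t by simp
      have e4: "f \<kappa> (bracket N y (W l (s u'))) = y u (s u')"
        unfolding W_bracket[OF so r(1,2) conjunct1[OF sr(4)] conjunct2[OF sr(4)]] ss rowl rowl' z t using zl by simp
      have e5: "f \<kappa> (bracket N y (W l' u')) = y l' l' + y u' u'"
        unfolding W_bracket[OF so r(5,6) r(7,8)] rowl' z by simp
      have e6: "f \<kappa> (bracket N y (W l' (s u'))) = y l' l' - y u' u'"
        unfolding W_bracket[OF so r(5,6) conjunct1[OF sr(4)] conjunct2[OF sr(4)]] ss rowl' z a m using zl by simp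
      show "f \<kappa> (bracket N y (Xu \<kappa> u)) = 0"
        unfolding ux linear_forms_rules[OF bracket_form_linear] e1 e2 e3 e4 e5 e6 e7[OF y] e8[OF y] m
        by (simp add: field_simps)
    qed
  next
    case False
    then have A: "l' = A" "odd A" using ru by auto
    have rz: "1 \<le> n + 1" "n + 1 \<le> N" using Nb by auto
    have lam_z: "lam (n + 1) = 0" using lam_s[OF rz] unfolding s_mid by simp
    note rowA = row_A(2,3)[OF A(2), where \<kappa> = \<kappa>, unfolded tl[unfolded A(1)]]
    have ux: "Xu \<kappa> u = W (s u) A - W u A - W l (n + 1) + mscale (\<kappa> u) (W A (n + 1)) - mscale (\<kappa> u / 2) (W l u - W l (s u))"
      unfolding Xu using False by simp
    have rA: "1 \<le> A" "A \<le> N" using r A by auto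
    have lA: "lam A = lam u" using lam_l' A by simp
    note sA = s_range[OF rA] s_s[OF rA]
    have "Xu \<kappa> u \<in> par" unfolding ux
      by (intro closed W_in_par) (use r rA rz sr ls lam_z lam_u lam_l lA in auto)
    then show ?thesis
    proof (rule in_stabiliser)
      fix y :: "'k matrix" assume y: "y \<in> par"
      have so: "y \<in> so N" using y by (simp add: incidence_def)
      have lz: "y i j = 0" if "lam j < lam i" for i j by (rule par_zero[OF y that])
      have z: "y (s u) u = 0" "y A l = 0" "y (n + 1) u = 0" "y (s u) (n + 1) = 0"
        using lam_u lam_l lA lam_z ls by (auto intro: lz)
      have a: "y (n + 1) (n + 1) = 0" using so_antidiagonal[OF so, of "n + 1"] s_mid unfolding s_def by metis
      have t: "tail \<kappa> y l (n + 1) = 0" using lam_l lam_u lam_z by (intro tail_zero[OF y r(1,2)]) simp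
      have m: "y (n + 1) (s u) = - y u (n + 1)" "y (s u) (s u) = - y u u"
        using mirror[OF so r(3,4) rz] mirror[OF so r(3,4) r(3,4)] unfolding s_mid by auto
      have e1: "f \<kappa> (bracket N y (W (s u) A)) = y u (n + 1) + \<kappa> u * y u u - y l A - \<kappa> u * y A A"
        unfolding W_bracket[OF so conjunct1[OF sr(2)] conjunct2[OF sr(2)] rA] ss rowl rowA m using u A(1) by (simp add: l'_def)
      have e2: "f \<kappa> (bracket N y (W u A)) = - y l A"
        unfolding W_bracket[OF so r(3,4) rA] rowl rowA z by simp
      have e3: "f \<kappa> (bracket N y (W l (n + 1))) = y u (n + 1)"
        unfolding W_bracket[OF so r(1,2) rz] s_mid rowl rowA z t by simp
      have e4: "f \<kappa> (bracket N y (W A (n + 1))) = y A A"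
        unfolding W_bracket[OF so rA rz] s_mid rowA z a by simp
      show "f \<kappa> (bracket N y (Xu \<kappa> u)) = 0"
        unfolding ux linear_forms_rules[OF bracket_form_linear] e1 e2 e3 e4 e7[OF y] e8[OF y] m
        by (simp add: field_simps)
    qed
  qed
qed

definition X :: "(nat \<Rightarrow> 'k) \<Rightarrow> nat \<Rightarrow> 'k::field_char_0 matrix" where
  "X \<kappa> k = (if k \<in> S then so_unit N k k - so_unit N (Suc k) (Suc k) else if k \<in> D then so_unit N k k else Xu \<kappa> k)"

lemma X_stabiliser:
  fixes \<kappa> :: "nat \<Rightarrow> 'k::field_char_0"
  assumes k: "k \<in> K"
  shows "X \<kappa> k \<in> stabiliser N par (f \<kappa>)"
proof -
  interpret matrix_lie_algebra N "par :: 'k matrix set" by (rule par_lie)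
  consider "k \<in> S" | "k \<in> D" "k \<notin> S" | "k \<in> U" "k \<notin> S" "k \<notin> D" using k ST by (auto simp: K_def)
  then show ?thesis
  proof cases
    case 1
    have r: "1 \<le> k" "k \<le> N" "1 \<le> Suc k" "Suc k \<le> N" using range_S[of k] 1 An Nb by auto
    have p: "pair k" using 1 by (simp add: S_def)
    have odd: "odd k" using p by (simp add: pair_def)
    have nU: "Suc k \<notin> U" using 1 by (auto simp: U_def S_def)
    have c: "chi k = (0::'k)" using 1 ST(1) by (auto simp: chi_def)
    have X: "X \<kappa> k = so_unit N k k - so_unit N (Suc k) (Suc k)" using 1 by (simp add: X_def)
    have "X \<kappa> k \<in> par" unfolding X using r by (intro mat_vs.subspace_diff[OF subspace] unit_in_par) auto
    then show ?thesis
    proof (rule in_stabiliser)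
      fix y :: "'k matrix" assume y: "y \<in> par"
      have so: "y \<in> so N" using y by (simp add: incidence_def)
      have lk: "lam k < 0" using lam_neg[OF r(1,2)] range_S[of k] 1 by auto
      have t: "tail \<kappa> y k (s k) = 0"
        unfolding tail_def
      proof (intro sum.neutral ballI)
        fix j assume j: "j \<in> U"
        have rj: "1 \<le> j" "j \<le> A" using range_U[OF j] by auto
        have "last_in j \<noteq> k"
        proof
          assume e: "last_in j = k"
          have "Suc k \<le> k"
            using last_in(3,4)[OF rj] 1 e range_S[of k] by (auto simp: S_def)
          then show False by simp
        qed
        then show "(if k = last_in j then \<kappa> j * y (s j) (s k) else 0) = 0" by simp
      qed
      have m: "y (s k) (s k) = - y k k" "y (s (Suc k)) (s (Suc k)) = - y (Suc k) (Suc k)"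
        "y (Suc k) (s k) = - y k (s (Suc k))"
        using mirror[OF so r(1,2) r(1,2)] mirror[OF so r(3,4) r(3,4)]
          mirror[OF so r(1,2) conjunct1[OF s_range[OF r(3,4)]] conjunct2[OF s_range[OF r(3,4)]]] s_s[OF r(3,4)] by auto
      show "f \<kappa> (bracket N y (X \<kappa> k)) = 0"
        unfolding X linear_forms_rules[OF bracket_form_linear] f_bracket[OF so r(1,2) r(1,2)] f_bracket[OF so r(3,4) r(3,4)]
          row_p[OF p] t m c using nU by (simp add: algebra_simps)
    qed
  next
    case 2
    have r: "1 \<le> k" "k \<le> N" using range_D[of k] 2 Nb by auto
    have X: "X \<kappa> k = so_unit N k k" using 2 by (simp add: X_def)
    have "X \<kappa> k \<in> par" unfolding X using r by (intro unit_in_par) auto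
    then show ?thesis
    proof (rule in_stabiliser)
      fix y :: "'k matrix" assume y: "y \<in> par"
      have so: "y \<in> so N" using y by (simp add: incidence_def)
      have m: "y (s k) (s k) = - y k k" by (rule mirror[OF so r r])
      show "f \<kappa> (bracket N y (X \<kappa> k)) = 0"
        unfolding X f_bracket[OF so r r] row_D[OF 2(1)] m by simp
    qed
  next
    case 3
    then show ?thesis using Xu_stabiliser[OF 3(1)] by (simp add: X_def)
  qed
qed

lemma g_unit:
  assumes j: "j \<in> K" and cd: "1 \<le> c" "c \<le> n" "c < d" "d \<le> N"
  shows "g j (so_unit N c d :: 'k::field_char_0 matrix) = 0"
proof -
  have d: "(so_unit N c d :: 'k matrix) i i = 0" if "i \<le> n" for i
  proof (rule ccontr)
    assume "(so_unit N c d :: 'k matrix) i i \<noteq> 0"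
    from so_unit_support[OF this] show False using that cd Nb by auto
  qed
  have u: "(so_unit N c d :: 'k matrix) (last_in j) j = 0" if "j \<in> U"
  proof (rule ccontr)
    assume "(so_unit N c d :: 'k matrix) (last_in j) j \<noteq> 0"
    from so_unit_support[OF this] show False using range_U[OF that] cd An Nb by auto
  qed
  show ?thesis using j d range_S[of j] range_D[of j] u An by (auto simp: g_def K_def)
qed

lemma g_diag:
  assumes j: "j \<in> K" and c: "1 \<le> c" "c \<le> n"
  shows "g j (so_unit N c c :: 'k::field_char_0 matrix) =
    (if j \<in> S then (if j = c then 1 else 0) - (if Suc j = c then 1 else 0) else if j \<in> D \<and> j = c then 1 else 0)"
proof -
  have d: "(so_unit N c c :: 'k matrix) i i = (if i = c then 1 else 0)" if "i \<le> n" for i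
    unfolding so_unit_apply using that c Nb by auto
  have u: "(so_unit N c c :: 'k matrix) (last_in j) j = 0" if "j \<in> U"
  proof (rule ccontr)
    assume "(so_unit N c c :: 'k matrix) (last_in j) j \<noteq> 0"
    from so_unit_support[OF this] show False using range_U[OF that] c An Nb by auto
  qed
  show ?thesis using j d range_S[of j] range_D[of j] u An ST by (auto simp: g_def K_def)
qed

lemma g_Xu:
  fixes \<kappa> :: "nat \<Rightarrow> 'k::field_char_0"
  assumes u: "u \<in> U" and j: "j \<in> K"
  shows "g j (Xu \<kappa> u) = (if j = u then - 1 else 0)"
proof -
  define l where "l = u - 1"
  define l' where "l' = last_in u"
  have ru: "2 \<le> u" "u \<le> A" "u < l'" "l' \<le> A" using range_U[OF u] by (auto simp: l'_def)
  have small: "g j (W c d :: 'k matrix) = 0" if "1 \<le> c" "c \<le> n" "1 \<le> d" "c + d \<le> N" for c d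
    unfolding W_def using that by (intro g_unit[OF j]) (auto simp: s_def)
  have main: "g j (W (s u) l' :: 'k matrix) = (if j = u then - 1 else 0)"
  proof -
    have e: "N + 1 - s l' = l'" "N + 1 - s u = u" using ru An Nb by (auto simp: s_def)
    have d: "(so_unit N (s u) (s l') :: 'k matrix) i i = 0" if "i \<le> n" for i
    proof (rule ccontr)
      assume "(so_unit N (s u) (s l') :: 'k matrix) i i \<noteq> 0"
      from so_unit_support[OF this, unfolded e] show False using that ru An Nb by (auto simp: s_def)
    qed
    have v: "(so_unit N (s u) (s l') :: 'k matrix) (last_in j) j = (if j = u then - 1 else 0)" if jU: "j \<in> U"
    proof -
      have "j \<noteq> s l'" using range_U[OF jU] ru An Nb by (auto simp: s_def)
      moreover have "last_in j = l' \<and> j = u \<longleftrightarrow> j = u" by (auto simp: l'_def)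
      ultimately show ?thesis unfolding so_unit_apply e by simp
    qed
    have nu: "u \<notin> S" "u \<notin> D" using u ST by auto
    show ?thesis unfolding W_def using j d v range_S[of j] range_D[of j] An nu by (auto simp: g_def K_def)
  qed
  have r: "1 \<le> l" "l \<le> n" "l + (n + 1) \<le> N" "u + l' \<le> N" "l + u \<le> N" "l + s u \<le> N" "1 \<le> s u" "u \<le> n" "l' \<le> n" "l' + (n + 1) \<le> N"
    using ru An Nb by (auto simp: s_def l_def)
  have r': "l + Suc l' \<le> N" "l + s (Suc l') \<le> N" "l' + Suc l' \<le> N" "l' + s (Suc l') \<le> N" "1 \<le> s (Suc l')" if "l' < A"
    using that ru An Nb by (auto simp: s_def l_def)
  show ?thesis
  proof (cases "l' < A")
    case True
    have "Xu \<kappa> u = W (s u) l' - W u l' - W l (Suc l') - W l (s (Suc l'))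
        + mscale (\<kappa> u / 2) (W l' (Suc l') + W l' (s (Suc l')) - W l u + W l (s u))"
      using True by (simp add: Xu_def l_def l'_def Let_def)
    then show ?thesis
      using r r'[OF True] ru by (simp add: linear_forms_rules[OF g_linear] main small)
  next
    case False
    then have A: "l' = A" using ru by simp
    have "Xu \<kappa> u = W (s u) l' - W u l' - W l (n + 1) + mscale (\<kappa> u) (W l' (n + 1)) - mscale (\<kappa> u / 2) (W l u - W l (s u))"
      using False A by (simp add: Xu_def l_def l'_def Let_def)
    then show ?thesis
      using r ru by (simp add: linear_forms_rules[OF g_linear] main small)
  qed
qed

text \<open>Coordinates and elements are dual up to the factors 2, 1 and -1 on \<open>S\<close>,
  \<open>D\<close> and \<open>U\<close>; this yields independence for all parameters at
  once.\<close>

lemma g_X: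
  fixes \<kappa> :: "nat \<Rightarrow> 'k::field_char_0"
  assumes j: "j \<in> K" and k: "k \<in> K"
  shows "j \<noteq> k \<Longrightarrow> g j (X \<kappa> k) = 0" "g k (X \<kappa> k) \<noteq> 0"
proof -
  have "g j (X \<kappa> k) = (if j = k then (if k \<in> S then 2 else if k \<in> D then 1 else -1) else 0)" if j: "j \<in> K" for j
  proof -
    consider "k \<in> S" | "k \<in> D" "k \<notin> S" | "k \<in> U" "k \<notin> S" "k \<notin> D" using k ST by (auto simp: K_def)
    then show ?thesis
    proof cases
      case 1
      have r: "1 \<le> k" "k \<le> n" "1 \<le> Suc k" "Suc k \<le> n" using range_S[of k] 1 An by auto
      have o: "odd k" "j \<in> S \<Longrightarrow> odd j" "Suc k \<notin> D" "k \<notin> D" "Suc k \<notin> S" using range_S[of k] range_S[of j] 1 range_D[of "Suc k"] range_D[of k] range_S[of "Suc k"] by auto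
      have "j \<in> S \<Longrightarrow> Suc j \<noteq> k \<and> j \<noteq> Suc k" using o by auto
      then show ?thesis using 1 o g_diag[OF j r(1,2), where 'k = 'k] g_diag[OF j r(3,4), where 'k = 'k]
        by (auto simp: X_def linear_forms_rules[OF g_linear])
    next
      case 2
      have r: "1 \<le> k" "k \<le> n" using range_D[of k] 2 by auto
      have "j \<in> S \<Longrightarrow> Suc j \<noteq> k" using range_S[of j] range_D[OF 2(1)] by auto
      then show ?thesis using 2 g_diag[OF j r, where 'k = 'k] ST by (auto simp: X_def)
    next
      case 3
      then show ?thesis using g_Xu[OF 3(1) j, of \<kappa>] by (simp add: X_def)
    qed
  qed
  from this[OF j] this[OF k] show "j \<noteq> k \<Longrightarrow> g j (X \<kappa> k) = 0" "g k (X \<kappa> k) \<noteq> 0" by auto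
qed

theorem has_slice_parabolic: "has_slice N (par :: 'k::field_char_0 matrix set) K"
proof -
  \<comment> \<open>The parameters of the base point, as demanded by
    \<open>parabolic_kernel\<close>. Adding slice directions to f \<kappa>0 only changes the
    parameters, so the elements \<open>X\<close> cover the whole family.\<close>
  define \<kappa>0 :: "nat \<Rightarrow> 'k" where "\<kappa>0 k = (if k \<in> U then 0 else of_nat k)" for k
  have slice: "(\<lambda>x. f \<kappa>0 x + (\<Sum>k\<in>K. c k * g k x)) = f (\<lambda>k. \<kappa>0 k + c k)" for c
    by (intro ext) (simp add: f_def distrib_right sum.distrib)
  have ind: "independent_family K (X \<kappa>)" for \<kappa> :: "nat \<Rightarrow> 'k"
    unfolding independent_family_def
  proof (intro allI impI ballI)
    fix d k assume d: "(\<Sum>k\<in>K. mscale (d k) (X \<kappa> k)) = 0" and k: "k \<in> K"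
    have "0 = g k (\<Sum>j\<in>K. mscale (d j) (X \<kappa> j))"
      unfolding d by (rule linear_forms_zero[OF g_linear mat_vs.subspace_UNIV, symmetric])
    also have "\<dots> = (\<Sum>j\<in>K. d j * g k (X \<kappa> j))" by (rule linear_forms_sum[OF g_linear mat_vs.subspace_UNIV]) simp
    also have "\<dots> = (\<Sum>j\<in>K. if j = k then d k * g k (X \<kappa> k) else 0)"
      using g_X(1)[OF k] by (intro sum.cong refl) auto
    finally show "d k = 0" using k finites g_X(2)[OF k k, of \<kappa>] by simp
  qed
  have ker: "x = 0" if x: "x \<in> stabiliser N par (f \<kappa>0)" and gx: "\<forall>k\<in>K. g k x = 0" for x
  proof -
    have xp: "x \<in> par" and st: "\<And>y. y \<in> par \<Longrightarrow> f \<kappa>0 (bracket N x y) = 0" using x by (auto simp: stabiliser_def)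
    have so: "x \<in> so N" using xp by (simp add: incidence_def)
    interpret parabolic_kernel n N A lam x \<kappa>0
    proof
      show "x \<in> so N" by (rule so)
      show "x i j \<noteq> 0 \<Longrightarrow> lam i \<le> lam j" for i j using xp by (simp add: incidence_def)
      show "k \<in> S \<union> D \<Longrightarrow> \<kappa>0 k = of_nat k" "k \<in> U \<Longrightarrow> \<kappa>0 k = 0" for k using ST by (auto simp: \<kappa>0_def)
      show "k \<in> K \<Longrightarrow> g k x = 0" for k using gx by simp
      fix i j assume ij: "1 \<le> i" "i \<le> N" "1 \<le> j" "j \<le> N" "lam j \<le> lam i"
      note si = s_range[OF ij(1,2), THEN conjunct1] s_range[OF ij(1,2), THEN conjunct2]
      note sj = s_range[OF ij(3,4), THEN conjunct1] s_range[OF ij(3,4), THEN conjunct2]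
      have "(so_unit N (s i) (s j) :: 'k matrix) \<in> par" using ij lam_s[OF ij(1,2)] lam_s[OF ij(3,4)] by (intro unit_in_par[OF si sj]) simp
      from st[OF this] show "Q \<kappa>0 x i j = Q \<kappa>0 x (s j) (s i)"
        unfolding f_bracket[OF so si sj] s_s[OF ij(1,2)] s_s[OF ij(3,4)] by simp
    qed
    show ?thesis by (rule zero)
  qed
  have "\<exists>X. (\<forall>k\<in>K. X k \<in> stabiliser N par (\<lambda>x. f \<kappa>0 x + (\<Sum>k\<in>K. c k * g k x))) \<and> independent_family K X" for c
    unfolding slice using X_stabiliser[of _ "\<lambda>k. \<kappa>0 k + c k"] ind[of "\<lambda>k. \<kappa>0 k + c k"] by (intro exI[of _ "X (\<lambda>k. \<kappa>0 k + c k)"]) simp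
  then show ?thesis unfolding has_slice_def
    using ker by (intro exI[of _ "f \<kappa>0"] exI[of _ g] conjI ballI allI impI f_linear g_linear) simp_all
qed

end

section \<open>The size of the slice of a parabolic\<close>

lemma lev_neg: "2 * sum_list a < N \<Longrightarrow> 1 \<le> i \<Longrightarrow> i \<le> N \<Longrightarrow> lev N a i < 0 \<longleftrightarrow> i \<le> sum_list a"
proof (induction a arbitrary: N i)
  case (Cons x a)
  then show ?case using Cons.IH[of "N - 2 * x" "i - x"] by auto
qed simp

text \<open>Counterpart of \<open>S\<close> for a tail of the composition: t indices have been
  peeled off before, so parity is that of p + t while p counts from the beginning of the
  tail.\<close>

definition inS :: "nat \<Rightarrow> (nat \<Rightarrow> int) \<Rightarrow> nat \<Rightarrow> nat \<Rightarrow> bool" where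
  "inS t f m p \<longleftrightarrow> 1 \<le> p \<and> p < m \<and> odd (p + t) \<and> f p = f (Suc p)"

definition inU :: "nat \<Rightarrow> (nat \<Rightarrow> int) \<Rightarrow> nat \<Rightarrow> nat \<Rightarrow> bool" where
  "inU t f m u \<longleftrightarrow> 1 \<le> u \<and> u \<le> m \<and> even (u + t) \<and> (u = 1 \<or> f (u - 1) \<noteq> f u) \<and>
     (\<exists>l. u \<le> l \<and> l \<le> m \<and> f l = f u \<and> (l = m \<or> f l \<noteq> f (Suc l)) \<and> odd (l + t))"

context
  fixes f f' :: "nat \<Rightarrow> int" and x m :: nat and v :: int
  assumes head: "\<And>p. p \<le> x \<Longrightarrow> f p = v" and shifted: "\<And>p. 1 \<le> p \<Longrightarrow> p \<le> m \<Longrightarrow> f (p + x) = f' p"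
    and neq: "\<And>p. f' p \<noteq> v"
begin

lemma at_border: "0 < m \<Longrightarrow> f (Suc x) \<noteq> v"
  using shifted[of 1] neq[of 1] by simp

lemma inS_low:
  assumes "p \<le> x"
  shows "inS t f (x + m) p \<longleftrightarrow> 1 \<le> p \<and> p < x \<and> odd (p + t)"
proof (cases "p = x")
  case True
  then show ?thesis using at_border head[of x] by (auto simp: inS_def)
next
  case False
  then show ?thesis using assms head[of p] head[of "Suc p"] by (auto simp: inS_def)
qed

lemma inS_high:
  assumes "1 \<le> p"
  shows "inS t f (x + m) (p + x) \<longleftrightarrow> inS (t + x) f' m p"
proof (cases "p < m")
  case True
  then show ?thesis using assms shifted[of p] shifted[of "Suc p"] by (auto simp: inS_def ac_simps)
qed (auto simp: inS_def)

text \<open>Only the first index of the head block can start a block; it counts if, in the original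
  numbering, it is even and the last index of the block is odd.\<close>

lemma inU_low:
  assumes "u \<le> x"
  shows "inU t f (x + m) u \<longleftrightarrow> u = 1 \<and> odd t \<and> odd (x + t)"
proof
  assume U: "inU t f (x + m) u"
  have u1: "u = 1" using U head[of "u - 1"] head[OF assms] assms by (auto simp: inU_def)
  obtain l where l: "u \<le> l" "l \<le> x + m" "f l = f u" "l = x + m \<or> f l \<noteq> f (Suc l)" "odd (l + t)"
    using U unfolding inU_def by blast
  have fl: "f l = v" using l(3) head[OF assms] by simp
  have "l \<le> x"
  proof (rule ccontr)
    assume "\<not> l \<le> x"
    then have "1 \<le> l - x" "l - x \<le> m" "l - x + x = l" using l(2) by auto
    then show False using shifted[of "l - x"] fl neq[of "l - x"] by simp
  qed
  moreover have "\<not> l < x" using l(4) fl head[of "Suc l"] by auto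
  ultimately show "u = 1 \<and> odd t \<and> odd (x + t)" using u1 l U by (auto simp: inU_def)
next
  assume h: "u = 1 \<and> odd t \<and> odd (x + t)"
  have "x = x + m \<or> f x \<noteq> f (Suc x)" using at_border head[of x] by auto
  moreover have "f x = f u" using head[OF assms] head[of x] by simp
  ultimately show "inU t f (x + m) u" using h assms unfolding inU_def by (auto intro!: exI[of _ x])
qed

lemma inU_high:
  assumes u1: "1 \<le> u"
  shows "inU t f (x + m) (u + x) \<longleftrightarrow> inU (t + x) f' m u"
proof (cases "u \<le> m")
  case u: True
  have pred: "(u + x = 1 \<or> f (u + x - 1) \<noteq> f (u + x)) \<longleftrightarrow> (u = 1 \<or> f' (u - 1) \<noteq> f' u)"
  proof (cases "u = 1")
    case True
    then show ?thesis using shifted[OF u1 u] head[of x] neq[of u] by simp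
  next
    case False
    then have "u + x - 1 = (u - 1) + x" using u1 by simp
    then show ?thesis using False u1 u shifted[OF u1 u] shifted[of "u - 1"] by simp
  qed
  have ex: "(\<exists>l. u + x \<le> l \<and> l \<le> x + m \<and> f l = f (u + x) \<and> (l = x + m \<or> f l \<noteq> f (Suc l)) \<and> odd (l + t)) \<longleftrightarrow>
      (\<exists>l. u \<le> l \<and> l \<le> m \<and> f' l = f' u \<and> (l = m \<or> f' l \<noteq> f' (Suc l)) \<and> odd (l + (t + x)))" (is "?L \<longleftrightarrow> ?R")
  proof
    assume ?L
    then obtain l where l: "u + x \<le> l" "l \<le> x + m" "f l = f (u + x)" "l = x + m \<or> f l \<noteq> f (Suc l)" "odd (l + t)" by blast
    define k where "k = l - x"
    have k: "l = k + x" "u \<le> k" "k \<le> m" "1 \<le> k" using l u1 by (auto simp: k_def)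
    have "k = m \<or> f' k \<noteq> f' (Suc k)"
      using l(4) shifted[OF k(4,3)] shifted[of "Suc k"] k by (cases "k = m") auto
    then show ?R using l k shifted[OF k(4,3)] shifted[OF u1 u] by (intro exI[of _ k]) (auto simp: ac_simps)
  next
    assume ?R
    then obtain k where k: "u \<le> k" "k \<le> m" "f' k = f' u" "k = m \<or> f' k \<noteq> f' (Suc k)" "odd (k + (t + x))" by blast
    have k1: "1 \<le> k" using k u1 by simp
    have "k + x = x + m \<or> f (k + x) \<noteq> f (Suc (k + x))"
      using k shifted[OF k1 k(2)] shifted[of "Suc k"] by (cases "k = m") auto
    then show ?L using k shifted[OF k1 k(2)] shifted[OF u1 u] by (intro exI[of _ "k + x"]) (auto simp: ac_simps)
  qed
  show ?thesis unfolding inU_def pred ex using u u1 by (simp add: ac_simps)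
qed (auto simp: inU_def)

end

lemma card_odd_below: "card {p. 1 \<le> p \<and> p < x \<and> odd (p + t)} = (if even t then x div 2 else (x - 1) div 2)"
proof (cases "even t")
  case True
  have "{p. 1 \<le> p \<and> p < x \<and> odd (p + t)} = (\<lambda>k. 2 * k + 1) ` {..<x div 2}"
  proof (intro equalityI subsetI)
    fix p assume "p \<in> {p. 1 \<le> p \<and> p < x \<and> odd (p + t)}"
    then show "p \<in> (\<lambda>k. 2 * k + 1) ` {..<x div 2}" using True by (intro image_eqI[of _ _ "p div 2"]) (auto elim!: oddE)
  qed (use True in auto)
  then show ?thesis using True by (simp add: card_image inj_on_def)
next
  case False
  have "{p. 1 \<le> p \<and> p < x \<and> odd (p + t)} = (\<lambda>k. 2 * k + 2) ` {..<(x - 1) div 2}"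
  proof (intro equalityI subsetI)
    fix p assume "p \<in> {p. 1 \<le> p \<and> p < x \<and> odd (p + t)}"
    then show "p \<in> (\<lambda>k. 2 * k + 2) ` {..<(x - 1) div 2}" using False by (intro image_eqI[of _ _ "p div 2 - 1"]) (auto elim!: evenE)
  qed (use False in auto)
  then show ?thesis using False by (simp add: card_image inj_on_def)
qed

text \<open>Every block contributes x div 2. The pairs inside it number x div 2, except that they
  fall one short when the length is even and positive and the start even; exactly then the block
  contributes to \<open>U\<close>.\<close>

lemma card_inS_inU: "2 * sum_list a \<le> N \<Longrightarrow> card {p. inS t (lev N a) (sum_list a) p \<or> inU t (lev N a) (sum_list a) p} = (\<Sum>x\<leftarrow>a. x div 2)"
proof (induction a arbitrary: N t)
  case Nil
  then show ?case by (simp add: inS_def inU_def)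
next
  case (Cons x a)
  let ?f = "lev N (x # a)" and ?f' = "lev (N - 2 * x) a" and ?m = "sum_list a" and ?v = "- (1 + int (length a))"
  let ?B = "{p. 1 \<le> p \<and> p < x \<and> odd (p + t)}"
  let ?E = "if 1 \<le> x \<and> odd t \<and> odd (x + t) then {1 :: nat} else {}"
  let ?M = "{p. inS (t + x) ?f' ?m p \<or> inU (t + x) ?f' ?m p}"
  have le: "2 * (x + sum_list a) \<le> N" using Cons.prems by simp
  have head: "?f p = ?v" if "p \<le> x" for p using that by simp
  have sh: "?f (p + x) = ?f' p" if "1 \<le> p" "p \<le> ?m" for p using that le by simp
  have neq: "?f' p \<noteq> ?v" for p using lev_bounds(1)[of a "N - 2 * x" p] by linarith
  have low: "inS t ?f (x + ?m) p \<longleftrightarrow> 1 \<le> p \<and> p < x \<and> odd (p + t)" "inU t ?f (x + ?m) p \<longleftrightarrow> p = 1 \<and> odd t \<and> odd (x + t)"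
    if "p \<le> x" for p
    by (rule inS_low[OF _ _ _ that, where f' = ?f' and v = ?v] inU_low[OF _ _ _ that, where f' = ?f' and v = ?v]; simp only: head sh neq not_False_eq_True)+
  have high: "inS t ?f (x + ?m) (p + x) \<longleftrightarrow> inS (t + x) ?f' ?m p" "inU t ?f (x + ?m) (p + x) \<longleftrightarrow> inU (t + x) ?f' ?m p"
    if "1 \<le> p" for p
    by (rule inS_high[OF _ _ _ that, where f' = ?f' and v = ?v] inU_high[OF _ _ _ that, where f' = ?f' and v = ?v]; simp only: head sh neq not_False_eq_True)+
  have fM: "finite ?M" by (rule finite_subset[of _ "{..sum_list a}"]) (auto simp: inS_def inU_def)
  have fB: "finite ?B" by (rule finite_subset[of _ "{..x}"]) auto
  have eq: "{p. inS t ?f (x + ?m) p \<or> inU t ?f (x + ?m) p} = (?B \<union> ?E) \<union> (\<lambda>p. p + x) ` ?M"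
  proof (rule Set.set_eqI)
    fix p
    show "p \<in> {p. inS t ?f (x + ?m) p \<or> inU t ?f (x + ?m) p} \<longleftrightarrow> p \<in> (?B \<union> ?E) \<union> (\<lambda>p. p + x) ` ?M"
    proof (cases "p \<le> x")
      case True
      have "p \<notin> (\<lambda>p. p + x) ` ?M" using True by (auto simp: inS_def inU_def)
      then show ?thesis unfolding mem_Collect_eq low[OF True] using True by auto
    next
      case False
      define p' where "p' = p - x"
      have p': "p = p' + x" "1 \<le> p'" using False by (auto simp: p'_def)
      have "p \<in> (\<lambda>p. p + x) ` ?M \<longleftrightarrow> p' \<in> ?M" unfolding p'(1) by auto
      moreover have "p \<notin> ?B \<union> ?E" using False by auto
      ultimately show ?thesis unfolding p'(1) mem_Collect_eq high[OF p'(2)] by simp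
    qed
  qed
  have BE: "card (?B \<union> ?E) = x div 2"
  proof -
    have "card (?B \<union> ?E) = card ?B + card ?E" by (intro card_Un_disjoint fB) auto
    also have "\<dots> = x div 2" unfolding card_odd_below by (cases x) auto
    finally show ?thesis .
  qed
  have "card {p. inS t ?f (x + ?m) p \<or> inU t ?f (x + ?m) p} = card (?B \<union> ?E) + card ((\<lambda>p. p + x) ` ?M)"
    unfolding eq
  proof (rule card_Un_disjoint)
    show "finite (?B \<union> ?E)" using fB by simp
    show "finite ((\<lambda>p. p + x) ` ?M)" using fM by simp
    show "(?B \<union> ?E) \<inter> (\<lambda>p. p + x) ` ?M = {}" by (auto simp: inS_def inU_def split: if_splits)
  qed
  also have "card ((\<lambda>p. p + x) ` ?M) = card ?M" by (rule card_image) (simp add: inj_on_def)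
  also have "card ?M = (\<Sum>x\<leftarrow>a. x div 2)" by (rule Cons.IH) (use Cons.prems in simp)
  finally show ?case unfolding BE by (simp del: lev.simps)
qed

lemma has_slice_base:
  assumes a: "sum_list a \<le> n"
  obtains K where "finite K" "0 \<notin> K" "has_slice (2 * n + 1) (sw n a [] :: 'k::field_char_0 matrix set) K"
    "card K = (\<Sum>x\<leftarrow>a. x div 2) + (n - sum_list a)"
proof -
  define N where "N = 2 * n + 1"
  define lam where "lam = lev N a"
  define A where "A = sum_list a"
  interpret parabolic n N A lam
  proof
    have "2 * sum_list a \<le> N" "2 * sum_list a < N" using a by (simp_all add: N_def)
    then show "1 \<le> i \<Longrightarrow> i \<le> N \<Longrightarrow> lam (N + 1 - i) = - lam i" "1 \<le> i \<Longrightarrow> i \<le> N \<Longrightarrow> (lam i < 0) = (i \<le> A)" for i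
      unfolding lam_def A_def using lev_mirror[of a N i] lev_neg[of a N i] by blast+
    show "i \<le> j \<Longrightarrow> lam i \<le> lam j" for i j unfolding lam_def by (rule lev_mono)
  qed (simp_all add: N_def A_def a)
  have sw: "sw n a [] = (par :: 'k matrix set)"
    unfolding sw_def lam_def N_def by (simp only: lev.simps(1) order_refl simp_thms)
  have slice: "has_slice (2 * n + 1) (sw n a [] :: 'k matrix set) K"
    unfolding sw N_def[symmetric] by (rule has_slice_parabolic)
  have S: "S = {p. inS 0 (lam) (A) p}"
    by (auto simp: S_def pair_def inS_def odd_pos Suc_leI)
  have U: "U = {p. inU 0 (lam) (A) p}"
  proof (intro equalityI subsetI)
    fix u assume u: "u \<in> U"
    note r = range_U[OF u]
    have r': "1 \<le> u" "u \<le> A" using r by auto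
    have "last_in u = A \<or> lam (last_in u) \<noteq> lam (Suc (last_in u))"
      using last_in(4)[OF r', of "Suc (last_in u)"] last_in(2,3)[OF r'] by (auto simp del: lev.simps)
    then show "u \<in> {p. inU 0 (lam) (A) p}"
      using u r last_in[OF r'] by (auto simp: inU_def U_def simp del: lev.simps intro!: exI[of _ "last_in u"])
  next
    fix u assume "u \<in> {p. inU 0 (lam) (A) p}"
    then have u: "1 \<le> u" "u \<le> A" "even u" "u = 1 \<or> lam (u - 1) \<noteq> lam u"
      and "\<exists>l. u \<le> l \<and> l \<le> A \<and> lam l = lam u \<and>
        (l = A \<or> lam l \<noteq> lam (Suc l)) \<and> odd l"
      by (auto simp: inU_def simp del: lev.simps)
    then obtain l where l: "u \<le> l" "l \<le> A" "lam l = lam u"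
        "l = A \<or> lam l \<noteq> lam (Suc l)" "odd l" by blast
    have "last_in u = l" by (rule last_in_eqI[OF u(1) l(1-4)])
    then show "u \<in> U" using u l(5) by (auto simp: U_def simp del: lev.simps)
  qed
  have "card K = card (S \<union> U) + card D"
  proof -
    have "K = (S \<union> U) \<union> D" by (auto simp: K_def)
    then show ?thesis using finites ST by (simp only:) (intro card_Un_disjoint; auto)
  qed
  moreover have "card (S \<union> U) = (\<Sum>x\<leftarrow>a. x div 2)"
  proof -
    have "S \<union> U = {p. inS 0 (lam) (A) p \<or> inU 0 (lam) (A) p}" unfolding S U by auto
    then show ?thesis using card_inS_inU[of a N 0] An Nb unfolding lam_def A_def by simp
  qed
  moreover have "D = {A<..n}" by (auto simp: D_def)
  ultimately have "card K = (\<Sum>x\<leftarrow>a. x div 2) + (n - A)" by simp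
  moreover have "0 \<notin> K" using range_S[of 0] range_D[of 0] range_U[of 0] by (auto simp: K_def)
  ultimately show ?thesis using that[OF finites(5) _ slice] unfolding A_def by blast
qed

subsection \<open>Pairs of involutions commuting with the reflection\<close>

text \<open>Both images are in bijection with the same partition of \<open>A\<close> into
  fibres.\<close>

lemma card_image_cong_iff:
  assumes "\<And>x y. x \<in> A \<Longrightarrow> y \<in> A \<Longrightarrow> f x = f y \<longleftrightarrow> h x = h y"
  shows "card (f ` A) = card (h ` A)"
proof (rule bij_betw_same_card[of "\<lambda>z. h (SOME x. x \<in> A \<and> f x = z)"])
  have e: "h (SOME y. y \<in> A \<and> f y = f x) = h x" if "x \<in> A" for x
  proof -
    have "(SOME y. y \<in> A \<and> f y = f x) \<in> A \<and> f (SOME y. y \<in> A \<and> f y = f x) = f x"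
      by (rule someI[of _ x]) (use that in simp)
    then show ?thesis using assms that by blast
  qed
  show "bij_betw (\<lambda>z. h (SOME x. x \<in> A \<and> f x = z)) (f ` A) (h ` A)"
    unfolding bij_betw_def
  proof
    show "inj_on (\<lambda>z. h (SOME x. x \<in> A \<and> f x = z)) (f ` A)" using assms e by (auto simp: inj_on_def)
    show "(\<lambda>z. h (SOME x. x \<in> A \<and> f x = z)) ` f ` A = h ` A" using e by (auto simp: image_iff)
  qed
qed

text \<open>An abstract meander graph: \<open>u\<close> and \<open>l\<close> send a vertex to the
  other end of its upper and lower arc, and a vertex without such an arc to itself.\<close>

locale mirror_system =
  fixes M :: nat and u l :: "nat \<Rightarrow> nat"
  assumes u_range: "i \<in> {1..M} \<Longrightarrow> u i \<in> {1..M}" and l_range: "i \<in> {1..M} \<Longrightarrow> l i \<in> {1..M}"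
    and u_u: "i \<in> {1..M} \<Longrightarrow> u (u i) = i" and l_l: "i \<in> {1..M} \<Longrightarrow> l (l i) = i"
    and u_mirror: "i \<in> {1..M} \<Longrightarrow> u (M + 1 - i) = M + 1 - u i"
    and l_mirror: "i \<in> {1..M} \<Longrightarrow> l (M + 1 - i) = M + 1 - l i"
begin

definition rev :: "nat \<Rightarrow> nat" where "rev i = M + 1 - i"
definition orb :: "(nat \<times> nat) set" where "orb = {(i, j). i \<in> {1..M} \<and> (j = u i \<or> j = l i)}\<^sup>*"
text \<open>A vertex lacking an arc on one side is an end of a path, so the classes containing a
  flag are the segments and the others the cycles (\<open>classify\<close>).\<close>

definition flag :: "nat \<Rightarrow> bool" where "flag v \<longleftrightarrow> v \<in> {1..M} \<and> (u v = v \<or> l v = v)"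
definition flagged :: "nat \<Rightarrow> bool" where "flagged i \<longleftrightarrow> (\<exists>v. flag v \<and> (i, v) \<in> orb)"
definition cls :: "nat \<Rightarrow> nat set" where "cls i = orb `` {i}"
text \<open>Twice the right-hand side of the index formula, restricted to the components that meet
  \<open>H\<close>.\<close>

definition J :: "nat set \<Rightarrow> nat" where
  "J H = 2 * card (cls ` {i \<in> H. \<not> flagged i}) + card (cls ` {i \<in> H. flagged i \<and> (i, rev i) \<notin> orb})"

lemma rev_range: "i \<in> {1..M} \<Longrightarrow> rev i \<in> {1..M}" and rev_rev: "i \<in> {1..M} \<Longrightarrow> rev (rev i) = i"
  by (auto simp: rev_def)

lemma u_rev: "i \<in> {1..M} \<Longrightarrow> u (rev i) = rev (u i)" and l_rev: "i \<in> {1..M} \<Longrightarrow> l (rev i) = rev (l i)"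
  unfolding rev_def by (rule u_mirror l_mirror; assumption)+

lemma orb_refl [simp]: "(i, i) \<in> orb"
  by (simp add: orb_def)

lemma orb_u: "i \<in> {1..M} \<Longrightarrow> (i, u i) \<in> orb" and orb_l: "i \<in> {1..M} \<Longrightarrow> (i, l i) \<in> orb"
  by (auto simp: orb_def)

lemma orb_trans: "(i, j) \<in> orb \<Longrightarrow> (j, k) \<in> orb \<Longrightarrow> (i, k) \<in> orb"
  unfolding orb_def by (rule rtrancl_trans)

lemma orb_induct [consumes 2, case_names base u l]:
  assumes "(i, j) \<in> orb" "i \<in> {1..M}" "P i"
    and "\<And>j. j \<in> {1..M} \<Longrightarrow> (i, j) \<in> orb \<Longrightarrow> P j \<Longrightarrow> P (u j)"
    and "\<And>j. j \<in> {1..M} \<Longrightarrow> (i, j) \<in> orb \<Longrightarrow> P j \<Longrightarrow> P (l j)"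
  shows "P j"
  using assms(1) unfolding orb_def
proof (induction rule: rtrancl_induct)
  case (step y z)
  have "(i, y) \<in> orb" using step.hyps(1) by (simp only: orb_def)
  then show ?case using step.hyps(2) step.IH assms(4,5) by auto
qed (rule assms(3))

lemma orb_range:
  assumes "(i, j) \<in> orb" "i \<in> {1..M}"
  shows "j \<in> {1..M}"
  using assms by (rule orb_induct) (rule assms(2) u_range l_range; assumption)+

lemma orb_sym: "(i, j) \<in> orb \<Longrightarrow> i \<in> {1..M} \<Longrightarrow> (j, i) \<in> orb"
proof (induction rule: orb_induct)
  case (u j)
  then show ?case using orb_u[OF u_range[OF u(1)]] u_u[OF u(1)] orb_trans by metis
next
  case (l j)
  then show ?case using orb_l[OF l_range[OF l(1)]] l_l[OF l(1)] orb_trans by metis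
qed simp

lemma orb_rev: "(i, j) \<in> orb \<Longrightarrow> i \<in> {1..M} \<Longrightarrow> (rev i, rev j) \<in> orb"
proof (induction rule: orb_induct)
  case (u j)
  show ?case using orb_u[OF rev_range[OF u(1)]] u(3) orb_trans unfolding u_rev[OF u(1)] by blast
next
  case (l j)
  show ?case using orb_l[OF rev_range[OF l(1)]] l(3) orb_trans unfolding l_rev[OF l(1)] by blast
qed simp

lemma cls_eq_iff: "i \<in> {1..M} \<Longrightarrow> j \<in> {1..M} \<Longrightarrow> cls i = cls j \<longleftrightarrow> (i, j) \<in> orb"
proof
  assume "cls i = cls j"
  then have "j \<in> cls i" by (simp add: cls_def)
  then show "(i, j) \<in> orb" by (simp add: cls_def)
next
  assume i: "i \<in> {1..M}" and o: "(i, j) \<in> orb"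
  note o' = orb_sym[OF o i]
  show "cls i = cls j"
    unfolding cls_def using orb_trans[OF o] orb_trans[OF o'] by (intro equalityI subsetI) (simp_all only: Image_singleton_iff)
qed

lemma flagged_orb: "(i, j) \<in> orb \<Longrightarrow> i \<in> {1..M} \<Longrightarrow> flagged i \<longleftrightarrow> flagged j"
  unfolding flagged_def using orb_sym orb_trans by blast

lemma flagI: "flag v \<Longrightarrow> flagged v"
  unfolding flagged_def using orb_refl by blast

lemma flag_rev: "flag v \<Longrightarrow> flag (rev v)"
  using rev_range[of v] u_rev[of v] l_rev[of v] unfolding flag_def by auto

lemma flagged_rev: "flagged i \<Longrightarrow> i \<in> {1..M} \<Longrightarrow> flagged (rev i)"
  unfolding flagged_def using flag_rev orb_rev by blast

lemma stable_orb: "(i, j) \<in> orb \<Longrightarrow> i \<in> {1..M} \<Longrightarrow> (i, rev i) \<in> orb \<longleftrightarrow> (j, rev j) \<in> orb"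
proof -
  assume o: "(i, j) \<in> orb" and i: "i \<in> {1..M}"
  note o' = orb_sym[OF o i]
  note r = orb_rev[OF o i] orb_rev[OF o' orb_range[OF o i]]
  show ?thesis
    using orb_trans[OF orb_trans[OF o' _] r(1)] orb_trans[OF orb_trans[OF o _] r(2)] by (intro iffI)
qed

lemma J_swap: "mirror_system.J M l u H = J H"
proof -
  interpret S: mirror_system M l u by standard (use u_range l_range u_u l_l u_mirror l_mirror in auto)
  have "S.orb = orb" unfolding S.orb_def orb_def by (rule arg_cong[of _ _ rtrancl]) auto
  then show ?thesis unfolding S.J_def J_def S.cls_def cls_def S.flagged_def flagged_def S.flag_def flag_def S.rev_def rev_def by (simp add: disj_commute)
qed

lemma card_classes:
  assumes "T \<subseteq> {1..M}" "H \<subseteq> {1..M}" "\<And>i j. i \<in> T \<Longrightarrow> j \<in> T \<Longrightarrow> (i, j) \<in> orb \<Longrightarrow> i = j"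
    and "\<And>i. i \<in> T \<Longrightarrow> i \<in> H" "\<And>i. i \<in> H \<Longrightarrow> \<exists>j\<in>T. (i, j) \<in> orb"
  shows "card (cls ` H) = card T"
proof -
  have "cls ` H = cls ` T"
  proof (intro equalityI subsetI)
    fix C assume "C \<in> cls ` H"
    then obtain i where i: "i \<in> H" "C = cls i" by blast
    obtain j where "j \<in> T" "(i, j) \<in> orb" using assms(5)[OF i(1)] by blast
    then show "C \<in> cls ` T" using cls_eq_iff[of i j] i assms(1,2) by blast
  qed (use assms(4) in blast)
  moreover have "inj_on cls T" using cls_eq_iff assms(1,3) unfolding inj_on_def by blast
  ultimately show ?thesis by (simp add: card_image)
qed

end

lemma card_classes_transfer:
  assumes "mirror_system M u l" "mirror_system M' u' l'" and H: "H \<subseteq> {1..M}" "H' \<subseteq> {1..M'}"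
    and r: "\<And>v. v \<in> H \<Longrightarrow> r v \<in> H'"
    and iff: "\<And>v w. v \<in> H \<Longrightarrow> w \<in> H \<Longrightarrow> (v, w) \<in> mirror_system.orb M u l \<longleftrightarrow> (r v, r w) \<in> mirror_system.orb M' u' l'"
    and onto: "\<And>w. w \<in> H' \<Longrightarrow> \<exists>v\<in>H. (r v, w) \<in> mirror_system.orb M' u' l'"
    and flagged: "\<And>v. v \<in> H \<Longrightarrow> mirror_system.flagged M u l v \<longleftrightarrow> mirror_system.flagged M' u' l' (r v)"
    and stable: "\<And>v. v \<in> H \<Longrightarrow> (v, mirror_system.rev M v) \<in> mirror_system.orb M u l \<longleftrightarrow>
       (r v, mirror_system.rev M' (r v)) \<in> mirror_system.orb M' u' l'"
  shows "mirror_system.J M u l H = mirror_system.J M' u' l' H'"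
proof -
  interpret A: mirror_system M u l by fact
  interpret B: mirror_system M' u' l' by fact
  have c: "card (A.cls ` {i \<in> H. P i}) = card (B.cls ` {i \<in> H'. P' i})"
    if P: "\<And>v. v \<in> H \<Longrightarrow> P v \<longleftrightarrow> P' (r v)" and inv: "\<And>i j. (i, j) \<in> B.orb \<Longrightarrow> i \<in> {1..M'} \<Longrightarrow> P' i \<longleftrightarrow> P' j" for P P'
  proof -
    have "card (A.cls ` {i \<in> H. P i}) = card ((\<lambda>v. B.cls (r v)) ` {i \<in> H. P i})"
    proof (rule card_image_cong_iff)
      fix x y assume "x \<in> {i \<in> H. P i}" "y \<in> {i \<in> H. P i}"
      then have xy: "x \<in> H" "y \<in> H" by auto
      have "x \<in> {1..M}" "y \<in> {1..M}" "r x \<in> {1..M'}" "r y \<in> {1..M'}" using xy r H by blast+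
      then show "A.cls x = A.cls y \<longleftrightarrow> B.cls (r x) = B.cls (r y)" using iff[OF xy] A.cls_eq_iff B.cls_eq_iff by simp
    qed
    also have "(\<lambda>v. B.cls (r v)) ` {i \<in> H. P i} = B.cls ` {i \<in> H'. P' i}"
    proof (intro equalityI subsetI)
      fix C assume "C \<in> B.cls ` {i \<in> H'. P' i}"
      then obtain w where w: "w \<in> H'" "P' w" "C = B.cls w" by blast
      obtain v where v: "v \<in> H" "(r v, w) \<in> B.orb" using onto[OF w(1)] by blast
      have rv: "r v \<in> {1..M'}" "w \<in> {1..M'}" using r[OF v(1)] H w by blast+
      have "C = B.cls (r v)" using B.cls_eq_iff[OF rv] v w by simp
      moreover have "P v" using P[OF v(1)] inv[OF v(2) rv(1)] w by simp
      ultimately show "C \<in> (\<lambda>v. B.cls (r v)) ` {i \<in> H. P i}" using v by blast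
    qed (use r P in blast)
    finally show ?thesis .
  qed
  have 1: "card (A.cls ` {i \<in> H. \<not> A.flagged i}) = card (B.cls ` {i \<in> H'. \<not> B.flagged i})"
    by (rule c) (use flagged B.flagged_orb in blast)+
  have 2: "card (A.cls ` {i \<in> H. A.flagged i \<and> (i, A.rev i) \<notin> A.orb}) = card (B.cls ` {i \<in> H'. B.flagged i \<and> (i, B.rev i) \<notin> B.orb})"
    by (rule c) (use flagged stable B.flagged_orb B.stable_orb in blast)+
  show ?thesis unfolding A.J_def B.J_def 1 2 ..
qed

text \<open>
  Homotopy equivalence of two systems of arcs: the maps \<open>r\<close> and \<open>t\<close> preserve connectedness and are
  mutually inverse up to connectedness. By symmetry only the left halves have to be checked.
\<close>

lemma J_transfer:
  assumes "mirror_system (2 * m) u l" "mirror_system (2 * m') u' l'"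
    and r_range: "\<And>v. 1 \<le> v \<Longrightarrow> v \<le> m \<Longrightarrow> r v \<in> {1..2 * m'}"
    and t_range: "\<And>w. 1 \<le> w \<Longrightarrow> w \<le> m' \<Longrightarrow> t w \<in> {1..2 * m}"
    and r_rev: "\<And>v. v \<in> {1..2 * m} \<Longrightarrow> r (2 * m + 1 - v) = 2 * m' + 1 - r v"
    and t_rev: "\<And>w. w \<in> {1..2 * m'} \<Longrightarrow> t (2 * m' + 1 - w) = 2 * m + 1 - t w"
    and r_u: "\<And>v. 1 \<le> v \<Longrightarrow> v \<le> m \<Longrightarrow> (r v, r (u v)) \<in> mirror_system.orb (2 * m') u' l'"
    and r_l: "\<And>v. 1 \<le> v \<Longrightarrow> v \<le> m \<Longrightarrow> (r v, r (l v)) \<in> mirror_system.orb (2 * m') u' l'"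
    and t_u: "\<And>w. 1 \<le> w \<Longrightarrow> w \<le> m' \<Longrightarrow> (t w, t (u' w)) \<in> mirror_system.orb (2 * m) u l"
    and t_l: "\<And>w. 1 \<le> w \<Longrightarrow> w \<le> m' \<Longrightarrow> (t w, t (l' w)) \<in> mirror_system.orb (2 * m) u l"
    and r_t: "\<And>w. 1 \<le> w \<Longrightarrow> w \<le> m' \<Longrightarrow> (r (t w), w) \<in> mirror_system.orb (2 * m') u' l'"
    and t_r: "\<And>v. 1 \<le> v \<Longrightarrow> v \<le> m \<Longrightarrow> (t (r v), v) \<in> mirror_system.orb (2 * m) u l"
    and r_flag: "\<And>v. 1 \<le> v \<Longrightarrow> v \<le> m \<Longrightarrow> u v = v \<or> l v = v \<Longrightarrow> mirror_system.flagged (2 * m') u' l' (r v)"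
    and t_flag: "\<And>w. 1 \<le> w \<Longrightarrow> w \<le> m' \<Longrightarrow> u' w = w \<or> l' w = w \<Longrightarrow> mirror_system.flagged (2 * m) u l (t w)"
  shows "mirror_system.J (2 * m) u l {1..2 * m} = mirror_system.J (2 * m') u' l' {1..2 * m'}"
proof -
  let ?V = "{1..2 * m}" and ?V' = "{1..2 * m'}"
  interpret A: mirror_system "2 * m" u l by fact
  interpret B: mirror_system "2 * m'" u' l' by fact
  have rr: "r (A.rev v) = B.rev (r v)" if "v \<in> ?V" for v using r_rev[OF that] unfolding A.rev_def B.rev_def .
  have tr: "t (B.rev w) = A.rev (t w)" if "w \<in> ?V'" for w using t_rev[OF that] unfolding A.rev_def B.rev_def .
  have left: "(1 \<le> v \<and> v \<le> k) \<or> (\<exists>x. 1 \<le> x \<and> x \<le> k \<and> v = 2 * k + 1 - x)" if "v \<in> {1..2 * k}" for v k :: nat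
  proof (cases "v \<le> k")
    case False
    then show ?thesis using that by (intro disjI2 exI[of _ "2 * k + 1 - v"]) auto
  qed (use that in auto)
  have A_left: "P v" if "v \<in> ?V" "\<And>x. 1 \<le> x \<Longrightarrow> x \<le> m \<Longrightarrow> P x" "\<And>x. 1 \<le> x \<Longrightarrow> x \<le> m \<Longrightarrow> P x \<Longrightarrow> P (A.rev x)" for v P
    using left[OF that(1)] that(2,3) unfolding A.rev_def by blast
  have B_left: "P v" if "v \<in> ?V'" "\<And>x. 1 \<le> x \<Longrightarrow> x \<le> m' \<Longrightarrow> P x" "\<And>x. 1 \<le> x \<Longrightarrow> x \<le> m' \<Longrightarrow> P x \<Longrightarrow> P (B.rev x)" for v P
    using left[OF that(1)] that(2,3) unfolding B.rev_def by blast
  have iV: "x \<in> ?V" if "1 \<le> x" "x \<le> m" for x using that by simp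
  have iV': "x \<in> ?V'" if "1 \<le> x" "x \<le> m'" for x using that by simp
  have rV: "r v \<in> ?V'" if "v \<in> ?V" for v
    by (rule A_left[OF that, of "\<lambda>v. r v \<in> ?V'"]) (use r_range rr iV B.rev_range in simp_all)
  have tV: "t w \<in> ?V" if "w \<in> ?V'" for w
    by (rule B_left[OF that, of "\<lambda>v. t v \<in> ?V"]) (use t_range tr iV' A.rev_range in simp_all)
  have ru: "(r v, r (u v)) \<in> B.orb" if "v \<in> ?V" for v
  proof (rule A_left[OF that, of "\<lambda>v. (r v, r (u v)) \<in> B.orb"])
    fix x assume x: "1 \<le> x" "x \<le> m" "(r x, r (u x)) \<in> B.orb"
    show "(r (A.rev x), r (u (A.rev x))) \<in> B.orb"
      unfolding A.u_rev[OF iV[OF x(1,2)]] rr[OF iV[OF x(1,2)]] rr[OF A.u_range[OF iV[OF x(1,2)]]]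
      by (rule B.orb_rev[OF x(3) rV[OF iV[OF x(1,2)]]])
  qed (rule r_u)
  have rl: "(r v, r (l v)) \<in> B.orb" if "v \<in> ?V" for v
  proof (rule A_left[OF that, of "\<lambda>v. (r v, r (l v)) \<in> B.orb"])
    fix x assume x: "1 \<le> x" "x \<le> m" "(r x, r (l x)) \<in> B.orb"
    show "(r (A.rev x), r (l (A.rev x))) \<in> B.orb"
      unfolding A.l_rev[OF iV[OF x(1,2)]] rr[OF iV[OF x(1,2)]] rr[OF A.l_range[OF iV[OF x(1,2)]]]
      by (rule B.orb_rev[OF x(3) rV[OF iV[OF x(1,2)]]])
  qed (rule r_l)
  have tu: "(t v, t (u' v)) \<in> A.orb" if "v \<in> ?V'" for v
  proof (rule B_left[OF that, of "\<lambda>v. (t v, t (u' v)) \<in> A.orb"])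
    fix x assume x: "1 \<le> x" "x \<le> m'" "(t x, t (u' x)) \<in> A.orb"
    show "(t (B.rev x), t (u' (B.rev x))) \<in> A.orb"
      unfolding B.u_rev[OF iV'[OF x(1,2)]] tr[OF iV'[OF x(1,2)]] tr[OF B.u_range[OF iV'[OF x(1,2)]]]
      by (rule A.orb_rev[OF x(3) tV[OF iV'[OF x(1,2)]]])
  qed (rule t_u)
  have tl: "(t v, t (l' v)) \<in> A.orb" if "v \<in> ?V'" for v
  proof (rule B_left[OF that, of "\<lambda>v. (t v, t (l' v)) \<in> A.orb"])
    fix x assume x: "1 \<le> x" "x \<le> m'" "(t x, t (l' x)) \<in> A.orb"
    show "(t (B.rev x), t (l' (B.rev x))) \<in> A.orb"
      unfolding B.l_rev[OF iV'[OF x(1,2)]] tr[OF iV'[OF x(1,2)]] tr[OF B.l_range[OF iV'[OF x(1,2)]]]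
      by (rule A.orb_rev[OF x(3) tV[OF iV'[OF x(1,2)]]])
  qed (rule t_l)
  have rt: "(r (t w), w) \<in> B.orb" if "w \<in> ?V'" for w
  proof (rule B_left[OF that, of "\<lambda>w. (r (t w), w) \<in> B.orb"])
    fix x assume x: "1 \<le> x" "x \<le> m'" "(r (t x), x) \<in> B.orb"
    show "(r (t (B.rev x)), B.rev x) \<in> B.orb"
      unfolding tr[OF iV'[OF x(1,2)]] rr[OF tV[OF iV'[OF x(1,2)]]] by (rule B.orb_rev[OF x(3) rV[OF tV[OF iV'[OF x(1,2)]]]])
  qed (rule r_t)
  have tr': "(t (r v), v) \<in> A.orb" if "v \<in> ?V" for v
  proof (rule A_left[OF that, of "\<lambda>w. (t (r w), w) \<in> A.orb"])
    fix x assume x: "1 \<le> x" "x \<le> m" "(t (r x), x) \<in> A.orb"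
    show "(t (r (A.rev x)), A.rev x) \<in> A.orb"
      unfolding rr[OF iV[OF x(1,2)]] tr[OF rV[OF iV[OF x(1,2)]]] by (rule A.orb_rev[OF x(3) tV[OF rV[OF iV[OF x(1,2)]]]])
  qed (rule t_r)
  have rf: "B.flagged (r v)" if "A.flag v" for v
  proof -
    have v: "v \<in> ?V" using that by (simp add: A.flag_def)
    from left[OF v] show ?thesis
    proof (elim disjE exE conjE)
      assume "1 \<le> v" "v \<le> m"
      then show ?thesis using r_flag that by (simp add: A.flag_def)
    next
      fix x assume x: "1 \<le> x" "x \<le> m" "v = 2 * m + 1 - x"
      note xV = iV[OF x(1,2)]
      have v': "v = A.rev x" using x by (simp add: A.rev_def)
      have "A.flag x" using A.flag_rev[OF that] unfolding v' A.rev_rev[OF xV] .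
      then have "B.flagged (r x)" using r_flag[OF x(1,2)] by (simp add: A.flag_def)
      then show ?thesis unfolding v' rr[OF xV] by (rule B.flagged_rev) (rule rV[OF xV])
    qed
  qed
  have tf: "A.flagged (t v)" if "B.flag v" for v
  proof -
    have v: "v \<in> ?V'" using that by (simp add: B.flag_def)
    from left[OF v] show ?thesis
    proof (elim disjE exE conjE)
      assume "1 \<le> v" "v \<le> m'"
      then show ?thesis using t_flag that by (simp add: B.flag_def)
    next
      fix x assume x: "1 \<le> x" "x \<le> m'" "v = 2 * m' + 1 - x"
      note xV = iV'[OF x(1,2)]
      have v': "v = B.rev x" using x by (simp add: B.rev_def)
      have "B.flag x" using B.flag_rev[OF that] unfolding v' B.rev_rev[OF xV] .
      then have "A.flagged (t x)" using t_flag[OF x(1,2)] by (simp add: B.flag_def)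
      then show ?thesis unfolding v' tr[OF xV] by (rule A.flagged_rev) (rule tV[OF xV])
    qed
  qed
  have r_orb: "(r v, r w) \<in> B.orb" if "(v, w) \<in> A.orb" "v \<in> ?V" for v w
    using that
  proof (induction rule: A.orb_induct)
    case (u j) then show ?case using ru B.orb_trans by blast
  next
    case (l j) then show ?case using rl B.orb_trans by blast
  qed simp
  have t_orb: "(t v, t w) \<in> A.orb" if "(v, w) \<in> B.orb" "v \<in> ?V'" for v w
    using that
  proof (induction rule: B.orb_induct)
    case (u j) then show ?case using tu A.orb_trans by blast
  next
    case (l j) then show ?case using tl A.orb_trans by blast
  qed simp
  have reflect: "(v, w) \<in> A.orb" if "(r v, r w) \<in> B.orb" "v \<in> ?V" "w \<in> ?V" for v w
  proof -
    have "(t (r v), t (r w)) \<in> A.orb" by (rule t_orb[OF that(1) rV[OF that(2)]])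
    moreover have "(v, t (r v)) \<in> A.orb" by (rule A.orb_sym[OF tr'[OF that(2)] tV[OF rV[OF that(2)]]])
    ultimately show ?thesis using tr'[OF that(3)] A.orb_trans by blast
  qed
  have iff: "(v, w) \<in> A.orb \<longleftrightarrow> (r v, r w) \<in> B.orb" if "v \<in> ?V" "w \<in> ?V" for v w
    using r_orb[OF _ that(1)] reflect[OF _ that] by (intro iffI)
  show ?thesis
  proof (rule card_classes_transfer[OF assms(1,2) subset_refl subset_refl, where r = r])
    show "r v \<in> ?V'" if "v \<in> ?V" for v by (rule rV[OF that])
    show "(v, w) \<in> A.orb \<longleftrightarrow> (r v, r w) \<in> B.orb" if "v \<in> ?V" "w \<in> ?V" for v w by (rule iff[OF that])
    show "\<exists>v\<in>?V. (r v, w) \<in> B.orb" if "w \<in> ?V'" for w using rt[OF that] tV[OF that] by blast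
    show "A.flagged v \<longleftrightarrow> B.flagged (r v)" if v: "v \<in> ?V" for v
    proof
      assume "A.flagged v"
      then obtain x where x: "A.flag x" "(v, x) \<in> A.orb" by (auto simp: A.flagged_def)
      show "B.flagged (r v)" using rf[OF x(1)] B.flagged_orb[OF r_orb[OF x(2) v] rV[OF v]] by blast
    next
      assume "B.flagged (r v)"
      then obtain y where y: "B.flag y" "(r v, y) \<in> B.orb" by (auto simp: B.flagged_def)
      have "A.flagged (t (r v))" using tf[OF y(1)] A.flagged_orb[OF t_orb[OF y(2) rV[OF v]] tV[OF rV[OF v]]] by blast
      then show "A.flagged v" using A.flagged_orb[OF tr'[OF v] tV[OF rV[OF v]]] by blast
    qed
    show "(v, A.rev v) \<in> A.orb \<longleftrightarrow> (r v, B.rev (r v)) \<in> B.orb" if v: "v \<in> ?V" for v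
      using iff[OF v A.rev_range[OF v]] rr[OF v] by simp
  qed
qed

text \<open>The outer part \<open>{1..c} \<union> {M + 1 - c..M}\<close> can be split off if it is invariant.\<close>

lemma J_split:
  assumes "mirror_system M u l" "mirror_system M' u' l'" and M: "M = M' + 2 * c"
    and u_shift: "\<And>i. i \<in> {1..M'} \<Longrightarrow> u (i + c) = u' i + c" and l_shift: "\<And>i. i \<in> {1..M'} \<Longrightarrow> l (i + c) = l' i + c"
  shows "mirror_system.J M u l {1..M} = mirror_system.J M' u' l' {1..M'} + mirror_system.J M u l ({1..c} \<union> {M + 1 - c..M})"
proof -
  interpret A: mirror_system M u l by fact
  interpret B: mirror_system M' u' l' by fact
  let ?H = "{1..c} \<union> {M + 1 - c..M}" and ?Mid = "(\<lambda>i. i + c) ` {1..M'}"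
  have V: "{1..M} = ?Mid \<union> ?H"
  proof (intro equalityI subsetI)
    fix i assume i: "i \<in> {1..M}"
    show "i \<in> ?Mid \<union> ?H"
    proof (cases "c < i \<and> i \<le> M' + c")
      case True
      then have "i = (i - c) + c" "i - c \<in> {1..M'}" by auto
      then show ?thesis by blast
    qed (use i M in auto)
  qed (use M in auto)
  have midV: "i + c \<in> {1..M}" if "i \<in> {1..M'}" for i using that M by auto
  have mid_orb: "\<exists>j\<in>{1..M'}. w = j + c \<and> (i, j) \<in> B.orb" if "(i + c, w) \<in> A.orb" and i: "i \<in> {1..M'}" for i w
    using that(1) midV[OF i]
  proof (induction rule: A.orb_induct)
    case base
    then show ?case using i by auto
  next
    case (u j)
    then obtain k where k: "k \<in> {1..M'}" "j = k + c" "(i, k) \<in> B.orb" by blast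
    show ?case unfolding k(2) u_shift[OF k(1)]
      by (rule bexI[of _ "u' k"]) (use k B.orb_u[OF k(1)] B.orb_trans B.u_range[OF k(1)] in blast)+
  next
    case (l j)
    then obtain k where k: "k \<in> {1..M'}" "j = k + c" "(i, k) \<in> B.orb" by blast
    show ?case unfolding k(2) l_shift[OF k(1)]
      by (rule bexI[of _ "l' k"]) (use k B.orb_l[OF k(1)] B.orb_trans B.l_range[OF k(1)] in blast)+
  qed
  have orb_mid: "(i + c, j + c) \<in> A.orb" if "(i, j) \<in> B.orb" and i: "i \<in> {1..M'}" for i j
    using that
  proof (induction rule: B.orb_induct)
    case (u j)
    then show ?case using A.orb_u[OF midV[OF u(1)]] A.orb_trans unfolding u_shift[OF u(1)] by blast
  next
    case (l j)
    then show ?case using A.orb_l[OF midV[OF l(1)]] A.orb_trans unfolding l_shift[OF l(1)] by blast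
  qed simp
  have iff: "(i, j) \<in> B.orb \<longleftrightarrow> (i + c, j + c) \<in> A.orb" if "i \<in> {1..M'}" "j \<in> {1..M'}" for i j
    using orb_mid[OF _ that(1)] mid_orb[OF _ that(1), of "j + c"] by auto
  have disj: "A.cls ` {i \<in> ?Mid. P i} \<inter> A.cls ` {i \<in> ?H. P i} = {}" for P
  proof (rule ccontr)
    assume "A.cls ` {i \<in> ?Mid. P i} \<inter> A.cls ` {i \<in> ?H. P i} \<noteq> {}"
    then obtain i h where ih: "i \<in> {1..M'}" "h \<in> ?H" "A.cls (i + c) = A.cls h" by blast
    have "h \<in> {1..M}" using ih(2) V by blast
    then have "(i + c, h) \<in> A.orb" using A.cls_eq_iff[OF midV[OF ih(1)]] ih(3) by blast
    then obtain j where "j \<in> {1..M'}" "h = j + c" using mid_orb[OF _ ih(1)] by blast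
    then show False using ih(2) M by auto
  qed
  have split: "card (A.cls ` {i \<in> {1..M}. P i}) = card (A.cls ` {i \<in> ?Mid. P i}) + card (A.cls ` {i \<in> ?H. P i})" for P
  proof -
    have "A.cls ` {i \<in> {1..M}. P i} = A.cls ` {i \<in> ?Mid. P i} \<union> A.cls ` {i \<in> ?H. P i}" unfolding V by blast
    then show ?thesis using disj by (simp only:) (rule card_Un_disjoint; simp)
  qed
  have "A.J {1..M} = A.J ?Mid + A.J ?H" unfolding A.J_def split by simp
  also have "A.J ?Mid = B.J {1..M'}"
  proof (rule card_classes_transfer[OF assms(2,1), where r = "\<lambda>i. i + c", symmetric])
    show "?Mid \<subseteq> {1..M}" using V by blast
    show "(v, w) \<in> B.orb \<longleftrightarrow> (v + c, w + c) \<in> A.orb" if "v \<in> {1..M'}" "w \<in> {1..M'}" for v w by (rule iff[OF that])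
    show "\<exists>v\<in>{1..M'}. (v + c, w) \<in> A.orb" if "w \<in> ?Mid" for w
    proof -
      obtain v where "v \<in> {1..M'}" "w = v + c" using \<open>w \<in> ?Mid\<close> by blast
      then show ?thesis using A.orb_refl by blast
    qed
    show "B.flagged v \<longleftrightarrow> A.flagged (v + c)" if v: "v \<in> {1..M'}" for v
    proof
      assume "B.flagged v"
      then obtain x where x: "B.flag x" "(v, x) \<in> B.orb" by (auto simp: B.flagged_def)
      have xr: "x \<in> {1..M'}" using x by (simp add: B.flag_def)
      have "A.flag (x + c)" using x u_shift[OF xr] l_shift[OF xr] midV[OF xr] by (auto simp: A.flag_def B.flag_def)
      then show "A.flagged (v + c)" using orb_mid[OF x(2) v] by (auto simp: A.flagged_def)
    next
      assume "A.flagged (v + c)"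
      then obtain y where y: "A.flag y" "(v + c, y) \<in> A.orb" by (auto simp: A.flagged_def)
      obtain j where j: "j \<in> {1..M'}" "y = j + c" "(v, j) \<in> B.orb" using mid_orb[OF y(2) v] by blast
      have "B.flag j" using y(1) j u_shift[OF j(1)] l_shift[OF j(1)] by (auto simp: A.flag_def B.flag_def)
      then show "B.flagged v" using j by (auto simp: B.flagged_def)
    qed
    show "(v, B.rev v) \<in> B.orb \<longleftrightarrow> (v + c, A.rev (v + c)) \<in> A.orb" if v: "v \<in> {1..M'}" for v
    proof -
      have "A.rev (v + c) = B.rev v + c" unfolding A.rev_def B.rev_def using v M by simp
      then show ?thesis using iff[OF v B.rev_range[OF v]] by simp
    qed
  qed auto
  finally show ?thesis by simp
qed

subsection \<open>The arcs of a type-C meander graph\<close>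

text \<open>The arcs on one side of the type-C graph. First and last block are peeled off together,
  which keeps the reflection visible and matches the recursion of \<open>lev\<close>; the empty list
  leaves the middle block of length 2n.\<close>

fun mirC :: "nat \<Rightarrow> nat list \<Rightarrow> nat \<Rightarrow> nat" where
  "mirC n [] i = 2 * n + 1 - i"
| "mirC n (a # as) i = (if i \<le> a then a + 1 - i else if 2 * n < i + a then 4 * n + 1 - a - i else a + mirC (n - a) as (i - a))"

lemma mirC_mid: "a < i \<Longrightarrow> i + a \<le> 2 * n \<Longrightarrow> mirC n (a # as) i = a + mirC (n - a) as (i - a)"
  by simp

lemma mirC_range: "sum_list a \<le> n \<Longrightarrow> 1 \<le> i \<Longrightarrow> i \<le> 2 * n \<Longrightarrow> 1 \<le> mirC n a i \<and> mirC n a i \<le> 2 * n"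
proof (induction a arbitrary: n i)
  case (Cons x a)
  show ?case
  proof (cases "x < i \<and> i + x \<le> 2 * n")
    case True
    then have "1 \<le> mirC (n - x) a (i - x) \<and> mirC (n - x) a (i - x) \<le> 2 * (n - x)"
      using Cons.prems by (intro Cons.IH) auto
    then show ?thesis using True mirC_mid[of x i n a] Cons.prems by auto
  qed (use Cons.prems in auto)
qed auto

lemma mirC_mid_range:
  assumes "a + sum_list as \<le> n" "a < i" "i + a \<le> 2 * n"
  shows "a < mirC n (a # as) i \<and> mirC n (a # as) i + a \<le> 2 * n"
proof -
  have "1 \<le> mirC (n - a) as (i - a) \<and> mirC (n - a) as (i - a) \<le> 2 * (n - a)"
    using assms by (intro mirC_range) auto
  then show ?thesis using assms mirC_mid[of a i n as] by auto
qed

lemma mirC_mirC: "sum_list a \<le> n \<Longrightarrow> 1 \<le> i \<Longrightarrow> i \<le> 2 * n \<Longrightarrow> mirC n a (mirC n a i) = i"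
proof (induction a arbitrary: n i)
  case (Cons x a)
  show ?case
  proof (cases "x < i \<and> i + x \<le> 2 * n")
    case True
    have "mirC (n - x) a (mirC (n - x) a (i - x)) = i - x" using True Cons.prems by (intro Cons.IH) auto
    then show ?thesis
      using True mirC_mid[of x i n a] mirC_mid[of x "mirC n (x # a) i" n a] mirC_mid_range[of x a n i] Cons.prems
      by (simp del: mirC.simps)
  next
    case False
    then consider "i \<le> x" | "2 * n < i + x" "x < i" by linarith
    then show ?thesis using Cons.prems by cases auto
  qed
qed auto

lemma mirC_mirror: "sum_list a \<le> n \<Longrightarrow> 1 \<le> i \<Longrightarrow> i \<le> 2 * n \<Longrightarrow> mirC n a (2 * n + 1 - i) = 2 * n + 1 - mirC n a i"
proof (induction a arbitrary: n i)
  case (Cons x a)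
  show ?case
  proof (cases "x < i \<and> i + x \<le> 2 * n")
    case True
    define R where "R = mirC (n - x) a (i - x)"
    have IH: "mirC (n - x) a (2 * (n - x) + 1 - (i - x)) = 2 * (n - x) + 1 - R"
      unfolding R_def using True Cons.prems by (intro Cons.IH) auto
    have e: "2 * (n - x) + 1 - (i - x) = 2 * n + 1 - i - x" using True Cons.prems by auto
    have m: "x < 2 * n + 1 - i" "2 * n + 1 - i + x \<le> 2 * n" using True by linarith+
    have R: "R \<le> 2 * (n - x)" unfolding R_def
      using True Cons.prems mirC_range[of a "n - x" "i - x"] by auto
    have 1: "mirC n (x # a) i = x + R" unfolding R_def using True by (intro mirC_mid) auto
    have 2: "mirC n (x # a) (2 * n + 1 - i) = x + (2 * (n - x) + 1 - R)"
      unfolding IH[symmetric] e by (rule mirC_mid[OF m])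
    have "x \<le> n" using Cons.prems by simp
    then show ?thesis unfolding 1 2 using R by linarith
  next
    case False
    then consider "i \<le> x" | "2 * n < i + x" "x < i" by linarith
    then show ?thesis using Cons.prems by cases auto
  qed
qed auto

lemma mirror_system_mirC:
  assumes "sum_list a \<le> n" "sum_list b \<le> n"
  shows "mirror_system (2 * n) (mirC n a) (mirC n b)"
proof
  fix i assume "i \<in> {1..2 * n}"
  then have i: "1 \<le> i" "i \<le> 2 * n" by auto
  show "mirC n a i \<in> {1..2 * n}" "mirC n b i \<in> {1..2 * n}" using mirC_range[OF _ i] assms by auto
  show "mirC n a (mirC n a i) = i" "mirC n b (mirC n b i) = i" using mirC_mirC[OF _ i] assms by auto
  show "mirC n a (2 * n + 1 - i) = 2 * n + 1 - mirC n a i" "mirC n b (2 * n + 1 - i) = 2 * n + 1 - mirC n b i"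
    using mirC_mirror[OF _ i] assms by blast+
qed

definition JC :: "nat \<Rightarrow> nat list \<Rightarrow> nat list \<Rightarrow> nat" where
  "JC n a b = mirror_system.J (2 * n) (mirC n a) (mirC n b) {1..2 * n}"

lemma JC_swap: "sum_list a \<le> n \<Longrightarrow> sum_list b \<le> n \<Longrightarrow> JC n b a = JC n a b"
  unfolding JC_def by (rule mirror_system.J_swap[OF mirror_system_mirC])

lemma mirC_zero: "1 \<le> i \<Longrightarrow> i \<le> 2 * n \<Longrightarrow> mirC n (0 # a) i = mirC n a i"
  by simp

lemma J_cong:
  assumes "mirror_system M u l" "mirror_system M u' l'"
    and "\<And>i. i \<in> {1..M} \<Longrightarrow> u i = u' i" "\<And>i. i \<in> {1..M} \<Longrightarrow> l i = l' i"
  shows "mirror_system.J M u l {1..M} = mirror_system.J M u' l' {1..M}"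
proof -
  interpret A: mirror_system M u l by fact
  interpret B: mirror_system M u' l' by fact
  have "A.orb = B.orb" unfolding A.orb_def B.orb_def by (rule arg_cong[of _ _ rtrancl]) (use assms(3,4) in auto)
  moreover have "A.flag = B.flag" unfolding A.flag_def B.flag_def fun_eq_iff using assms(3,4) by auto
  ultimately show ?thesis
    unfolding A.J_def B.J_def A.cls_def B.cls_def A.flagged_def B.flagged_def A.rev_def B.rev_def by simp
qed

lemma JC_zero: "sum_list a \<le> n \<Longrightarrow> sum_list b \<le> n \<Longrightarrow> JC n (0 # a) b = JC n a b"
  unfolding JC_def by (rule J_cong) (auto intro!: mirror_system_mirC simp del: mirC.simps simp: mirC_zero)

text \<open>The first a vertices, and symmetrically the last a, are retracted along their lower
  arcs; the rest is shifted by a. The lower arcs used up at b - a + 1, ..., b are replaced by images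
  of the upper arcs on 1..a: there \<open>l'\<close> is the path lower, upper, lower.\<close>

lemma J_step_long:
  fixes n a b :: nat
  assumes A: "mirror_system (2 * n) u l" and B: "mirror_system (2 * (n - a)) u' l'" and n: "b \<le> n" "2 * a \<le> b"
    and u1: "\<And>v. 1 \<le> v \<Longrightarrow> v \<le> a \<Longrightarrow> u v + v = a + 1" and l1: "\<And>v. 1 \<le> v \<Longrightarrow> v \<le> b \<Longrightarrow> l v + v = b + 1"
    and u2: "\<And>v. a < v \<Longrightarrow> v + a \<le> 2 * n \<Longrightarrow> u v = u' (v - a) + a \<and> a < u v \<and> u v + a \<le> 2 * n"
    and l2: "\<And>v. b < v \<Longrightarrow> v + b \<le> 2 * n \<Longrightarrow> l v = l' (v - a) + a \<and> b < l v \<and> l v + b \<le> 2 * n"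
    and l4: "\<And>w. 1 \<le> w \<Longrightarrow> w + 2 * a \<le> b \<Longrightarrow> l' w + w + 2 * a = b + 1"
    and l5: "\<And>w. b < w + 2 * a \<Longrightarrow> w + a \<le> b \<Longrightarrow> l' w + w + 3 * a = 2 * b + 1"
  shows "mirror_system.J (2 * n) u l {1..2 * n} = mirror_system.J (2 * (n - a)) u' l' {1..2 * (n - a)}"
proof -
  interpret A: mirror_system "2 * n" u l by (rule A)
  interpret B: mirror_system "2 * (n - a)" u' l' by (rule B)
  define r where "r v = (if v \<le> a then b + 1 - v - a else if 2 * n < v + a then 2 * (n - a) + 1 - (b + 1 - (2 * n + 1 - v) - a) else v - a)" for v
  define t where "t w = w + a" for w
  have r1: "r v + v + a = b + 1" if "v \<le> a" for v using that n by (simp add: r_def)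
  have r2: "r v + a = v" if "a < v" "v + a \<le> 2 * n" for v using that by (simp add: r_def)
  have eqB: "(x, y) \<in> B.orb" if "x \<in> {1..2 * (n - a)}" "y = u' x \<or> y = l' x \<or> y = x" for x y
    using that B.orb_u B.orb_l B.orb_refl by blast
  have eqA: "(x, y) \<in> A.orb" if "x \<in> {1..2 * n}" "y = u x \<or> y = l x \<or> y = x" for x y
    using that A.orb_u A.orb_l A.orb_refl by blast
  show ?thesis
  proof (rule J_transfer[OF A B, where r = r and t = t])
    fix v assume "v \<in> {1..2 * n}"
    then show "r (2 * n + 1 - v) = 2 * (n - a) + 1 - r v" using n unfolding r_def by (auto split: if_splits)
  next
    fix w assume "w \<in> {1..2 * (n - a)}"
    then show "t (2 * (n - a) + 1 - w) = 2 * n + 1 - t w" using n unfolding t_def by auto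
  next
    fix v assume v: "1 \<le> v" "v \<le> n"
    have mid: "v + a \<le> 2 * n" using v n by linarith
    have rv: "r v \<in> {1..2 * (n - a)}"
      using r1[of v] r2[of v] mid v n by (cases "v \<le> a") auto
    then show "r v \<in> {1..2 * (n - a)}" .
    have vV: "v \<in> {1..2 * n}" using v by simp
    consider "v \<le> a" | "a < v" "v + a \<le> b" | "b < v + a" "a < v" "v \<le> b" | "b < v" by linarith
    note cs = this
    have f4: "a < v" "v + b \<le> 2 * n" if "b < v" using that n v by linarith+
    have va: "v - a = r v" if "a < v" using r2[OF that mid] by linarith
    show "(r v, r (u v)) \<in> B.orb"
    proof (rule eqB[OF rv], cases "v \<le> a")
      case True
      have "r (u v) + u v + a = b + 1" using u1[OF v(1) True] v True by (intro r1) linarith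
      moreover have "l' (r v) + r v + 3 * a = 2 * b + 1" using r1[OF True] v True n by (intro l5) linarith+
      ultimately have "r (u v) = l' (r v)" using u1[OF v(1) True] r1[OF True] by linarith
      then show "r (u v) = u' (r v) \<or> r (u v) = l' (r v) \<or> r (u v) = r v" by blast
    next
      case False
      then have f: "a < v" by simp
      have "r (u v) + a = u v" using u2[OF f mid] by (intro r2) auto
      then have "r (u v) = u' (r v)" using u2[OF f mid] unfolding va[OF f] by linarith
      then show "r (u v) = u' (r v) \<or> r (u v) = l' (r v) \<or> r (u v) = r v" by blast
    qed
    show "(r v, r (l v)) \<in> B.orb"
    proof (rule eqB[OF rv])
      show "r (l v) = u' (r v) \<or> r (l v) = l' (r v) \<or> r (l v) = r v"
        using cs
      proof cases
        case 1
        have "l v + v = b + 1" using 1 n v by (intro l1) linarith+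
        moreover from this have "r (l v) + a = l v" using 1 n v by (intro r2) linarith+
        ultimately have "r (l v) = r v" using r1[OF 1] by linarith
        then show ?thesis by blast
      next
        case 2
        have "l v + v = b + 1" using 2 n v by (intro l1) linarith+
        moreover from this have "r (l v) + a = l v" using 2 n v by (intro r2) linarith+
        moreover have "l' (r v) + r v + 2 * a = b + 1" using r2[OF 2(1) mid] 2 by (intro l4) linarith+
        ultimately have "r (l v) = l' (r v)" using r2[OF 2(1) mid] by linarith
        then show ?thesis by blast
      next
        case 3
        have "l v + v = b + 1" using 3 n v by (intro l1) linarith+
        moreover from this have "r (l v) + l v + a = b + 1" using 3 n v by (intro r1) linarith+
        ultimately have "r (l v) = r v" using r2[OF 3(2) mid] by linarith
        then show ?thesis by blast
      next
        case 4
        note f = f4[OF 4]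
        have "r (l v) + a = l v" using l2[OF 4 f(2)] n by (intro r2) linarith+
        then have "r (l v) = l' (r v)" using l2[OF 4 f(2)] unfolding va[OF f(1)] by linarith
        then show ?thesis by blast
      qed
    qed
    have "(v, t (r v)) \<in> A.orb"
    proof (rule eqA[OF vV], cases "v \<le> a")
      case True
      have "l v + v = b + 1" using True n v by (intro l1) linarith+
      then have "t (r v) = l v" using r1[OF True] unfolding t_def by linarith
      then show "t (r v) = u v \<or> t (r v) = l v \<or> t (r v) = v" by blast
    next
      case False
      then have "t (r v) = v" using r2[OF _ mid] unfolding t_def by simp
      then show "t (r v) = u v \<or> t (r v) = l v \<or> t (r v) = v" by blast
    qed
    then show "(t (r v), v) \<in> A.orb" by (rule A.orb_sym[OF _ vV])
    assume fl: "u v = v \<or> l v = v"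
    have "u' (r v) = r v \<or> l' (r v) = r v"
      using cs
    proof cases
      case 1
      have "l v + v = b + 1" using 1 n v by (intro l1) linarith+
      then have "u v = v" using fl 1 n by linarith
      moreover have "l' (r v) + r v + 3 * a = 2 * b + 1" using r1[OF 1] v 1 n by (intro l5) linarith+
      ultimately show ?thesis using r1[OF 1] u1[OF v(1) 1] by linarith
    next
      case 2
      have "u v = u' (r v) + a" using u2[OF 2(1) mid] unfolding va[OF 2(1)] by blast
      moreover have "l v + v = b + 1" using 2 n v by (intro l1) linarith+
      moreover have "l' (r v) + r v + 2 * a = b + 1" using r2[OF 2(1) mid] 2 by (intro l4) linarith+
      ultimately show ?thesis using fl r2[OF 2(1) mid] by linarith
    next
      case 3
      have "u v = u' (r v) + a" using u2[OF 3(2) mid] unfolding va[OF 3(2)] by blast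
      moreover have "l v + v = b + 1" using 3 n v by (intro l1) linarith+
      ultimately show ?thesis using fl r2[OF 3(2) mid] 3 n by linarith
    next
      case 4
      note f = f4[OF 4]
      have "u v = u' (r v) + a" "l v = l' (r v) + a" using u2[OF f(1) mid] l2[OF 4 f(2)] unfolding va[OF f(1)] by blast+
      then show ?thesis using fl r2[OF f(1) mid] by linarith
    qed
    then show "B.flagged (r v)" using rv by (intro B.flagI) (simp add: B.flag_def)
  next
    fix w assume w: "1 \<le> w" "w \<le> n - a"
    have tw: "t w \<in> {1..2 * n}" using w n by (auto simp: t_def)
    then show "t w \<in> {1..2 * n}" .
    have mid: "a < t w" "t w + a \<le> 2 * n" using w n by (auto simp: t_def)
    have wt: "t w - a = w" by (simp add: t_def)
    have ut: "u (t w) = t (u' w)" using u2[OF mid] unfolding wt by (simp add: t_def)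
    show "(t w, t (u' w)) \<in> A.orb" by (rule eqA[OF tw]) (simp add: ut)
    have "r (t w) = w" using r2[OF mid] by (simp add: t_def)
    then show "(r (t w), w) \<in> B.orb" by simp
    \<comment> \<open>A new arc on the block of length a comes from three old arcs. If w is its
      middle vertex, the vertex reached by the first lower arc has no upper arc, so end points are
      preserved.\<close>
    have J: "t (l' w) = l (u (l (t w)))" "2 * w + 3 * a = 2 * b + 1 \<Longrightarrow> u (l (t w)) = l (t w)"
      if j: "b < w + 2 * a" "w + a \<le> b"
    proof -
      have 1: "l (t w) + t w = b + 1" using j unfolding t_def by (intro l1) linarith+
      have 2: "u (l (t w)) + l (t w) = a + 1" using 1 j unfolding t_def by (intro u1) linarith+
      have 3: "l (u (l (t w))) + u (l (t w)) = b + 1" using 1 2 j n unfolding t_def by (intro l1) linarith+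
      show "t (l' w) = l (u (l (t w)))" using 1 2 3 l5[OF j] unfolding t_def by linarith
      show "2 * w + 3 * a = 2 * b + 1 \<Longrightarrow> u (l (t w)) = l (t w)" using 1 2 unfolding t_def by linarith
    qed
    have l4': "l (t w) + t w = b + 1" "l' w + w + 2 * a = b + 1" if "w + 2 * a \<le> b"
      using l1[of "t w"] l4[OF w(1) that] that w by (auto simp: t_def)
    have l2': "l (t w) = t (l' w)" if "b < w + a"
    proof -
      have f: "b < t w" "t w + b \<le> 2 * n" using that w n by (auto simp: t_def)
      show ?thesis using l2[OF f] unfolding wt by (simp add: t_def)
    qed
    consider "w + 2 * a \<le> b" | "b < w + 2 * a" "w + a \<le> b" | "b < w + a" by linarith
    note cs = this
    show "(t w, t (l' w)) \<in> A.orb"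
      using cs
    proof cases
      case 1
      have "t (l' w) = l (t w)" using l4'[OF 1] unfolding t_def by linarith
      then show ?thesis by (intro eqA[OF tw]) blast
    next
      case 2
      have "(t w, u (l (t w))) \<in> A.orb" by (rule A.orb_trans[OF A.orb_l[OF tw] A.orb_u[OF A.l_range[OF tw]]])
      then show ?thesis unfolding J(1)[OF 2] by (rule A.orb_trans) (rule A.orb_l[OF A.u_range[OF A.l_range[OF tw]]])
    next
      case 3
      then show ?thesis using l2' by (intro eqA[OF tw]) simp
    qed
    assume fl: "u' w = w \<or> l' w = w"
    have "A.flag (t w) \<or> A.flag (l (t w))"
    proof (cases "u' w = w")
      case True
      then show ?thesis using ut tw by (simp add: A.flag_def)
    next
      case False
      then have lw: "l' w = w" using fl by simp
      show ?thesis
        using cs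
      proof cases
        case 1
        have "l (t w) = t w" using l4'[OF 1] lw unfolding t_def by linarith
        then show ?thesis using tw by (simp add: A.flag_def)
      next
        case 2
        have "u (l (t w)) = l (t w)" using l5[OF 2] lw by (intro J(2)[OF 2]) linarith
        then show ?thesis using A.l_range[OF tw] by (simp add: A.flag_def)
      next
        case 3
        then show ?thesis using l2' lw tw by (simp add: A.flag_def)
      qed
    qed
    then show "A.flagged (t w)" unfolding A.flagged_def using A.orb_l[OF tw] A.orb_refl by blast
  qed
qed

text \<open>A vertex y with a < y <= a + c is joined to y - c by a lower and then an upper arc, so
  the two may be identified. The vertices 1..a stay and their old upper arcs serve as new lower
  arcs. New upper arcs on 1..a - c are paths upper, lower, upper of the old graph; old lower arcs on
  c + 1..a are paths \<open>l'\<close>, \<open>u'\<close>, \<open>l'\<close> of the new one.\<close>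

lemma J_step_short:
  fixes n a c :: nat
  assumes A: "mirror_system (2 * n) u l" and B: "mirror_system (2 * (n - c)) u' l'" and n: "a + c \<le> n" "c \<le> a"
    and u1: "\<And>v. 1 \<le> v \<Longrightarrow> v \<le> a \<Longrightarrow> u v + v = a + 1" and l1: "\<And>v. 1 \<le> v \<Longrightarrow> v \<le> a + c \<Longrightarrow> l v + v = a + c + 1"
    and u2: "\<And>v. a < v \<Longrightarrow> v + a \<le> 2 * n \<Longrightarrow> u v = u' (v - c) + c \<and> a < u v \<and> u v + a \<le> 2 * n"
    and l2: "\<And>v. a + c < v \<Longrightarrow> v + (a + c) \<le> 2 * n \<Longrightarrow> l v = l' (v - c) + c \<and> a + c < l v \<and> l v + (a + c) \<le> 2 * n"
    and u3: "\<And>w. 1 \<le> w \<Longrightarrow> w + c \<le> a \<Longrightarrow> u' w + w + c = a + 1"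
    and l3: "\<And>w. 1 \<le> w \<Longrightarrow> w \<le> a \<Longrightarrow> l' w + w = a + 1"
  shows "mirror_system.J (2 * n) u l {1..2 * n} = mirror_system.J (2 * (n - c)) u' l' {1..2 * (n - c)}"
proof -
  interpret A: mirror_system "2 * n" u l by (rule A)
  interpret B: mirror_system "2 * (n - c)" u' l' by (rule B)
  define r where "r v = (if v \<le> a then v else if 2 * n < v + a then v - 2 * c else v - c)" for v
  define t where "t w = (if w \<le> a then w else if 2 * (n - c) < w + a then w + 2 * c else w + c)" for w
  have r1: "r v = v" if "v \<le> a" for v using that by (simp add: r_def)
  have r2: "r v + c = v" if "a < v" "v + a \<le> 2 * n" for v using that n by (simp add: r_def)
  have t1: "t w = w" if "w \<le> a" for w using that by (simp add: t_def)
  have t2: "t w = w + c" if "a < w" "w + a \<le> 2 * (n - c)" for w using that by (simp add: t_def)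
  have eqB: "(x, y) \<in> B.orb" if "x \<in> {1..2 * (n - c)}" "y = u' x \<or> y = l' x \<or> y = x" for x y
    using that B.orb_u B.orb_l B.orb_refl by blast
  have eqA: "(x, y) \<in> A.orb" if "x \<in> {1..2 * n}" "y = u x \<or> y = l x \<or> y = x" for x y
    using that A.orb_u A.orb_l A.orb_refl by blast
  have t_rev: "t (2 * (n - c) + 1 - w) = 2 * n + 1 - t w" if "w \<in> {1..2 * (n - c)}" for w
    using that n unfolding t_def by (auto split: if_splits; linarith)
  \<comment> \<open>On the left this is the two-arc path through \<open>l y\<close>; near the right
    end it is its reflection; in between \<open>t\<close> just undoes the shift.\<close>
  have near: "(t (y - c), y) \<in> A.orb" if y: "a < y" "y + a \<le> 2 * n" for y
  proof -
    have left: "(t (y - c), y) \<in> A.orb" if y: "a < y" "y \<le> a + c" for y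
    proof -
      have yV: "y \<in> {1..2 * n}" using y n by auto
      have 1: "l y + y = a + c + 1" using y by (intro l1) linarith+
      have 2: "u (l y) + l y = a + 1" using y 1 n by (intro u1) linarith+
      have "t (y - c) = u (l y)" using 1 2 y t1[of "y - c"] by linarith
      then have "(y, t (y - c)) \<in> A.orb" using A.orb_trans[OF A.orb_l[OF yV] A.orb_u[OF A.l_range[OF yV]]] by simp
      then show ?thesis by (rule A.orb_sym[OF _ yV])
    qed
    consider "y \<le> a + c" | "a + c < y" "y + (a + c) \<le> 2 * n" | "2 * n < y + (a + c)" by linarith
    then show ?thesis
    proof cases
      case 1
      then show ?thesis by (rule left[OF y(1)])
    next
      case 2
      then have "t (y - c) = y" using t2[of "y - c"] n by simp
      then show ?thesis by simp
    next
      case 3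
      define x where "x = 2 * n + 1 - y"
      have x: "a < x" "x \<le> a + c" "y = 2 * n + 1 - x" "x \<in> {1..2 * n}" using 3 y n by (auto simp: x_def)
      have xc: "x - c \<in> {1..2 * (n - c)}" "2 * (n - c) + 1 - (x - c) = y - c" using x n by auto
      have tx: "t (x - c) \<in> {1..2 * n}" using t1[of "x - c"] x xc n by auto
      have "(A.rev (t (x - c)), A.rev x) \<in> A.orb" by (rule A.orb_rev[OF left[OF x(1,2)] tx])
      moreover have "A.rev x = y" "A.rev (t (x - c)) = t (y - c)"
        using t_rev[OF xc(1)] unfolding A.rev_def xc(2) using x by auto
      ultimately show ?thesis by simp
    qed
  qed
  show ?thesis
  proof (rule J_transfer[OF A B, where r = r and t = t])
    fix v assume "v \<in> {1..2 * n}"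
    then show "r (2 * n + 1 - v) = 2 * (n - c) + 1 - r v" using n unfolding r_def by (auto split: if_splits)
  next
    fix w assume "w \<in> {1..2 * (n - c)}"
    then show "t (2 * (n - c) + 1 - w) = 2 * n + 1 - t w" by (rule t_rev)
  next
    fix v assume v: "1 \<le> v" "v \<le> n"
    have mid: "v + a \<le> 2 * n" using v n by linarith
    have rv: "r v \<in> {1..2 * (n - c)}"
      using r1[of v] r2[of v] mid v n by (cases "v \<le> a") auto
    then show "r v \<in> {1..2 * (n - c)}" .
    have vV: "v \<in> {1..2 * n}" using v by simp
    have vc: "v - c = r v" if "a < v" using r2[OF that mid] by linarith
    show "(r v, r (u v)) \<in> B.orb"
    proof (rule eqB[OF rv], cases "v \<le> a")
      case True
      have "r (u v) = u v" using u1[OF v(1) True] v by (intro r1) linarith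
      then have "r (u v) = l' (r v)" using u1[OF v(1) True] l3[OF v(1) True] r1[OF True] by simp
      then show "r (u v) = u' (r v) \<or> r (u v) = l' (r v) \<or> r (u v) = r v" by blast
    next
      case False
      then have f: "a < v" by simp
      have "r (u v) + c = u v" using u2[OF f mid] by (intro r2) auto
      then have "r (u v) = u' (r v)" using u2[OF f mid] unfolding vc[OF f] by linarith
      then show "r (u v) = u' (r v) \<or> r (u v) = l' (r v) \<or> r (u v) = r v" by blast
    qed
    consider "v \<le> c" | "c < v" "v \<le> a" | "a < v" "v \<le> a + c" | "a + c < v" by linarith
    note cs = this
    have c2: "r (l v) = l' (u' (l' (r v)))" "2 * v = a + c + 1 \<Longrightarrow> u' (l' (r v)) = l' (r v)" if 2: "c < v" "v \<le> a"
    proof -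
      have 1: "l v + v = a + c + 1" using 2 by (intro l1) linarith+
      have e: "r (l v) = l v" using 1 2 by (intro r1) linarith
      have 3: "l' v + v = a + 1" by (rule l3[OF v(1) 2(2)])
      have 4: "u' (l' v) + l' v + c = a + 1" using 3 2 by (intro u3) linarith+
      have 5: "l' (u' (l' v)) + u' (l' v) = a + 1" using 3 4 2 by (intro l3) linarith+
      show "r (l v) = l' (u' (l' (r v)))" unfolding r1[OF 2(2)] using 1 e 3 4 5 by linarith
      show "2 * v = a + c + 1 \<Longrightarrow> u' (l' (r v)) = l' (r v)" unfolding r1[OF 2(2)] using 3 4 by linarith
    qed
    have f4: "a < v" "v + (a + c) \<le> 2 * n" if "a + c < v" using that n v by linarith+
    show "(r v, r (l v)) \<in> B.orb"
      using cs
    proof cases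
      case 1
      have "l v + v = a + c + 1" using 1 n v by (intro l1) linarith+
      moreover from this have "r (l v) + c = l v" using 1 n v by (intro r2) linarith+
      moreover have "l' v + v = a + 1" using 1 n v by (intro l3) linarith+
      ultimately have "r (l v) = l' (r v)" using r1[of v] 1 n by simp
      then show ?thesis by (intro eqB[OF rv]) blast
    next
      case 2
      have "(r v, u' (l' (r v))) \<in> B.orb" by (rule B.orb_trans[OF B.orb_l[OF rv] B.orb_u[OF B.l_range[OF rv]]])
      then show ?thesis unfolding c2(1)[OF 2] by (rule B.orb_trans) (rule B.orb_l[OF B.u_range[OF B.l_range[OF rv]]])
    next
      case 3
      have 1: "l v + v = a + c + 1" using 3 n v by (intro l1) linarith+
      moreover from this have "r (l v) = l v" using 3 n v by (intro r1) linarith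
      moreover have "l' (r v) + r v = a + 1" using r2[OF 3(1) mid] 3 n by (intro l3) linarith+
      ultimately have "r (l v) = l' (r v)" using r2[OF 3(1) mid] by linarith
      then show ?thesis by (intro eqB[OF rv]) blast
    next
      case 4
      note f = f4[OF 4]
      have "r (l v) + c = l v" using l2[OF 4 f(2)] n by (intro r2) linarith+
      then have "r (l v) = l' (r v)" using l2[OF 4 f(2)] unfolding vc[OF f(1)] by linarith
      then show ?thesis by (intro eqB[OF rv]) blast
    qed
    show "(t (r v), v) \<in> A.orb"
    proof (cases "v \<le> a")
      case True
      then show ?thesis using r1 t1 by simp
    next
      case False
      then show ?thesis using near[of v] mid vc by simp
    qed
    assume fl: "u v = v \<or> l v = v"
    have "B.flag (r v) \<or> B.flag (l' (r v))"
      using cs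
    proof cases
      case 1
      have "l v + v = a + c + 1" using 1 n v by (intro l1) linarith+
      then have "u v = v" using fl 1 n by linarith
      moreover have va: "v \<le> a" using 1 n by linarith
      ultimately have "l' (r v) = r v" using u1[OF v(1) va] l3[OF v(1) va] r1[OF va] by simp
      then show ?thesis using rv by (simp add: B.flag_def)
    next
      case 2
      have e: "l v + v = a + c + 1" using 2 by (intro l1) linarith+
      show ?thesis
      proof (cases "u v = v")
        case True
        then have "l' (r v) = r v" using u1[OF v(1) 2(2)] l3[OF v(1) 2(2)] r1[OF 2(2)] by simp
        then show ?thesis using rv by (simp add: B.flag_def)
      next
        case False
        then have "2 * v = a + c + 1" using fl e by linarith
        then show ?thesis using c2(2)[OF 2] B.l_range[OF rv] by (simp add: B.flag_def)
      qed
    next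
      case 3
      have "l v + v = a + c + 1" using 3 n v by (intro l1) linarith+
      then have "u v = v" using fl 3 n by linarith
      then have "u' (r v) = r v" using u2[OF 3(1) mid] r2[OF 3(1) mid] unfolding vc[OF 3(1)] by linarith
      then show ?thesis using rv by (simp add: B.flag_def)
    next
      case 4
      note f = f4[OF 4]
      have "u v = u' (r v) + c" "l v = l' (r v) + c" using u2[OF f(1) mid] l2[OF 4 f(2)] unfolding vc[OF f(1)] by blast+
      then have "u' (r v) = r v \<or> l' (r v) = r v" using fl r2[OF f(1) mid] by linarith
      then show ?thesis using rv by (simp add: B.flag_def)
    qed
    then show "B.flagged (r v)" unfolding B.flagged_def using B.orb_l[OF rv] B.orb_refl by blast
  next
    fix w assume w: "1 \<le> w" "w \<le> n - c"
    have mid: "w + a \<le> 2 * (n - c)" using w n by linarith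
    have tw: "t w \<in> {1..2 * n}" using w n t1[of w] t2[of w] mid by (cases "w \<le> a") auto
    then show "t w \<in> {1..2 * n}" .
    have wc: "w + c \<in> {1..2 * n}" using w n by auto
    have near_w: "(t w, w + c) \<in> A.orb" if "a < w + c" using near[of "w + c"] that mid n by simp
    have tr: "r (t w) = w"
    proof (cases "w \<le> a")
      case True
      then show ?thesis using t1 r1 by simp
    next
      case False
      then show ?thesis using t2[OF _ mid] r2[of "w + c"] mid n by simp
    qed
    show "(r (t w), w) \<in> B.orb" using tr by simp
    have u_big: "u (w + c) = u' w + c" "a < u' w + c" "u' w + c + a \<le> 2 * n" if "a < w + c"
    proof -
      have "w + c + a \<le> 2 * n" using mid n by linarith
      from u2[OF that this] show "u (w + c) = u' w + c" "a < u' w + c" "u' w + c + a \<le> 2 * n" by auto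
    qed
    have u_small: "t (u' w) = u (l (u (t w)))" "u' w = w \<Longrightarrow> l (u (t w)) = u (t w)" if 1: "w + c \<le> a"
    proof -
      have tw: "t w = w" using 1 by (intro t1) simp
      have 2: "u' w + w + c = a + 1" by (rule u3[OF w(1) 1])
      have 3: "u w + w = a + 1" using 1 w by (intro u1) linarith+
      have 4: "l (u w) + u w = a + c + 1" using 1 3 w by (intro l1) linarith+
      have 5: "u (l (u w)) + l (u w) = a + 1" using 1 3 4 w by (intro u1) linarith+
      have "t (u' w) = u' w" using 2 w by (intro t1) linarith
      then show "t (u' w) = u (l (u (t w)))" unfolding tw using 2 3 4 5 by linarith
      show "u' w = w \<Longrightarrow> l (u (t w)) = u (t w)" unfolding tw using 2 3 4 by linarith
    qed
    show "(t w, t (u' w)) \<in> A.orb"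
    proof (cases "w + c \<le> a")
      case True
      have "(t w, l (u (t w))) \<in> A.orb" by (rule A.orb_trans[OF A.orb_u[OF tw] A.orb_l[OF A.u_range[OF tw]]])
      then show ?thesis unfolding u_small(1)[OF True] by (rule A.orb_trans) (rule A.orb_u[OF A.l_range[OF A.u_range[OF tw]]])
    next
      case False
      then have f: "a < w + c" by simp
      have "(t (u' w), u' w + c) \<in> A.orb" using near[OF u_big(2,3)[OF f]] by simp
      then have 1: "(u' w + c, t (u' w)) \<in> A.orb"
      proof (rule A.orb_sym)
        have "u' w \<in> {1..2 * (n - c)}" by (rule B.u_range) (use w in simp)
        then show "t (u' w) \<in> {1..2 * n}"
          unfolding t_def using n by (auto split: if_splits)
      qed
      have "(t w, u' w + c) \<in> A.orb" using A.orb_trans[OF near_w[OF f] A.orb_u[OF wc]] unfolding u_big(1)[OF f] .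
      then show ?thesis using 1 by (rule A.orb_trans)
    qed
    have l_small: "t (l' w) = u (t w)" if 1: "w \<le> a"
      using l3[OF w(1) 1] u1[OF w(1) 1] t1[OF 1] t1[of "l' w"] w by simp
    have l_big: "t (l' w) = l (t w)" if 1: "a < w"
    proof -
      have e: "t w = w + c" by (rule t2[OF 1 mid])
      have "a + c < w + c" "w + c + (a + c) \<le> 2 * n" using 1 mid n by auto
      note L = l2[OF this]
      have "l (w + c) = l' w + c" "a < l' w" "l' w + a \<le> 2 * (n - c)" using L by auto
      then show ?thesis unfolding e using t2[of "l' w"] by simp
    qed
    show "(t w, t (l' w)) \<in> A.orb"
      using l_small l_big by (intro eqA[OF tw]) (cases "w \<le> a"; simp)
    assume fl: "u' w = w \<or> l' w = w"
    show "A.flagged (t w)"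
    proof (cases "l' w = w")
      case True
      then have "A.flag (t w)" using l_small l_big tw by (cases "w \<le> a") (auto simp: A.flag_def)
      then show ?thesis by (rule A.flagI)
    next
      case False
      then have uw: "u' w = w" using fl by simp
      show ?thesis
      proof (cases "w + c \<le> a")
        case True
        have "A.flag (u (t w))" using u_small(2)[OF True uw] A.u_range[OF tw] by (simp add: A.flag_def)
        then show ?thesis unfolding A.flagged_def using A.orb_u[OF tw] by blast
      next
        case False
        then have f: "a < w + c" by simp
        have "A.flag (w + c)" using u_big(1)[OF f] uw wc by (simp add: A.flag_def)
        then show ?thesis unfolding A.flagged_def using near_w[OF f] by blast
      qed
    qed
  qed
qed

section \<open>The recursion for the doubled count of a meander graph\<close>

lemma mirC_head: "i \<le> a \<Longrightarrow> mirC n (a # as) i + i = a + 1"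
  by simp

lemma JC_step_long:
  assumes a: "a1 + sum_list as \<le> n" and b: "b1 + sum_list bs \<le> n" and ab: "2 * a1 \<le> b1"
  shows "JC n (a1 # as) (b1 # bs) = JC (n - a1) as ((b1 - 2 * a1) # a1 # bs)"
  unfolding JC_def
proof (rule J_step_long)
  show "mirror_system (2 * n) (mirC n (a1 # as)) (mirC n (b1 # bs))" using a b by (intro mirror_system_mirC) auto
  show "mirror_system (2 * (n - a1)) (mirC (n - a1) as) (mirC (n - a1) ((b1 - 2 * a1) # a1 # bs))"
    using a b ab by (intro mirror_system_mirC) auto
  show "b1 \<le> n" "2 * a1 \<le> b1" using b ab by auto
  fix v
  show "v \<le> a1 \<Longrightarrow> mirC n (a1 # as) v + v = a1 + 1" "v \<le> b1 \<Longrightarrow> mirC n (b1 # bs) v + v = b1 + 1" by (rule mirC_head; assumption)+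
  show "mirC n (a1 # as) v = mirC (n - a1) as (v - a1) + a1 \<and> a1 < mirC n (a1 # as) v \<and> mirC n (a1 # as) v + a1 \<le> 2 * n"
    if v: "a1 < v" "v + a1 \<le> 2 * n"
    using mirC_mid[OF v] mirC_mid_range[OF a v] by (simp del: mirC.simps)
  show "mirC n (b1 # bs) v = mirC (n - a1) ((b1 - 2 * a1) # a1 # bs) (v - a1) + a1 \<and> b1 < mirC n (b1 # bs) v \<and> mirC n (b1 # bs) v + b1 \<le> 2 * n"
    if v: "b1 < v" "v + b1 \<le> 2 * n"
  proof -
    have e: "n - a1 - (b1 - 2 * a1) - a1 = n - b1" "v - a1 - (b1 - 2 * a1) - a1 = v - b1" using ab v b by auto
    have "mirC (n - a1) ((b1 - 2 * a1) # a1 # bs) (v - a1) = (b1 - 2 * a1) + mirC (n - a1 - (b1 - 2 * a1)) (a1 # bs) (v - a1 - (b1 - 2 * a1))"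
      by (rule mirC_mid) (use v ab b in linarith)+
    also have "mirC (n - a1 - (b1 - 2 * a1)) (a1 # bs) (v - a1 - (b1 - 2 * a1)) = a1 + mirC (n - b1) bs (v - b1)"
      unfolding e[symmetric] by (rule mirC_mid) (use v ab b in linarith)+
    finally show ?thesis using mirC_mid[OF v] mirC_mid_range[OF b v] ab by (simp del: mirC.simps)
  qed
  show "mirC (n - a1) ((b1 - 2 * a1) # a1 # bs) v + v + 2 * a1 = b1 + 1" if "v + 2 * a1 \<le> b1"
    using mirC_head[of v "b1 - 2 * a1" "n - a1" "a1 # bs"] that by (simp del: mirC.simps)
  show "mirC (n - a1) ((b1 - 2 * a1) # a1 # bs) v + v + 3 * a1 = 2 * b1 + 1" if v: "b1 < v + 2 * a1" "v + a1 \<le> b1"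
  proof -
    have "mirC (n - a1) ((b1 - 2 * a1) # a1 # bs) v = (b1 - 2 * a1) + mirC (n - a1 - (b1 - 2 * a1)) (a1 # bs) (v - (b1 - 2 * a1))"
      by (rule mirC_mid) (use v ab b in linarith)+
    moreover have "mirC (n - a1 - (b1 - 2 * a1)) (a1 # bs) (v - (b1 - 2 * a1)) + (v - (b1 - 2 * a1)) = a1 + 1"
      by (rule mirC_head) (use v ab in linarith)
    ultimately show ?thesis using v ab by linarith
  qed
qed

lemma JC_step_short:
  assumes a: "a1 + sum_list as \<le> n" and b: "b1 + sum_list bs \<le> n" and ab: "a1 \<le> b1" "b1 \<le> 2 * a1"
  shows "JC n (a1 # as) (b1 # bs) = JC (n - (b1 - a1)) ((2 * a1 - b1) # as) (a1 # bs)"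
proof -
  define c where "c = b1 - a1"
  have c: "b1 = a1 + c" "c \<le> a1" using ab by (auto simp: c_def)
  have "JC n (a1 # as) ((a1 + c) # bs) = JC (n - c) ((a1 - c) # as) (a1 # bs)"
    unfolding JC_def
  proof (rule J_step_short)
    show "mirror_system (2 * n) (mirC n (a1 # as)) (mirC n ((a1 + c) # bs))" using a b c by (intro mirror_system_mirC) auto
    show "mirror_system (2 * (n - c)) (mirC (n - c) ((a1 - c) # as)) (mirC (n - c) (a1 # bs))"
      using a b c by (intro mirror_system_mirC) auto
    show "a1 + c \<le> n" "c \<le> a1" using b c by auto
    have b': "a1 + c + sum_list bs \<le> n" using b c by simp
    fix v
    show "v \<le> a1 \<Longrightarrow> mirC n (a1 # as) v + v = a1 + 1" "v \<le> a1 + c \<Longrightarrow> mirC n ((a1 + c) # bs) v + v = a1 + c + 1"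
      "v \<le> a1 \<Longrightarrow> mirC (n - c) (a1 # bs) v + v = a1 + 1" by (rule mirC_head; assumption)+
    show "mirC (n - c) ((a1 - c) # as) v + v + c = a1 + 1" if "v + c \<le> a1"
      using mirC_head[of v "a1 - c" "n - c" as] that by (simp del: mirC.simps)
    show "mirC n (a1 # as) v = mirC (n - c) ((a1 - c) # as) (v - c) + c \<and> a1 < mirC n (a1 # as) v \<and> mirC n (a1 # as) v + a1 \<le> 2 * n"
      if v: "a1 < v" "v + a1 \<le> 2 * n"
    proof -
      have e: "n - c - (a1 - c) = n - a1" "v - c - (a1 - c) = v - a1" using c v a by auto
      have "mirC (n - c) ((a1 - c) # as) (v - c) = (a1 - c) + mirC (n - a1) as (v - a1)"
        unfolding e[symmetric] by (rule mirC_mid) (use v c a in linarith)+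
      then show ?thesis using mirC_mid[OF v] mirC_mid_range[OF a v] c by (simp del: mirC.simps)
    qed
    show "mirC n ((a1 + c) # bs) v = mirC (n - c) (a1 # bs) (v - c) + c \<and> a1 + c < mirC n ((a1 + c) # bs) v \<and>
        mirC n ((a1 + c) # bs) v + (a1 + c) \<le> 2 * n"
      if v: "a1 + c < v" "v + (a1 + c) \<le> 2 * n"
    proof -
      have e: "n - c - a1 = n - (a1 + c)" "v - c - a1 = v - (a1 + c)" by auto
      have "mirC (n - c) (a1 # bs) (v - c) = a1 + mirC (n - (a1 + c)) bs (v - (a1 + c))"
        unfolding e[symmetric] by (rule mirC_mid) (use v c b in linarith)+
      then show ?thesis using mirC_mid[OF v] mirC_mid_range[OF b' v] by (simp del: mirC.simps)
    qed
  qed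
  moreover have "2 * a1 - b1 = a1 - c" "b1 - a1 = c" using c by auto
  ultimately show ?thesis using c(1) by simp
qed

context
  fixes n m :: nat and as bs :: "nat list"
  assumes a: "m + sum_list as \<le> n" and b: "m + sum_list bs \<le> n"
begin

text \<open>On the first and on the last m vertices upper and lower arcs coincide. Each side has m
  div 2 two-vertex cycles and, for odd m, an isolated vertex, which is unstable because reflection
  moves it to the other side. The contribution is 4 (m div 2) + 2 (m mod 2) = 2m.\<close>

lemma JC_equal_heads: "JC n (m # as) (m # bs) = JC (n - m) as bs + 2 * m"
proof -
  let ?u = "mirC n (m # as)" and ?l = "mirC n (m # bs)" and ?M = "2 * n"
  let ?H = "{1..m} \<union> {?M + 1 - m..?M}"
  define d where "d = m div 2"
  have mn: "m \<le> n" using a by simp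
  have A: "mirror_system ?M ?u ?l" using a b by (intro mirror_system_mirC) auto
  have B: "mirror_system (2 * (n - m)) (mirC (n - m) as) (mirC (n - m) bs)" using a b by (intro mirror_system_mirC) auto
  interpret A: mirror_system ?M ?u ?l by (rule A)
  have split: "A.J {1..?M} = mirror_system.J (2 * (n - m)) (mirC (n - m) as) (mirC (n - m) bs) {1..2 * (n - m)} + A.J ?H"
  proof (rule J_split[OF A B])
    show "2 * n = 2 * (n - m) + 2 * m" using mn by simp
    fix i assume "i \<in> {1..2 * (n - m)}"
    then show "?u (i + m) = mirC (n - m) as i + m" "?l (i + m) = mirC (n - m) bs i + m"
      using mirC_mid[of m "i + m" n] mn by auto
  qed
  have low: "?u i + i = m + 1" "?l i = ?u i" if "i \<le> m" for i using that by auto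
  have high: "?u i + i = 2 * ?M + 1 - m" "?l i = ?u i" if "i \<in> {?M + 1 - m..?M}" for i using that mn by auto
  have HV: "?H \<subseteq> {1..?M}" using mn by auto
  have uH: "?u i \<in> ?H \<and> ?l i = ?u i" if "i \<in> ?H" for i
    using that low[of i] high[of i] mn by auto
  have orbit: "j = i \<or> j = ?u i" if "(i, j) \<in> A.orb" and i: "i \<in> ?H" for i j
  proof -
    have iV: "i \<in> {1..?M}" using i HV by blast
    have ui: "?u i \<in> ?H" "?l i = ?u i" "?l (?u i) = i" "?u (?u i) = i"
      using uH[OF i] uH[of "?u i"] A.u_u[OF iV] by simp_all
    from that(1) iV show ?thesis
      by (induction rule: A.orb_induct) (use ui in \<open>auto simp del: mirC.simps\<close>)
  qed
  have flagged: "A.flagged i \<longleftrightarrow> ?u i = i" if i: "i \<in> ?H" for i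
  proof
    have iV: "i \<in> {1..?M}" using i HV by blast
    assume "A.flagged i"
    then obtain v where v: "A.flag v" "(i, v) \<in> A.orb" unfolding A.flagged_def by blast
    have "v = i \<or> v = ?u i" by (rule orbit[OF v(2) i])
    then show "?u i = i" using v(1) uH[OF i] uH[of "?u i"] A.u_u[OF iV] unfolding A.flag_def by metis
  next
    assume "?u i = i"
    then show "A.flagged i" using i HV by (intro A.flagI) (auto simp: A.flag_def simp del: mirC.simps)
  qed
  have nonstable: "(i, A.rev i) \<notin> A.orb" if i: "i \<in> ?H" for i
  proof
    assume "(i, A.rev i) \<in> A.orb"
    then have "A.rev i = i \<or> A.rev i = ?u i" by (rule orbit[OF _ i])
    then show False using i low(1)[of i] high(1)[of i] mn unfolding A.rev_def by (auto simp del: mirC.simps)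
  qed
  have d2: "2 * d + m mod 2 = m" by (simp add: d_def)
  \<comment> \<open>Representatives of the cycles: the outer half of each of the two blocks.\<close>
  let ?T = "{1..d} \<union> {?M + 1 - d..?M}"
  have "card (A.cls ` {i \<in> ?H. \<not> A.flagged i}) = card ?T"
  proof (rule A.card_classes)
    show "?T \<subseteq> {1..?M}" "{i \<in> ?H. \<not> A.flagged i} \<subseteq> {1..?M}" using mn d2 HV by auto
    fix i
    show "i \<in> {i \<in> ?H. \<not> A.flagged i}" if T: "i \<in> ?T"
    proof -
      have i: "i \<in> ?H" using T d2 mn by auto
      have "?u i \<noteq> i" using T low(1)[of i] high(1)[of i] d2 mn by auto
      then show ?thesis using i flagged[OF i] by simp
    qed
    fix j assume T: "i \<in> ?T" "j \<in> ?T" "(i, j) \<in> A.orb"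
    have i: "i \<in> ?H" using T(1) d2 mn by auto
    from orbit[OF T(3) i] show "i = j"
    proof
      assume j: "j = ?u i"
      have ij: "i \<le> d \<or> ?M + 1 \<le> i + d" "j \<le> d \<or> ?M + 1 \<le> j + d" using T(1,2) by auto
      have "i + j = m + 1 \<or> i + j = 2 * ?M + 1 - m \<and> ?M + 1 \<le> i + m"
      proof (cases "i \<le> m")
        case True
        then show ?thesis using low(1)[OF True] unfolding j by linarith
      next
        case False
        then have h: "i \<in> {?M + 1 - m..?M}" using i by auto
        have "?M + 1 \<le> i + m" using h mn by auto
        then show ?thesis using high(1)[OF h] unfolding j by linarith
      qed
      moreover have "1 \<le> i" "i \<le> ?M" "1 \<le> j" using T(1,2) d2 mn by auto
      ultimately have False using ij d2 mn by (elim disjE; linarith)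
      then show ?thesis ..
    qed simp
  next
    fix i assume "i \<in> {i \<in> ?H. \<not> A.flagged i}"
    then have i: "i \<in> ?H" "?u i \<noteq> i" using flagged by auto
    have iV: "i \<in> {1..?M}" using i HV by blast
    have "i \<in> ?T \<or> ?u i \<in> ?T"
    proof (cases "i \<le> m")
      case True
      have "i \<le> d \<or> ?u i \<le> d" "1 \<le> ?u i" "1 \<le> i" using low(1)[OF True] i(2) d2 True iV by auto
      then show ?thesis by auto
    next
      case False
      then have h: "i \<in> {?M + 1 - m..?M}" using i(1) by auto
      have "?M + 1 \<le> i + d \<or> ?M + 1 \<le> ?u i + d" "?u i \<le> ?M" "i \<le> ?M"
      proof -
        have h': "?M + 1 \<le> i + m" "i \<le> ?M" using h by auto
        note e = high(1)[OF h]
        show "i \<le> ?M" by (rule h'(2))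
        show "?u i \<le> ?M" using e h' mn by linarith
        have "m mod 2 \<le> 1" by simp
        then show "?M + 1 \<le> i + d \<or> ?M + 1 \<le> ?u i + d" using e h' d2 mn i(2) by linarith
      qed
      then show ?thesis by auto
    qed
    then show "\<exists>j\<in>?T. (i, j) \<in> A.orb" using A.orb_u[OF iV] A.orb_refl by blast
  qed
  also have "card ?T = 2 * d"
  proof -
    have "card ?T = card {1..d} + card {?M + 1 - d..?M}" by (rule card_Un_disjoint) (use mn d2 in auto)
    then show ?thesis using mn d2 by simp
  qed
  finally have c1: "card (A.cls ` {i \<in> ?H. \<not> A.flagged i}) = 2 * d" .
  let ?T' = "if odd m then {d + 1, ?M - d} else {}"
  have "card (A.cls ` {i \<in> ?H. A.flagged i \<and> (i, A.rev i) \<notin> A.orb}) = card ?T'"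
  proof (rule A.card_classes)
    show "?T' \<subseteq> {1..?M}" using mn d2 by (auto simp: odd_iff_mod_2_eq_one split: if_splits)
    show "{i \<in> ?H. A.flagged i \<and> (i, A.rev i) \<notin> A.orb} \<subseteq> {1..?M}" using HV by auto
    fix i
    have T: "i \<in> ?H \<and> ?u i = i" if "i \<in> ?T'"
    proof -
      have o: "odd m" "i = d + 1 \<or> i = ?M - d" using that by (auto split: if_splits)
      have m: "m = 2 * d + 1" using o(1) d2 by (simp add: odd_iff_mod_2_eq_one)
      have "i \<in> ?H" using o(2) m mn by auto
      moreover have "?u i = i" using o(2) low(1)[of i] high(1)[of i] m mn by auto
      ultimately show ?thesis by blast
    qed
    show "i \<in> {i \<in> ?H. A.flagged i \<and> (i, A.rev i) \<notin> A.orb}" if "i \<in> ?T'"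
      using T[OF that] flagged nonstable by blast
    fix j assume ij: "i \<in> ?T'" "j \<in> ?T'" "(i, j) \<in> A.orb"
    show "i = j" using orbit[OF ij(3)] T[OF ij(1)] by auto
  next
    fix i assume "i \<in> {i \<in> ?H. A.flagged i \<and> (i, A.rev i) \<notin> A.orb}"
    then have i: "i \<in> ?H" "?u i = i" using flagged by auto
    have "i \<in> ?T'"
    proof (cases "i \<le> m")
      case True
      then have "2 * i = m + 1" using low(1) i(2) by (metis mult_2)
      moreover have "1 \<le> i" using i(1) mn by auto
      ultimately have "m = 2 * (i - 1) + 1" by linarith
      then have "odd m" "d = i - 1" by (simp_all add: d_def)
      then show ?thesis using \<open>1 \<le> i\<close> by simp
    next
      case False
      then have h: "i \<in> {?M + 1 - m..?M}" using i(1) by auto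
      then have "2 * i + m = 2 * ?M + 1" using high(1)[OF h] i(2) mn by linarith
      moreover have "i \<le> ?M" using h by simp
      ultimately have "m = 2 * (?M - i) + 1" by linarith
      then have "odd m" "d = ?M - i" by (simp_all add: d_def)
      then show ?thesis using \<open>i \<le> ?M\<close> by simp
    qed
    then show "\<exists>j\<in>?T'. (i, j) \<in> A.orb" using A.orb_refl by blast
  qed
  also have "card ?T' = 2 * (m mod 2)"
  proof (cases "odd m")
    case True
    then have o: "m mod 2 = 1" by (simp add: odd_iff_mod_2_eq_one)
    have "d + 1 \<noteq> ?M - d" using d2 mn unfolding o by linarith
    then show ?thesis using True o by simp
  qed simp
  finally have c2: "card (A.cls ` {i \<in> ?H. A.flagged i \<and> (i, A.rev i) \<notin> A.orb}) = 2 * (m mod 2)" .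
  have "A.J ?H = 2 * m" unfolding A.J_def c1 c2 using d2 by linarith
  then show ?thesis using split unfolding JC_def by simp
qed

text \<open>The lower arcs are the reflection itself, so a component in the outer blocks consists of
  i, u i and their mirrors. It is a four-cycle, or a stable segment if i is the middle of an odd
  block; the latter has weight 0.\<close>

lemma JC_parabolic_head: "JC n (m # as) [] = JC (n - m) as [] + 2 * (m div 2)"
proof -
  let ?u = "mirC n (m # as)" and ?l = "mirC n []" and ?M = "2 * n"
  let ?H = "{1..m} \<union> {?M + 1 - m..?M}"
  define d where "d = m div 2"
  have mn: "m \<le> n" using a by simp
  have A: "mirror_system ?M ?u ?l" using a by (intro mirror_system_mirC) auto
  have B: "mirror_system (2 * (n - m)) (mirC (n - m) as) (mirC (n - m) [])" using a by (intro mirror_system_mirC) auto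
  interpret A: mirror_system ?M ?u ?l by (rule A)
  have split: "A.J {1..?M} = mirror_system.J (2 * (n - m)) (mirC (n - m) as) (mirC (n - m) []) {1..2 * (n - m)} + A.J ?H"
  proof (rule J_split[OF A B])
    show "2 * n = 2 * (n - m) + 2 * m" using mn by simp
    fix i assume i: "i \<in> {1..2 * (n - m)}"
    then show "?u (i + m) = mirC (n - m) as i + m" using mirC_mid[of m "i + m" n] mn by auto
    show "?l (i + m) = mirC (n - m) [] i + m" using i mn by simp
  qed
  have lr: "?l i = A.rev i" for i by (simp add: A.rev_def)
  have low: "?u i + i = m + 1" if "i \<le> m" for i using that by auto
  have high: "?u i + i = 2 * ?M + 1 - m" if "i \<in> {?M + 1 - m..?M}" for i using that mn by auto
  have HV: "?H \<subseteq> {1..?M}" using mn by auto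
  have orbit: "j = i \<or> j = ?u i \<or> j = A.rev i \<or> j = A.rev (?u i)" if "(i, j) \<in> A.orb" and iV: "i \<in> {1..?M}" for i j
    using that
  proof (induction rule: A.orb_induct)
    case (u j)
    then show ?case using A.u_u[OF iV] A.u_rev[OF iV] A.u_rev[OF A.u_range[OF iV]] by (auto simp del: mirC.simps)
  next
    case (l j)
    then show ?case using A.rev_rev[OF iV] A.rev_rev[OF A.u_range[OF iV]] unfolding lr by (auto simp del: mirC.simps)
  qed simp
  have noflag: "A.rev i \<noteq> i" if "i \<in> {1..?M}" for i unfolding A.rev_def using that by auto presburger
  have flagged: "A.flagged i \<longleftrightarrow> ?u i = i" if iV: "i \<in> {1..?M}" for i
  proof
    assume "A.flagged i"
    then obtain v where v: "A.flag v" "(i, v) \<in> A.orb" unfolding A.flagged_def by blast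
    have vV: "v \<in> {1..?M}" and "?u v = v" using v(1) noflag lr unfolding A.flag_def by auto
    moreover have "v = i \<or> v = ?u i \<or> v = A.rev i \<or> v = A.rev (?u i)" by (rule orbit[OF v(2) iV])
    moreover have "?u i = i" if "A.rev x = A.rev (?u x)" "x \<in> {1..?M}" "x = i \<or> x = ?u i" for x
    proof -
      have "x = ?u x" using A.rev_rev[OF that(2)] A.rev_rev[OF A.u_range[OF that(2)]] that(1) by metis
      then show ?thesis using that(3) A.u_u[OF iV] by auto
    qed
    ultimately show "?u i = i"
      using A.u_rev[OF iV] A.u_rev[OF A.u_range[OF iV]] A.u_u[OF iV] iV A.u_range[OF iV] by metis
  next
    assume "?u i = i"
    then show "A.flagged i" using iV by (intro A.flagI) (auto simp: A.flag_def simp del: mirC.simps)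
  qed
  have none: "{i \<in> ?H. A.flagged i \<and> (i, A.rev i) \<notin> A.orb} = {}"
    using HV A.orb_l unfolding lr by blast
  have d2: "2 * d + m mod 2 = m" by (simp add: d_def)
  have "card (A.cls ` {i \<in> ?H. \<not> A.flagged i}) = card {1..d}"
  proof (rule A.card_classes)
    show "{1..d} \<subseteq> {1..?M}" "{i \<in> ?H. \<not> A.flagged i} \<subseteq> {1..?M}" using mn d2 HV by auto
    fix i
    have T: "i \<in> ?H" "?u i + i = m + 1" "i \<in> {1..?M}" if "i \<in> {1..d}"
      using that d2 mn low[of i] by (auto simp del: mirC.simps)
    show "i \<in> {i \<in> ?H. \<not> A.flagged i}" if "i \<in> {1..d}"
      using T[OF that] flagged[OF T(3)[OF that]] that d2 by (auto simp del: mirC.simps)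
    fix j assume ij: "i \<in> {1..d}" "j \<in> {1..d}" "(i, j) \<in> A.orb"
    from orbit[OF ij(3) T(3)[OF ij(1)]] show "i = j"
      using T(2)[OF ij(1)] ij(1,2) d2 mn unfolding A.rev_def by (auto simp del: mirC.simps)
  next
    fix i assume "i \<in> {i \<in> ?H. \<not> A.flagged i}"
    then have iH: "i \<in> ?H" and iV: "i \<in> {1..?M}" and nf: "\<not> A.flagged i" using HV by blast+
    have ui: "?u i \<noteq> i" using nf flagged[OF iV] by blast
    have "i \<in> {1..d} \<or> ?u i \<in> {1..d} \<or> A.rev i \<in> {1..d} \<or> A.rev (?u i) \<in> {1..d}"
    proof (cases "i \<le> m")
      case True
      then show ?thesis using low[OF True] ui d2 iV by (auto simp del: mirC.simps)
    next
      case False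
      then have h: "i \<in> {?M + 1 - m..?M}" using iH by auto
      show ?thesis using high[OF h] h ui d2 mn unfolding A.rev_def by (auto simp del: mirC.simps)
    qed
    moreover have "(i, ?u i) \<in> A.orb" "(i, A.rev i) \<in> A.orb" "(i, A.rev (?u i)) \<in> A.orb"
      using A.orb_u[OF iV] A.orb_l[OF iV] A.orb_trans[OF A.orb_u[OF iV] A.orb_l[OF A.u_range[OF iV]]] unfolding lr by auto
    ultimately show "\<exists>j\<in>{1..d}. (i, j) \<in> A.orb" using A.orb_refl by blast
  qed
  then have "A.J ?H = 2 * d" unfolding A.J_def none by simp
  then show ?thesis using split unfolding JC_def d_def by simp
qed

end

lemma JC_empty: "JC n [] [] = 2 * n"
proof -
  interpret A: mirror_system "2 * n" "mirC n []" "mirC n []" by (rule mirror_system_mirC) simp_all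
  have lr: "mirC n [] i = A.rev i" for i by (simp add: A.rev_def)
  have orbit: "j = i \<or> j = A.rev i" if "(i, j) \<in> A.orb" and iV: "i \<in> {1..2 * n}" for i j
    using that by (induction rule: A.orb_induct) (use A.rev_rev[OF iV] lr in auto)
  have noflag: "\<not> A.flag v" for v
    unfolding A.flag_def lr A.rev_def by auto presburger
  then have nf: "\<not> A.flagged i" for i by (simp add: A.flagged_def)
  have "card (A.cls ` {1..2 * n}) = card {1..n}"
  proof (rule A.card_classes)
    fix i j assume ij: "i \<in> {1..n}" "j \<in> {1..n}" "(i, j) \<in> A.orb"
    then show "i = j" using orbit[OF ij(3)] unfolding A.rev_def by auto
  next
    fix i assume i: "i \<in> {1..2 * n}"
    have "i \<in> {1..n} \<or> A.rev i \<in> {1..n}" using i unfolding A.rev_def by auto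
    then show "\<exists>j\<in>{1..n}. (i, j) \<in> A.orb" using A.orb_u[OF i] A.orb_refl unfolding lr by blast
  qed auto
  moreover have "{i \<in> {1..2 * n}. \<not> A.flagged i} = {1..2 * n}"
    "{i \<in> {1..2 * n}. A.flagged i \<and> (i, A.rev i) \<notin> A.orb} = {}"
    using nf by auto
  ultimately show ?thesis unfolding JC_def A.J_def by simp
qed

lemma JC_parabolic: "sum_list a \<le> n \<Longrightarrow> JC n a [] = 2 * ((\<Sum>x\<leftarrow>a. x div 2) + (n - sum_list a))"
proof (induction a arbitrary: n)
  case Nil
  then show ?case by (simp add: JC_empty)
next
  case (Cons x a)
  have "JC (n - x) a [] = 2 * ((\<Sum>x\<leftarrow>a. x div 2) + (n - x - sum_list a))" by (rule Cons.IH) (use Cons.prems in simp)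
  then show ?case using JC_parabolic_head[of x a n] Cons.prems by simp
qed

subsection \<open>Cycles and segments\<close>

text \<open>A graph given by two involutions. The sides are parameters so that a walk may start with
  either involution.\<close>

locale walk =
  fixes V :: "nat set" and p q :: "nat \<Rightarrow> nat" and s1 s2 :: side and E :: "edge set"
  assumes finite_V: "finite V" and p_V: "x \<in> V \<Longrightarrow> p x \<in> V" and q_V: "x \<in> V \<Longrightarrow> q x \<in> V"
    and p_p: "x \<in> V \<Longrightarrow> p (p x) = x" and q_q: "x \<in> V \<Longrightarrow> q (q x) = x" and s12: "s1 \<noteq> s2"
    and E: "E = {s1} \<times> {{i, p i} | i. i \<in> V \<and> p i \<noteq> i} \<union> {s2} \<times> {{i, q i} | i. i \<in> V \<and> q i \<noteq> i}"
begin

definition f :: "nat \<Rightarrow> nat \<Rightarrow> nat" where "f k = (if even k then p else q)"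
definition sd :: "nat \<Rightarrow> side" where "sd k = (if even k then s1 else s2)"

text \<open>The alternating walk begins with \<open>p\<close>; at a fixed point of \<open>q\<close>
  it therefore leaves the end point along the only arc that can exist there.\<close>

primrec w :: "nat \<Rightarrow> nat \<Rightarrow> nat" where
  "w v 0 = v"
| "w v (Suc k) = f k (w v k)"

lemma w_V: "v \<in> V \<Longrightarrow> w v k \<in> V"
  by (induction k) (auto simp: f_def p_V q_V)

lemma w_back: "v \<in> V \<Longrightarrow> f k (w v (Suc k)) = w v k"
  using w_V[of v k] by (auto simp: f_def p_p q_q)

lemma w_pred: "v \<in> V \<Longrightarrow> 0 < k \<Longrightarrow> w v (k - 1) = f (k - 1) (w v k)"
  using w_back[of v "k - 1"] by (cases k) auto

text \<open>Folding a coincidence \<open>w i = w j\<close> inwards or outwards.\<close>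

lemma w_fold:
  assumes v: "v \<in> V" and eq: "w v i = w v j" "i < j"
  shows "odd (j - i) \<Longrightarrow> w v (Suc i) = w v (j - 1)" "even (j - i) \<Longrightarrow> 0 < i \<Longrightarrow> w v (i - 1) = w v (j - 1)"
proof -
  have j: "w v (j - 1) = f (j - 1) (w v i)" using w_pred[OF v, of j] eq by simp
  show "odd (j - i) \<Longrightarrow> w v (Suc i) = w v (j - 1)" unfolding j using eq(2) by (auto simp: f_def)
  assume e: "even (j - i)" "0 < i"
  have "even (i - 1) \<longleftrightarrow> even (j - 1)" using e eq(2) by presburger
  then have "f (i - 1) = f (j - 1)" by (simp add: f_def)
  then show "w v (i - 1) = w v (j - 1)" unfolding j using w_pred[OF v e(2)] by simp
qed

text \<open>A coincidence at odd distance folds inwards until some step fails to move. At even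
  distance both positions move back by one; at position 0 the equation q v = v supplies this move
  and makes the distance odd. Either way an earlier coincidence or a stationary step
  results.\<close>

lemma path_inj:
  assumes v: "v \<in> V" and end0: "q v = v" and mv: "\<And>k. k < m \<Longrightarrow> w v (Suc k) \<noteq> w v k"
  shows "i < j \<Longrightarrow> j \<le> m \<Longrightarrow> w v i \<noteq> w v j"
proof (induction j arbitrary: i rule: less_induct)
  case (less j)
  show ?case
  proof
    assume eq: "w v i = w v j"
    show False
    proof (cases "odd (j - i)")
      case True
      have e: "w v (Suc i) = w v (j - 1)" by (rule w_fold(1)[OF v eq less.prems(1) True])
      show False
      proof (cases "j = Suc i")
        case True
        then show False using eq mv[of i] less.prems by simp
      next
        case False
        then have "Suc i < j - 1" using less.prems(1) True by presburger
        then show False using less.IH[of "j - 1" "Suc i"] e less.prems by simp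
      qed
    next
      case False
      show False
      proof (cases "i = 0")
        case True
        have "odd (j - 1)" "0 < j" "0 < j - 1" using False True less.prems(1) by presburger+
        then have "w v (j - 1) = w v 0" using w_pred[OF v, of j] eq True end0 by (simp add: f_def)
        moreover have "j - 1 < j" "j - 1 \<le> m" using \<open>0 < j\<close> less.prems by simp_all
        ultimately show False using less.IH[OF _ \<open>0 < j - 1\<close>] by metis
      next
        case i: False
        then have "w v (i - 1) = w v (j - 1)" using w_fold(2)[OF v eq less.prems(1)] False by simp
        moreover have "j - 1 < j" "j - 1 \<le> m" "i - 1 < j - 1" using i less.prems by auto
        ultimately show False using less.IH by metis
      qed
    qed
  qed
qed

lemma not_inj: "v \<in> V \<Longrightarrow> \<exists>i j. i < j \<and> w v i = w v j"
proof (rule ccontr)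
  assume v: "v \<in> V" and "\<not> ?thesis"
  then have "inj (w v)" by (intro injI) (metis linorder_neqE_nat)
  moreover have "range (w v) \<subseteq> V" using w_V[OF v] by auto
  ultimately show False using finite_V infinite_UNIV_nat by (meson finite_imageD finite_subset)
qed

lemma f_edge: "x \<in> V \<Longrightarrow> f k x \<noteq> x \<Longrightarrow> (sd k, {x, f k x}) \<in> E"
  unfolding E f_def sd_def by auto

lemma edge_cases:
  assumes "e \<in> E" obtains x k where "x \<in> V" "k < 2" "e = (sd k, {x, f k x})" "f k x \<noteq> x"
proof -
  have "(\<exists>x. x \<in> V \<and> e = (sd 0, {x, f 0 x}) \<and> f 0 x \<noteq> x) \<or> (\<exists>x. x \<in> V \<and> e = (sd 1, {x, f 1 x}) \<and> f 1 x \<noteq> x)"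
    using assms unfolding E f_def sd_def by auto
  then show thesis
  proof (elim disjE exE conjE)
    fix x assume "x \<in> V" "e = (sd 0, {x, f 0 x})" "f 0 x \<noteq> x"
    then show thesis by (intro that[of x 0]) simp_all
  next
    fix x assume x: "x \<in> V" "e = (sd 1, {x, f 1 x})" "f 1 x \<noteq> x"
    show thesis by (rule that[OF x(1) _ x(2,3)]) simp
  qed
qed

lemma f_parity: "even k \<longleftrightarrow> even k' \<Longrightarrow> f k = f k' \<and> sd k = sd k'"
  by (simp add: f_def sd_def)

text \<open>An arc at a vertex of the walk is its outgoing or its incoming step; only at the start
  can there be a \<open>q\<close>-arc not yet walked.\<close>

lemma edge_at:
  assumes v: "v \<in> V" and e: "e = (sd t, {w v k, f t (w v k)})"
  shows "e = (sd k, {w v k, w v (Suc k)}) \<and> f t (w v k) = w v (Suc k) \<or>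
    k = 0 \<and> odd t \<or> 0 < k \<and> e = (sd (k - 1), {w v (k - 1), w v (Suc (k - 1))}) \<and> f t (w v k) = w v (k - 1)"
proof (cases "even t \<longleftrightarrow> even k")
  case True
  then show ?thesis using e f_parity[of t k] by simp
next
  case False
  show ?thesis
  proof (cases "k = 0")
    case k: False
    then have "even t \<longleftrightarrow> even (k - 1)" using False by presburger
    then have "f t = f (k - 1)" "sd t = sd (k - 1)" using f_parity by blast+
    moreover have "f (k - 1) (w v k) = w v (k - 1)" using w_pred[OF v] k by simp
    ultimately show ?thesis using e k by (simp add: insert_commute)
  qed (use False in auto)
qed

text \<open>Closure together with an induction principle describes the component of v without
  mentioning the walk or a closure relation, so it can be matched with \<open>cls\<close> in
  \<open>orbit_eq_cls\<close>.\<close>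

definition orbit_of :: "nat \<Rightarrow> nat set \<Rightarrow> bool" where
  "orbit_of v C \<longleftrightarrow> v \<in> C \<and> (\<forall>x\<in>C. p x \<in> C \<and> q x \<in> C) \<and>
     (\<forall>P. P v \<longrightarrow> (\<forall>x\<in>V. P x \<longrightarrow> P (p x) \<and> P (q x)) \<longrightarrow> (\<forall>x\<in>C. P x))"

lemma w_reach: "v \<in> V \<Longrightarrow> P v \<Longrightarrow> \<forall>x\<in>V. P x \<longrightarrow> P (p x) \<and> P (q x) \<Longrightarrow> P (w v k)"
proof (induction k)
  case (Suc k)
  then show ?case using w_V[OF Suc.prems(1), of k] by (simp add: f_def)
qed simp

text \<open>The walk stops at the first step that does not move. Up to there it is injective, and by
  \<open>edge_at\<close> it uses every arc at its vertices.\<close>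

lemma segment_from:
  assumes v: "v \<in> V" and end0: "q v = v"
  shows "\<exists>C. orbit_of v C \<and> is_segment E C"
proof -
  have "\<exists>k. w v (Suc k) = w v k"
  proof (rule ccontr)
    assume "\<not> ?thesis"
    then have "w v i \<noteq> w v j" if "i < j" for i j using path_inj[OF v end0, of j i j] that by blast
    then show False using not_inj[OF v] by blast
  qed
  then obtain m where m: "w v (Suc m) = w v m" and least: "\<And>k. k < m \<Longrightarrow> w v (Suc k) \<noteq> w v k"
    using exists_least_iff[of "\<lambda>k. w v (Suc k) = w v k"] by blast
  have ne: "w v i \<noteq> w v j" if "i < j" "j \<le> m" for i j
    by (rule path_inj[OF v end0 least that])
  have inj: "i = j" if "w v i = w v j" "i \<le> m" "j \<le> m" for i j
    using ne[of i j] ne[of j i] that by (cases i j rule: linorder_cases) auto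
  define C where "C = w v ` {..m}"
  let ?vs = "map (w v) [0..<Suc m]" and ?es = "map (\<lambda>k. (sd k, {w v k, w v (Suc k)})) [0..<m]"
  have at: "f t (w v k) \<in> C \<and> (f t (w v k) \<noteq> w v k \<longrightarrow> (sd t, {w v k, f t (w v k)}) \<in> set ?es)" if k: "k \<le> m" for k t
    using edge_at[OF v refl, of t k]
  proof (elim disjE conjE)
    assume h: "(sd t, {w v k, f t (w v k)}) = (sd k, {w v k, w v (Suc k)})" "f t (w v k) = w v (Suc k)"
    show ?thesis
    proof (cases "k = m")
      case True
      then show ?thesis using h(2) m by (auto simp: C_def)
    next
      case False
      then have "k < m" using k by simp
      then show ?thesis unfolding h(1) unfolding h(2) C_def by (auto simp del: w.simps)
    qed
  next
    assume "k = 0" "odd t"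
    then show ?thesis using end0 by (auto simp: C_def f_def image_iff intro!: bexI[of _ 0])
  next
    assume h: "0 < k" "(sd t, {w v k, f t (w v k)}) = (sd (k - 1), {w v (k - 1), w v (Suc (k - 1))})" "f t (w v k) = w v (k - 1)"
    have "k - 1 < m" using h(1) k by simp
    then show ?thesis unfolding h(2) unfolding h(3) C_def by (auto simp del: w.simps)
  qed
  have "orbit_of v C" unfolding orbit_of_def
  proof (intro conjI ballI allI impI)
    show "v \<in> C" unfolding C_def by (rule image_eqI[of _ _ 0]) auto
    fix x assume "x \<in> C"
    then obtain k where k: "k \<le> m" "x = w v k" by (auto simp: C_def)
    show "p x \<in> C" "q x \<in> C" using at[OF k(1), of 0] at[OF k(1), of 1] by (auto simp: k(2) f_def)
  next
    fix P x assume "P v" "\<forall>x\<in>V. P x \<longrightarrow> P (p x) \<and> P (q x)" "x \<in> C"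
    then show "P x" using w_reach[OF v, of P] by (auto simp: C_def)
  qed
  moreover have "is_segment E C" unfolding is_segment_def
  proof (intro exI conjI allI impI)
    show "distinct ?vs" using inj by (auto simp: distinct_map inj_on_def simp del: w.simps upt_Suc)
    show "set ?vs = C" unfolding C_def set_map set_upt by (intro arg_cong2[where f = image] refl) auto
    show "distinct ?es"
      unfolding distinct_map inj_on_def
    proof (intro conjI ballI impI distinct_upt)
      fix k k' assume kk: "k \<in> set [0..<m]" "k' \<in> set [0..<m]" "(sd k, {w v k, w v (Suc k)}) = (sd k', {w v k', w v (Suc k')})"
      then have "w v k = w v k' \<or> (w v k = w v (Suc k') \<and> w v (Suc k) = w v k')" by (auto simp: doubleton_eq_iff simp del: w.simps)
      then show "k = k'" using inj[of k k'] inj[of k "Suc k'"] inj[of "Suc k" k'] kk(1,2) by auto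
    qed
    show "set ?es = edges_within E C"
    proof (intro equalityI subsetI)
      fix e assume "e \<in> set ?es"
      then obtain k where k: "k < m" "e = (sd k, {w v k, w v (Suc k)})" by auto
      have "e \<in> E" unfolding k(2) using f_edge[OF w_V[OF v], of k k] least[OF k(1)] by simp
      moreover have "snd e \<subseteq> C" unfolding k(2) C_def using k(1) by (auto simp del: w.simps)
      ultimately show "e \<in> edges_within E C" by (simp add: edges_within_def)
    next
      fix e assume "e \<in> edges_within E C"
      then have e: "e \<in> E" "snd e \<subseteq> C" by (auto simp: edges_within_def)
      obtain x t where x: "e = (sd t, {x, f t x})" "f t x \<noteq> x" by (rule edge_cases[OF e(1)])
      have "x \<in> C" using e(2) x by auto
      then obtain k where k: "k \<le> m" "x = w v k" by (auto simp: C_def)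
      show "e \<in> set ?es" using at[OF k(1), of t] x unfolding k(2) by blast
    qed
    show "length ?vs = Suc (length ?es)" by simp
    fix i assume "i < length ?es"
    then show "snd (?es ! i) = {?vs ! i, ?vs ! Suc i}" by (simp del: w.simps upt_Suc)
  qed
  ultimately show ?thesis by blast
qed

text \<open>Consider the first repetition. An odd distance would fold inwards to a fixed point or an
  earlier repetition, and an even distance away from position 0 would move back to an earlier one.
  So the walk returns to its start after an even number of steps, with sides alternating
  consistently.\<close>

lemma cycle_from:
  assumes v: "v \<in> V" and nofix: "\<And>k t. f t (w v k) \<noteq> w v k"
  shows "\<exists>C. orbit_of v C \<and> is_cycle E C"
proof -
  obtain j where ex: "\<exists>i<j. w v i = w v j" and least: "\<And>k. k < j \<Longrightarrow> \<not> (\<exists>i<k. w v i = w v k)"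
    using not_inj[OF v] exists_least_iff[of "\<lambda>j. \<exists>i<j. w v i = w v j"] by blast
  obtain i where i: "i < j" "w v i = w v j" using ex by blast
  have ev: "even (j - i)"
  proof (rule ccontr)
    assume o: "odd (j - i)"
    have e: "w v (Suc i) = w v (j - 1)" by (rule w_fold(1)[OF v i(2,1) o])
    show False
    proof (cases "j = Suc i")
      case True
      then show False using i(2) nofix[of i i] by simp
    next
      case False
      then have "Suc i < j - 1" using i(1) o by presburger
      then show False using least[of "j - 1"] e i(1) by auto
    qed
  qed
  have i0: "i = 0"
  proof (rule ccontr)
    assume "i \<noteq> 0"
    then have "w v (i - 1) = w v (j - 1)" using w_fold(2)[OF v i(2,1) ev] by simp
    then show False using least[of "j - 1"] i(1) \<open>i \<noteq> 0\<close> by (auto dest!: spec[of _ "i - 1"])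
  qed
  have "w v j = v" "even j" "0 < j" using i ev i0 by simp_all
  then have j: "w v j = v" "even j" "2 \<le> j" by (simp, simp, presburger)
  have inj: "a = b" if "w v a = w v b" "a < j" "b < j" for a b
    using least[of a] least[of b] that by (cases a b rule: linorder_cases) auto
  define C where "C = w v ` {..<j}"
  have wC: "w v k \<in> C" if "k \<le> j" for k
  proof (cases "k = j")
    case True
    then have "w v k = w v 0" using j by simp
    then show ?thesis unfolding C_def using j(3) by (intro image_eqI[of _ _ 0]) auto
  qed (use that in \<open>auto simp: C_def\<close>)
  let ?vs = "map (w v) [0..<j]" and ?es = "map (\<lambda>k. (sd k, {w v k, w v (Suc k)})) [0..<j]"
  have at: "f t (w v k) \<in> C \<and> (sd t, {w v k, f t (w v k)}) \<in> set ?es" if k: "k < j" for k t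
    using edge_at[OF v refl, of t k]
  proof (elim disjE conjE)
    assume h: "(sd t, {w v k, f t (w v k)}) = (sd k, {w v k, w v (Suc k)})" "f t (w v k) = w v (Suc k)"
    show ?thesis unfolding h(1) unfolding h(2) using k wC[of "Suc k"] by (auto simp del: w.simps)
  next
    assume h: "k = 0" "odd t"
    have o: "odd (j - 1)" "Suc (j - 1) = j" using j by auto
    have ft: "f t = f (j - 1)" "sd t = sd (j - 1)" using f_parity[of t "j - 1"] o(1) h(2) by blast+
    have "f t (w v k) = w v (j - 1)" unfolding ft h using w_pred[OF v, of j] j by simp
    moreover have "(sd t, {w v k, w v (j - 1)}) = (sd (j - 1), {w v (j - 1), w v (Suc (j - 1))})"
      unfolding ft o(2) h j(1) by (simp add: insert_commute)
    moreover have "j - 1 < j" using j by simp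
    ultimately show ?thesis using wC[of "j - 1"] by (auto simp del: w.simps)
  next
    assume h: "0 < k" "(sd t, {w v k, f t (w v k)}) = (sd (k - 1), {w v (k - 1), w v (Suc (k - 1))})" "f t (w v k) = w v (k - 1)"
    have "k - 1 < j" using k by simp
    then show ?thesis unfolding h(2) unfolding h(3) using wC[of "k - 1"] by (auto simp del: w.simps)
  qed
  have "orbit_of v C" unfolding orbit_of_def
  proof (intro conjI ballI allI impI)
    show "v \<in> C" using wC[of 0] by simp
    fix x assume "x \<in> C"
    then obtain k where k: "k < j" "x = w v k" by (auto simp: C_def)
    show "p x \<in> C" "q x \<in> C" using at[OF k(1), of 0] at[OF k(1), of 1] by (auto simp: k(2) f_def)
  next
    fix P x assume "P v" "\<forall>x\<in>V. P x \<longrightarrow> P (p x) \<and> P (q x)" "x \<in> C"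
    then show "P x" using w_reach[OF v, of P] by (auto simp: C_def)
  qed
  moreover have "is_cycle E C" unfolding is_cycle_def
  proof (intro exI conjI allI impI)
    show "2 \<le> length ?vs" using j by simp
    show "distinct ?vs" using inj by (auto simp: distinct_map inj_on_def simp del: w.simps)
    show "set ?vs = C" unfolding C_def by (simp add: atLeast0LessThan)
    show "distinct ?es"
      unfolding distinct_map inj_on_def
    proof (intro conjI ballI impI distinct_upt)
      fix k k' assume "k \<in> set [0..<j]" "k' \<in> set [0..<j]" and e: "(sd k, {w v k, w v (Suc k)}) = (sd k', {w v k', w v (Suc k')})"
      then have kk: "k < j" "k' < j" by auto
      have par: "even k \<longleftrightarrow> even k'" using e s12 by (auto simp: sd_def split: if_splits)
      have "w v k = w v k' \<or> w v k = w v (Suc k')" using e by (auto simp: doubleton_eq_iff simp del: w.simps)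
      then show "k = k'"
      proof
        assume h: "w v k = w v (Suc k')"
        show ?thesis
        proof (cases "Suc k' = j")
          case True
          then have "w v k = w v 0" using h j by simp
          then have "k = 0" using inj kk j by blast
          then show ?thesis using par True j(2) by auto
        next
          case False
          then have "k = Suc k'" using inj[OF h kk(1)] kk by simp
          then show ?thesis using par by simp
        qed
      qed (use inj kk in blast)
    qed
    show "set ?es = edges_within E C"
    proof (intro equalityI subsetI)
      fix e assume "e \<in> set ?es"
      then obtain k where k: "k < j" "e = (sd k, {w v k, w v (Suc k)})" by auto
      have "e \<in> E" unfolding k(2) using f_edge[OF w_V[OF v], of k k] nofix[of k k] by simp
      moreover have "snd e \<subseteq> C" unfolding k(2) using k(1) wC[of k] wC[of "Suc k"] by (auto simp del: w.simps)
      ultimately show "e \<in> edges_within E C" by (simp add: edges_within_def)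
    next
      fix e assume "e \<in> edges_within E C"
      then have e: "e \<in> E" "snd e \<subseteq> C" by (auto simp: edges_within_def)
      obtain x t where x: "e = (sd t, {x, f t x})" by (rule edge_cases[OF e(1)])
      have "x \<in> C" using e(2) x by auto
      then obtain k where k: "k < j" "x = w v k" by (auto simp: C_def)
      show "e \<in> set ?es" using at[OF k(1), of t] unfolding x k(2) by blast
    qed
    show "length ?es = length ?vs" by simp
    fix i assume i: "i < length ?es"
    show "snd (?es ! i) = {?vs ! i, ?vs ! (Suc i mod length ?vs)}"
    proof (cases "Suc i = j")
      case True
      then have "w v (Suc i) = w v 0" using j by simp
      then show ?thesis using i True by (simp del: w.simps) 
    qed (use i in \<open>simp del: w.simps\<close>)
  qed
  ultimately show ?thesis by blast
qed

end

text \<open>A cycle has as many edges as vertices, a path one edge less.\<close>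

lemma not_cycle_and_segment: "is_cycle E C \<Longrightarrow> \<not> is_segment E C"
proof
  assume "is_cycle E C" "is_segment E C"
  then obtain vs es vs' es' where c: "distinct vs" "set vs = C" "distinct es" "set es = edges_within E C" "length es = length vs"
    and s: "distinct vs'" "set vs' = C" "distinct es'" "set es' = edges_within E C" "length vs' = Suc (length es')"
    unfolding is_cycle_def is_segment_def by blast
  have "length vs = card C" "length es = card (edges_within E C)" "length vs' = card C" "length es' = card (edges_within E C)"
    using c s distinct_card by metis+
  then show False using c(5) s(5) by simp
qed

context mirror_system
begin

definition edges :: "edge set" where
  "edges = {Above} \<times> {{i, u i} | i. i \<in> {1..M} \<and> u i \<noteq> i} \<union> {Below} \<times> {{i, l i} | i. i \<in> {1..M} \<and> l i \<noteq> i}"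

text \<open>Fixed points give no arc, so the two generating relations differ only on the diagonal,
  which the reflexive closure restores.\<close>

lemma adjacency_rtrancl: "(adjacency edges)\<^sup>* = orb"
proof -
  have uu: "x \<in> {1..M} \<and> y = u x" if "{x, y} = {i, u i}" "i \<in> {1..M}" for x y i
    using that u_u[OF that(2)] u_range[OF that(2)] by (auto simp: doubleton_eq_iff)
  have ll: "x \<in> {1..M} \<and> y = l x" if "{x, y} = {i, l i}" "i \<in> {1..M}" for x y i
    using that l_l[OF that(2)] l_range[OF that(2)] by (auto simp: doubleton_eq_iff)
  have "adjacency edges = {(i, j). i \<in> {1..M} \<and> (j = u i \<or> j = l i)} - Id"
  proof (intro equalityI subsetI)
    fix z assume z: "z \<in> adjacency edges"
    obtain x y where xy: "z = (x, y)" by (cases z)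
    have "(\<exists>i. {x, y} = {i, u i} \<and> i \<in> {1..M} \<and> u i \<noteq> i) \<or> (\<exists>i. {x, y} = {i, l i} \<and> i \<in> {1..M} \<and> l i \<noteq> i)"
      using z unfolding xy adjacency_def edges_def by auto
    then show "z \<in> {(i, j). i \<in> {1..M} \<and> (j = u i \<or> j = l i)} - Id"
    proof (elim disjE exE conjE)
      fix i assume i: "{x, y} = {i, u i}" "i \<in> {1..M}" "u i \<noteq> i"
      then have "x \<noteq> y" by (auto simp: doubleton_eq_iff)
      then show ?thesis using uu[OF i(1,2)] unfolding xy by auto
    next
      fix i assume i: "{x, y} = {i, l i}" "i \<in> {1..M}" "l i \<noteq> i"
      then have "x \<noteq> y" by (auto simp: doubleton_eq_iff)
      then show ?thesis using ll[OF i(1,2)] unfolding xy by auto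
    qed
  next
    fix z assume z: "z \<in> {(i, j). i \<in> {1..M} \<and> (j = u i \<or> j = l i)} - Id"
    then obtain x y where xy: "z = (x, y)" "x \<in> {1..M}" "y = u x \<or> y = l x" "x \<noteq> y" by blast
    have "(Above, {x, u x}) \<in> edges" if "u x \<noteq> x" using xy(2) that unfolding edges_def by blast
    moreover have "(Below, {x, l x}) \<in> edges" if "l x \<noteq> x" using xy(2) that unfolding edges_def by blast
    ultimately show "z \<in> adjacency edges" unfolding xy(1) adjacency_def using xy(3,4) by auto
  qed
  then show ?thesis unfolding orb_def by (simp only: rtrancl_r_diff_Id)
qed

lemma components_eq: "components {1..M} edges = cls ` {1..M}"
  unfolding components_def adjacency_rtrancl quotient_def cls_def by auto

lemma orbit_eq_cls:
  assumes v: "v \<in> {1..M}" and C: "v \<in> C" "\<And>x. x \<in> C \<Longrightarrow> u x \<in> C \<and> l x \<in> C"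
    and reach: "\<And>P. P v \<Longrightarrow> \<forall>x\<in>{1..M}. P x \<longrightarrow> P (u x) \<and> P (l x) \<Longrightarrow> \<forall>x\<in>C. P x"
  shows "C = cls v"
proof (intro equalityI subsetI)
  have "\<forall>x\<in>C. (v, x) \<in> orb"
  proof (rule reach)
    show "\<forall>x\<in>{1..M}. (v, x) \<in> orb \<longrightarrow> (v, u x) \<in> orb \<and> (v, l x) \<in> orb"
      using orb_u orb_l orb_trans by blast
  qed simp
  then show "x \<in> cls v" if "x \<in> C" for x using that by (simp add: cls_def)
  fix x assume "x \<in> cls v"
  then have "(v, x) \<in> orb" by (simp add: cls_def)
  then show "x \<in> C" using v by (induction rule: orb_induct) (use C in auto)
qed

text \<open>Two instances of \<open>walk\<close> are required, because at an end point the walk has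
  to start with the involution other than the one known to fix it.\<close>

lemma classify:
  assumes v: "v \<in> {1..M}"
  shows "flagged v \<Longrightarrow> is_segment edges (cls v)" "\<not> flagged v \<Longrightarrow> is_cycle edges (cls v)"
proof -
  interpret W: walk "{1..M}" l u Below Above edges
    by standard (use u_range l_range u_u l_l in \<open>auto simp: edges_def\<close>)
  interpret W': walk "{1..M}" u l Above Below edges
    by standard (use u_range l_range u_u l_l in \<open>auto simp: edges_def\<close>)
  have W: "C = cls x" if "x \<in> {1..M}" "W.orbit_of x C" for x C
    by (rule orbit_eq_cls[OF that(1)]) (use that(2) in \<open>unfold W.orbit_of_def, blast+\<close>)
  have W': "C = cls x" if "x \<in> {1..M}" "W'.orbit_of x C" for x C
    by (rule orbit_eq_cls[OF that(1)]) (use that(2) in \<open>unfold W'.orbit_of_def, blast+\<close>)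
  show "is_segment edges (cls v)" if "flagged v"
  proof -
    from that obtain x where x: "flag x" "(v, x) \<in> orb" unfolding flagged_def by blast
    have xV: "x \<in> {1..M}" using x by (simp add: flag_def)
    have "is_segment edges (cls x)"
    proof (cases "u x = x")
      case True
      then show ?thesis using W.segment_from[OF xV] W[OF xV] by blast
    next
      case False
      then have "l x = x" using x by (simp add: flag_def)
      then show ?thesis using W'.segment_from[OF xV] W'[OF xV] by blast
    qed
    then show ?thesis using cls_eq_iff[OF v xV] x(2) by simp
  qed
  show "is_cycle edges (cls v)" if nf: "\<not> flagged v"
  proof -
    have "W.f t (W.w v k) \<noteq> W.w v k" for k t
    proof
      assume e: "W.f t (W.w v k) = W.w v k"
      have "(v, W.w v k) \<in> orb"
        by (rule W.w_reach[OF v]) (use orb_u orb_l orb_trans in \<open>simp, blast\<close>)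
      moreover have "flag (W.w v k)" using e W.w_V[OF v, of k] by (auto simp: flag_def W.f_def split: if_splits)
      ultimately show False using nf by (auto simp: flagged_def)
    qed
    then show ?thesis using W.cycle_from[OF v] W[OF v] by blast
  qed
qed

theorem twice_cycles_plus_segments:
  "2 * card {C \<in> components {1..M} edges. is_cycle edges C} +
     card {C \<in> {C \<in> components {1..M} edges. is_segment edges C}. rev ` C \<noteq> C} = J {1..M}"
proof -
  have cyc: "is_cycle edges (cls v) \<longleftrightarrow> \<not> flagged v" and seg: "is_segment edges (cls v) \<longleftrightarrow> flagged v" if "v \<in> {1..M}" for v
    using classify[OF that] not_cycle_and_segment by blast+
  have st: "rev ` cls v = cls v \<longleftrightarrow> (v, rev v) \<in> orb" if v: "v \<in> {1..M}" for v
  proof -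
    have "rev ` cls v = cls (rev v)"
    proof (intro equalityI subsetI)
      fix y assume "y \<in> rev ` cls v"
      then show "y \<in> cls (rev v)" using orb_rev[OF _ v] by (auto simp: cls_def)
    next
      fix y assume "y \<in> cls (rev v)"
      then have y: "(rev v, y) \<in> orb" by (simp add: cls_def)
      have "(v, rev y) \<in> orb" using orb_rev[OF y rev_range[OF v]] rev_rev[OF v] by simp
      moreover have "y = rev (rev y)" using rev_rev[OF orb_range[OF y rev_range[OF v]]] by simp
      ultimately show "y \<in> rev ` cls v" unfolding cls_def by blast
    qed
    then show ?thesis using cls_eq_iff[OF v rev_range[OF v]] by auto
  qed
  have 1: "{C \<in> components {1..M} edges. is_cycle edges C} = cls ` {i \<in> {1..M}. \<not> flagged i}"
    unfolding components_eq using cyc by blast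
  have 2: "{C \<in> {C \<in> components {1..M} edges. is_segment edges C}. rev ` C \<noteq> C} = cls ` {i \<in> {1..M}. flagged i \<and> (i, rev i) \<notin> orb}"
    unfolding components_eq using seg st by blast
  show ?thesis unfolding 1 2 J_def ..
qed

end

subsection \<open>The meander graph as a pair of involutions\<close>

text \<open>The reflection of each interval for an arbitrary list. It links \<open>arcs\<close>,
  defined for plain compositions, with the symmetric recursion of \<open>mirC\<close>.\<close>

fun mir :: "nat list \<Rightarrow> nat \<Rightarrow> nat" where
  "mir [] i = i"
| "mir (x # c) i = (if i \<le> x then x + 1 - i else x + mir c (i - x))"

lemma mir_interval:
  "k < length c \<Longrightarrow> i \<in> interval c k \<Longrightarrow> mir c i + i = sum_list (take k c) + 1 + sum_list (take (Suc k) c)"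
proof (induction c arbitrary: k i)
  case (Cons x c)
  show ?case
  proof (cases k)
    case 0
    then show ?thesis using Cons.prems by (auto simp: interval_def)
  next
    case (Suc k')
    have i: "x < i" "i - x \<in> interval c k'" using Cons.prems unfolding Suc interval_Cons_Suc by auto
    have "mir c (i - x) + (i - x) = sum_list (take k' c) + 1 + sum_list (take (Suc k') c)"
      using Cons.prems(1) Suc by (intro Cons.IH[OF _ i(2)]) simp
    then show ?thesis using i(1) by (simp add: Suc)
  qed
qed simp

lemma Min_Max_interval:
  assumes "i \<in> interval c k"
  shows "Min (interval c k) + Max (interval c k) = sum_list (take k c) + 1 + sum_list (take (Suc k) c)"
proof -
  have "sum_list (take k c) + 1 \<le> sum_list (take (Suc k) c)" using assms unfolding interval_def by simp
  then have "Min (interval c k) = sum_list (take k c) + 1" "Max (interval c k) = sum_list (take (Suc k) c)"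
    unfolding interval_def by (intro Min_eqI Max_eqI; simp)+
  then show ?thesis by simp
qed

lemma arcs_eq: "arcs c = {{i, mir c i} | i. i \<in> {1..sum_list c} \<and> mir c i \<noteq> i}"
proof (intro equalityI subsetI)
  fix A assume "A \<in> arcs c"
  then obtain i j k where A: "A = {i, j}" "k < length c" "i \<in> interval c k" "j \<in> interval c k" "i < j"
      "i + j = Min (interval c k) + Max (interval c k)"
    unfolding arcs_def by blast
  have "mir c i = j" using mir_interval[OF A(2,3)] Min_Max_interval[OF A(3)] A(6) by linarith
  moreover have "i \<in> {1..sum_list c}"
  proof -
    have "sum_list (take (Suc k) c) \<le> sum_list c"
      by (metis append_take_drop_id le_add1 sum_list_append)
    then show ?thesis using A(3) by (auto simp: interval_def)
  qed
  ultimately show "A \<in> {{i, mir c i} | i. i \<in> {1..sum_list c} \<and> mir c i \<noteq> i}"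
    unfolding mem_Collect_eq using A(1,5) by (intro exI[of _ i]) simp
next
  fix A assume "A \<in> {{i, mir c i} | i. i \<in> {1..sum_list c} \<and> mir c i \<noteq> i}"
  then obtain i where i: "A = {i, mir c i}" "1 \<le> i" "i \<le> sum_list c" "mir c i \<noteq> i" by auto
  obtain k where k: "k < length c" "i \<in> interval c k" using interval_cover[OF i(2,3)] by blast
  note e = mir_interval[OF k]
  have j: "mir c i \<in> interval c k" using e k(2) unfolding interval_def by simp
  have s: "i + mir c i = Min (interval c k) + Max (interval c k)" using e Min_Max_interval[OF k(2)] by linarith
  consider "i < mir c i" | "mir c i < i" using i(4) by linarith
  then show "A \<in> arcs c"
  proof cases
    case 1
    then show ?thesis unfolding arcs_def using i(1) k j s by blast
  next
    case 2
    have "A = {mir c i, i}" "mir c i + i = Min (interval c k) + Max (interval c k)" using i(1) s by auto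
    then show ?thesis unfolding arcs_def using k j 2 by blast
  qed
qed

lemma mir_append: "1 \<le> i \<Longrightarrow> mir (c @ d) i = (if i \<le> sum_list c then mir c i else sum_list c + mir d (i - sum_list c))"
proof (induction c arbitrary: i)
  case (Cons x c)
  show ?case
  proof (cases "i \<le> x")
    case False
    then show ?thesis using Cons.IH[of "i - x"] by auto
  qed auto
qed auto

lemma parts_C_Cons: "parts_C n (x # a) = x # parts_C (n - x) a @ [x]"
  by (simp add: parts_C_def Let_def)

lemma sum_parts_C: "sum_list a \<le> n \<Longrightarrow> sum_list (parts_C n a) = 2 * n"
  unfolding parts_C_def Let_def by (cases "n - sum_list a = 0") (simp_all add: sum_list_rev, linarith?)

lemma mir_parts_C: "sum_list a \<le> n \<Longrightarrow> 1 \<le> i \<Longrightarrow> i \<le> 2 * n \<Longrightarrow> mir (parts_C n a) i = mirC n a i"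
proof (induction a arbitrary: n i)
  case Nil
  then show ?case by (simp add: parts_C_def)
next
  case (Cons x a)
  have sm: "sum_list (parts_C (n - x) a) = 2 * (n - x)" using Cons.prems by (intro sum_parts_C) simp
  show ?case
  proof (cases "i \<le> x")
    case True
    then show ?thesis by (simp add: parts_C_Cons)
  next
    case False
    then have i: "1 \<le> i - x" by simp
    have e: "mir (parts_C n (x # a)) i = x + mir (parts_C (n - x) a @ [x]) (i - x)"
      using False by (simp add: parts_C_Cons)
    show ?thesis
    proof (cases "i + x \<le> 2 * n")
      case True
      have "mir (parts_C (n - x) a) (i - x) = mirC (n - x) a (i - x)"
        using Cons.prems True False by (intro Cons.IH) auto
      then show ?thesis unfolding e mir_append[OF i] sm using True False by auto
    next
      case r: False
      have "\<not> i - x \<le> 2 * (n - x)" using r False Cons.prems by auto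
      then show ?thesis unfolding e mir_append[OF i] sm using r False Cons.prems by auto
    qed
  qed
qed

lemma edges_C_eq:
  assumes a: "sum_list a \<le> n" and b: "sum_list b \<le> n"
  shows "edges_C n a b = mirror_system.edges (2 * n) (mirC n a) (mirC n b)"
proof -
  interpret mirror_system "2 * n" "mirC n a" "mirC n b" by (rule mirror_system_mirC[OF a b])
  have "arcs (parts_C n c) = {{i, mirC n c i} | i. i \<in> {1..2 * n} \<and> mirC n c i \<noteq> i}" if c: "sum_list c \<le> n" for c
    unfolding arcs_eq sum_parts_C[OF c] using mir_parts_C[OF c]
    by (intro Collect_cong iff_exI) (auto simp del: mirC.simps)
  then show ?thesis unfolding edges_C_def meander_edges_def edges_def using a b by simp
qed

lemma graph_count:
  assumes a: "sum_list a \<le> n" and b: "sum_list b \<le> n"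
  shows "2 * card (cycles_C n a b) + card {C \<in> segments_C n a b. \<not> sigma_stable n C} = JC n a b"
proof -
  interpret mirror_system "2 * n" "mirC n a" "mirC n b" by (rule mirror_system_mirC[OF a b])
  have "rev = (\<lambda>i. 2 * n + 1 - i)" by (simp add: fun_eq_iff rev_def)
  then show ?thesis
    using twice_cycles_plus_segments unfolding cycles_C_def segments_C_def sigma_stable_def edges_C_eq[OF a b] JC_def by simp
qed

subsection \<open>The index\<close>

text \<open>The additional extreme levels are attained only at indices outside 1..N, where all
  entries vanish.\<close>

lemma sw_zero: "(sw n (0 # a) b :: 'k::field matrix set) = sw n a b"
proof -
  have e: "lev (2 * n + 1) (0 # a) i = lev (2 * n + 1) a i" if "1 \<le> i" "i \<le> 2 * n + 1" for i
    using that by simp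
  have "(\<forall>i j. x i j \<noteq> 0 \<longrightarrow> lev (2 * n + 1) (0 # a) i \<le> lev (2 * n + 1) (0 # a) j \<and> lev (2 * n + 1) b j \<le> lev (2 * n + 1) b i) \<longleftrightarrow>
      (\<forall>i j. x i j \<noteq> 0 \<longrightarrow> lev (2 * n + 1) a i \<le> lev (2 * n + 1) a j \<and> lev (2 * n + 1) b j \<le> lev (2 * n + 1) b i)"
    if x: "x \<in> so (2 * n + 1)" for x :: "'k matrix"
  proof (intro iff_allI imp_cong refl)
    fix i j assume "x i j \<noteq> 0"
    then have "1 \<le> i" "i \<le> 2 * n + 1" "1 \<le> j" "j \<le> 2 * n + 1" using so_support[OF x] by auto
    note this
    then show "(lev (2 * n + 1) (0 # a) i \<le> lev (2 * n + 1) (0 # a) j \<and> lev (2 * n + 1) b j \<le> lev (2 * n + 1) b i) =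
        (lev (2 * n + 1) a i \<le> lev (2 * n + 1) a j \<and> lev (2 * n + 1) b j \<le> lev (2 * n + 1) b i)"
      by (simp only: e)
  qed
  then show ?thesis unfolding sw_def incidence_def by (intro Collect_cong conj_cong refl)
qed

text \<open>The type argument names the field, which would otherwise be hidden in the existential.
  \<open>0 \<notin> K\<close> is carried along for \<open>has_slice_equal_heads\<close>.\<close>

definition index_slice :: "'k::field_char_0 itself \<Rightarrow> nat \<Rightarrow> nat list \<Rightarrow> nat list \<Rightarrow> bool" where
  "index_slice _ n a b \<longleftrightarrow> (\<exists>K. finite K \<and> 0 \<notin> K \<and> has_slice (2 * n + 1) (sw n a b :: 'k matrix set) K \<and> 2 * card K = JC n a b)"

lemma index_slice_swap:
  assumes "sum_list a \<le> n" "sum_list b \<le> n" "index_slice (t :: 'k::field_char_0 itself) n b a"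
  shows "index_slice t n a b"
proof -
  obtain K where K: "finite K" "0 \<notin> K" "has_slice (2 * n + 1) (sw n b a :: 'k matrix set) K" "2 * card K = JC n b a"
    using assms(3) unfolding index_slice_def by (elim exE conjE)
  show ?thesis unfolding index_slice_def
    by (intro exI[of _ K] conjI K(1,2) has_slice_sw_swap[OF K(3)]) (simp only: K(4) JC_swap[OF assms(1,2)])
qed

lemma index_slice_parabolic: "sum_list a \<le> n \<Longrightarrow> index_slice (t :: 'k::field_char_0 itself) n a []"
proof -
  assume a: "sum_list a \<le> n"
  obtain K where "finite K" "0 \<notin> K" "has_slice (2 * n + 1) (sw n a [] :: 'k matrix set) K"
    "card K = (\<Sum>x\<leftarrow>a. x div 2) + (n - sum_list a)"
    by (rule has_slice_base[OF a])
  then show ?thesis unfolding index_slice_def JC_parabolic[OF a] by (intro exI[of _ K] conjI) simp_all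
qed

lemma index_slice_heads:
  assumes a: "a1 + sum_list as \<le> n" and b: "b1 + sum_list bs \<le> n" and ab: "0 < a1" "a1 \<le> b1"
    and IH: "\<And>n' a' b'. n' + length a' + length b' < n + length (a1 # as) + length (b1 # bs) \<Longrightarrow>
      sum_list a' \<le> n' \<Longrightarrow> sum_list b' \<le> n' \<Longrightarrow> index_slice t n' a' b'"
  shows "index_slice (t :: 'k::field_char_0 itself) n (a1 # as) (b1 # bs)"
proof -
  \<comment> \<open>For equal heads n and both lengths drop. In the other two cases the total number
    of parts is unchanged and n drops by a1 or by b1 - a1, both positive.\<close>
  consider "a1 = b1" | "a1 < b1" "2 * a1 \<le> b1" | "a1 < b1" "b1 \<le> 2 * a1" using ab by linarith
  then show ?thesis
  proof cases
    case 1
    have b': "a1 + sum_list bs \<le> n" using b 1 by simp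
    have "index_slice t (n - a1) as bs" using a b' ab by (intro IH) auto
    then obtain K where K: "finite K" "0 \<notin> K" "has_slice (2 * (n - a1) + 1) (sw (n - a1) as bs :: 'k matrix set) K"
        "2 * card K = JC (n - a1) as bs"
      unfolding index_slice_def by blast
    let ?K = "{1..a1} \<union> (\<lambda>k. k + a1) ` K"
    have "card ?K = a1 + card K"
    proof -
      have "{1..a1} \<inter> (\<lambda>k. k + a1) ` K = {}" using K(2) by auto
      then have "card ?K = card {1..a1} + card ((\<lambda>k. k + a1) ` K)" using K(1) by (intro card_Un_disjoint) auto
      then show ?thesis by (simp add: card_image)
    qed
    then have "2 * card ?K = JC n (a1 # as) (a1 # bs)" unfolding JC_equal_heads[OF a b'] using K(4) by simp
    moreover have "finite ?K" "0 \<notin> ?K" using K(1) ab by auto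
    ultimately show ?thesis
      unfolding index_slice_def 1[symmetric]
      by (intro exI[of _ ?K] conjI has_slice_equal_heads[OF a b' K(1-3)])
  next
    case 2
    have "index_slice t (n - a1) as ((b1 - 2 * a1) # a1 # bs)" using a b ab 2 by (intro IH) auto
    then show ?thesis
      unfolding index_slice_def JC_step_long[OF a b 2(2)]
      by (elim exE conjE) (intro exI conjI has_slice_step_long[OF a b 2(2)]; assumption)
  next
    case 3
    have "index_slice t (n - (b1 - a1)) ((2 * a1 - b1) # as) (a1 # bs)" using a b ab 3 by (intro IH) auto
    then show ?thesis
      unfolding index_slice_def JC_step_short[OF a b ab(2) 3(2)]
      by (elim exE conjE) (intro exI conjI has_slice_step_short[OF a b ab(2) 3(2)]; assumption)
  qed
qed

text \<open>The measure also decreases when a zero head is removed, and swapping the two lists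
  leaves it unchanged, so the smaller head may be assumed to come first.\<close>

lemma index_slice: "sum_list a \<le> n \<Longrightarrow> sum_list b \<le> n \<Longrightarrow> index_slice (t :: 'k::field_char_0 itself) n a b"
proof (induction "n + length a + length b" arbitrary: n a b rule: less_induct)
  case less
  note IH = less.hyps
  show ?case
  proof (cases "a = [] \<or> b = []")
    case True
    then show ?thesis
    proof
      assume "a = []"
      then have "index_slice t n b a" using index_slice_parabolic[OF less.prems(2)] by simp
      then show ?thesis by (rule index_slice_swap[OF less.prems])
    next
      assume "b = []"
      then show ?thesis using index_slice_parabolic[OF less.prems(1)] by simp
    qed
  next
    case False
    then obtain a1 as b1 bs where ab: "a = a1 # as" "b = b1 # bs" by (auto simp: neq_Nil_conv)
    have a: "a1 + sum_list as \<le> n" and b: "b1 + sum_list bs \<le> n" using less.prems unfolding ab by simp_all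
    consider "a1 = 0" | "b1 = 0" | "0 < a1" "a1 \<le> b1" | "0 < b1" "b1 \<le> a1" by linarith
    then show ?thesis
    proof cases
      case 1
      have "index_slice t n as b" using less.prems by (intro IH) (simp_all add: ab)
      then show ?thesis using JC_zero[of as n b] less.prems unfolding index_slice_def ab(1) 1 sw_zero by simp
    next
      case 2
      have "index_slice t n bs a" using less.prems by (intro IH) (simp_all add: ab)
      then have "index_slice t n b a" using JC_zero[of bs n a] less.prems unfolding index_slice_def ab(2) 2 sw_zero by simp
      then show ?thesis by (rule index_slice_swap[OF less.prems])
    next
      case 3
      show ?thesis unfolding ab by (rule index_slice_heads[OF a b 3]) (rule IH; simp add: ab)
    next
      case 4
      have "index_slice t n b a" unfolding ab by (rule index_slice_heads[OF b a 4]) (rule IH; simp add: ab)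
      then show ?thesis by (rule index_slice_swap[OF less.prems])
    qed
  qed
qed

theorem mainTheorem4:
  fixes n :: nat and a b :: "nat list"
  assumes "n \<ge> 1"
    and "composition a" and "sum_list a \<le> n"
    and "composition b" and "sum_list b \<le> n"
  shows "real (lie_index (2 * n + 1) (seaweed_B n a b :: 'k::{alg_closed_field, field_char_0} matrix set)) =
    real (card (cycles_C n a b)) + 1 / 2 * real (card {C \<in> segments_C n a b. \<not> sigma_stable n C})"
proof -
  obtain K where K: "finite K" "has_slice (2 * n + 1) (sw n a b :: 'k matrix set) K" "2 * card K = JC n a b"
    using index_slice[OF assms(3,5), of "TYPE('k)"] unfolding index_slice_def by blast
  have "lie_index (2 * n + 1) (seaweed_B n a b :: 'k matrix set) = card K"
    unfolding seaweed_B_eq_sw[OF assms(3,5)]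
    by (rule matrix_lie_algebra.lie_index_eq_card_slice[OF matrix_lie_algebra_sw K(2,1)])
  moreover have "2 * card (cycles_C n a b) + card {C \<in> segments_C n a b. \<not> sigma_stable n C} = 2 * card K"
    using graph_count[OF assms(3,5)] K(3) by simp
  then have "2 * real (card (cycles_C n a b)) + real (card {C \<in> segments_C n a b. \<not> sigma_stable n C}) = 2 * real (card K)"
    by linarith
  ultimately show ?thesis by simp
qed

end
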